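(* Let $p$ and $q$ be distinct odd primes and let $T>1$. Then for every $\epsilon>0$, \begin{align*} \int_{-\infty}^{\infty} \Big(\frac{p}{q}\Big)^{it} |\zeta(\tfrac{1}{2}+it)|^2 \exp\Big(-\frac{t^2}{T^2}\Big) dt &= \Big(\frac{\pi}{pq}\Big)^{\frac{1}{2}} T\Big( \log \Big(\frac{T}{2\pi pq}\Big)+2\gamma+\frac{1}{2} \frac{\Gamma'}{\Gamma}\Big(\frac{1}{2}\Big)\Big)\\ &\quad + \Big( \frac{T}{2\pi}\Big)^{\frac{1}{2}} \frac{p^{\frac{1}{2}}}{p-1} \mathop{{\sum}^{\star}}_{\substack{\chi\bmod p\\ \chi(-1)=1}} \chi(q) \int_{-\infty}^{\infty} \Gamma\Big(\frac{1-2it}{4}\Big) \Big( \frac{T}{2 q}\Big)^{it} |L(\tfrac{1}{2}+it,\chi)|^2 \, dt\\ &\quad + O\left((pqT)^\epsilon \Big(\frac{q}{p} \Big)^{\frac{1}{2}} + (pqT)^\epsilon \Big(\frac{p}{q} \Big)^{\frac{1}{2}} \right), \end{align*} where the implied constant depends only on $\epsilon$.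
   Context: $\zeta$ is the Riemann zeta function, $\gamma$ is the Euler–Mascheroni constant, $\Gamma$ is the Gamma function, and $L(s,\chi)$ is the Dirichlet $L$-function of the Dirichlet character $\chi$. The notation $\mathop{{\sum}^{\star}}_{\chi \bmod p,\ \chi(-1)=1}$ denotes a sum over the primitive Dirichlet characters $\chi$ modulo $p$ that are even, i.e. satisfy $\chi(-1)=1$. *)

theory Defs
  imports "HOL-Complex_Analysis.Complex_Analysis" "HOL-Computational_Algebra.Primes"
begin

text \<open>
  The meromorphic continuation to the whole plane of a Dirichlet series
  \<open>a(1) + a(2) / 2\<^sup>s + a(3) / 3\<^sup>s + \<dots>\<close> converging for \<open>Re s > 1\<close>.
  Requiring \<^emph>\<open>nicely\<close> meromorphic functions (value \<open>0\<close> at poles, no removable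
  singularities) makes the continuation unique as a total function, so that the definite
  description is determined whenever a continuation exists.
\<close>

definition continued_dirichlet_series :: "(nat \<Rightarrow> complex) \<Rightarrow> complex \<Rightarrow> complex" where
  "continued_dirichlet_series a =
     (THE f. f nicely_meromorphic_on UNIV \<and>
        (\<forall>s. Re s > 1 \<longrightarrow> (\<lambda>n. a (Suc n) / of_nat (Suc n) powr s) sums f s))"

definition zeta :: "complex \<Rightarrow> complex" where
  "zeta = continued_dirichlet_series (\<lambda>_. 1)"

text \<open>
  Characters are functions on the integers, so that \<open>chi (- 1)\<close> can be written literally.
  Since \<open>chi 1 \<noteq> 0\<close>, multiplicativity forces \<open>chi 1 = 1\<close>.
\<close>

definition dirichlet_character :: "nat \<Rightarrow> (int \<Rightarrow> complex) \<Rightarrow> bool" where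
  "dirichlet_character m chi \<longleftrightarrow>
     (\<forall>a b. chi (a * b) = chi a * chi b) \<and>
     (\<forall>a. chi (a + int m) = chi a) \<and>
     (\<forall>a. chi a \<noteq> 0 \<longleftrightarrow> coprime a (int m))"

definition primitive_character :: "nat \<Rightarrow> (int \<Rightarrow> complex) \<Rightarrow> bool" where
  "primitive_character m chi \<longleftrightarrow>
     dirichlet_character m chi \<and>
     \<not> (\<exists>d \<psi>. d dvd m \<and> d < m \<and> dirichlet_character d \<psi> \<and>
           (\<forall>a. coprime a (int m) \<longrightarrow> chi a = \<psi> a))"

definition dirichlet_L :: "(int \<Rightarrow> complex) \<Rightarrow> complex \<Rightarrow> complex" where
  "dirichlet_L chi = continued_dirichlet_series (\<lambda>n. chi (int n))"

end

theory Submission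
  imports
    Defs
    "HOL-Number_Theory.Number_Theory"
    "HOL-Probability.Sinc_Integral"
    "HOL-Probability.Characteristic_Functions"
    "HOL-Real_Asymp.Real_Asymp"
begin

text \<open>
  By the functional equation, \<open>\<bar>zeta s\<bar>^2 = zeta s ^ 2 * (zeta (1 - s) / zeta s)\<close> on the critical line, and the
  second factor is elementary. Moving the line of integration to \<open>Re s = 2\<close> and expanding
  \<open>zeta s ^ 2\<close> turns the moment, up to an admissible error, into
  \<open>4 pi (q/p)^(1/2)\<close> times the sum of \<open>cos (2 pi m n q / p) exp (- (m n / X)^2)\<close> over \<open>m, n \<ge> 1\<close>, where
  \<open>X = p T / (2 pi q)\<close>. The additive character is expanded in even Dirichlet characters modulo \<open>p\<close>.
  The trivial character and the terms with \<open>p\<close> dividing \<open>m n\<close> give smoothed divisor sums of lengths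
  \<open>X\<close>, \<open>X / p\<close> and \<open>X / p^2\<close>, whose main terms (from the double pole of \<open>zeta s ^ 2\<close>) combine to the diagonal term.
  For a primitive character the sum is a Mellin integral of \<open>L(s, chi)^2\<close> over the critical line; the functional
  equation replaces \<open>L(s, chi)^2\<close> by \<open>\<bar>L(s, chi)\<bar>^2\<close>, and the Gauss sums cancel to \<open>p\<close>.
\<close>

section \<open>Shifting vertical lines of integration\<close>

text \<open>Zeta and the L-functions are used through two representations. Theta series give the
  continuation whose existence the definite description presupposes, and the functional equation;
  but \<open>rGamma\<close> grows exponentially, so no usable bound in vertical strips results. The
  Laplace transform of the summatory function reaches only \<open>Re s > 0\<close>, but with linear
  growth, which is what moving lines of integration requires.

  The delicate point is uniformity in T. The growth of \<open>cos (pi s / 2)\<close> cancels the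
  exponential decay of \<open>Gamma s\<close>, so only the factor exp (- t^2 / T^2) makes the
  twisted integral converge, on a scale that depends on T. The oscillatory kernel is therefore
  evaluated up to (1/T) (T/y)^(1 + \<delta>): summed over y = 2 pi m n q / p, this leaves
  (p/q)^(1/2) (p T / q)^\<delta>. The other error term, with (q/p)^(1/2), is the remainder
  X^\<delta> of the divisor sums times the prefactor.\<close>

lemma rectangle_residues:
  fixes f :: "complex \<Rightarrow> complex"
  assumes ab: "a < b" and K: "0 < K" and S: "open S" "connected S"
    and sub: "cbox (Complex a (-K)) (Complex b K) \<subseteq> S"
    and pts: "finite pts" "pts \<subseteq> box (Complex a (-K)) (Complex b K)"
    and holo: "f holomorphic_on S - pts"
    and B: "B \<ge> 0" "\<And>x. x \<in> {a..b} \<Longrightarrow> norm (f (Complex x K)) \<le> B"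
       "\<And>x. x \<in> {a..b} \<Longrightarrow> norm (f (Complex x (-K))) \<le> B"
  shows "norm (integral {-K..K} (\<lambda>t. f (Complex b t)) - integral {-K..K} (\<lambda>t. f (Complex a t))
               - 2 * pi * (\<Sum>z\<in>pts. residue f z)) \<le> 2 * B * (b - a)"
proof -
  define z1 z2 z3 z4 where "z1 = Complex a (-K)" and "z2 = Complex b (-K)"
    and "z3 = Complex b K" and "z4 = Complex a K"
  let ?g = "rectpath z1 z3"
  have im: "path_image ?g \<subseteq> S - pts"
    using path_image_rectpath_cbox_minus_box[of z1 z3] ab K sub pts(2)
    by (auto simp: z1_def z3_def)
  have win1: "winding_number ?g p = 1" if "p \<in> pts" for p
    using that pts(2) by (intro winding_number_rectpath) (auto simp: z1_def z3_def)
  have win0: "winding_number ?g p = 0" if "p \<notin> S" for p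
    using that sub ab K by (intro winding_number_rectpath_outside) (auto simp: z1_def z3_def)
  have "contour_integral ?g f = 2 * pi * \<i> * (\<Sum>p\<in>pts. winding_number ?g p * residue f p)"
    by (rule Residue_theorem[OF S pts(1) holo]) (use im win0 in auto)
  also have "(\<Sum>p\<in>pts. winding_number ?g p * residue f p) = (\<Sum>p\<in>pts. residue f p)"
    by (rule sum.cong) (auto simp: win1)
  finally have 1: "contour_integral ?g f = 2 * pi * \<i> * (\<Sum>p\<in>pts. residue f p)" .
  have cont: "continuous_on (path_image ?g) f"
    using holo im holomorphic_on_imp_continuous_on holomorphic_on_subset by blast
  have geq: "?g = linepath z1 z2 +++ linepath z2 z3 +++ linepath z3 z4 +++ linepath z4 z1"
    by (simp add: rectpath_def Let_def z1_def z2_def z3_def z4_def)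
  have pim: "path_image ?g = closed_segment z1 z2 \<union> closed_segment z2 z3 \<union> closed_segment z3 z4 \<union> closed_segment z4 z1"
    by (simp add: geq path_image_join Un_assoc)
  have ci: "f contour_integrable_on linepath z1 z2" "f contour_integrable_on linepath z2 z3"
           "f contour_integrable_on linepath z3 z4" "f contour_integrable_on linepath z4 z1"
    by (rule contour_integrable_continuous_linepath, rule continuous_on_subset[OF cont], force simp: pim)+
  have 2: "contour_integral ?g f = contour_integral (linepath z1 z2) f + contour_integral (linepath z2 z3) f
     + contour_integral (linepath z3 z4) f + contour_integral (linepath z4 z1) f"
    unfolding geq using ci by (simp add: contour_integrable_join)
  have 3: "contour_integral (linepath z2 z3) f = \<i> * integral {-K..K} (\<lambda>t. f (Complex b t))"
    by (rule contour_integral_linepath_same_Re) (use K in \<open>auto simp: z2_def z3_def\<close>)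
  have "contour_integral (linepath z1 z4) f = \<i> * integral {-K..K} (\<lambda>t. f (Complex a t))"
    by (rule contour_integral_linepath_same_Re) (use K in \<open>auto simp: z1_def z4_def\<close>)
  moreover have "contour_integral (linepath z4 z1) f = - contour_integral (linepath z1 z4) f"
    by (rule contour_integral_reverse_linepath)
       (rule continuous_on_subset[OF cont], auto simp: pim closed_segment_commute)
  ultimately have 4: "contour_integral (linepath z4 z1) f = - (\<i> * integral {-K..K} (\<lambda>t. f (Complex a t)))"
    by simp
  have 5: "norm (contour_integral (linepath z1 z2) f) \<le> B * norm (z2 - z1)"
  proof (rule contour_integral_bound_linepath[OF ci(1) B(1)])
    fix x assume "x \<in> closed_segment z1 z2"
    hence "x = Complex (Re x) (-K)" "Re x \<in> {a..b}"
      using ab by (auto simp: z1_def z2_def closed_segment_same_Im complex_eq_iff closed_segment_eq_real_ivl)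
    with B(3) show "norm (f x) \<le> B" by metis
  qed
  have 6: "norm (contour_integral (linepath z3 z4) f) \<le> B * norm (z4 - z3)"
  proof (rule contour_integral_bound_linepath[OF ci(3) B(1)])
    fix x assume "x \<in> closed_segment z3 z4"
    hence "x = Complex (Re x) K" "Re x \<in> {a..b}"
      using ab by (auto simp: z3_def z4_def closed_segment_same_Im complex_eq_iff closed_segment_eq_real_ivl)
    with B(2) show "norm (f x) \<le> B" by metis
  qed
  have n: "norm (z2 - z1) = b - a" "norm (z4 - z3) = b - a"
    using ab by (auto simp: z1_def z2_def z3_def z4_def norm_complex_def real_sqrt_abs)
  let ?X = "integral {-K..K} (\<lambda>t. f (Complex b t)) - integral {-K..K} (\<lambda>t. f (Complex a t))
               - 2 * pi * (\<Sum>z\<in>pts. residue f z)"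
  \<comment> \<open>On vertical sides ds = \<i> dt, and the residue sum carries the same factor
    \<i>. Dividing by it leaves 2 pi times the residues, and the defect consists of the two
    horizontal sides.\<close>
  have "\<i> * ?X = - (contour_integral (linepath z1 z2) f + contour_integral (linepath z3 z4) f)"
    using 1 2 3 4 by (simp add: algebra_simps)
  hence "norm (\<i> * ?X) = norm (contour_integral (linepath z1 z2) f + contour_integral (linepath z3 z4) f)"
    by (simp only: norm_minus_cancel)
  hence "norm ?X = norm (contour_integral (linepath z1 z2) f + contour_integral (linepath z3 z4) f)"
    by (simp add: norm_mult)
  also have "\<dots> \<le> B * (b - a) + B * (b - a)"
    using 5 6 n norm_triangle_le add_mono by metis
  finally show ?thesis by (simp add: algebra_simps)
qed

lemma integrable_inverse_square: "integrable lborel (\<lambda>t::real. 1 / (1 + t\<^sup>2))"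
proof -
  have "set_integrable lborel (einterval (-\<infinity>) \<infinity>) (\<lambda>t::real. 1 / (1 + t\<^sup>2))"
  proof (rule interval_integral_FTC_nonneg(1)[where F = arctan])
    show "\<And>x. - \<infinity> < ereal x \<Longrightarrow> ereal x < \<infinity> \<Longrightarrow> DERIV arctan x :> 1 / (1 + x\<^sup>2)"
      by (auto intro!: derivative_eq_intros simp: inverse_eq_divide)
    show "\<And>x. - \<infinity> < ereal x \<Longrightarrow> ereal x < \<infinity> \<Longrightarrow> isCont (\<lambda>t. 1 / (1 + t\<^sup>2)) x"
      by (auto intro!: continuous_intros simp: add_nonneg_eq_0_iff)
    show "((arctan \<circ> real_of_ereal) \<longlongrightarrow> - (pi/2)) (at_right (- \<infinity>))"
      by (simp add: ereal_tendsto_simps tendsto_arctan_at_bot)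
    show "((arctan \<circ> real_of_ereal) \<longlongrightarrow> (pi/2)) (at_left \<infinity>)"
      by (simp add: ereal_tendsto_simps tendsto_arctan_at_top)
  qed auto
  thus ?thesis by (simp add: set_integrable_def)
qed

lemma integrable_of_decay:
  fixes f :: "real \<Rightarrow> complex"
  assumes "continuous_on UNIV f" and "\<And>t. \<bar>t\<bar> \<ge> 1 \<Longrightarrow> norm (f t) \<le> C / t\<^sup>2"
  shows "integrable lborel f"
proof -
  have "compact (f ` {-1..1})"
    by (intro compact_continuous_image continuous_on_subset[OF assms(1)]) auto
  then obtain M where M: "\<And>t. t \<in> {-1..1} \<Longrightarrow> norm (f t) \<le> M"
    using compact_imp_bounded bounded_iff by (metis imageI)
  have [measurable]: "f \<in> borel_measurable borel"
    using assms(1) by (simp add: borel_measurable_continuous_onI)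
  have M0: "0 \<le> M" using order_trans[OF norm_ge_zero M[of 0]] by simp
  have C0: "0 \<le> C" using order_trans[OF norm_ge_zero assms(2)[of 1]] by simp
  show ?thesis
  proof (rule Bochner_Integration.integrable_bound)
    show "integrable lborel (\<lambda>t::real. (2 * (M + C)) *  (1 / (1 + t\<^sup>2)))"
      by (intro integrable_mult_right integrable_inverse_square)
    show "AE t in lborel. norm (f t) \<le> norm ((2 * (M + C)) *  (1 / (1 + t\<^sup>2)))"
    proof (rule AE_I2)
      fix t :: real
      show "norm (f t) \<le> norm ((2 * (M + C)) *  (1 / (1 + t\<^sup>2)))"
      proof (cases "\<bar>t\<bar> \<ge> 1")
        case True
        have t2: "1 \<le> t\<^sup>2" using True by (simp add: abs_square_le_1 power2_eq_square one_le_power abs_le_square_iff[of 1 t, simplified])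
        have "C / t\<^sup>2 \<le> (2 * (M + C)) / (1 + t\<^sup>2)"
        proof -
          have "C * (1 + t\<^sup>2) \<le> C * (2 * t\<^sup>2)" using C0 t2 by (intro mult_left_mono) auto
          also have "\<dots> \<le> (2 * (M + C)) * t\<^sup>2" using M0 t2 by (simp add: algebra_simps)
          finally have *: "C * (1 + t\<^sup>2) \<le> (2 * (M + C)) * t\<^sup>2" .
          have "0 < t\<^sup>2" "0 < 1 + t\<^sup>2" using t2 by linarith+
          have "C / t\<^sup>2 = (C * (1 + t\<^sup>2)) / (t\<^sup>2 * (1 + t\<^sup>2))"
            using \<open>0 < 1 + t\<^sup>2\<close> by simp
          also have "\<dots> \<le> ((2 * (M + C)) * t\<^sup>2) / (t\<^sup>2 * (1 + t\<^sup>2))"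
            using * \<open>0 < t\<^sup>2\<close> \<open>0 < 1 + t\<^sup>2\<close> by (intro divide_right_mono) auto
          also have "\<dots> = (2 * (M + C)) / (1 + t\<^sup>2)" using \<open>0 < t\<^sup>2\<close> by simp
          finally show ?thesis .
        qed
        with assms(2)[OF True] M0 C0 show ?thesis by (auto simp: add_pos_nonneg)
      next
        case False
        hence "t\<^sup>2 \<le> 1" by (simp add: abs_square_le_1)
        hence "M * (1 + t\<^sup>2) \<le> M * 2" using M0 by (intro mult_left_mono) auto
        also have "\<dots> \<le> 2 * (M + C)" using C0 by simp
        finally have "M \<le> (2 * (M + C)) / (1 + t\<^sup>2)"
          by (simp add: pos_le_divide_eq add_pos_nonneg)
        moreover have "norm (f t) \<le> M" using False by (intro M) (auto simp: abs_if split: if_splits)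
        ultimately show ?thesis using M0 C0 by (auto simp: add_pos_nonneg)
      qed
    qed
  qed auto
qed

lemma LBINT_eq_lim_integral:
  fixes f :: "real \<Rightarrow> complex"
  assumes "integrable lborel f" "filterlim k at_top sequentially"
  shows "(\<lambda>n. integral {-k n..k n} f) \<longlonglongrightarrow> (LBINT t. f t)"
proof -
  have [measurable]: "f \<in> borel_measurable borel" using assms(1) by auto
  have 1: "integral {-k n..k n} f = (LBINT t. indicator {-k n..k n} t *\<^sub>R f t)" for n
    using set_borel_integral_eq_integral(2)[of "{-k n..k n}" f]
      integrable_mult_indicator[OF _ assms(1), of "{-k n..k n}"]
    by (simp add: set_lebesgue_integral_def set_integrable_def)
  show ?thesis unfolding 1
  proof (rule integral_dominated_convergence)
    show "integrable lborel (\<lambda>x. norm (f x))" using assms by auto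
    show "AE x in lborel. (\<lambda>n. indicator {-k n..k n} x *\<^sub>R f x) \<longlonglongrightarrow> f x"
    proof (rule AE_I2)
      fix x
      have "eventually (\<lambda>n. \<bar>x\<bar> \<le> k n) sequentially"
        using assms(2) by (simp add: filterlim_at_top)
      hence "eventually (\<lambda>n. indicator {-k n..k n} x *\<^sub>R f x = f x) sequentially"
        by eventually_elim (auto simp: indicator_def)
      thus "(\<lambda>n. indicator {-k n..k n} x *\<^sub>R f x) \<longlonglongrightarrow> f x"
        by (rule tendsto_eventually)
    qed
    show "\<And>i. AE x in lborel. norm (indicator {-k i..k i} x *\<^sub>R f x) \<le> norm (f x)"
      by (auto simp: indicator_def)
  qed (auto)
qed

lemma continuous_on_Complex [continuous_intros]:
  "continuous_on A f \<Longrightarrow> continuous_on A g \<Longrightarrow> continuous_on A (\<lambda>x. Complex (f x) (g x))"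
  unfolding Complex_eq by (intro continuous_intros)

text \<open>Quadratic decay makes the horizontal sides of a rectangle of height k contribute
  O(1/k^2), and it gives integrability on both lines. The exceptional point \<open>z0\<close> may be
  a double pole, but also a regular point with residue 0, so the same statement serves for
  integrands without a pole.\<close>

lemma vertical_line_shift:
  fixes f :: "complex \<Rightarrow> complex"
  assumes ab: "a < Re z0" "Re z0 < b" and S: "open S" "connected S" "{z. a \<le> Re z \<and> Re z \<le> b} \<subseteq> S"
    and holo: "f holomorphic_on S - {z0}"
    and bd: "\<And>z. a \<le> Re z \<Longrightarrow> Re z \<le> b \<Longrightarrow> \<bar>Im z\<bar> \<ge> 1 \<Longrightarrow> norm (f z) \<le> C / (Im z)\<^sup>2"
  shows "(LBINT t. f (Complex b t)) = (LBINT t. f (Complex a t)) + 2 * pi * residue f z0"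
    and "integrable lborel (\<lambda>t. f (Complex a t))" "integrable lborel (\<lambda>t. f (Complex b t))"
proof -
  have fc: "continuous_on UNIV (\<lambda>t. f (Complex c t))" if c: "c = a \<or> c = b" for c
  proof (rule continuous_on_compose2[OF holomorphic_on_imp_continuous_on[OF holo]])
    show "continuous_on UNIV (\<lambda>t. Complex c t)" by (intro continuous_intros)
    show "range (Complex c) \<subseteq> S - {z0}" using S(3) ab c by auto
  qed
  show int: "integrable lborel (\<lambda>t. f (Complex a t))" "integrable lborel (\<lambda>t. f (Complex b t))"
    by (rule integrable_of_decay[OF fc, of _ C]; use bd[of "Complex a _"] bd[of "Complex b _"] ab in force)+
  \<comment> \<open>This choice makes every \<open>k n\<close> exceed the height of
    \<open>z0\<close>, so that the point lies inside all rectangles.\<close>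
  define N where "N = nat \<lceil>\<bar>Im z0\<bar>\<rceil>"
  define k where "k n = real (n + N + 1)" for n
  have k: "filterlim k at_top sequentially"
    unfolding k_def by real_asymp
  have C0: "0 \<le> C" using order_trans[OF norm_ge_zero bd[of "Complex a 1"]] ab by simp
  let ?D = "\<lambda>n. integral {-k n..k n} (\<lambda>t. f (Complex b t)) - integral {-k n..k n} (\<lambda>t. f (Complex a t)) - 2 * pi * residue f z0"
  have "norm (?D n) \<le> 2 * (C / (k n)\<^sup>2) * (b - a)" for n
  proof -
    have kz: "\<bar>Im z0\<bar> < k n" unfolding k_def N_def by linarith
    have k1: "1 \<le> k n" by (simp add: k_def)
    have "norm (integral {-k n..k n} (\<lambda>t. f (Complex b t)) - integral {-k n..k n} (\<lambda>t. f (Complex a t)) - 2 * pi * (\<Sum>z\<in>{z0}. residue f z)) \<le> 2 * (C / (k n)\<^sup>2) * (b - a)"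
    proof (rule rectangle_residues[OF _ _ S(1,2)])
      show "cbox (Complex a (- k n)) (Complex b (k n)) \<subseteq> S" using S(3) by (auto simp: in_cbox_complex_iff)
      show "{z0} \<subseteq> box (Complex a (- k n)) (Complex b (k n))" using ab kz by (auto simp: in_box_complex_iff)
      show "norm (f (Complex x (k n))) \<le> C / (k n)\<^sup>2" if "x \<in> {a..b}" for x
        using bd[of "Complex x (k n)"] that k1 by auto
      show "norm (f (Complex x (- k n))) \<le> C / (k n)\<^sup>2" if "x \<in> {a..b}" for x
        using bd[of "Complex x (- k n)"] that k1 by auto
    qed (use ab k1 holo C0 in auto)
    thus ?thesis by simp
  qed
  moreover have "(\<lambda>n. 2 * (C / (k n)\<^sup>2) * (b - a)) \<longlonglongrightarrow> 0"
    unfolding k_def by real_asymp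
  ultimately have "?D \<longlonglongrightarrow> 0" by (rule Lim_null_comparison[OF always_eventually[OF allI]])
  moreover have "?D \<longlonglongrightarrow> (LBINT t. f (Complex b t)) - (LBINT t. f (Complex a t)) - 2 * pi * residue f z0"
    by (intro tendsto_intros LBINT_eq_lim_integral[OF _ k] int)
  ultimately have "(LBINT t. f (Complex b t)) - (LBINT t. f (Complex a t)) - 2 * pi * residue f z0 = 0"
    using LIMSEQ_unique by blast
  thus "(LBINT t. f (Complex b t)) = (LBINT t. f (Complex a t)) + 2 * pi * residue f z0"
    by (simp add: algebra_simps)
qed

section \<open>Gaussian, Gamma and Fourier integrals\<close>

lemma has_bochner_integral_complex_of_realD:
  assumes "has_bochner_integral M (\<lambda>x. complex_of_real (f x)) (complex_of_real c)"
  shows "has_bochner_integral M f c"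
  using has_bochner_integral_bounded_linear[OF bounded_linear_Re assms] by simp

text \<open>A rescaled form of the characteristic function of the standard normal distribution. The
  real part of \<open>b\<close> is removed by completing the square, a real translation, and the
  imaginary part becomes the frequency \<open>\<tau>\<close>; so a complex \<open>b\<close> costs no
  contour shift.\<close>

lemma gaussian_integral:
  fixes a :: real and b :: complex
  assumes a: "a > 0"
  shows "has_bochner_integral lborel (\<lambda>t. exp (- of_real (a * t\<^sup>2) + b * of_real t))
           (of_real (sqrt (pi / a)) * exp (b\<^sup>2 / (4 * of_real a)))"
proof -
  define \<tau> where "\<tau> = Im b / sqrt (2 * a)"
  have 1: "has_bochner_integral lborel (\<lambda>x. exp (- of_real (x\<^sup>2 / 2) + \<i> * of_real (\<tau> * x)))
             (of_real (sqrt (2 * pi) * exp (- (\<tau>\<^sup>2) / 2)))"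
  proof -
    have "(CLINT x|std_normal_distribution. iexp (\<tau> * x)) = complex_of_real (exp (- (\<tau>\<^sup>2) / 2))"
      using char_std_normal_distribution by (simp add: char_def fun_eq_iff)
    also have "(CLINT x|std_normal_distribution. iexp (\<tau> * x)) =
        (CLBINT x. std_normal_density x *\<^sub>R iexp (\<tau> * x))"
      by (rule integral_density) auto
    finally have e: "(CLBINT x. std_normal_density x *\<^sub>R iexp (\<tau> * x)) = complex_of_real (exp (- (\<tau>\<^sup>2) / 2))" .
    \<comment> \<open>The integral of a non-integrable function is 0 by default, whereas the value
      just found is an exponential.\<close>
    moreover have "integrable lborel (\<lambda>x. std_normal_density x *\<^sub>R iexp (\<tau> * x))"
      using e not_integrable_integral_eq by fastforce
    ultimately have "has_bochner_integral lborel (\<lambda>x. std_normal_density x *\<^sub>R iexp (\<tau> * x))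
       (complex_of_real (exp (- (\<tau>\<^sup>2) / 2)))" by (simp add: has_bochner_integral_iff)
    from has_bochner_integral_mult_right[OF this, of "of_real (sqrt (2 * pi))"]
    have "has_bochner_integral lborel (\<lambda>x. complex_of_real (sqrt (2*pi)) * (std_normal_density x *\<^sub>R iexp (\<tau> * x)))
       (complex_of_real (sqrt (2*pi)) * complex_of_real (exp (- (\<tau>\<^sup>2) / 2)))" by simp
    moreover have "complex_of_real (sqrt (2*pi)) * (std_normal_density x *\<^sub>R iexp (\<tau> * x)) =
       exp (- of_real (x\<^sup>2 / 2) + \<i> * of_real (\<tau> * x))" for x
    proof -
      have "complex_of_real (sqrt (2*pi)) * (std_normal_density x *\<^sub>R iexp (\<tau> * x)) = of_real (exp (- (x\<^sup>2 / 2))) * iexp (\<tau> * x)"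
        by (simp add: std_normal_density_def scaleR_conv_of_real)
      also have "\<dots> = exp (- of_real (x\<^sup>2 / 2) + \<i> * of_real (\<tau> * x))"
        by (simp only: exp_add of_real_minus flip: exp_of_real)
      finally show ?thesis .
    qed
    ultimately show ?thesis by simp
  qed
  define c where "c = sqrt (2 * a)"
  have c: "c > 0" "c\<^sup>2 = 2 * a" using a by (auto simp: c_def)
  have 2: "has_bochner_integral lborel (\<lambda>s. exp (- of_real ((- Re b / c + c * s)\<^sup>2 / 2) + \<i> * of_real (\<tau> * (- Re b / c + c * s))))
        (of_real (sqrt (2 * pi) * exp (- (\<tau>\<^sup>2) / 2)) /\<^sub>R \<bar>c\<bar>)"
    using 1 c by (subst (asm) lborel_has_bochner_integral_real_affine_iff[where c = c and t = "- Re b / c"]) auto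
  define k where "k = exp (of_real ((Re b)\<^sup>2 / (4 * a)) + \<i> * of_real (Re b * Im b / (2 * a)))"
  have e: "k * exp (- of_real ((- Re b / c + c * s)\<^sup>2 / 2) + \<i> * of_real (\<tau> * (- Re b / c + c * s))) =
     exp (- of_real (a * s\<^sup>2) + b * of_real s)" for s
  proof -
    have e1: "(- Re b / c + c * s)\<^sup>2 / 2 = (Re b)\<^sup>2 / (4 * a) - Re b * s + a * s\<^sup>2"
    proof -
      have "(- Re b / c + c * s)\<^sup>2 = (Re b)\<^sup>2 / c\<^sup>2 - 2 * Re b * s + c\<^sup>2 * s\<^sup>2"
        using c(1) by (simp add: power2_eq_square field_simps)
      thus ?thesis unfolding c(2) using a by (simp add: field_simps)
    qed
    have e2: "\<tau> * (- Re b / c + c * s) = - (Re b * Im b / (2 * a)) + Im b * s"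
      using c a by (simp add: \<tau>_def flip: c_def) (simp add: field_simps power2_eq_square)
    have "of_real ((Re b)\<^sup>2 / (4 * a)) + \<i> * of_real (Re b * Im b / (2 * a)) +
       (- of_real ((- Re b / c + c * s)\<^sup>2 / 2) + \<i> * of_real (\<tau> * (- Re b / c + c * s))) =
       - of_real (a * s\<^sup>2) + b * of_real s"
      unfolding e1 e2 by (simp add: complex_eq_iff)
    thus ?thesis by (simp only: k_def flip: exp_add)
  qed
  have v: "k * (of_real (sqrt (2 * pi) * exp (- (\<tau>\<^sup>2) / 2)) /\<^sub>R \<bar>c\<bar>) = of_real (sqrt (pi / a)) * exp (b\<^sup>2 / (4 * of_real a))"
  proof -
    have "sqrt (2 * pi) / c = sqrt (pi / a)" using a by (simp add: c_def real_sqrt_divide real_sqrt_mult)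
    moreover have "of_real ((Re b)\<^sup>2 / (4 * a)) + \<i> * of_real (Re b * Im b / (2 * a)) + of_real (- (\<tau>\<^sup>2) / 2) = b\<^sup>2 / (4 * of_real a)"
    proof -
      have "\<tau>\<^sup>2 = (Im b)\<^sup>2 / (2 * a)" using a by (simp add: \<tau>_def power_divide)
      moreover have "b\<^sup>2 = Complex ((Re b)\<^sup>2 - (Im b)\<^sup>2) (2 * Re b * Im b)"
        by (rule complex_eqI) (simp_all add: power2_eq_square)
      moreover have "Complex x y / (4 * of_real a) = Complex (x / (4 * a)) (y / (4 * a))" for x y
      proof -
        have "4 * complex_of_real a = of_real (4 * a)" by simp
        thus ?thesis by (simp only: complex_eq_iff Re_divide_of_real Im_divide_of_real complex.sel) simp
      qed
      ultimately show ?thesis using a by (simp add: complex_eq_iff diff_divide_distrib)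
    qed
    ultimately have "k * of_real (exp (- (\<tau>\<^sup>2) / 2)) = exp (b\<^sup>2 / (4 * of_real a))" "sqrt (2 * pi) / c = sqrt (pi / a)"
      by (simp_all only: k_def flip: exp_of_real exp_add)
    moreover have "k * (of_real (sqrt (2 * pi) * exp (- (\<tau>\<^sup>2) / 2)) /\<^sub>R \<bar>c\<bar>) = of_real (sqrt (2 * pi) / c) * (k * of_real (exp (- (\<tau>\<^sup>2) / 2)))"
      by (simp only: scaleR_conv_of_real of_real_mult of_real_divide abs_of_pos[OF c(1)] divide_inverse of_real_inverse mult_ac)
    ultimately show ?thesis by simp
  qed
  from has_bochner_integral_mult_right[OF 2, of k] show ?thesis
    unfolding e v by simp
qed

section \<open>Euler's integral and the decay of Gamma in vertical strips\<close>

lemma range_exp_real: "range (exp :: real \<Rightarrow> real) = {0<..}"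
proof (intro equalityI subsetI)
  fix y :: real assume "y \<in> {0<..}"
  hence "y = exp (ln y)" by simp
  thus "y \<in> range exp" by blast
qed auto

text \<open>Euler's integral after the substitution t = x exp v. In the logarithmic variable a
  Mellin transform is an integral over the whole line, and scaling by \<open>x\<close> is the
  translation by \<open>ln x\<close>.\<close>

lemma Gamma_log_Mellin:
  fixes s :: complex and x :: real
  assumes s: "Re s > 0" and x: "x > 0"
  shows "has_bochner_integral lborel (\<lambda>v. exp (- of_real (x * exp v) + s * of_real v)) (Gamma s * of_real x powr (-s))"
proof -
  define f where "f = (\<lambda>t. complex_of_real t powr (s - 1) / of_real (exp t))"
  define g where "g = (\<lambda>v. exp (- of_real (exp v) + s * of_real v))"
  have ge: "\<bar>exp v\<bar> *\<^sub>R f (exp v) = g v" for v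
  proof -
    have "complex_of_real (exp v) powr (s - 1) = exp ((s - 1) * of_real v)"
      by (simp add: powr_def Ln_of_real)
    thus ?thesis
      by (simp add: f_def g_def scaleR_conv_of_real exp_add exp_diff exp_minus algebra_simps divide_inverse flip: exp_of_real)
  qed
  have "f absolutely_integrable_on (exp ` UNIV) \<and> integral (exp ` UNIV) f = Gamma s"
    using absolutely_integrable_Gamma_integral'[OF s] Gamma_integral_complex'[OF s]
    by (auto simp: f_def integral_unique range_exp_real)
  hence *: "(\<lambda>v. \<bar>exp v\<bar> *\<^sub>R f (exp v)) absolutely_integrable_on UNIV \<and> integral UNIV (\<lambda>v. \<bar>exp v\<bar> *\<^sub>R f (exp v)) = Gamma s"
    by (subst has_absolute_integral_change_of_variables_real) (auto intro!: derivative_eq_intros simp: inj_on_def)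
  have gm: "g \<in> borel_measurable borel" unfolding g_def by measurable
  have i: "g absolutely_integrable_on UNIV" "integral UNIV g = Gamma s" using * unfolding ge by blast+
  hence "integrable lborel g" using gm
    by (simp add: set_integrable_def integrable_completion)
  moreover have "integral\<^sup>L lborel g = Gamma s"
    using set_lebesgue_integral_eq_integral(2)[OF i(1)] i(2) gm
    by (simp add: set_lebesgue_integral_def integral_completion)
  ultimately have "has_bochner_integral lborel g (Gamma s)" by (simp add: has_bochner_integral_iff)
  hence "has_bochner_integral lborel (\<lambda>v. g (ln x + 1 * v)) (Gamma s /\<^sub>R \<bar>1\<bar>)"
    by (subst (asm) lborel_has_bochner_integral_real_affine_iff[where c=1 and t = "ln x"]) auto
  from has_bochner_integral_mult_right[OF this, of "exp (- s * of_real (ln x))"]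
  have "has_bochner_integral lborel (\<lambda>v. exp (- s * of_real (ln x)) * g (ln x + v)) (exp (- s * of_real (ln x)) * Gamma s)"
    by simp
  moreover have "exp (- s * of_real (ln x)) * g (ln x + v) = exp (- of_real (x * exp v) + s * of_real v)" for v
  proof -
    have "- s * of_real (ln x) + (- of_real (exp (ln x + v)) + s * of_real (ln x + v)) = - of_real (x * exp v) + s * of_real v"
      using x by (simp add: exp_add algebra_simps)
    thus ?thesis by (simp only: g_def flip: exp_add)
  qed
  moreover have "exp (- s * of_real (ln x)) = of_real x powr (-s)" using x by (simp add: powr_def Ln_of_real)
  ultimately show ?thesis by (simp add: mult.commute)
qed

lemma norm_Gamma_le:
  assumes "Re s > 0"
  shows "norm (Gamma s) \<le> Gamma (Re s)"
proof -
  have 1: "has_bochner_integral lborel (\<lambda>v. exp (- of_real (exp v) + s * of_real v)) (Gamma s)"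
    using Gamma_log_Mellin[OF assms, of 1] by simp
  have "has_bochner_integral lborel (\<lambda>v. exp (- of_real (exp v) + of_real (Re s) * of_real v)) (Gamma (complex_of_real (Re s)))"
    using Gamma_log_Mellin[of "of_real (Re s)" 1] assms by simp
  hence "has_bochner_integral lborel (\<lambda>v. complex_of_real (exp (- exp v + Re s * v))) (of_real (Gamma (Re s)))"
    by (simp add: Gamma_complex_of_real exp_add exp_minus flip: exp_of_real)
  hence 2: "has_bochner_integral lborel (\<lambda>v. exp (- exp v + Re s * v)) (Gamma (Re s))"
    by (rule has_bochner_integral_complex_of_realD)
  have "norm (Gamma s) \<le> (LBINT v. norm (exp (- of_real (exp v) + s * of_real v)))"
    using integral_norm_bound[of lborel "\<lambda>v. exp (- of_real (exp v) + s * of_real v)"] 1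
    by (simp add: has_bochner_integral_iff)
  also have "\<dots> = Gamma (Re s)" using 2 by (simp add: has_bochner_integral_iff)
  finally show ?thesis .
qed

text \<open>Each use of Gamma (z + 1) = z Gamma z moves one unit to the right and gains a factor
  \<bar>Im z\<bar>, since \<bar>z\<bar> \<ge> \<bar>Im z\<bar>. This gives polynomial decay of any
  order without Stirling's formula.\<close>

lemma norm_Gamma_le_shift:
  assumes "Re z > 0" "Im z \<noteq> 0"
  shows "norm (Gamma z) \<le> Gamma (Re z + real k) / \<bar>Im z\<bar> ^ k"
  using assms
proof (induction k arbitrary: z)
  case 0
  thus ?case using norm_Gamma_le[of z] by simp
next
  case (Suc k)
  have z: "z \<noteq> 0" using Suc.prems by auto
  have "\<bar>Im z\<bar> * norm (Gamma z) \<le> norm z * norm (Gamma z)"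
    by (intro mult_right_mono abs_Im_le_cmod) auto
  also have "\<dots> = norm (Gamma (z + 1))"
    by (subst Gamma_plus1) (use Suc.prems in \<open>auto simp: norm_mult elim!: nonpos_Ints_cases\<close>)
  also have "\<dots> \<le> Gamma (Re (z + 1) + real k) / \<bar>Im (z + 1)\<bar> ^ k"
    by (rule Suc.IH) (use Suc.prems in auto)
  finally show ?case using Suc.prems by (simp add: field_simps)
qed

lemma Gamma_strip_bound:
  assumes "0 < a"
  obtains C where "C > 0" "\<And>z. a \<le> Re z \<Longrightarrow> Re z \<le> b \<Longrightarrow> norm (Gamma z) \<le> C"
    "\<And>z. a \<le> Re z \<Longrightarrow> Re z \<le> b \<Longrightarrow> Im z \<noteq> 0 \<Longrightarrow> norm (Gamma z) \<le> C / \<bar>Im z\<bar> ^ k"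
proof -
  have c: "continuous_on {a..b} (\<lambda>x. Gamma x + Gamma (x + real k))"
    using assms by (intro continuous_intros continuous_on_compose2[OF continuous_on_Gamma[of "{0<..}"]]) (auto elim!: nonpos_Ints_cases)
  have "compact ((\<lambda>x. Gamma x + Gamma (x + real k)) ` {a..b})"
    by (intro compact_continuous_image c) auto
  then obtain C where C: "\<And>x. x \<in> {a..b} \<Longrightarrow> norm (Gamma x + Gamma (x + real k)) \<le> C"
    using compact_imp_bounded bounded_iff by (metis (no_types, lifting) imageI)
  have C': "Gamma x \<le> max C 1" "Gamma (x + real k) \<le> max C 1" if "x \<in> {a..b}" for x
  proof -
    have "0 < Gamma x" "0 < Gamma (x + real k)" using that assms by (auto intro!: Gamma_real_pos)
    with C[OF that] show "Gamma x \<le> max C 1" "Gamma (x + real k) \<le> max C 1" by auto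
  qed
  show ?thesis
  proof (rule that[of "max C 1"])
    fix z assume z: "a \<le> Re z" "Re z \<le> b"
    show "norm (Gamma z) \<le> max C 1"
      using norm_Gamma_le[of z] C'(1)[of "Re z"] z assms by auto
    assume i: "Im z \<noteq> 0"
    have "norm (Gamma z) \<le> Gamma (Re z + real k) / \<bar>Im z\<bar> ^ k"
      using norm_Gamma_le_shift[of z k] z i assms by auto
    also have "\<dots> \<le> max C 1 / \<bar>Im z\<bar> ^ k"
      using C'(2)[of "Re z"] z by (intro divide_right_mono) auto
    finally show "norm (Gamma z) \<le> max C 1 / \<bar>Im z\<bar> ^ k" .
  qed auto
qed

section \<open>Fubini's theorem and Fourier inversion\<close>

lemma Fubini_product_bound:
  fixes F :: "real \<Rightarrow> real \<Rightarrow> complex"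
  assumes [measurable]: "(\<lambda>(x, y). F x y) \<in> borel_measurable (borel \<Otimes>\<^sub>M borel)"
    and g: "integrable lborel g" and h: "integrable lborel h"
    and bd: "\<And>x y. norm (F x y) \<le> g x * h y"
  shows "(LBINT y. LBINT x. F x y) = (LBINT x. LBINT y. F x y)"
proof -

  have m: "(\<lambda>(x, y). F x y) \<in> borel_measurable (lborel \<Otimes>\<^sub>M lborel)"
    by (simp add: borel_prod)
  have [measurable]: "g \<in> borel_measurable borel" "h \<in> borel_measurable borel" using g h by auto
  have iy: "integrable lborel (F x)" for x
  proof (rule Bochner_Integration.integrable_bound)
    show "integrable lborel (\<lambda>y. g x * h y)" using h by simp
    show "F x \<in> borel_measurable lborel" by measurable
  qed (use order_trans[OF bd abs_ge_self] in auto)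
  have "integrable (lborel \<Otimes>\<^sub>M lborel) (\<lambda>(x, y). F x y)"
  proof (rule lborel_pair.Fubini_integrable[OF m])
    show "integrable lborel (\<lambda>x. LBINT y. norm (case (x, y) of (x, y) \<Rightarrow> F x y))"
    proof (rule Bochner_Integration.integrable_bound)
      show "integrable lborel (\<lambda>x. g x * (LBINT y. h y))" using g by simp
      show "(\<lambda>x. LBINT y. norm (case (x, y) of (x, y) \<Rightarrow> F x y)) \<in> borel_measurable lborel"
        by measurable
      have "(LBINT y. norm (F x y)) \<le> g x * (LBINT y. h y)" for x
        using integral_mono[of lborel "\<lambda>y. norm (F x y)" "\<lambda>y. g x * h y"] iy[of x] h bd by simp
      moreover have "0 \<le> (LBINT y. norm (F x y))" for x by simp
      ultimately show "AE x in lborel. norm (LBINT y. norm (case (x, y) of (x, y) \<Rightarrow> F x y)) \<le> norm (g x * (LBINT y. h y))"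
        by (auto intro!: AE_I2 order_trans[OF _ abs_ge_self])
    qed
  qed (use iy in auto)
  from lborel_pair.Fubini_integral[OF this] show ?thesis .
qed

text \<open>Gaussian summation: the convergence factor in \<open>w n\<close> makes the double
  integral absolutely convergent. After Fubini the inner integral is again Gaussian, so
  \<open>I n\<close> is an average of \<open>f\<close> over a window of width about 1/(n + 1) around
  \<open>x\<close>, and tends to the value at \<open>x\<close>. The bound \<open>M\<close> supplies
  the dominating function for this last limit.\<close>

lemma Fourier_inversion:
  fixes f :: "real \<Rightarrow> complex"
  assumes cont: "continuous_on UNIV f" and int: "integrable lborel f" and bd: "\<And>v. norm (f v) \<le> M"
  defines "F \<equiv> \<lambda>t. LBINT v. f v * exp (\<i> * of_real (t * v))"
  assumes Fint: "integrable lborel F"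
  shows "(LBINT t. F t * exp (- \<i> * of_real (t * x))) = 2 * pi * f x"
proof -
  have [measurable]: "f \<in> borel_measurable borel" using cont by (simp add: borel_measurable_continuous_onI)
  have [measurable]: "F \<in> borel_measurable borel" using Fint by auto
  define w where "w n t = exp (- of_real ((t / real (Suc n))\<^sup>2)) * exp (- \<i> * of_real (t * x))" for n t
  define I where "I n = (LBINT t. F t * w n t)" for n
  have w: "norm (w n t) \<le> 1" for n t by (simp add: w_def norm_mult)
  have [measurable]: "w n \<in> borel_measurable borel" for n unfolding w_def by measurable
  have 1: "I \<longlonglongrightarrow> (LBINT t. F t * exp (- \<i> * of_real (t * x)))"
    unfolding I_def
  proof (rule integral_dominated_convergence)
    show "integrable lborel (\<lambda>t. norm (F t))" using Fint by simp
    show "AE t in lborel. norm (F t * w i t) \<le> norm (F t)" for i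
      using mult_left_mono[OF w norm_ge_zero] by (auto simp: norm_mult)
    have "(\<lambda>n. w n t) \<longlonglongrightarrow> exp (- of_real (0\<^sup>2)) * exp (- \<i> * of_real (t * x))" for t
      unfolding w_def by (intro tendsto_intros LIMSEQ_Suc lim_const_over_n)
    thus "AE t in lborel. (\<lambda>n. F t * w n t) \<longlonglongrightarrow> F t * exp (- \<i> * of_real (t * x))"
      by (auto intro!: tendsto_mult_left)
  qed measurable
  have 2: "I n = (LBINT u. f (x + u / real (Suc n)) * of_real (sqrt pi * exp (- (u\<^sup>2 / 4))))" for n
  proof -
    let ?N = "real (Suc n)"
    have gi: "has_bochner_integral lborel (\<lambda>t. exp (- of_real (1 / ?N\<^sup>2 * t\<^sup>2) + (\<i> * of_real y) * of_real t))
        (of_real (sqrt (pi / (1 / ?N\<^sup>2))) * exp ((\<i> * of_real y)\<^sup>2 / (4 * of_real (1 / ?N\<^sup>2))))" for y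
      by (rule gaussian_integral) simp
    have g0: "integrable lborel (\<lambda>t. exp (- (t / ?N)\<^sup>2))"
    proof -
      have "integrable lborel (\<lambda>t. norm (exp (- complex_of_real (1 / ?N\<^sup>2 * t\<^sup>2) + (\<i> * of_real 0) * of_real t)))"
        using gi[of 0] by (intro integrable_norm) (auto simp: has_bochner_integral_iff)
      thus ?thesis by (simp add: power_divide)
    qed
    have "I n = (LBINT t. LBINT v. f v * exp (\<i> * of_real (t * v)) * w n t)"
      unfolding I_def F_def by (subst integral_mult_left_zero) simp
    also have "\<dots> = (LBINT v. LBINT t. f v * exp (\<i> * of_real (t * v)) * w n t)"
    proof (rule Fubini_product_bound[OF _ integrable_norm[OF int] g0])
      show "norm (f v * exp (\<i> * of_real (t * v)) * w n t) \<le> norm (f v) * exp (- (t / ?N)\<^sup>2)" for v t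
        by (simp add: norm_mult w_def)
    qed measurable
    also have "(\<lambda>v. LBINT t. f v * exp (\<i> * of_real (t * v)) * w n t) = (\<lambda>v. f v * of_real (sqrt pi * ?N * exp (- ((?N * (v - x))\<^sup>2 / 4))))"
    proof
      fix v
      have "f v * exp (\<i> * of_real (t * v)) * w n t = f v * exp (- of_real (1 / ?N\<^sup>2 * t\<^sup>2) + (\<i> * of_real (v - x)) * of_real t)" for t
        by (simp add: w_def power_divide algebra_simps flip: exp_add)
      moreover have "(LBINT t. exp (- of_real (1 / ?N\<^sup>2 * t\<^sup>2) + (\<i> * of_real (v - x)) * of_real t)) =
          (of_real (sqrt (pi / (1 / ?N\<^sup>2))) * exp ((\<i> * of_real (v - x))\<^sup>2 / (4 * of_real (1 / ?N\<^sup>2))))"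
        using gi[of "v - x"] by (simp only: has_bochner_integral_iff)
      moreover have "sqrt (pi / (1 / ?N\<^sup>2)) = sqrt pi * ?N" by (simp add: real_sqrt_mult)
      moreover have "(\<i> * of_real (v - x))\<^sup>2 / (4 * of_real (1 / ?N\<^sup>2)) = complex_of_real (- ((?N * (v - x))\<^sup>2 / 4))"
        by (simp add: power_mult_distrib right_diff_distrib[symmetric] mult.commute)
      ultimately show "(LBINT t. f v * exp (\<i> * of_real (t * v)) * w n t) = f v * of_real (sqrt pi * ?N * exp (- ((?N * (v - x))\<^sup>2 / 4)))"
        by (simp only: integral_mult_right_zero of_real_mult exp_of_real[symmetric] )
    qed
    also have "(LBINT v. f v * of_real (sqrt pi * ?N * exp (- ((?N * (v - x))\<^sup>2 / 4)))) =
        (LBINT u. f (x + u / ?N) * of_real (sqrt pi * exp (- (u\<^sup>2 / 4))))"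
    proof -
      have "(LBINT v. f v * of_real (sqrt pi * ?N * exp (- ((?N * (v - x))\<^sup>2 / 4)))) =
         \<bar>1 / ?N\<bar> *\<^sub>R (LBINT u. f (x + 1 / ?N * u) * of_real (sqrt pi * ?N * exp (- ((?N * (x + 1 / ?N * u - x))\<^sup>2 / 4))))"
        by (rule lborel_integral_real_affine) simp
      also have "\<dots> = (LBINT u. \<bar>1 / ?N\<bar> *\<^sub>R (f (x + 1 / ?N * u) * of_real (sqrt pi * ?N * exp (- ((?N * (x + 1 / ?N * u - x))\<^sup>2 / 4)))))"
        by simp
      also have "(\<lambda>u. \<bar>1 / ?N\<bar> *\<^sub>R (f (x + 1 / ?N * u) * of_real (sqrt pi * ?N * exp (- ((?N * (x + 1 / ?N * u - x))\<^sup>2 / 4))))) =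
        (\<lambda>u. f (x + u / ?N) * of_real (sqrt pi * exp (- (u\<^sup>2 / 4))))"
      proof
        fix u
        have "?N * (x + 1 / ?N * u - x) = u" "x + 1 / ?N * u = x + u / ?N" by simp_all
        moreover have "sqrt pi * ?N * E = ?N * (sqrt pi * E)" for E by simp
        ultimately show "\<bar>1 / ?N\<bar> *\<^sub>R (f (x + 1 / ?N * u) * of_real (sqrt pi * ?N * exp (- ((?N * (x + 1 / ?N * u - x))\<^sup>2 / 4)))) =
          f (x + u / ?N) * of_real (sqrt pi * exp (- (u\<^sup>2 / 4)))"
          by (simp only: scaleR_conv_of_real of_real_mult) (simp del: of_nat_Suc)
      qed
      finally show ?thesis .
    qed
    finally show ?thesis .
  qed
  have g4: "has_bochner_integral lborel (\<lambda>u. exp (- (u\<^sup>2 / 4))) (sqrt (4 * pi))"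
  proof -
    have "has_bochner_integral lborel (\<lambda>u. complex_of_real (exp (- (u\<^sup>2 / 4)))) (complex_of_real (sqrt (4 * pi)))"
      using gaussian_integral[of "1/4" 0] by (simp add: field_simps flip: exp_of_real)
    thus ?thesis by (rule has_bochner_integral_complex_of_realD)
  qed
  have "I \<longlonglongrightarrow> (LBINT u. f x * of_real (sqrt pi * exp (- (u\<^sup>2 / 4))))"
    unfolding 2
  proof (rule integral_dominated_convergence)
    show "integrable lborel (\<lambda>u. M * (sqrt pi * exp (- (u\<^sup>2 / 4))))"
      using g4 by (simp add: has_bochner_integral_iff)
    show "AE u in lborel. norm (f (x + u / real (Suc i)) * of_real (sqrt pi * exp (- (u\<^sup>2 / 4)))) \<le> M * (sqrt pi * exp (- (u\<^sup>2 / 4)))" for i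
      by (auto simp: norm_mult intro!: mult_right_mono bd)
    have "(\<lambda>n. x + u / real (Suc n)) \<longlonglongrightarrow> x + 0" for u
      by (intro tendsto_intros LIMSEQ_Suc lim_const_over_n)
    hence "(\<lambda>n. f (x + u / real (Suc n))) \<longlonglongrightarrow> f (x + 0)" for u
      by (rule continuous_on_tendsto_compose[OF cont]) auto
    thus "AE u in lborel. (\<lambda>n. f (x + u / real (Suc n)) * of_real (sqrt pi * exp (- (u\<^sup>2 / 4)))) \<longlonglongrightarrow> f x * of_real (sqrt pi * exp (- (u\<^sup>2 / 4)))"
      by (auto intro!: tendsto_mult_right)
  qed measurable
  also have "(LBINT u. f x * of_real (sqrt pi * exp (- (u\<^sup>2 / 4)))) = f x * of_real (sqrt pi * sqrt (4 * pi))"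
    using g4 by (simp only: integral_mult_right_zero integral_complex_of_real has_bochner_integral_iff of_real_mult)
  also have "sqrt pi * sqrt (4 * pi) = 2 * pi" by (simp add: real_sqrt_mult)
  finally show ?thesis using LIMSEQ_unique[OF 1] by (simp add: mult.commute)
qed

text \<open>By \<open>Gamma_log_Mellin\<close>, Gamma on the line Re s = c is the Fourier transform
  of exp (- exp v + c v); inversion is evaluated at v = ln y.\<close>

lemma Gamma_Mellin_inversion:
  assumes c: "c > 0" and y: "y > 0"
  shows "(LBINT t. Gamma (Complex c t) * of_real y powr (- Complex c t)) = 2 * pi * exp (- y)"
proof -
  define f where "f = (\<lambda>v. exp (- complex_of_real (exp v) + of_real c * of_real v))"
  have fv: "f v * exp (\<i> * of_real (t * v)) = exp (- complex_of_real (1 * exp v) + Complex c t * of_real v)" for v t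
    by (simp add: f_def Complex_eq algebra_simps flip: exp_add)
  have Fe: "(LBINT v. f v * exp (\<i> * of_real (t * v))) = Gamma (Complex c t)" for t
    using Gamma_log_Mellin[of "Complex c t" 1] c unfolding fv by (simp add: has_bochner_integral_iff)
  have int: "integrable lborel f"
    using Gamma_log_Mellin[of "of_real c" 1] c by (simp add: has_bochner_integral_iff f_def)
  have cont: "continuous_on UNIV f" unfolding f_def by (intro continuous_intros)
  \<comment> \<open>The only nontrivial range is v > c, where 2 c v \<le> c^2 + v^2 and the
    quadratic Taylor bound for exp v are combined.\<close>
  have bd: "norm (f v) \<le> exp (c\<^sup>2)" for v
  proof -
    have "- exp v + c * v \<le> c\<^sup>2"
    proof (cases "v \<le> c")
      case True thus ?thesis using c exp_gt_zero[of v] mult_left_mono[OF True, of c] unfolding power2_eq_square by linarith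
    next
      case False
      have "2 * (c * v) \<le> c\<^sup>2 + v\<^sup>2" using sum_squares_bound[of c v] by (simp add: mult.assoc)
      moreover have "1 + v + v\<^sup>2 / 2 \<le> exp v" using exp_lower_Taylor_quadratic[of v] False c by auto
      moreover have "0 \<le> c\<^sup>2" by simp
      ultimately show ?thesis using False c by linarith
    qed
    thus ?thesis by (simp add: f_def)
  qed
  obtain C where C: "\<And>z. c \<le> Re z \<Longrightarrow> Re z \<le> c \<Longrightarrow> Im z \<noteq> 0 \<Longrightarrow> norm (Gamma z) \<le> C / \<bar>Im z\<bar> ^ 2"
    using Gamma_strip_bound[OF c] by metis
  have "integrable lborel (\<lambda>t. Gamma (Complex c t))"
  proof (rule integrable_of_decay)
    show "continuous_on UNIV (\<lambda>t. Gamma (Complex c t))"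
      by (rule continuous_on_compose2[OF holomorphic_on_imp_continuous_on[OF holomorphic_Gamma[of "{z. Re z > 0}"]]])
         (use c in \<open>auto elim!: nonpos_Ints_cases intro!: continuous_intros\<close>)
    show "norm (Gamma (Complex c t)) \<le> C / t\<^sup>2" if "\<bar>t\<bar> \<ge> 1" for t
      using C[of "Complex c t"] that by auto
  qed
  from Fourier_inversion[OF cont int bd, unfolded Fe, OF this, of "ln y"]
  have "(LBINT t. Gamma (Complex c t) * exp (- \<i> * of_real (t * ln y))) = 2 * pi * f (ln y)" .
  moreover have "of_real y powr (- Complex c t) = exp (- \<i> * of_real (t * ln y)) * of_real (y powr (-c))" for t
    using y by (simp add: powr_def Ln_of_real Complex_eq algebra_simps flip: exp_add exp_of_real)
  moreover have "f (ln y) = of_real (exp (- y) * y powr c)"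
  proof -
    have "exp (complex_of_real (ln y)) = of_real y" using y by (simp add: exp_of_real)
    thus ?thesis using y by (simp add: f_def powr_def exp_diff exp_minus divide_inverse mult.commute flip: exp_of_real)
  qed
  ultimately show ?thesis using y by (simp add: powr_minus flip: mult.assoc)
qed

text \<open>Expanding exp (s u) and integrating termwise yields a convergent power series in
  \<open>s\<close>; integrability at the radius \<open>R\<close> dominates all partial sums. No
  differentiation under the integral sign is involved.\<close>

lemma Laplace_holomorphic:
  fixes g :: "real \<Rightarrow> complex"
  assumes [measurable]: "g \<in> borel_measurable borel"
    and int: "integrable lborel (\<lambda>u. norm (g u) * exp (R * \<bar>u\<bar>))"
  shows "(\<lambda>s. LBINT u. g u * exp (s * of_real u)) holomorphic_on ball 0 R"
proof (rule power_series_holomorphic)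
  fix s :: complex assume s: "s \<in> ball 0 R"
  define f where "f n u = g u * (s * of_real u) ^ n / fact n" for n u
  have sm: "(\<lambda>n. norm (f n u)) sums (norm (g u) * exp (norm s * \<bar>u\<bar>))" for u
  proof -
    have "(\<lambda>n. norm (g u) * ((norm s * \<bar>u\<bar>) ^ n /\<^sub>R fact n)) sums (norm (g u) * exp (norm s * \<bar>u\<bar>))"
      by (intro sums_mult exp_converges)
    thus ?thesis by (simp add: f_def norm_mult norm_power norm_divide divide_inverse mult_ac norm_inverse)
  qed
  have sm': "(\<lambda>n. f n u) sums (g u * exp (s * of_real u))" for u
  proof -
    have "(\<lambda>n. g u * ((s * of_real u) ^ n /\<^sub>R fact n)) sums (g u * exp (s * of_real u))"
      by (intro sums_mult exp_converges)
    thus ?thesis by (simp add: f_def scaleR_conv_of_real divide_inverse mult_ac)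
  qed
  have [measurable]: "f n \<in> borel_measurable borel" for n unfolding f_def by measurable
  have dom: "integrable lborel (\<lambda>u. norm (g u) * exp (norm s * \<bar>u\<bar>))"
    by (rule Bochner_Integration.integrable_bound[OF int])
       (use s in \<open>auto intro!: mult_left_mono mult_right_mono\<close>)
  have part: "(\<Sum>n<m. norm (f n u)) \<le> norm (g u) * exp (norm s * \<bar>u\<bar>)" for m u
    using sum_le_suminf[of "\<lambda>n. norm (f n u)" "{..<m}"] sm[of u] sums_unique[OF sm[of u]] by (auto simp: sums_iff)
  have fi: "integrable lborel (f n)" for n
  proof (rule Bochner_Integration.integrable_bound[OF dom])
    have "norm (f n u) \<le> (\<Sum>k<Suc n. norm (f k u))" for u by (rule member_le_sum) auto
    from order_trans[OF this part] show "AE u in lborel. norm (f n u) \<le> norm (norm (g u) * exp (norm s * \<bar>u\<bar>))"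
      by auto
  qed measurable
  have "(\<lambda>n. LBINT u. f n u) sums (LBINT u. (\<Sum>n. f n u))"
  proof (rule sums_integral[OF fi])
    show "AE u in lborel. summable (\<lambda>n. norm (f n u))" using sm by (auto simp: sums_iff)
    show "summable (\<lambda>n. LBINT u. norm (f n u))"
    proof (rule summableI_nonneg_bounded)
      fix m
      have "(\<Sum>n<m. LBINT u. norm (f n u)) = (LBINT u. (\<Sum>n<m. norm (f n u)))"
        using fi by (subst Bochner_Integration.integral_sum) auto
      also have "\<dots> \<le> (LBINT u. norm (g u) * exp (norm s * \<bar>u\<bar>))"
        using fi dom part by (intro integral_mono) auto
      finally show "(\<Sum>n<m. LBINT u. norm (f n u)) \<le> (LBINT u. norm (g u) * exp (norm s * \<bar>u\<bar>))" .
    qed auto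
  qed
  also have "(\<lambda>u. \<Sum>n. f n u) = (\<lambda>u. g u * exp (s * of_real u))"
    using sm' by (simp add: sums_iff)
  also have "(\<lambda>n. LBINT u. f n u) = (\<lambda>n. (LBINT u. g u * of_real u ^ n / fact n) * (s - 0) ^ n)"
    by (simp add: f_def power_mult_distrib flip: integral_mult_left_zero) (simp add: mult_ac)
  finally show "(\<lambda>n. (LBINT u. g u * of_real u ^ n / fact n) * (s - 0) ^ n) sums (LBINT u. g u * exp (s * of_real u))" .
qed

section \<open>Theta inversion\<close>

text \<open>The integrand is exp (- pi x (z + a)^2) exp (2 pi \<i> j z) on the line z = - t + \<i>
  \<eta>. That the value does not depend on \<eta> is the contour shift, here contained in the
  Gaussian integral with complex linear term.\<close>

lemma gaussian_Fourier_shifted: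
  fixes x a \<eta> j :: real
  assumes x: "x > 0"
  shows "has_bochner_integral lborel
     (\<lambda>t. exp (- of_real (pi * x) * (Complex (a - t) \<eta>)\<^sup>2 + 2 * pi * \<i> * j * Complex (- t) \<eta>))
     (of_real (1 / sqrt x * exp (- pi * j\<^sup>2 / x)) * exp (- 2 * pi * \<i> * j * a))"
proof -
  define b where "b = 2 * pi * (of_real x * Complex a \<eta> - \<i> * j)"
  define k where "k = - of_real (pi * x) * (Complex a \<eta>)\<^sup>2 - 2 * pi * \<eta> * j"
  have "has_bochner_integral lborel (\<lambda>t. exp k * exp (- of_real (pi * x * t\<^sup>2) + b * of_real t))
     (exp k * (of_real (sqrt (pi / (pi * x))) * exp (b\<^sup>2 / (4 * of_real (pi * x)))))"
    by (intro has_bochner_integral_mult_right gaussian_integral) (use x in auto)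
  moreover have "exp k * exp (- of_real (pi * x * t\<^sup>2) + b * of_real t) =
     exp (- of_real (pi * x) * (Complex (a - t) \<eta>)\<^sup>2 + 2 * pi * \<i> * j * Complex (- t) \<eta>)" for t
  proof -
    have "k + (- of_real (pi * x * t\<^sup>2) + b * of_real t) = - of_real (pi * x) * (Complex (a - t) \<eta>)\<^sup>2 + 2 * pi * \<i> * j * Complex (- t) \<eta>"
      by (simp add: k_def b_def Complex_eq algebra_simps power2_eq_square)
    thus ?thesis by (simp only: exp_add[symmetric])
  qed
  moreover have "exp k * (of_real (sqrt (pi / (pi * x))) * exp (b\<^sup>2 / (4 * of_real (pi * x)))) =
     of_real (1 / sqrt x * exp (- pi * j\<^sup>2 / x)) * exp (- 2 * pi * \<i> * j * a)"
  proof -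
    have "b\<^sup>2 / (4 * of_real (pi * x)) = pi * (of_real x * Complex a \<eta> - \<i> * j)\<^sup>2 / x"
      using x by (simp add: b_def power_mult_distrib power2_eq_square)
    also have "\<dots> = pi * x * (Complex a \<eta>)\<^sup>2 - 2 * pi * \<i> * j * Complex a \<eta> - pi * j\<^sup>2 / x"
      using x by (simp add: power2_eq_square field_simps)
    finally have "k + b\<^sup>2 / (4 * of_real (pi * x)) = of_real (- pi * j\<^sup>2 / x) + (- 2 * pi * \<i> * j * a)"
      using x by (simp add: k_def Complex_eq algebra_simps)
    hence "exp k * exp (b\<^sup>2 / (4 * of_real (pi * x))) = exp (of_real (- pi * j\<^sup>2 / x)) * exp (- 2 * pi * \<i> * j * a)"
      by (simp only: exp_add[symmetric])
    moreover have "sqrt (pi / (pi * x)) = 1 / sqrt x" by (simp add: real_sqrt_divide)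
    ultimately have "exp k * (of_real (sqrt (pi / (pi * x))) * exp (b\<^sup>2 / (4 * of_real (pi * x)))) =
       of_real (1 / sqrt x) * (exp (of_real (- pi * j\<^sup>2 / x)) * exp (- 2 * pi * \<i> * j * a))"
      by (metis mult.left_commute)
    thus ?thesis by (simp only: of_real_mult exp_of_real mult.assoc)
  qed
  ultimately show ?thesis by simp
qed

lemma has_sum_int_symmetricI:
  fixes g :: "int \<Rightarrow> real"
  assumes nn: "\<And>m. g m \<ge> 0" and lim: "(\<lambda>M. \<Sum>m\<in>{-int M..int M}. g m) \<longlonglongrightarrow> L"
  shows "(g has_sum L) UNIV"
proof -
  let ?P = "\<lambda>M. \<Sum>m\<in>{-int M..int M}. g m"
  have cov: "\<exists>M. F \<subseteq> {-int M..int M}" if "finite F" for F :: "int set"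
  proof -
    have "\<bar>m\<bar> \<le> (\<Sum>k\<in>F. \<bar>k\<bar>)" if "m \<in> F" for m
      using \<open>finite F\<close> that by (intro member_le_sum) auto
    thus ?thesis by (intro exI[of _ "nat (\<Sum>k\<in>F. \<bar>k\<bar>)"]) force
  qed
  have inc: "incseq ?P" by (intro monoI sum_mono2) (use nn in auto)
  have le: "?P M \<le> L" for M by (rule incseq_le[OF inc lim])
  have bdd: "sum g F \<le> L" if F: "finite F" for F
  proof -
    obtain M where "F \<subseteq> {-int M..int M}" using cov[OF F] by blast
    hence "sum g F \<le> ?P M" using nn by (intro sum_mono2) auto
    with le show ?thesis by (rule order_trans[rotated])
  qed
  have sm: "g summable_on UNIV"
    by (rule nonneg_bdd_above_summable_on) (use nn bdd in \<open>auto intro!: bdd_aboveI[of _ L]\<close>)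
  have "infsum g UNIV \<le> L"
    by (rule infsum_le_finite_sums[OF sm]) (use bdd in auto)
  moreover have "L \<le> infsum g UNIV"
  proof (rule LIMSEQ_le_const2[OF lim], intro exI allI impI)
    fix M show "?P M \<le> infsum g UNIV"
      by (rule finite_sum_le_infsum[OF sm]) (use nn in auto)
  qed
  ultimately have "infsum g UNIV = L" by (rule antisym)
  thus ?thesis using has_sum_infsum[OF sm] by metis
qed

lemma has_sum_int_even:
  fixes h :: "int \<Rightarrow> complex"
  assumes h: "(h has_sum H) UNIV" and ev: "\<And>n. h (- n) = h n"
  shows "(\<lambda>n. h (int (Suc n))) sums ((H - h 0) / 2)"
proof -
  have sm: "h summable_on A" for A using h summable_on_subset_banach[of h UNIV A] by (auto simp: summable_on_def)
  obtain P where P: "(h has_sum P) {1..}" using sm[of "{1..}"] by (auto simp: summable_on_def)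
  have N: "(h has_sum P) {..-1}"
  proof -
    have "((\<lambda>n. h (- n)) has_sum P) {..-1} \<longleftrightarrow> (h has_sum P) {1..}"
      by (rule has_sum_reindex_bij_witness[of _ uminus uminus]) auto
    thus ?thesis using P ev by simp
  qed
  have "(h has_sum (h 0)) {0}" by (rule has_sum_finiteI) auto
  hence "(h has_sum (P + P + h 0)) (({1..} \<union> {..-1}) \<union> {0})"
    using P N by (intro has_sum_Un_disjoint) auto
  moreover have "({1..} \<union> {..-1}) \<union> {0::int} = UNIV" by auto
  ultimately have "H = P + P + h 0" using h has_sum_unique by metis
  moreover have "((\<lambda>n. h (int (Suc n))) has_sum P) UNIV"
  proof -
    have "((\<lambda>n. h (int (Suc n))) has_sum P) UNIV \<longleftrightarrow> (h has_sum P) {1..}"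
      by (rule has_sum_reindex_bij_witness[of _ "\<lambda>m. nat (m - 1)" "\<lambda>n. int (Suc n)"]) auto
    thus ?thesis using P by simp
  qed
  hence "(\<lambda>n. h (int (Suc n))) sums P" by (rule has_sum_imp_sums)
  ultimately show ?thesis by simp
qed

lemma integral_geometric_sums:
  fixes h r :: "real \<Rightarrow> complex"
  assumes h: "integrable lborel h" and [measurable]: "r \<in> borel_measurable borel"
    and r: "\<And>t. norm (r t) \<le> q" and q: "q < 1"
  shows "(\<lambda>n. LBINT t. h t * r t ^ n) sums (LBINT t. h t / (1 - r t))"
    and "integrable lborel (\<lambda>t. h t / (1 - r t))"
proof -
  have [measurable]: "h \<in> borel_measurable borel" using h by auto
  have q0: "0 \<le> q" using order_trans[OF norm_ge_zero r] .
  have bd: "norm (h t * r t ^ n) \<le> norm (h t) * q ^ n" for n t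
    unfolding norm_mult norm_power by (intro mult_left_mono power_mono r) auto
  have hi: "integrable lborel (\<lambda>t. h t * r t ^ n)" for n
    by (rule Bochner_Integration.integrable_bound[of _ "\<lambda>t. norm (h t) * q ^ n"])
       (use h bd q0 in \<open>auto simp: abs_mult\<close>)
  have sm: "summable (\<lambda>n. norm (h t) * q ^ n)" for t
    using q q0 by (intro summable_mult summable_geometric) auto
  have sm1: "summable (\<lambda>n. norm (h t * r t ^ n))" for t
    by (rule summable_comparison_test'[OF sm[of t]]) (use bd in auto)
  have sm2: "summable (\<lambda>n. LBINT t. norm (h t * r t ^ n))"
  proof (rule summable_comparison_test')
    show "summable (\<lambda>n. (LBINT t. norm (h t)) * q ^ n)"
      using q q0 by (intro summable_mult summable_geometric) auto
    have "(LBINT t. norm (h t * r t ^ n)) \<le> (LBINT t. norm (h t) * q ^ n)" for n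
      using hi h bd by (intro integral_mono) auto
    thus "norm (LBINT t. norm (h t * r t ^ n)) \<le> (LBINT t. norm (h t)) * q ^ n" for n
      by simp
  qed
  have "(\<lambda>n. h t * r t ^ n) sums (h t * (1 / (1 - r t)))" for t
    using r[of t] q by (intro sums_mult geometric_sums) auto
  hence e: "(\<Sum>n. h t * r t ^ n) = h t / (1 - r t)" for t
    by (simp add: sums_iff)
  show "(\<lambda>n. LBINT t. h t * r t ^ n) sums (LBINT t. h t / (1 - r t))"
    using sums_integral[OF hi AE_I2[OF sm1] sm2] by (simp add: e)
  show "integrable lborel (\<lambda>t. h t / (1 - r t))"
    using integrable_suminf[OF hi AE_I2[OF sm1] sm2] by (simp add: e)
qed

text \<open>
  Residue calculus instead of Poisson summation: integrate
  \<open>exp (- pi x (z + a)^2) / (1 - exp (2 pi i z))\<close> along two horizontal lines around the real axis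
  and expand the denominator geometrically on each of them.
\<close>

lemma theta_inversion:
  fixes x a :: real
  assumes x: "x > 0"
  obtains L where "((\<lambda>m::int. exp (- pi * x * (of_int m + a)\<^sup>2)) has_sum L) UNIV"
    "(\<lambda>k. exp (- pi * (real (Suc k))\<^sup>2 / x) * cos (2 * pi * real (Suc k) * a)) sums ((sqrt x * L - 1) / 2)"
proof -
  define g where "g z = exp (- of_real (pi * x) * (z + of_real a)\<^sup>2)" for z :: complex
  \<comment> \<open>The plane is turned by a quarter: this is the integrand at \<i> z, so that the
    two horizontal lines become the sides Re z = 1 and Re z = -1 of
    \<open>rectangle_residues\<close> and the poles lie at \<i> m.\<close>
  define F where "F z = g (\<i> * z) / (1 - exp (- 2 * pi * z))" for z :: complex
  define P where "P M = (\<lambda>m. \<i> * complex_of_int m) ` {-int M..int M}" for M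
  \<comment> \<open>At half-integral height exp (- 2 pi z) is a negative real number, so the
    denominator has norm at least 1 on the horizontal sides.\<close>
  define K where "K M = real M + 1/2" for M
  have ez: "exp (- 2 * pi * z) = 1 \<longleftrightarrow> (\<exists>m::int. z = \<i> * of_int m)" for z :: complex
  proof -
    have "exp (- 2 * pi * z) = 1 \<longleftrightarrow> (\<exists>m::int. - 2 * pi * z = of_int (2 * m) * pi * \<i>)"
      by (subst exp_eq_1) (auto simp: complex_eq_iff)
    also have "\<dots> \<longleftrightarrow> (\<exists>m::int. z = \<i> * of_int m)"
    proof safe
      fix m :: int assume "- 2 * pi * z = of_int (2 * m) * pi * \<i>"
      hence "- 2 * (of_real pi * z) = - 2 * (of_real pi * (\<i> * of_int (- m)))" by (simp add: algebra_simps)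
      hence "of_real pi * z = of_real pi * (\<i> * of_int (- m))" by (subst (asm) mult_cancel_left) simp
      hence "z = \<i> * of_int (- m)" by (subst (asm) mult_cancel_left) simp
      thus "\<exists>m::int. z = \<i> * of_int m" by blast
    next
      fix m :: int
      show "\<exists>n::int. - 2 * pi * (\<i> * of_int m) = of_int (2 * n) * pi * \<i>"
        by (intro exI[of _ "-m"]) (simp add: algebra_simps)
    qed
    finally show ?thesis .
  qed
  have res: "residue F (\<i> * of_int m) = g (of_int (- m)) / (2 * pi)" for m :: int
  proof -
    have "residue (\<lambda>z. g (\<i> * z) / (1 - exp (- 2 * pi * z))) (\<i> * of_int m) =
          g (\<i> * (\<i> * of_int m)) / (2 * pi)"
    proof (rule residue_simple_pole_deriv[where s = UNIV])
      show "((\<lambda>z. 1 - exp (- 2 * pi * z)) has_field_derivative 2 * pi) (at (\<i> * of_int m))"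
        using ez[of "\<i> * of_int m"] by (auto intro!: derivative_eq_intros simp: algebra_simps)
      show "1 - exp (- 2 * pi * (\<i> * of_int m)) = 0" using ez[of "\<i> * of_int m"] by auto
      show "g (\<i> * (\<i> * of_int m)) \<noteq> 0" by (simp add: g_def)
    qed (auto simp: g_def intro!: holomorphic_intros)
    thus ?thesis by (simp add: F_def[abs_def] flip: mult.assoc)
  qed
  define h where "h \<eta> j t = exp (- of_real (pi * x) * (Complex (a - t) \<eta>)\<^sup>2 + 2 * pi * \<i> * of_real j * Complex (- t) \<eta>)" for \<eta> j t :: real
  define c where "c j = complex_of_real (1 / sqrt x * exp (- pi * j\<^sup>2 / x)) * exp (- 2 * pi * \<i> * of_real j * a)" for j :: real
  have h: "integrable lborel (h \<eta> j)" "(LBINT t. h \<eta> j t) = c j" for \<eta> j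
  proof -
    have "h \<eta> j = (\<lambda>t. exp (- of_real (pi * x) * (Complex (a - t) \<eta>)\<^sup>2 + 2 * pi * \<i> * of_real j * Complex (- t) \<eta>))"
      by (rule ext) (simp only: h_def)
    thus "integrable lborel (h \<eta> j)" "(LBINT t. h \<eta> j t) = c j"
      using gaussian_Fourier_shifted[OF x, of a \<eta> j] by (simp_all only: c_def has_bochner_integral_iff)
  qed
  have hmult: "h \<eta> j t * exp (2 * pi * \<i> * of_real l * Complex (- t) \<eta>) ^ k = h \<eta> (j + real k * l) t" for \<eta> j l t k
  proof -
    have "A + 2 * pi * \<i> * of_real j * w + of_nat k * (2 * pi * \<i> * of_real l * w) = A + 2 * pi * \<i> * of_real (j + real k * l) * w" for A w :: complex
      by (simp add: distrib_left distrib_right mult_ac)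
    thus ?thesis unfolding h_def by (simp only: exp_of_nat_mult[symmetric] exp_add[symmetric])
  qed
  have gh: "g (\<i> * Complex \<eta> t) = h \<eta> 0 t" for \<eta> t
  proof -
    have "\<i> * Complex \<eta> t + of_real a = Complex (a - t) \<eta>" by (simp add: complex_eq_iff)
    thus ?thesis by (simp add: g_def h_def)
  qed
  have em: "exp (- 2 * pi * Complex \<eta> t) = exp (2 * pi * \<i> * of_real 1 * Complex (- t) \<eta>)" for \<eta> t
    by (rule arg_cong[where f = exp]) (simp add: complex_eq_iff)
  have q: "norm (exp (2 * pi * \<i> * of_real l * Complex (- t) \<eta>)) = exp (- 2 * pi * l * \<eta>)" for l \<eta> t
    by simp
  have q1: "exp (- 2 * pi) < 1" by simp
  have F1: "F (Complex 1 t) = h 1 0 t / (1 - exp (2 * pi * \<i> * of_real 1 * Complex (- t) 1))" for t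
    by (simp only: F_def gh em)
  \<comment> \<open>On this side the exponential in the denominator has norm greater than 1. With
    its inverse E, 1 / (1 - 1/E) = - E / (1 - E), so the geometric series starts with the first
    power of E: the frequencies are -1, -2, and so on.\<close>
  have F2: "F (Complex (-1) t) = - h (-1) (-1) t / (1 - exp (2 * pi * \<i> * of_real (-1) * Complex (- t) (-1)))" for t
  proof -
    define E where "E = exp (2 * pi * \<i> * of_real (-1) * Complex (- t) (-1))"
    have E0: "E \<noteq> 0" by (simp add: E_def)
    have "exp (2 * pi * \<i> * of_real 1 * Complex (- t) (-1)) * E = 1"
      unfolding E_def by (subst exp_add[symmetric]) (simp add: algebra_simps)
    hence "exp (2 * pi * \<i> * of_real 1 * Complex (- t) (-1)) = inverse E"
      using E0 by (metis mult.commute inverse_unique)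
    moreover have "h (-1) (-1) t = h (-1) 0 t * E" using hmult[of "-1" 0 t "-1" 1] by (simp add: E_def)
    ultimately have "F (Complex (-1) t) = h (-1) 0 t / (1 - inverse E)" "h (-1) (-1) t = h (-1) 0 t * E"
      by (simp_all only: F_def gh em)
    moreover have "E \<noteq> 1"
    proof
      assume "E = 1"
      hence "exp (- 2 * pi) = (1::real)" using q[of "-1" t "-1"] by (simp add: E_def)
      thus False using q1 by simp
    qed
    ultimately show ?thesis using E0 unfolding E_def[symmetric] by (simp add: field_simps)
  qed
  have S1: "(\<lambda>k. LBINT t. h 1 0 t * exp (2 * pi * \<i> * of_real 1 * Complex (- t) 1) ^ k) sums (LBINT t. F (Complex 1 t))"
    and i1: "integrable lborel (\<lambda>t. F (Complex 1 t))"
    unfolding F1 by (intro integral_geometric_sums[OF h(1) _ _ q1]; use q[of 1 _ 1] in \<open>simp add: Complex_eq\<close>)+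
  have S2: "(\<lambda>k. LBINT t. - h (-1) (-1) t * exp (2 * pi * \<i> * of_real (-1) * Complex (- t) (-1)) ^ k) sums (LBINT t. F (Complex (-1) t))"
    and i2: "integrable lborel (\<lambda>t. F (Complex (-1) t))"
    unfolding F2 by (intro integral_geometric_sums[OF integrable_minus[OF h(1)] _ _ q1]; use q[of "-1" _ "-1"] in \<open>simp add: Complex_eq\<close>)+
  have S1': "(\<lambda>k. c (real k)) sums (LBINT t. F (Complex 1 t))"
    using S1 unfolding hmult h(2) by simp
  have S2': "(\<lambda>k. - c (- real (Suc k))) sums (LBINT t. F (Complex (-1) t))"
    using S2 unfolding hmult mult_minus_left integral_minus h(2) by (simp add: algebra_simps)
  have KP: "(\<lambda>M. integral {-K M..K M} (\<lambda>t. F (Complex 1 t)) - integral {-K M..K M} (\<lambda>t. F (Complex (-1) t)) - 2 * pi * (\<Sum>z\<in>P M. residue F z)) \<longlonglongrightarrow> 0"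
  proof (rule Lim_null_comparison)
    define B where "B M = exp (pi * x - pi * x * (K M - \<bar>a\<bar>)\<^sup>2)" for M
    show "(\<lambda>M. 2 * B M * (1 - (-1))) \<longlonglongrightarrow> 0"
      unfolding B_def K_def using x by real_asymp
    have "eventually (\<lambda>M. K M \<ge> \<bar>a\<bar>) sequentially" unfolding K_def by real_asymp
    thus "eventually (\<lambda>M. norm (integral {-K M..K M} (\<lambda>t. F (Complex 1 t)) - integral {-K M..K M} (\<lambda>t. F (Complex (-1) t)) - 2 * pi * (\<Sum>z\<in>P M. residue F z)) \<le> 2 * B M * (1 - (-1))) sequentially"
    proof eventually_elim
      case (elim M)
      have Fb: "norm (F (Complex u s)) \<le> B M" if u: "u \<in> {-1..1}" and s: "s = K M \<or> s = - K M" for u s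
      proof -
        have "exp (- 2 * pi * Complex u s) = - of_real (exp (- 2 * pi * u))"
        proof -
          have c: "cos (2 * pi * K M) = -1" "sin (2 * pi * K M) = 0"
            unfolding K_def distrib_left cos_add sin_add using cos_2npi[of M] sin_2npi[of M] by (simp_all add: mult_ac)
          show ?thesis using s c by (auto simp: exp_eq_polar complex_eq_iff Re_exp Im_exp)
        qed
        hence "norm (1 - exp (- 2 * pi * Complex u s)) = 1 + exp (- 2 * pi * u)"
          using norm_of_real[of "1 + exp (- 2 * pi * u)", where 'a = complex] by simp
        hence d: "norm (1 - exp (- 2 * pi * Complex u s)) \<ge> 1" by simp
        have "norm (h u 0 s) = exp (- pi * x * ((a - s)\<^sup>2 - u\<^sup>2))"
          by (simp add: h_def power2_eq_square)
        also have "\<dots> \<le> B M"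
        proof -
          have "\<bar>K M - \<bar>a\<bar>\<bar> \<le> \<bar>a - s\<bar>" using s elim by auto
          hence "(K M - \<bar>a\<bar>)\<^sup>2 \<le> (a - s)\<^sup>2" by (simp only: abs_le_square_iff)
          moreover have "u\<^sup>2 \<le> 1" using u abs_square_le_1[of u] by (auto simp: abs_le_iff)
          ultimately have "pi * x * (u\<^sup>2 - (a - s)\<^sup>2) \<le> pi * x * (1 - (K M - \<bar>a\<bar>)\<^sup>2)"
            using x by (intro mult_left_mono) auto
          thus ?thesis by (simp add: B_def algebra_simps)
        qed
        finally have n: "norm (g (\<i> * Complex u s)) \<le> B M" by (simp add: gh)
        have "norm (F (Complex u s)) \<le> B M / 1"
          unfolding F_def norm_divide using n d by (intro frac_le) (auto simp: B_def)
        thus ?thesis by simp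
      qed
      have km: "K M > 0" by (simp add: K_def)
      show ?case
      proof (rule rectangle_residues[where S = "{z. - (real M + 1) < Im z} \<inter> {z. Im z < real M + 1}"])
        show "open ({z. - (real M + 1) < Im z} \<inter> {z. Im z < real M + 1})"
          by (intro open_Int open_halfspace_Im_gt open_halfspace_Im_lt)
        show "connected ({z. - (real M + 1) < Im z} \<inter> {z. Im z < real M + 1})"
          by (intro convex_connected convex_Int convex_halfspace_Im_gt convex_halfspace_Im_lt)
        show "cbox (Complex (- 1) (- K M)) (Complex 1 (K M)) \<subseteq> {z. - (real M + 1) < Im z} \<inter> {z. Im z < real M + 1}"
          by (auto simp: in_cbox_complex_iff K_def)
        show "P M \<subseteq> box (Complex (- 1) (- K M)) (Complex 1 (K M))"
          by (auto simp: P_def in_box_complex_iff K_def)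
        have "finite (P M)" by (simp add: P_def)
        thus "finite (P M)" .
        show "F holomorphic_on {z. - (real M + 1) < Im z} \<inter> {z. Im z < real M + 1} - P M"
        proof -
          have "1 - exp (- 2 * pi * z) \<noteq> 0" if "z \<in> {z. - (real M + 1) < Im z} \<inter> {z. Im z < real M + 1} - P M" for z :: complex
          proof
            assume "1 - exp (- 2 * pi * z) = 0"
            hence "exp (- 2 * pi * z) = 1" by simp
            then obtain m :: int where m: "z = \<i> * of_int m" using ez by blast
            with that have "- (real M + 1) < of_int m" "of_int m < real M + 1" by auto
            hence "m \<in> {- int M..int M}" by auto
            with m that show False by (auto simp: P_def)
          qed
          thus ?thesis unfolding F_def g_def by (intro holomorphic_intros) auto
        qed
      qed (use Fb km in \<open>auto simp: B_def\<close>)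
    qed
  qed
  have Klim: "filterlim K at_top sequentially" unfolding K_def by real_asymp
  define L where "L = Re ((LBINT t. F (Complex 1 t)) - (LBINT t. F (Complex (-1) t)))"
  have PM: "2 * pi * (\<Sum>z\<in>P M. residue F z) = of_real (\<Sum>m\<in>{-int M..int M}. exp (- pi * x * (of_int m + a)\<^sup>2))" for M
  proof -
    have "(\<Sum>z\<in>P M. residue F z) = (\<Sum>m\<in>{-int M..int M}. residue F (\<i> * of_int m))"
      unfolding P_def by (subst sum.reindex) (auto simp: inj_on_def)
    also have "\<dots> = (\<Sum>m\<in>{-int M..int M}. g (of_int m) / (2 * pi))"
      unfolding res by (rule sum.reindex_bij_witness[of _ uminus uminus]) auto
    also have "\<dots> = (\<Sum>m\<in>{-int M..int M}. g (of_int m)) / (2 * pi)" by (rule sum_divide_distrib[symmetric])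
    finally have "2 * pi * (\<Sum>z\<in>P M. residue F z) = (\<Sum>m\<in>{-int M..int M}. g (of_int m))" by simp
    also have "(\<lambda>m. g (of_int m)) = (\<lambda>m. complex_of_real (exp (- pi * x * (of_int m + a)\<^sup>2)))"
      by (simp add: g_def fun_eq_iff flip: exp_of_real)
    finally show ?thesis by simp
  qed
  have "(\<lambda>M. complex_of_real (\<Sum>m\<in>{-int M..int M}. exp (- pi * x * (of_int m + a)\<^sup>2))) \<longlonglongrightarrow>
     (LBINT t. F (Complex 1 t)) - (LBINT t. F (Complex (-1) t)) - 0"
    using tendsto_diff[OF tendsto_diff[OF LBINT_eq_lim_integral[OF i1 Klim] LBINT_eq_lim_integral[OF i2 Klim]] KP]
    unfolding PM by simp
  from tendsto_Re[OF this] have "(\<lambda>M. \<Sum>m\<in>{-int M..int M}. exp (- pi * x * (of_int m + a)\<^sup>2)) \<longlonglongrightarrow> L"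
    by (simp add: L_def)
  hence 1: "((\<lambda>m::int. exp (- pi * x * (of_int m + a)\<^sup>2)) has_sum L) UNIV"
    by (intro has_sum_int_symmetricI) auto
  have "(\<lambda>k. c (real (Suc k))) sums ((LBINT t. F (Complex 1 t)) - c 0)"
    using sums_split_initial_segment[OF S1', of 1] by simp
  \<comment> \<open>The frequency 0 has been split off from the right-hand side; the remaining
    frequencies k + 1 pair with - (k + 1) from the left-hand side to give cosines.\<close>
  from sums_diff[OF this S2'] have "(\<lambda>k. c (real (Suc k)) + c (- real (Suc k))) sums
     ((LBINT t. F (Complex 1 t)) - c 0 - (LBINT t. F (Complex (-1) t)))" by simp
  from sums_mult[OF sums_Re[OF this], of "sqrt x / 2"]
  have "(\<lambda>k. sqrt x / 2 * Re (c (real (Suc k)) + c (- real (Suc k)))) sums (sqrt x / 2 * (L - 1 / sqrt x))"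
  proof -
    have "Re ((LBINT t. F (Complex 1 t)) - c 0 - (LBINT t. F (Complex (-1) t))) = L - 1 / sqrt x"
      by (simp add: L_def c_def)
    thus ?thesis using \<open>(\<lambda>k. sqrt x / 2 * Re (c (real (Suc k)) + c (- real (Suc k)))) sums _\<close> by (simp only:)
  qed
  moreover have "sqrt x / 2 * Re (c (real (Suc k)) + c (- real (Suc k))) = exp (- pi * (real (Suc k))\<^sup>2 / x) * cos (2 * pi * real (Suc k) * a)" for k
    unfolding c_def using x by (simp add: Re_exp algebra_simps del: of_nat_Suc)
  moreover have "sqrt x / 2 * (L - 1 / sqrt x) = (sqrt x * L - 1) / 2" using x by (simp add: field_simps)
  ultimately have 2: "(\<lambda>k. exp (- pi * (real (Suc k))\<^sup>2 / x) * cos (2 * pi * real (Suc k) * a)) sums ((sqrt x * L - 1) / 2)"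
    by (simp only:)
  show ?thesis by (rule that[OF 1 2])
qed

lemma power_le_fact_exp:
  fixes y :: real
  assumes "y \<ge> 0"
  shows "y ^ k \<le> fact k * exp y"
proof -
  have s: "(\<lambda>n. y ^ n /\<^sub>R fact n) sums exp y" by (rule exp_converges)
  have "(\<Sum>n\<in>{k}. y ^ n /\<^sub>R fact n) \<le> (\<Sum>n. y ^ n /\<^sub>R fact n)"
    using s assms by (intro sum_le_suminf) (auto simp: sums_iff)
  thus ?thesis using s by (simp add: sums_iff field_simps)
qed

lemma integral_exp_halfline:
  fixes s :: complex
  assumes s: "Re s > 0"
  shows "has_bochner_integral lborel (\<lambda>u. indicator {0<..} u *\<^sub>R exp (- s * of_real u)) (1 / s)"
proof -
  have i: "set_integrable lborel {0<..} (\<lambda>u. exp (- s * of_real u))"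
    unfolding set_integrable_def
  proof (rule Bochner_Integration.integrable_bound)
    show "integrable lborel (\<lambda>u. indicator {0<..} u *\<^sub>R exp (- (u * Re s)))"
      using integrable_I0i_exp_mscale[OF s] by (simp add: set_integrable_def)
  qed (auto simp: mult.commute)
  have "(LBINT u=0..\<infinity>. exp (- s * of_real u)) = 0 - (- 1 / s)"
  proof (rule interval_integral_FTC_integrable[where F = "\<lambda>u. - exp (- s * of_real u) / s"])
    have s0: "s \<noteq> 0" using s by auto
    show "((\<lambda>u. - exp (- s * of_real u) / s) has_vector_derivative exp (- s * of_real x)) (at x)" for x :: real
      using s0 by (auto intro!: derivative_eq_intros has_vector_derivative_real_field simp: field_simps)
    show "set_integrable lborel (einterval 0 \<infinity>) (\<lambda>u. exp (- s * of_real u))"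
      using i by (simp add: zero_ereal_def)
    have "isCont (\<lambda>u::real. - exp (- s * of_real u) / s) 0" using s0 by (intro continuous_intros)
    hence "((\<lambda>u::real. - exp (- s * of_real u) / s) \<longlongrightarrow> - 1 / s) (at_right 0)"
      by (auto simp: isCont_def intro: tendsto_within_subset)
    thus "((((\<lambda>u::real. - exp (- s * of_real u) / s)) \<circ> real_of_ereal) \<longlongrightarrow> - 1 / s) (at_right 0)"
      by (simp add: zero_ereal_def ereal_tendsto_simps)
    have "((\<lambda>u::real. - exp (- s * of_real u) / s) \<longlongrightarrow> 0) at_top"
    proof (rule Lim_null_comparison)
      show "eventually (\<lambda>u. norm (- exp (- s * complex_of_real u) / s) \<le> exp (- Re s * u) / norm s) at_top"
        by (simp add: norm_divide)
      have "((\<lambda>u. exp (- r * u)) \<longlongrightarrow> 0) at_top" if "r > 0" for r :: real using that by real_asymp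
      from tendsto_divide_zero[OF this[OF s]]
      show "((\<lambda>u. exp (- Re s * u) / norm s) \<longlongrightarrow> 0) at_top" .
    qed
    thus "((((\<lambda>u::real. - exp (- s * of_real u) / s)) \<circ> real_of_ereal) \<longlongrightarrow> 0) (at_left \<infinity>)"
      by (simp add: ereal_tendsto_simps)
  qed (auto intro!: continuous_intros)
  moreover have "(LBINT u=0..\<infinity>. exp (- s * of_real u)) = (LBINT u. indicator {0<..} u *\<^sub>R exp (- s * of_real u))"
    by (simp add: interval_lebesgue_integral_def set_lebesgue_integral_def zero_ereal_def)
  ultimately show ?thesis using i by (simp add: has_bochner_integral_iff set_integrable_def)
qed

lemma has_sum_UN_finite:
  fixes h :: "'a \<Rightarrow> complex"
  assumes "finite I" "\<And>i. i \<in> I \<Longrightarrow> (h has_sum S i) (A i)" "disjoint_family_on A I"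
  shows "(h has_sum (\<Sum>i\<in>I. S i)) (\<Union>i\<in>I. A i)"
  using assms
proof (induction I rule: finite_induct)
  case (insert i I)
  have "(h has_sum (S i + (\<Sum>i\<in>I. S i))) (A i \<union> (\<Union>i\<in>I. A i))"
  proof (rule has_sum_Un_disjoint)
    show "A i \<inter> (\<Union>i\<in>I. A i) = {}" using insert.prems(2) insert.hyps
      by (auto simp: disjoint_family_on_def)
  qed (use insert in \<open>auto simp: disjoint_family_on_def\<close>)
  thus ?case using insert by simp
qed auto

text \<open>Split the integers into classes modulo N. Since N m + r = N (m + r/N), each class is a
  theta series with parameter N x and shift r/N, to which \<open>theta_inversion\<close> applies;
  summing over r produces the finite cosine transform \<open>fhat\<close>. The link between the two
  series is \<open>H\<close>, the first theta series over all integers.\<close>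

lemma theta_periodic:
  fixes f :: "int \<Rightarrow> complex" and x :: real and fhat :: "nat \<Rightarrow> complex"
  assumes N: "N > 0" and per: "\<And>n. f (n + int N) = f n" and ev: "\<And>n. f (- n) = f n" and x: "x > 0"
  defines "fhat \<equiv> (\<lambda>k::nat. \<Sum>r<N. f (int r) * of_real (cos (2 * pi * real k * (real r / real N))) :: complex)"
  obtains H :: complex where "(\<lambda>n. f (int (Suc n)) * of_real (exp (- pi * (real (Suc n))\<^sup>2 * x / N))) sums ((H - f 0) / 2)"
    "(\<lambda>k. fhat (Suc k) * of_real (exp (- pi * (real (Suc k))\<^sup>2 / (N * x)))) sums ((sqrt (N * x) * H - fhat 0) / 2)"
proof -
  define A where "A r = range (\<lambda>m. int r + m * int N)" for r
  have fper: "f (n + m * int N) = f n" for n m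
  proof -
    have *: "f (n + int k * int N) = f n" for k n
    proof (induction k)
      case (Suc k)
      have "n + int (Suc k) * int N = (n + int k * int N) + int N" by (simp add: algebra_simps)
      thus ?case using per Suc by metis
    qed simp
    show ?thesis
    proof (cases "m \<ge> 0")
      case True thus ?thesis using *[of n "nat m"] by simp
    next
      case False thus ?thesis using *[of "n + m * int N" "nat (- m)"] by simp
    qed
  qed
  define h where "h n = f n * of_real (exp (- pi * (of_int n)\<^sup>2 * x / N))" for n
  have NX: "N * x > 0" using N x by simp
  have "\<forall>r::nat. \<exists>L. ((\<lambda>m::int. exp (- pi * (N * x) * (of_int m + real r / N)\<^sup>2)) has_sum L) UNIV \<and>
    (\<lambda>k. exp (- pi * (real (Suc k))\<^sup>2 / (N * x)) * cos (2 * pi * real (Suc k) * (real r / N))) sums ((sqrt (N * x) * L - 1) / 2)"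
    by (rule allI, rule theta_inversion[OF NX], intro exI conjI)
  from choice[OF this] obtain L where L0: "\<forall>r::nat. ((\<lambda>m::int. exp (- pi * (N * x) * (of_int m + real r / N)\<^sup>2)) has_sum L r) UNIV \<and>
    (\<lambda>k. exp (- pi * (real (Suc k))\<^sup>2 / (N * x)) * cos (2 * pi * real (Suc k) * (real r / N))) sums ((sqrt (N * x) * L r - 1) / 2)" by (rule exE)
  have L1: "((\<lambda>m::int. exp (- pi * (N * x) * (of_int m + real r / N)\<^sup>2)) has_sum L r) UNIV"
    and L2: "(\<lambda>k. exp (- pi * (real (Suc k))\<^sup>2 / (N * x)) * cos (2 * pi * real (Suc k) * (real r / N))) sums ((sqrt (N * x) * L r - 1) / 2)" for r :: nat
    using L0[THEN spec, of r] by (rule conjunct1, rule conjunct2)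
  have hA: "(h has_sum (f (int r) * of_real (L r))) (A r)" for r
  proof -
    have "((\<lambda>m::int. f (int r) * complex_of_real (exp (- pi * (N * x) * (of_int m + real r / N)\<^sup>2))) has_sum (f (int r) * of_real (L r))) UNIV"
      by (intro has_sum_cmult_right has_sum_of_real L1)
    moreover have "f (int r) * complex_of_real (exp (- pi * (N * x) * (of_int m + real r / N)\<^sup>2)) = h (int r + m * int N)" for m
    proof -
      have "real N * (of_int m + real r / N)\<^sup>2 = (real r + of_int m * N)\<^sup>2 / N"
        using N by (simp add: power2_eq_square field_simps)
      hence "- pi * (N * x) * (of_int m + real r / N)\<^sup>2 = - pi * (of_int (int r + m * int N))\<^sup>2 * x / N"
        using N by (simp add: field_simps)
      thus ?thesis by (simp only: h_def fper)
    qed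
    ultimately have "((h \<circ> (\<lambda>m. int r + m * int N)) has_sum (f (int r) * of_real (L r))) UNIV" by (simp add: o_def)
    thus ?thesis unfolding A_def using N by (subst has_sum_reindex) (auto simp: inj_on_def)
  qed
  have "disjoint_family_on A {..<N}"
    unfolding disjoint_family_on_def
  proof (intro ballI impI equals0I)
    fix r r' n assume r: "r \<in> {..<N}" "r' \<in> {..<N}" "r \<noteq> r'" "n \<in> A r \<inter> A r'"
    from r(4) obtain m where "n = int r + m * int N" by (auto simp: A_def)
    hence "n mod int N = int r" using r by auto
    moreover from r(4) obtain m' where "n = int r' + m' * int N" by (auto simp: A_def)
    hence "n mod int N = int r'" using r by auto
    ultimately show False using r(3) by simp
  qed
  from has_sum_UN_finite[OF finite_lessThan hA this]
  have 1: "(h has_sum (\<Sum>r<N. f (int r) * of_real (L r))) (\<Union>r<N. A r)" by simp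
  have "(\<Union>r<N. A r) = UNIV"
  proof (intro equalityI subsetI)
    fix n :: int
    have "n = int (nat (n mod int N)) + (n div int N) * int N" "nat (n mod int N) < N"
      using N by (auto simp: nat_less_iff)
    thus "n \<in> (\<Union>r<N. A r)" unfolding A_def by blast
  qed auto
  define H where "H = (\<Sum>r<N. f (int r) * of_real (L r))"
  have "(h has_sum H) UNIV" using 1 \<open>(\<Union>r<N. A r) = UNIV\<close> by (simp add: H_def)
  from has_sum_int_even[OF this] have s1: "(\<lambda>n. h (int (Suc n))) sums ((H - h 0) / 2)"
    by (simp add: h_def ev)
  have "(\<lambda>k. \<Sum>r<N. f (int r) * of_real (exp (- pi * (real (Suc k))\<^sup>2 / (N * x)) * cos (2 * pi * real (Suc k) * (real r / N)))) sums
      (\<Sum>r<N. f (int r) * of_real ((sqrt (N * x) * L r - 1) / 2))"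
    by (intro sums_sum sums_mult sums_of_real L2)
  moreover have "(\<Sum>r<N. f (int r) * of_real (exp (- pi * (real (Suc k))\<^sup>2 / (N * x)) * cos (2 * pi * real (Suc k) * (real r / N))))
     = fhat (Suc k) * of_real (exp (- pi * (real (Suc k))\<^sup>2 / (N * x)))" for k
    unfolding fhat_def sum_distrib_right of_real_mult by (intro sum.cong refl) (simp only: mult_ac)
  moreover have "(\<Sum>r<N. f (int r) * of_real ((sqrt (N * x) * L r - 1) / 2)) = (sqrt (N * x) * H - fhat 0) / 2"
    by (simp add: H_def fhat_def sum_distrib_left sum_subtractf sum_divide_distrib[symmetric] algebra_simps)
  ultimately have s2: "(\<lambda>k. fhat (Suc k) * of_real (exp (- pi * (real (Suc k))\<^sup>2 / (N * x)))) sums ((sqrt (N * x) * H - fhat 0) / 2)"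
    by (simp only:)
  show ?thesis
    by (rule that[OF _ s2]) (use s1 in \<open>simp add: h_def\<close>)
qed

section \<open>Mellin transforms of theta series\<close>

text \<open>A theta series at x = exp (2 u) without its constant term, which does not decay and is
  carried separately. Index n belongs to the integer n + 1.\<close>

definition theta_tail :: "real \<Rightarrow> (nat \<Rightarrow> complex) \<Rightarrow> real \<Rightarrow> complex" where
  "theta_tail c f u = (\<Sum>n. f n * of_real (exp (- c * (real (Suc n))\<^sup>2 * exp (2 * u))))"

lemma inverse_square_summable: "summable (\<lambda>n. 1 / (real (Suc n))\<^sup>2)"
  using inverse_squares_sums by (auto simp: sums_iff)

text \<open>exp (- y) \<le> (k + 1)! / y^(k + 1). Of the powers of n + 1 only the square is kept,
  for summability, while all powers of exp (2 u) are kept; as k is arbitrary, the tail decays faster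
  than any exponential in u.\<close>

lemma theta_tail_bound:
  assumes c: "c > 0" and f: "\<And>n. norm (f n) \<le> M"
  shows "\<exists>B. \<forall>u. summable (\<lambda>n. norm (f n * of_real (exp (- c * (real (Suc n))\<^sup>2 * exp (2 * u))))) \<and>
           norm (theta_tail c f u) \<le> B * exp (- 2 * real (Suc k) * u)"
proof -
  define D where "D = M * fact (Suc k) / c ^ Suc k"
  have M0: "0 \<le> M" using order_trans[OF norm_ge_zero f] .
  have tb: "norm (f n * of_real (exp (- c * (real (Suc n))\<^sup>2 * exp (2 * u)))) \<le> D * exp (- 2 * real (Suc k) * u) * (1 / (real (Suc n))\<^sup>2)" for n u
  proof -
    define y where "y = c * (real (Suc n))\<^sup>2 * exp (2 * u)"
    have y: "y > 0" using c by (simp add: y_def)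
    have "exp (- y) \<le> fact (Suc k) / y ^ Suc k"
      using power_le_fact_exp[of y "Suc k"] y by (simp add: exp_minus field_simps)
    also have "y ^ Suc k = c ^ Suc k * ((real (Suc n))\<^sup>2) ^ Suc k * exp (2 * real (Suc k) * u)"
      by (simp only: y_def power_mult_distrib exp_of_nat_mult[symmetric]) (simp only: mult_ac)
    also have "fact (Suc k) / \<dots> \<le> fact (Suc k) / (c ^ Suc k * (real (Suc n))\<^sup>2 * exp (2 * real (Suc k) * u))"
    proof (intro divide_left_mono mult_right_mono mult_left_mono)
      have "((real (Suc n))\<^sup>2) ^ 1 \<le> ((real (Suc n))\<^sup>2) ^ Suc k" by (intro power_increasing) (auto simp: one_le_power)
      thus "(real (Suc n))\<^sup>2 \<le> ((real (Suc n))\<^sup>2) ^ Suc k" by simp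
    qed (use c in auto)
    also have "\<dots> = fact (Suc k) / c ^ Suc k * exp (- 2 * real (Suc k) * u) * (1 / (real (Suc n))\<^sup>2)"
      by (simp add: exp_minus field_simps del: of_nat_Suc fact_Suc power_Suc)
    finally have e: "exp (- y) \<le> fact (Suc k) / c ^ Suc k * exp (- 2 * real (Suc k) * u) * (1 / (real (Suc n))\<^sup>2)" .
    have "norm (f n * of_real (exp (- y))) \<le> M * (fact (Suc k) / c ^ Suc k * exp (- 2 * real (Suc k) * u) * (1 / (real (Suc n))\<^sup>2))"
      unfolding norm_mult using e f M0 by (intro mult_mono) auto
    thus ?thesis by (simp add: D_def y_def del: of_nat_Suc fact_Suc power_Suc)
  qed
  show ?thesis
  proof (intro exI allI conjI)
    fix u
    have s: "summable (\<lambda>n. D * exp (- 2 * real (Suc k) * u) * (1 / (real (Suc n))\<^sup>2))"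
      by (intro summable_mult inverse_square_summable)
    show s': "summable (\<lambda>n. norm (f n * of_real (exp (- c * (real (Suc n))\<^sup>2 * exp (2 * u)))))"
      by (rule summable_comparison_test'[OF s]) (use tb in simp)
    have "norm (theta_tail c f u) \<le> (\<Sum>n. norm (f n * of_real (exp (- c * (real (Suc n))\<^sup>2 * exp (2 * u)))))"
      unfolding theta_tail_def by (rule summable_norm[OF s'])
    also have "\<dots> \<le> (\<Sum>n. D * exp (- 2 * real (Suc k) * u) * (1 / (real (Suc n))\<^sup>2))"
      by (rule suminf_le[OF tb s' s])
    also have "\<dots> = D * exp (- 2 * real (Suc k) * u) * (\<Sum>n. 1 / (real (Suc n))\<^sup>2)"
      by (rule suminf_mult[OF inverse_square_summable])
    finally show "norm (theta_tail c f u) \<le> (D * (\<Sum>n. 1 / (real (Suc n))\<^sup>2)) * exp (- 2 * real (Suc k) * u)"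
      by (simp add: mult_ac)
  qed
qed

lemma theta_tail_measurable [measurable]: "theta_tail c f \<in> borel_measurable borel"
  unfolding theta_tail_def[abs_def] by measurable

text \<open>The Mellin integral over x > 1 only, in the variable x = exp (2 u). The fast decay there
  makes it an entire function of s.\<close>

definition theta_entire :: "real \<Rightarrow> (nat \<Rightarrow> complex) \<Rightarrow> complex \<Rightarrow> complex" where
  "theta_entire c f s = (LBINT u. (indicator {0<..} u *\<^sub>R theta_tail c f u) * exp (s * of_real u))"

lemma integrable_exp_halfline: "a > 0 \<Longrightarrow> integrable lborel (\<lambda>u::real. indicator {0<..} u * exp (- a * u))"
  using integrable_I0i_exp_mscale[of a] by (simp add: set_integrable_def mult.commute)

lemma theta_entire_integrable:
  assumes c: "c > 0" and f: "\<And>n. norm (f n) \<le> M"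
  shows "integrable lborel (\<lambda>u. norm (indicator {0<..} u *\<^sub>R theta_tail c f u) * exp (R * \<bar>u\<bar>))"
proof -
  \<comment> \<open>The decay of order 2 (k + 1) then beats exp (R u) and leaves exp (- u) to
    spare.\<close>
  obtain k where "R + 1 \<le> real k" using real_arch_simple[of "R + 1"] by blast
  hence k: "R + 1 \<le> 2 * real (Suc k)" by simp
  obtain B where B: "\<And>u. norm (theta_tail c f u) \<le> B * exp (- 2 * real (Suc k) * u)"
    using theta_tail_bound[where f = f and k = k, OF c f] by blast
  have B0: "0 \<le> B" using order_trans[OF norm_ge_zero B[of 0]] by simp
  show ?thesis
  proof (rule Bochner_Integration.integrable_bound)
    show "integrable lborel (\<lambda>u::real. B * (indicator {0<..} u * exp (- 1 * u)))"
      by (intro integrable_mult_right integrable_exp_halfline) auto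
    show "AE u in lborel. norm (norm (indicator {0<..} u *\<^sub>R theta_tail c f u) * exp (R * \<bar>u\<bar>)) \<le> norm (B * (indicator {0<..} u * exp (- 1 * u)))"
    proof (rule AE_I2)
      fix u :: real
      show "norm (norm (indicator {0<..} u *\<^sub>R theta_tail c f u) * exp (R * \<bar>u\<bar>)) \<le> norm (B * (indicator {0<..} u * exp (- 1 * u)))"
      proof (cases "u > 0")
        case True
        have "norm (theta_tail c f u) * exp (R * u) \<le> B * exp (- 2 * real (Suc k) * u) * exp (R * u)"
          using B by (intro mult_right_mono) auto
        also have "\<dots> = B * exp ((R - 2 * real (Suc k)) * u)" by (simp add: algebra_simps flip: exp_add)
        also have "\<dots> \<le> B * exp (-1 * u)"
        proof -
          have "(R - 2 * real (Suc k)) * u \<le> -1 * u" using k True by (intro mult_right_mono) auto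
          thus ?thesis using B0 by (intro mult_left_mono) auto
        qed
        finally show ?thesis using True B0 by simp
      qed auto
    qed
  qed measurable
qed

lemma theta_entire_holomorphic:
  assumes c: "c > 0" and f: "\<And>n. norm (f n) \<le> M"
  shows "theta_entire c f holomorphic_on A"
proof -
  have "theta_entire c f holomorphic_on UNIV"
  proof (subst holomorphic_on_open)
    show "\<forall>x\<in>UNIV. \<exists>f'. (theta_entire c f has_field_derivative f') (at x)"
    proof
      fix x :: complex
      have "theta_entire c f holomorphic_on ball 0 (norm x + 1)"
        unfolding theta_entire_def[abs_def]
        by (intro Laplace_holomorphic theta_entire_integrable[where f = f, OF c f]) measurable
      thus "\<exists>f'. (theta_entire c f has_field_derivative f') (at x)"
        by (subst (asm) holomorphic_on_open) auto
    qed
  qed auto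
  thus ?thesis by (rule holomorphic_on_subset) auto
qed

text \<open>Termwise \<open>Gamma_log_Mellin\<close> after v = 2 u, which is the source of the
  argument s/2 and of the factor 1/2.\<close>

lemma theta_Mellin:
  assumes c: "c > 0" and f: "\<And>n. norm (f n) \<le> M" and s: "Re s > 1"
  shows "integrable lborel (\<lambda>u. theta_tail c f u * exp (s * of_real u))"
    and "(\<lambda>n. f n / of_nat (Suc n) powr s * (1/2 * Gamma (s/2) * of_real c powr (- s/2))) sums
           (LBINT u. theta_tail c f u * exp (s * of_real u))"
proof -
  define h where "h n s u = exp (- of_real (c * (real (Suc n))\<^sup>2 * exp (2 * u)) + s * of_real u)" for n and s :: complex and u :: real
  have hi: "has_bochner_integral lborel (h n s) (1/2 * Gamma (s/2) * of_real c powr (- s/2) / of_nat (Suc n) powr s)" if "Re s > 0" for n s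
  proof -
    have cn: "c * (real (Suc n))\<^sup>2 > 0" using c by simp
    have "has_bochner_integral lborel (\<lambda>v. exp (- of_real (c * (real (Suc n))\<^sup>2 * exp v) + s / 2 * of_real v)) (Gamma (s/2) * of_real (c * (real (Suc n))\<^sup>2) powr (- (s/2)))"
      by (rule Gamma_log_Mellin) (use that cn in auto)
    hence "has_bochner_integral lborel (\<lambda>u. exp (- of_real (c * (real (Suc n))\<^sup>2 * exp (0 + 2 * u)) + s / 2 * of_real (0 + 2 * u))) ((Gamma (s/2) * of_real (c * (real (Suc n))\<^sup>2) powr (- (s/2))) /\<^sub>R \<bar>2\<bar>)"
      by (subst (asm) lborel_has_bochner_integral_real_affine_iff[where c=2 and t=0]) auto
    moreover have "exp (- of_real (c * (real (Suc n))\<^sup>2 * exp (0 + 2 * u)) + s / 2 * of_real (0 + 2 * u)) = h n s u" for u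
      by (simp add: h_def)
    moreover have "of_real (c * (real (Suc n))\<^sup>2) powr (- (s/2)) = of_real c powr (- s/2) / of_nat (Suc n) powr s"
    proof -
      have "ln (c * (real (Suc n))\<^sup>2) = ln c + 2 * ln (real (Suc n))" using c by (simp add: ln_mult ln_realpow del: of_nat_Suc)
      moreover have "of_nat (Suc n) powr s = exp (s * of_real (ln (real (Suc n))))"
        by (simp add: powr_def Ln_of_nat del: of_nat_Suc)
      moreover have "complex_of_real c powr (- s/2) = exp (- s/2 * of_real (ln c))"
        using c by (simp add: powr_def Ln_of_real)
      moreover have "of_real (c * (real (Suc n))\<^sup>2) powr (- (s/2)) = exp (- (s/2) * of_real (ln (c * (real (Suc n))\<^sup>2)))"
        using c by (simp add: powr_def Ln_of_real del: of_nat_Suc of_real_mult)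
      ultimately show ?thesis
        by (simp only: exp_diff[symmetric], intro arg_cong[where f = exp]) (simp add: field_simps)
    qed
    ultimately show ?thesis by (simp add: scaleR_conv_of_real mult.commute)
  qed
  have hn: "norm (h n s u) = Re (h n (of_real (Re s)) u)" for n s u
    by (simp add: h_def Re_exp)
  have nint: "(LBINT u. norm (h n s u)) = 1/2 * Re (Gamma (of_real (Re s / 2)) * of_real c powr (- of_real (Re s)/2)) / real (Suc n) powr (Re s)" for n
  proof -
    have "(LBINT u. norm (h n s u)) = Re (LBINT u. h n (of_real (Re s)) u)"
      unfolding hn using hi[of "of_real (Re s)" n] s by (subst integral_Re) (auto simp: has_bochner_integral_iff)
    also have "(LBINT u. h n (of_real (Re s)) u) = (1/2 * Gamma (of_real (Re s)/2) * of_real c powr (- of_real (Re s)/2) / of_nat (Suc n) powr of_real (Re s))"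
      using hi[of "of_real (Re s)" n] s by (simp add: has_bochner_integral_iff)
    also have "of_nat (Suc n) powr of_real (Re s) = complex_of_real (real (Suc n) powr Re s)"
      using powr_of_real[of "real (Suc n)" "Re s"] by simp
    finally show ?thesis by (simp only: Re_divide_of_real) simp
  qed
  have fi: "integrable lborel (\<lambda>u. f n * h n s u)" for n using hi[of s n] s by (simp add: has_bochner_integral_iff)
  have fh: "f n * of_real (exp (- c * (real (Suc n))\<^sup>2 * exp (2 * u))) * exp (s * of_real u) = f n * h n s u" for n u
    unfolding h_def exp_add by (simp flip: exp_of_real)
  have sm: "summable (\<lambda>n. norm (f n * h n s u))" for u
  proof -
    have "summable (\<lambda>n. norm (f n * of_real (exp (- c * (real (Suc n))\<^sup>2 * exp (2 * u)))) * norm (exp (s * of_real u)))"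
      using theta_tail_bound[where f = f and k = 0, OF c f] by (intro summable_mult2) blast
    thus ?thesis by (simp only: norm_mult[symmetric] fh)
  qed
  have sm2: "summable (\<lambda>n. LBINT u. norm (f n * h n s u))"
  proof (rule summable_comparison_test')
    define K where "K = 1/2 * Re (Gamma (of_real (Re s / 2)) * of_real c powr (- of_real (Re s)/2))"
    have "summable (\<lambda>n. real (Suc n) powr (- Re s))"
      using s summable_Suc_iff[of "\<lambda>n. real n powr (- Re s)"] by (simp add: summable_real_powr_iff)
    thus "summable (\<lambda>n. M * (K * real (Suc n) powr (- Re s)))" by (intro summable_mult)
    fix n
    have "(LBINT u. norm (f n * h n s u)) = norm (f n) * (K * real (Suc n) powr (- Re s))"
      unfolding norm_mult integral_mult_right_zero nint K_def powr_minus divide_inverse ..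
    moreover have "0 \<le> K * real (Suc n) powr (- Re s)"
    proof -
      have "0 \<le> (LBINT u. norm (h n s u))" by simp
      thus ?thesis unfolding nint K_def powr_minus divide_inverse .
    qed
    ultimately show "norm (LBINT u. norm (f n * h n s u)) \<le> M * (K * real (Suc n) powr (- Re s))"
      using mult_right_mono[OF f[of n], of "K * real (Suc n) powr (- Re s)"]
      by (metis abs_of_nonneg mult_nonneg_nonneg norm_ge_zero real_norm_def)
  qed
  have e: "(\<Sum>n. f n * h n s u) = theta_tail c f u * exp (s * of_real u)" for u
  proof -
    have "summable (\<lambda>n. norm (f n * of_real (exp (- c * (real (Suc n))\<^sup>2 * exp (2 * u)))))"
      using theta_tail_bound[where f = f and k = 0, OF c f] by blast
    hence "summable (\<lambda>n. f n * of_real (exp (- c * (real (Suc n))\<^sup>2 * exp (2 * u))))"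
      by (rule summable_norm_cancel)
    from suminf_mult2[OF this, of "exp (s * of_real u)"] show ?thesis
      unfolding theta_tail_def fh by simp
  qed
  show "integrable lborel (\<lambda>u. theta_tail c f u * exp (s * of_real u))"
    using integrable_suminf[OF fi AE_I2[OF sm] sm2] by (simp add: e)
  have "(\<lambda>n. LBINT u. f n * h n s u) sums (LBINT u. theta_tail c f u * exp (s * of_real u))"
    using sums_integral[OF fi AE_I2[OF sm] sm2] by (simp add: e)
  moreover have "(LBINT u. f n * h n s u) = f n / of_nat (Suc n) powr s * (1/2 * Gamma (s/2) * of_real c powr (- s/2))" for n
    using hi[of s n] s by (simp add: has_bochner_integral_iff)
  ultimately show "(\<lambda>n. f n / of_nat (Suc n) powr s * (1/2 * Gamma (s/2) * of_real c powr (- s/2))) sums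
           (LBINT u. theta_tail c f u * exp (s * of_real u))" by simp
qed

text \<open>
  \<open>f0\<close> and \<open>g0\<close> are the constant terms of the two theta series; \<open>g0\<close> produces the pole at \<open>1\<close>,
  and division by Gamma (written with \<open>rGamma\<close>) cancels the pole at \<open>0\<close> coming from \<open>f0\<close>.
\<close>

locale theta_pair =
  fixes f g :: "nat \<Rightarrow> complex" and f0 g0 \<kappa> :: complex and c Mf Mg :: real
  assumes c: "c > 0" and fb: "\<And>n. norm (f n) \<le> Mf" and gb: "\<And>n. norm (g n) \<le> Mg"
    and inv: "\<And>u. theta_tail c f (- u) = \<kappa> * of_real (exp u) * (g0 / 2 + theta_tail c g u) - f0 / 2"
begin

text \<open>The coefficient f0/4 is f0/2 from the constant term of the theta series times the 1/2 in
  rGamma (s/2) / s = rGamma (s/2 + 1) / 2.\<close>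

definition "entire_part s = 2 * of_real c powr (s/2) *
   (rGamma (s/2) * (theta_entire c f s + \<kappa> * theta_entire c g (1 - s)) - f0 / 4 * rGamma (s/2 + 1))"

definition "polar_part s = of_real c powr (s/2) * rGamma (s/2) * \<kappa> * g0"

lemma entire_part_holomorphic: "entire_part holomorphic_on A"
proof -
  have "theta_entire c f holomorphic_on UNIV" "theta_entire c g holomorphic_on UNIV"
    by (rule theta_entire_holomorphic[where f = f, OF c fb], rule theta_entire_holomorphic[where f = g, OF c gb])
  hence "theta_entire c f holomorphic_on A" "(theta_entire c g \<circ> (\<lambda>s. 1 - s)) holomorphic_on A"
    by (auto intro: holomorphic_on_subset intro!: holomorphic_on_compose_gen[of _ _ _ UNIV] holomorphic_intros)
  thus ?thesis unfolding entire_part_def[abs_def] o_def using c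
    by (intro holomorphic_intros holomorphic_rGamma') auto
qed

lemma polar_part_holomorphic: "polar_part holomorphic_on A"
  unfolding polar_part_def[abs_def] using c by (intro holomorphic_intros holomorphic_rGamma') auto

text \<open>Riemann's splitting: the half-line u < 0 is reflected and the inversion law replaces the
  theta series of \<open>f\<close> by that of \<open>g\<close>. The two constant terms are
  integrated explicitly and give the fractions with denominators s - 1 and s.\<close>

lemma theta_Mellin_split:
  assumes s: "Re s > 1"
  shows "(LBINT u. theta_tail c f u * exp (s * of_real u)) =
           theta_entire c f s + \<kappa> * theta_entire c g (1 - s) + \<kappa> * g0 / 2 / (s - 1) - f0 / 2 / s"
proof -
  let ?w = "\<lambda>u. theta_tail c f u * exp (s * of_real u)"
  have int: "integrable lborel ?w" by (rule theta_Mellin(1)[where f = f, OF c fb s])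
  have "(LBINT u. ?w u) = (LBINT u. indicator {0<..} u *\<^sub>R ?w u + indicator {..<0} u *\<^sub>R ?w u)"
  proof (rule integral_cong_AE)
    have "AE u in lborel. u \<noteq> (0::real)" by (rule AE_lborel_singleton)
    thus "AE u in lborel. ?w u = indicator {0<..} u *\<^sub>R ?w u + indicator {..<0} u *\<^sub>R ?w u"
      by eventually_elim (auto simp: indicator_def)
  qed measurable
  also have "\<dots> = (LBINT u. indicator {0<..} u *\<^sub>R ?w u) + (LBINT u. indicator {..<0} u *\<^sub>R ?w u)"
    using int by (intro Bochner_Integration.integral_add integrable_mult_indicator) auto
  also have "(LBINT u. indicator {0<..} u *\<^sub>R ?w u) = theta_entire c f s"
    by (simp add: theta_entire_def)
  also have "(LBINT u. indicator {..<0} u *\<^sub>R ?w u) = (LBINT u. indicator {..<0} (0 + (-1) * u) *\<^sub>R ?w (0 + (-1) * u))"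
    by (subst lborel_integral_real_affine[where c = "-1" and t = 0]) auto
  also have "(\<lambda>u. indicator {..<0} (0 + (-1) * u) *\<^sub>R ?w (0 + (-1) * u)) =
     (\<lambda>u. \<kappa> * ((indicator {0<..} u *\<^sub>R theta_tail c g u) * exp ((1 - s) * of_real u))
        + (\<kappa> * g0 / 2) * (indicator {0<..} u *\<^sub>R exp (- (s - 1) * of_real u))
        - (f0 / 2) * (indicator {0<..} u *\<^sub>R exp (- s * of_real u)))" (is "?L = ?R")
  proof
    fix u :: real
    have e: "exp (complex_of_real u) * exp (- s * of_real u) = exp ((1 - s) * of_real u)"
      by (simp add: algebra_simps flip: exp_add)
    have "?w (- u) = (\<kappa> * of_real (exp u) * (g0 / 2 + theta_tail c g u) - f0 / 2) * exp (- s * of_real u)"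
      by (simp add: inv)
    also have "\<dots> = \<kappa> * theta_tail c g u * (exp (complex_of_real u) * exp (- s * of_real u)) + \<kappa> * g0 / 2 * (exp (complex_of_real u) * exp (- s * of_real u)) - f0 / 2 * exp (- s * of_real u)"
      by (simp add: algebra_simps flip: exp_of_real)
    finally have "?w (- u) = \<kappa> * theta_tail c g u * exp ((1 - s) * of_real u) + \<kappa> * g0 / 2 * exp ((1 - s) * of_real u) - f0 / 2 * exp (- s * of_real u)"
      unfolding e .
    thus "?L u = ?R u" by (auto simp: indicator_def minus_diff_eq)
  qed
  also have "(LBINT u. ?R u) = \<kappa> * theta_entire c g (1 - s) + (\<kappa> * g0 / 2) * (1 / (s - 1)) - (f0 / 2) * (1 / s)"
  proof -
    have 1: "has_bochner_integral lborel (\<lambda>u. (indicator {0<..} u *\<^sub>R theta_tail c g u) * exp ((1 - s) * of_real u)) (theta_entire c g (1 - s))"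
    proof -
      have "integrable lborel (\<lambda>u. (indicator {0<..} u *\<^sub>R theta_tail c g u) * exp ((1 - s) * of_real u))"
        by (rule Bochner_Integration.integrable_bound[OF theta_entire_integrable[where f = g and R = 0, OF c gb]])
           (use s in \<open>auto simp: norm_mult indicator_def mult_nonpos_nonneg intro!: AE_I2 mult_right_le_one_le\<close>)
      thus ?thesis by (simp add: has_bochner_integral_iff theta_entire_def)
    qed
    have "has_bochner_integral lborel ?R (\<kappa> * theta_entire c g (1 - s) + (\<kappa> * g0 / 2) * (1 / (s - 1)) - (f0 / 2) * (1 / s))"
      by (intro has_bochner_integral_diff has_bochner_integral_add has_bochner_integral_mult_right 1 integral_exp_halfline) (use s in auto)
    thus ?thesis by (simp add: has_bochner_integral_iff)
  qed
  finally show ?thesis by (simp add: algebra_simps)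
qed

lemma completed_series:
  assumes s: "Re s > 1"
  shows "(\<lambda>n. f n / of_nat (Suc n) powr s) sums (entire_part s + polar_part s / (s - 1))"
proof -
  have s0: "s \<noteq> 0" "s \<noteq> 1" using s by auto
  have "s / 2 \<notin> \<int>\<^sub>\<le>\<^sub>0"
  proof
    assume "s / 2 \<in> \<int>\<^sub>\<le>\<^sub>0"
    then obtain n where "s / 2 = - of_nat n" by (elim nonpos_Ints_cases')
    hence "Re (s / 2) = - real n" by simp
    thus False using s by simp
  qed
  hence G: "Gamma (s/2) * rGamma (s/2) = 1" by (simp add: Gamma_def rGamma_eq_zero_iff)
  have p: "of_real c powr (s/2) * of_real c powr (- s/2) = (1::complex)"
    using c by (simp add: powr_minus)
  have "(\<lambda>n. f n / of_nat (Suc n) powr s * (1/2 * Gamma (s/2) * of_real c powr (- s/2)) * (2 * of_real c powr (s/2) * rGamma (s/2))) sums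
     ((LBINT u. theta_tail c f u * exp (s * of_real u)) * (2 * of_real c powr (s/2) * rGamma (s/2)))"
    by (intro sums_mult2 theta_Mellin(2)[where f = f, OF c fb s])
  moreover have "f n / of_nat (Suc n) powr s * (1/2 * Gamma (s/2) * of_real c powr (- s/2)) * (2 * of_real c powr (s/2) * rGamma (s/2)) =
     f n / of_nat (Suc n) powr s * (Gamma (s/2) * rGamma (s/2)) * (of_real c powr (s/2) * of_real c powr (- s/2))" for n
    by (simp add: algebra_simps)
  ultimately have "(\<lambda>n. f n / of_nat (Suc n) powr s) sums
     ((LBINT u. theta_tail c f u * exp (s * of_real u)) * (2 * of_real c powr (s/2) * rGamma (s/2)))"
    by (simp only: G p mult_1_right)
  also have "(LBINT u. theta_tail c f u * exp (s * of_real u)) * (2 * of_real c powr (s/2) * rGamma (s/2)) =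
     entire_part s + polar_part s / (s - 1)"
  proof -
    have r: "rGamma (s/2) = s / 2 * rGamma (s/2 + 1)" using rGamma_plus1[of "s/2"] by simp
    define P where "P = of_real c powr (s/2)"
    define X where "X = theta_entire c f s + \<kappa> * theta_entire c g (1 - s)"
    have "(X + \<kappa> * g0 / 2 / (s - 1) - f0 / 2 / s) * (2 * P * rGamma (s/2)) = 2 * P * rGamma (s/2) * X + P * rGamma (s/2) * \<kappa> * g0 / (s - 1) - f0 / s * P * rGamma (s/2)"
      using s0 by (simp add: field_simps)
    also have "f0 / s * P * rGamma (s/2) = 2 * P * (f0 / 4 * rGamma (s/2 + 1))"
      unfolding r using s0 by simp
    finally show ?thesis unfolding theta_Mellin_split[OF s] entire_part_def polar_part_def P_def[symmetric] X_def[symmetric]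
      by (simp add: algebra_simps)
  qed
  finally show ?thesis .
qed

end

section \<open>Continuation of Dirichlet series\<close>

definition halfline_Laplace :: "(real \<Rightarrow> complex) \<Rightarrow> complex \<Rightarrow> complex" where
  "halfline_Laplace D s = (LBINT v. indicator {0<..} v *\<^sub>R (D v * exp (- s * of_real v)))"

lemma halfline_Laplace_integrable:
  assumes [measurable]: "D \<in> borel_measurable borel" and bd: "\<And>v. v > 0 \<Longrightarrow> norm (D v) \<le> M" and s: "Re s > 0"
  shows "integrable lborel (\<lambda>v. indicator {0<..} v *\<^sub>R (D v * exp (- s * of_real v)))"
proof (rule Bochner_Integration.integrable_bound)
  show "integrable lborel (\<lambda>v::real. M * (indicator {0<..} v * exp (- Re s * v)))"
    by (intro integrable_mult_right integrable_exp_halfline s)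
  show "AE v in lborel. norm (indicator {0<..} v *\<^sub>R (D v * exp (- s * of_real v))) \<le> norm (M * (indicator {0<..} v * exp (- Re s * v)))"
    using bd by (auto simp: indicator_def norm_mult intro!: AE_I2 mult_right_mono order_trans[OF _ abs_ge_self])
qed measurable

lemma halfline_Laplace_bound:
  assumes [measurable]: "D \<in> borel_measurable borel" and bd: "\<And>v. v > 0 \<Longrightarrow> norm (D v) \<le> M" and s: "Re s > 0"
  shows "norm (halfline_Laplace D s) \<le> M / Re s"
proof -
  have r: "has_bochner_integral lborel (\<lambda>v. indicator {0<..} v * exp (- Re s * v)) (1 / Re s)"
  proof -
    have "has_bochner_integral lborel (\<lambda>v. complex_of_real (indicator {0<..} v * exp (- Re s * v))) (of_real (1 / Re s))"
      using integral_exp_halfline[of "of_real (Re s)"] s by (simp add: scaleR_conv_of_real flip: exp_of_real)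
    thus ?thesis by (rule has_bochner_integral_complex_of_realD)
  qed
  have "norm (halfline_Laplace D s) \<le> (LBINT v. norm (indicator {0<..} v *\<^sub>R (D v * exp (- s * of_real v))))"
    unfolding halfline_Laplace_def by (rule integral_norm_bound)
  also have "\<dots> \<le> (LBINT v. M * (indicator {0<..} v * exp (- Re s * v)))"
  proof (rule integral_mono)
    show "integrable lborel (\<lambda>v. norm (indicator {0<..} v *\<^sub>R (D v * exp (- s * of_real v))))"
      by (intro integrable_norm halfline_Laplace_integrable[OF assms(1) bd s])
    show "integrable lborel (\<lambda>v::real. M * (indicator {0<..} v * exp (- Re s * v)))"
      by (intro integrable_mult_right integrable_exp_halfline s)
  qed (use bd in \<open>auto simp: indicator_def norm_mult intro!: mult_right_mono\<close>)
  also have "\<dots> = M * (1 / Re s)" using r by (simp add: has_bochner_integral_iff)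
  finally show ?thesis by simp
qed

lemma halfline_Laplace_holomorphic:
  assumes m[measurable]: "D \<in> borel_measurable borel" and bd: "\<And>v. v > 0 \<Longrightarrow> norm (D v) \<le> M"
  shows "halfline_Laplace D holomorphic_on {s. Re s > 0}"
proof (subst holomorphic_on_open)
  show "open {s. Re s > 0}" by (rule open_halfspace_Re_gt)
  show "\<forall>s0\<in>{s. Re s > 0}. \<exists>f'. (halfline_Laplace D has_field_derivative f') (at s0)"
  proof
    fix s0 :: complex assume "s0 \<in> {s. Re s > 0}"
    hence s0: "Re s0 > 0" by simp
    \<comment> \<open>With exp (- s0 v) as part of the integrand there is still room for an
      exponential weight of rate Re s0 / 2, so \<open>Laplace_holomorphic\<close> applies on a ball
      around s0.\<close>
    define R where "R = Re s0 / 2"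
    define g where "g v = indicator {0<..} v *\<^sub>R (D v * exp (- s0 * of_real v))" for v :: real
    have "(\<lambda>w. LBINT v. g v * exp (w * of_real v)) holomorphic_on ball 0 R"
    proof (rule Laplace_holomorphic)
      show "integrable lborel (\<lambda>v. norm (g v) * exp (R * \<bar>v\<bar>))"
      proof (rule Bochner_Integration.integrable_cong[THEN iffD1, OF refl _ integrable_norm[OF halfline_Laplace_integrable[OF m bd, of "s0 - of_real R"]]])
        show "norm (indicator {0<..} v *\<^sub>R (D v * exp (- (s0 - of_real R) * of_real v))) = norm (g v) * exp (R * \<bar>v\<bar>)" for v
          by (auto simp: g_def indicator_def norm_mult algebra_simps simp flip: exp_add)
      qed (use s0 in \<open>auto simp: R_def\<close>)
    qed (unfold g_def, measurable)
    hence "((\<lambda>w. LBINT v. g v * exp (w * of_real v)) \<circ> (\<lambda>s. s0 - s)) holomorphic_on ball s0 R"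
      by (intro holomorphic_on_compose_gen[where t = "ball 0 R"] holomorphic_intros) (auto simp: dist_norm norm_minus_commute)
    moreover have "(\<lambda>w. LBINT v. g v * exp (w * of_real v)) \<circ> (\<lambda>s. s0 - s) = halfline_Laplace D"
      by (auto simp: g_def halfline_Laplace_def fun_eq_iff algebra_simps simp flip: exp_add)
    ultimately have "halfline_Laplace D holomorphic_on ball s0 R" by simp
    moreover have "R > 0" using s0 by (simp add: R_def)
    ultimately show "\<exists>f'. (halfline_Laplace D has_field_derivative f') (at s0)"
      by (subst (asm) holomorphic_on_open) auto
  qed
qed

text \<open>
  The variable is logarithmic, and \<open>f n\<close> is the coefficient of \<open>n + 1\<close>, so the sum runs over the
  coefficients of \<open>1, \<dots>, \<lfloor>exp v\<rfloor>\<close>.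
\<close>

definition summatory_defect :: "(nat \<Rightarrow> complex) \<Rightarrow> complex \<Rightarrow> real \<Rightarrow> complex" where
  "summatory_defect f c v = (\<Sum>n<nat \<lfloor>exp v\<rfloor>. f n) - c * of_real (exp v)"

lemma summatory_defect_measurable [measurable]: "summatory_defect f c \<in> borel_measurable borel"
proof -
  have "(\<lambda>v::real. nat \<lfloor>exp v\<rfloor>) \<in> borel \<rightarrow>\<^sub>M count_space UNIV" by measurable
  from measurable_compose[OF this, of "\<lambda>k. \<Sum>n<k. f n" borel]
  have [measurable]: "(\<lambda>v::real. \<Sum>n<nat \<lfloor>exp v\<rfloor>. f n) \<in> borel_measurable borel" by simp
  show ?thesis unfolding summatory_defect_def[abs_def] by measurable
qed

text \<open>Abel summation in continuous form: n^(-s) is s times the integral of exp (- s v) over v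
  > ln n, and exchanging sum and integral produces the summatory function. Once the linear term c
  exp v is split off, the bounded defect has a Laplace transform in all of Re s > 0, together with
  the growth bound that the theta representation does not provide.\<close>

lemma Dirichlet_series_Laplace:
  assumes f: "\<And>n. norm (f n) \<le> M" and bd: "\<And>v. v > 0 \<Longrightarrow> norm (summatory_defect f c v) \<le> B" and s: "Re s > 1"
  shows "(\<lambda>n. f n / of_nat (Suc n) powr s) sums (c * s / (s - 1) + s * halfline_Laplace (summatory_defect f c) s)"
proof -
  have s0: "s \<noteq> 0" "s \<noteq> 1" using s by auto
  define h where "h n v = f n * (indicator {ln (real (Suc n))<..} v *\<^sub>R exp (- s * of_real v))" for n and v :: real
  have l: "has_bochner_integral lborel (\<lambda>v. indicator {l<..} v *\<^sub>R exp (- z * of_real v)) (exp (- z * of_real l) / z)" if "Re z > 0" for l z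
  proof -
    have "has_bochner_integral lborel (\<lambda>v. indicator {0<..} (- l + 1 * v) *\<^sub>R exp (- z * of_real (- l + 1 * v))) ((1 / z) /\<^sub>R \<bar>1\<bar>)"
      using integral_exp_halfline[OF that] by (subst (asm) lborel_has_bochner_integral_real_affine_iff[where c = 1 and t = "- l"]) auto
    from has_bochner_integral_mult_right[OF this, of "exp (- z * of_real l)"]
    have "has_bochner_integral lborel (\<lambda>v. exp (- z * of_real l) * (indicator {0<..} (- l + 1 * v) *\<^sub>R exp (- z * of_real (- l + 1 * v)))) (exp (- z * of_real l) / z)"
      by simp
    moreover have "exp (- z * of_real l) * (indicator {0<..} (- l + 1 * v) *\<^sub>R exp (- z * of_real (- l + 1 * v))) = indicator {l<..} v *\<^sub>R exp (- z * of_real v)" for v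
      by (auto simp: indicator_def algebra_simps simp flip: exp_add)
    ultimately show ?thesis by simp
  qed
  have el: "exp (- z * of_real (ln (real (Suc n)))) = 1 / of_nat (Suc n) powr z" for z :: complex and n
    by (simp add: powr_def Ln_of_nat exp_minus divide_inverse del: of_nat_Suc)
  have hi: "has_bochner_integral lborel (h n) (f n * (exp (- s * of_real (ln (real (Suc n)))) / s))" for n
    unfolding h_def[abs_def] by (intro has_bochner_integral_mult_right l) (use s in auto)
  have hint: "integrable lborel (h n)" for n using hi by (simp add: has_bochner_integral_iff)
  have hn: "(LBINT v. norm (h n v)) = norm (f n) * (real (Suc n) powr (- Re s) / Re s)" for n
  proof -
    have "has_bochner_integral lborel (\<lambda>v. complex_of_real (indicator {ln (real (Suc n))<..} v * exp (- Re s * v))) (of_real (exp (- Re s * ln (real (Suc n))) / Re s))"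
      using l[of "of_real (Re s)" "ln (real (Suc n))"] s by (simp add: scaleR_conv_of_real flip: exp_of_real)
    from has_bochner_integral_complex_of_realD[OF this]
    have "has_bochner_integral lborel (\<lambda>v. norm (f n) * (indicator {ln (real (Suc n))<..} v * exp (- Re s * v))) (norm (f n) * (exp (- Re s * ln (real (Suc n))) / Re s))"
      by (intro has_bochner_integral_mult_right) auto
    moreover have "norm (h n v) = norm (f n) * (indicator {ln (real (Suc n))<..} v * exp (- Re s * v))" for v
      by (simp add: h_def norm_mult)
    ultimately show ?thesis by (simp add: has_bochner_integral_iff powr_def)
  qed
  have supp: "h n v = 0" if "v \<le> 0 \<or> n \<ge> nat \<lfloor>exp v\<rfloor>" for n v
  proof -
    have "v \<le> ln (real (Suc n))"
    proof (cases "v \<le> 0")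
      case True thus ?thesis by (rule order_trans) simp
    next
      case False
      hence "exp v < real (Suc n)" using that by linarith
      hence "ln (exp v) \<le> ln (real (Suc n))" by (subst ln_le_cancel_iff) auto
      thus ?thesis by simp
    qed
    thus ?thesis by (simp add: h_def)
  qed
  have sm: "summable (\<lambda>n. norm (h n v))" for v
    by (rule summable_finite[of "{..<nat \<lfloor>exp v\<rfloor>}"]) (use supp in auto)
  have sm2: "summable (\<lambda>n. LBINT v. norm (h n v))"
  proof (rule summable_comparison_test')
    have "summable (\<lambda>n. real (Suc n) powr (- Re s))"
      using s summable_Suc_iff[of "\<lambda>n. real n powr (- Re s)"] by (simp add: summable_real_powr_iff)
    thus "summable (\<lambda>n. M * (real (Suc n) powr (- Re s) / Re s))" by (intro summable_mult summable_divide)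
    fix n
    have "norm (f n) * (real (Suc n) powr (- Re s) / Re s) \<le> M * (real (Suc n) powr (- Re s) / Re s)"
      using f s by (intro mult_right_mono) auto
    thus "norm (LBINT v. norm (h n v)) \<le> M * (real (Suc n) powr (- Re s) / Re s)"
      unfolding hn using s by (simp add: abs_mult)
  qed
  \<comment> \<open>The two sides can differ only at v = ln n, where the strict indicator in
    \<open>h\<close> does not yet count the n-th term but the floor does.\<close>
  have AEeq: "AE v in lborel. (\<Sum>n. h n v) = indicator {0<..} v *\<^sub>R (summatory_defect f c v * exp (- s * of_real v)) + c * (indicator {0<..} v *\<^sub>R exp (- (s - 1) * of_real v))"
  proof -
    have "AE v in lborel. v \<notin> range (\<lambda>n. ln (real (Suc n)))"
      by (rule AE_not_in, rule countable_imp_null_set_lborel) auto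
    thus ?thesis
    proof eventually_elim
      case (elim v)
      show ?case
      proof (cases "v > 0")
        case False thus ?thesis using supp by simp
      next
        case True
        have "h n v = f n * exp (- s * of_real v)" if "n < nat \<lfloor>exp v\<rfloor>" for n
        proof -
          have "real (Suc n) \<le> exp v" using that by linarith
          hence "ln (real (Suc n)) \<le> ln (exp v)" by (subst ln_le_cancel_iff) auto
          with elim have "ln (real (Suc n)) < v" by (metis ln_exp order_le_less rangeI)
          thus ?thesis by (simp add: h_def)
        qed
        moreover have "(\<Sum>n. h n v) = (\<Sum>n<nat \<lfloor>exp v\<rfloor>. h n v)"
          by (rule suminf_finite) (use supp in auto)
        ultimately have "(\<Sum>n. h n v) = (\<Sum>n<nat \<lfloor>exp v\<rfloor>. f n) * exp (- s * of_real v)"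
          by (simp add: sum_distrib_right)
        also have "\<dots> = summatory_defect f c v * exp (- s * of_real v) + c * (of_real (exp v) * exp (- s * of_real v))"
          by (simp add: summatory_defect_def algebra_simps)
        also have "of_real (exp v) * exp (- s * of_real v) = exp (- (s - 1) * of_real v)"
          by (simp add: algebra_simps flip: exp_of_real exp_add)
        finally show ?thesis using True by simp
      qed
    qed
  qed
  have [measurable]: "h n \<in> borel_measurable borel" for n using hint[of n] by auto
  have "(\<lambda>n. LBINT v. h n v) sums (LBINT v. (\<Sum>n. h n v))"
    by (rule sums_integral[OF hint AE_I2[OF sm] sm2])
  also have "(LBINT v. (\<Sum>n. h n v)) = (LBINT v. indicator {0<..} v *\<^sub>R (summatory_defect f c v * exp (- s * of_real v)) + c * (indicator {0<..} v *\<^sub>R exp (- (s - 1) * of_real v)))"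
    by (rule integral_cong_AE[OF _ _ AEeq]) measurable
  also have "\<dots> = halfline_Laplace (summatory_defect f c) s + c * (1 / (s - 1))"
  proof -
    have "has_bochner_integral lborel (\<lambda>v. c * (indicator {0<..} v *\<^sub>R exp (- (s - 1) * of_real v))) (c * (1 / (s - 1)))"
      by (intro has_bochner_integral_mult_right integral_exp_halfline) (use s in auto)
    moreover have "integrable lborel (\<lambda>v. indicator {0<..} v *\<^sub>R (summatory_defect f c v * exp (- s * of_real v)))"
      by (rule halfline_Laplace_integrable[OF _ bd]) (use s in auto)
    ultimately show ?thesis by (simp add: has_bochner_integral_iff halfline_Laplace_def)
  qed
  finally have "(\<lambda>n. LBINT v. h n v) sums (halfline_Laplace (summatory_defect f c) s + c * (1 / (s - 1)))" .
  from sums_mult[OF this, of s]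
  have "(\<lambda>n. s * (LBINT v. h n v)) sums (c * s / (s - 1) + s * halfline_Laplace (summatory_defect f c) s)"
    by (simp add: algebra_simps)
  moreover have "s * (LBINT v. h n v) = f n / of_nat (Suc n) powr s" for n
    using hi[of n] s0 unfolding el by (simp add: has_bochner_integral_iff)
  ultimately show ?thesis by simp
qed

text \<open>The difference, with its singularities removed, vanishes on a half-plane and hence
  everywhere. This yields agreement only in punctured neighbourhoods; the values at the centre agree
  because both functions are 0 at a common pole and equal their limit elsewhere.\<close>

lemma nicely_meromorphic_unique:
  assumes f: "f nicely_meromorphic_on UNIV" and g: "g nicely_meromorphic_on UNIV"
    and eq: "\<And>s. Re s > 1 \<Longrightarrow> f s = g s"
  shows "f = g"
proof
  fix z
  define h where "h = (\<lambda>s. f s - g s)"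
  have fm: "f meromorphic_on UNIV" "g meromorphic_on UNIV"
    using f g by (auto simp: nicely_meromorphic_on_def)
  hence hm: "h meromorphic_on UNIV" unfolding h_def by (intro meromorphic_intros)
  have "remove_sings h s = 0" if "s \<in> {s. Re s > 1}" for s
  proof (rule remove_sings_eqI)
    have "eventually (\<lambda>w. w \<in> {s. Re s > 1}) (at s)"
      using that by (intro eventually_at_in_open' open_halfspace_Re_gt) auto
    hence "eventually (\<lambda>w. h w = 0) (at s)"
      by eventually_elim (use eq in \<open>auto simp: h_def\<close>)
    thus "h \<midarrow>s\<rightarrow> 0" by (rule tendsto_eventually)
  qed
  hence "remove_sings h constant_on {s. Re s > 1}" by (auto simp: constant_on_def)
  hence "remove_sings h constant_on UNIV"
    by (rule constant_on_extend_nicely_meromorphic_on[rotated])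
       (use hm in \<open>auto intro!: remove_sings_nicely_meromorphic open_halfspace_Re_gt exI[of _ 2]\<close>)
  moreover have "remove_sings h 2 = 0" using \<open>\<And>s. s \<in> {s. Re s > 1} \<Longrightarrow> remove_sings h s = 0\<close> by simp
  ultimately have r0: "remove_sings h s = 0" for s unfolding constant_on_def by (metis UNIV_I)
  have "isolated_singularity_at h z" using hm by (meson UNIV_I meromorphic_on_isolated_singularity meromorphic_on_subset subset_UNIV)
  from eventually_remove_sings_eq_at[OF this]
  have ev: "eventually (\<lambda>w. f w = g w) (at z)"
    by eventually_elim (simp add: r0, simp add: h_def)
  have fz: "(is_pole f z \<and> f z = 0) \<or> f \<midarrow>z\<rightarrow> f z" and gz: "(is_pole g z \<and> g z = 0) \<or> g \<midarrow>z\<rightarrow> g z"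
    using f g by (auto simp: nicely_meromorphic_on_def)
  have pg: "is_pole f z \<longleftrightarrow> is_pole g z" using ev by (intro is_pole_cong) auto
  have lg: "(f \<midarrow>z\<rightarrow> l) \<longleftrightarrow> (g \<midarrow>z\<rightarrow> l)" for l using ev by (intro filterlim_cong) auto
  show "f z = g z"
  proof (cases "is_pole f z")
    case True
    hence "\<not> f \<midarrow>z\<rightarrow> f z" "\<not> g \<midarrow>z\<rightarrow> g z" using pg
      by (auto simp: is_pole_def dest: not_tendsto_and_filterlim_at_infinity[OF at_neq_bot])
    thus ?thesis using fz gz by simp
  next
    case False
    hence "f \<midarrow>z\<rightarrow> f z" "f \<midarrow>z\<rightarrow> g z" using fz gz pg lg by auto
    thus ?thesis using tendsto_unique[OF at_neq_bot] by blast
  qed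
qed

lemma continued_dirichlet_series_eqI:
  assumes "f nicely_meromorphic_on UNIV"
    and "\<And>s. Re s > 1 \<Longrightarrow> (\<lambda>n. a (Suc n) / of_nat (Suc n) powr s) sums f s"
  shows "continued_dirichlet_series a = f"
  unfolding continued_dirichlet_series_def
proof (rule the_equality)
  fix g assume g: "g nicely_meromorphic_on UNIV \<and> (\<forall>s. Re s > 1 \<longrightarrow> (\<lambda>n. a (Suc n) / of_nat (Suc n) powr s) sums g s)"
  show "g = f"
    by (rule nicely_meromorphic_unique) (use g assms sums_unique2 in blast)+
qed (use assms in blast)

section \<open>The zeta function\<close>

text \<open>\<open>theta_periodic\<close> at x = exp (- 2 u), with \<open>H\<close> eliminated
  between its two series. The factor sqrt (N x) = sqrt N exp (- u) becomes the constant 1 / sqrt N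
  and the weight exp u of the inversion law.\<close>

lemma theta_pair_of_periodic:
  fixes f :: "int \<Rightarrow> complex" and fhat :: "nat \<Rightarrow> complex"
  assumes N: "N > 0" and per: "\<And>n. f (n + int N) = f n" and ev: "\<And>n. f (- n) = f n" and bd: "\<And>n. norm (f n) \<le> 1"
    and fhat: "\<And>k. fhat k = (\<Sum>r<N. f (int r) * of_real (cos (2 * pi * real k * (real r / real N))))"
  shows "theta_pair (\<lambda>n. f (int (Suc n))) (\<lambda>n. fhat (Suc n)) (f 0) (fhat 0) (of_real (1 / sqrt N)) (pi / N) 1 N"
proof
  show "pi / N > 0" using N by simp
  show "norm (f (int (Suc n))) \<le> 1" for n by (rule bd)
  show "norm (fhat (Suc n)) \<le> real N" for n
  proof -
    have "norm (fhat (Suc n)) \<le> (\<Sum>r<N. norm (f (int r) * of_real (cos (2 * pi * real (Suc n) * (real r / real N)))))"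
      unfolding fhat by (rule norm_sum)
    also have "\<dots> \<le> (\<Sum>r<N. 1)"
    proof (rule sum_mono)
      fix r
      have "norm (f (int r)) * \<bar>cos (2 * pi * real (Suc n) * (real r / real N))\<bar> \<le> 1 * 1"
        by (intro mult_mono bd abs_cos_le_one) auto
      thus "norm (f (int r) * of_real (cos (2 * pi * real (Suc n) * (real r / real N)))) \<le> 1"
        by (simp only: norm_mult norm_of_real)
    qed
    finally show ?thesis by simp
  qed
  fix u :: real
  have x: "exp (- 2 * u) > 0" by simp
  obtain H :: complex where 1: "(\<lambda>n. f (int (Suc n)) * of_real (exp (- pi * (real (Suc n))\<^sup>2 * exp (- 2 * u) / N))) sums ((H - f 0) / 2)"
    and 2: "(\<lambda>k. fhat (Suc k) * of_real (exp (- pi * (real (Suc k))\<^sup>2 / (N * exp (- 2 * u))))) sums ((sqrt (N * exp (- 2 * u)) * H - fhat 0) / 2)"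
    using theta_periodic[where f = f, OF N per ev x] unfolding fhat[symmetric] by blast
  have a: "theta_tail (pi / N) (\<lambda>n. f (int (Suc n))) (- u) = (H - f 0) / 2"
    using sums_unique[OF 1] by (simp add: theta_tail_def mult_ac)
  have b: "theta_tail (pi / N) (\<lambda>n. fhat (Suc n)) u = (sqrt (N * exp (- 2 * u)) * H - fhat 0) / 2"
  proof -
    have "- pi * y / (N * exp (- 2 * u)) = - (pi / N) * y * exp (2 * u)" for y :: real
      using N exp_minus[of "2 * u"] by (simp add: field_simps)
    thus ?thesis using sums_unique[OF 2] by (simp only: theta_tail_def)
  qed
  have "sqrt (N * exp (- 2 * u)) = sqrt N * exp (- u)"
    using exp_double[of "- u"] by (simp add: real_sqrt_mult real_sqrt_power)
  hence c: "fhat 0 / 2 + theta_tail (pi / N) (\<lambda>n. fhat (Suc n)) u = of_real (sqrt N * exp (- u)) * H / 2"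
    unfolding b by (simp add: field_simps)
  have "complex_of_real (1 / sqrt N) * of_real (exp u) * (of_real (sqrt N * exp (- u)) * H / 2) = of_real ((1 / sqrt N) * exp u * (sqrt N * exp (- u))) * H / 2"
    by (simp add: field_simps)
  also have "(1 / sqrt N) * exp u * (sqrt N * exp (- u)) = 1" using N by (simp add: exp_minus)
  finally show "theta_tail (pi / N) (\<lambda>n. f (int (Suc n))) (- u) = complex_of_real (1 / sqrt N) * of_real (exp u) * (fhat 0 / 2 + theta_tail (pi / N) (\<lambda>n. fhat (Suc n)) u) - f 0 / 2"
    unfolding a c by (simp add: diff_divide_distrib)
qed

interpretation zeta: theta_pair "\<lambda>_. 1" "\<lambda>_. 1" 1 1 1 pi 1 1
proof -
  have "theta_pair (\<lambda>n. (\<lambda>_. 1) (int (Suc n))) (\<lambda>n. (\<lambda>_. 1) (Suc n)) ((\<lambda>_. 1) (0::int)) ((\<lambda>_. 1) (0::nat)) (of_real (1 / sqrt (real 1))) (pi / real 1) 1 (real 1)"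
    by (rule theta_pair_of_periodic) auto
  thus "theta_pair (\<lambda>_. 1) (\<lambda>_. 1) 1 1 1 pi 1 1" by simp
qed

text \<open>Zeta without its polar term in the half-plane Re s > 0. The summand 1 comes from s / (s
  - 1) = 1 + 1 / (s - 1).\<close>

definition zeta_regular :: "complex \<Rightarrow> complex" where
  "zeta_regular s = 1 + s * halfline_Laplace (summatory_defect (\<lambda>_. 1) 1) s"

lemma zeta_polar_part_1: "zeta.polar_part 1 = 1"
proof -
  have "complex_of_real pi powr (1/2) = of_real (sqrt pi)"
    using powr_of_real[of pi "1/2"] by (simp add: powr_half_sqrt)
  moreover have "rGamma (1/2 :: complex) = 1 / of_real (sqrt pi)"
    using Gamma_one_half_complex by (simp add: rGamma_inverse_Gamma inverse_eq_divide)
  ultimately show ?thesis unfolding zeta.polar_part_def by simp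
qed

text \<open>The value 0 at 1 is the convention for poles. That 1 is a genuine pole matters here, as
  a removable singularity would force the limit as value; it follows from the polar part being 1
  there.\<close>

lemma zeta_eq: "zeta s = (if s = 1 then 0 else zeta.entire_part s + zeta.polar_part s / (s - 1))"
proof -
  define F where "F s = (if s = 1 then 0 else zeta.entire_part s + zeta.polar_part s / (s - 1))" for s
  have Fan: "F analytic_on UNIV - {1}"
  proof (subst analytic_on_open)
    have "(\<lambda>s. zeta.entire_part s + zeta.polar_part s / (s - 1)) holomorphic_on UNIV - {1}"
      by (intro holomorphic_intros zeta.entire_part_holomorphic zeta.polar_part_holomorphic) auto
    thus "F holomorphic_on UNIV - {1}"
      by (rule holomorphic_transform) (auto simp: F_def)
  qed auto
  have pole: "is_pole F 1"
  proof -
    have "is_pole (\<lambda>s. ((s - 1) * zeta.entire_part s + zeta.polar_part s) / (s - 1)) 1"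
    proof (rule is_pole_divide)
      have "(\<lambda>s. (s - 1) * zeta.entire_part s + zeta.polar_part s) holomorphic_on UNIV"
        by (intro holomorphic_intros zeta.entire_part_holomorphic zeta.polar_part_holomorphic)
      thus "isCont (\<lambda>s. (s - 1) * zeta.entire_part s + zeta.polar_part s) 1"
        using holomorphic_on_imp_continuous_on continuous_on_eq_continuous_at by blast
      show "filterlim (\<lambda>s. s - 1) (at 0) (at (1::complex))"
        by (intro filterlim_atI tendsto_eq_intros) (auto simp: eventually_at_filter)
    qed (simp add: zeta_polar_part_1)
    moreover have "eventually (\<lambda>s. F s = ((s - 1) * zeta.entire_part s + zeta.polar_part s) / (s - 1)) (at 1)"
      by (auto simp: eventually_at_filter F_def add_divide_distrib)
    ultimately show ?thesis by (subst is_pole_cong) auto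
  qed
  have "F nicely_meromorphic_on UNIV"
  proof (rule nicely_meromorphic_onI_open[where pts = "{1}"])
    show "isolated_singularity_at F x" for x
    proof (cases "x = 1")
      case True
      thus ?thesis unfolding isolated_singularity_at_def
        by (intro exI[of _ 1] conjI analytic_on_subset[OF Fan]) auto
    next
      case False
      hence "F analytic_on {x}" using Fan by (rule_tac analytic_on_subset) auto
      thus ?thesis by (rule isolated_singularity_at_analytic)
    qed
  qed (use Fan pole in \<open>auto simp: F_def\<close>)
  hence "zeta = F" unfolding zeta_def
    by (rule continued_dirichlet_series_eqI) (use zeta.completed_series in \<open>auto simp: F_def\<close>)
  from fun_cong[OF this, of s] show ?thesis by (simp only: F_def)
qed

section \<open>Zeta in the right half-plane\<close>

lemma summatory_defect_one: "v > 0 \<Longrightarrow> norm (summatory_defect (\<lambda>_. 1) 1 v) \<le> 1"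
proof -
  assume "v > 0"
  hence "exp v > 0" by simp
  have "summatory_defect (\<lambda>_. 1) 1 v = of_real (of_int \<lfloor>exp v\<rfloor> - exp v)"
    by (simp add: summatory_defect_def)
  also have "norm \<dots> \<le> 1" by (simp only: norm_of_real) linarith
  finally show ?thesis .
qed

lemma zeta_regular_holomorphic: "zeta_regular holomorphic_on {s. Re s > 0}"
  unfolding zeta_regular_def[abs_def]
  by (intro holomorphic_intros halfline_Laplace_holomorphic[where M = 1] summatory_defect_one) measurable

text \<open>Multiplied by s - 1, the theta and the Laplace representation are both holomorphic for
  Re s > 0, and they agree where the Dirichlet series converges.\<close>

lemma zeta_eq_regular:
  assumes s: "Re s > 0" "s \<noteq> 1"
  shows "zeta s = 1 / (s - 1) + zeta_regular s"
proof -
  have "(s - 1) * zeta.entire_part s + zeta.polar_part s = 1 + (s - 1) * zeta_regular s"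
  proof (rule analytic_continuation_open[where s = "{s. Re s > 1}" and s' = "{s. Re s > 0}" and z = s
        and f = "\<lambda>s. (s - 1) * zeta.entire_part s + zeta.polar_part s" and g = "\<lambda>s. 1 + (s - 1) * zeta_regular s"])
    show "(\<lambda>s. (s - 1) * zeta.entire_part s + zeta.polar_part s) holomorphic_on {s. Re s > 0}"
      by (intro holomorphic_intros zeta.entire_part_holomorphic zeta.polar_part_holomorphic)
    show "(\<lambda>s. 1 + (s - 1) * zeta_regular s) holomorphic_on {s. Re s > 0}"
      by (intro holomorphic_intros zeta_regular_holomorphic)
    show "connected {s. Re s > 0}" by (intro convex_connected convex_halfspace_Re_gt)
    fix z assume "z \<in> {s. Re s > 1}"
    hence z: "Re z > 1" "z \<noteq> 1" by auto
    have "zeta.entire_part z + zeta.polar_part z / (z - 1) = 1 * z / (z - 1) + z * halfline_Laplace (summatory_defect (\<lambda>_. 1) 1) z"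
      by (rule sums_unique2[OF zeta.completed_series Dirichlet_series_Laplace[where M = 1 and B = 1]])
         (use z summatory_defect_one in auto)
    hence "(z - 1) * (zeta.entire_part z + zeta.polar_part z / (z - 1)) = (z - 1) * (1 * z / (z - 1) + z * halfline_Laplace (summatory_defect (\<lambda>_. 1) 1) z)"
      by simp
    moreover have "(z - 1) * (zeta.entire_part z + zeta.polar_part z / (z - 1)) = (z - 1) * zeta.entire_part z + zeta.polar_part z"
      using z by (simp add: distrib_left)
    moreover have "(z - 1) * (1 * z / (z - 1) + w) = z + (z - 1) * w" for w
      using z by (simp add: distrib_left)
    moreover have "z + (z - 1) * w = 1 + (z - 1) * (1 + w)" for w by (simp add: algebra_simps)
    ultimately show "(z - 1) * zeta.entire_part z + zeta.polar_part z = 1 + (z - 1) * zeta_regular z"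
      by (simp only: zeta_regular_def)
  qed (use s in \<open>auto intro!: open_halfspace_Re_gt exI[of _ 2]\<close>)
  hence "((s - 1) * zeta.entire_part s + zeta.polar_part s) / (s - 1) = (1 + (s - 1) * zeta_regular s) / (s - 1)" by simp
  thus ?thesis using s by (simp add: zeta_eq add_divide_distrib)
qed

lemma zeta_regular_bound: "Re s > 0 \<Longrightarrow> norm (zeta_regular s) \<le> 1 + norm s / Re s"
proof -
  assume s: "Re s > 0"
  have "norm (halfline_Laplace (summatory_defect (\<lambda>_. 1) 1) s) \<le> 1 / Re s"
    by (rule halfline_Laplace_bound) (use s summatory_defect_one in auto)
  hence "norm s * norm (halfline_Laplace (summatory_defect (\<lambda>_. 1) 1) s) \<le> norm s * (1 / Re s)"
    by (intro mult_left_mono) auto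
  hence "norm (s * halfline_Laplace (summatory_defect (\<lambda>_. 1) 1) s) \<le> norm s / Re s"
    by (simp only: norm_mult times_divide_eq_right mult_1_right)
  thus ?thesis unfolding zeta_regular_def
    using norm_triangle_ineq[of 1 "s * halfline_Laplace (summatory_defect (\<lambda>_. 1) 1) s"] by (simp only: norm_one)
qed

text \<open>At s = 1 the Laplace integrand is (floor (exp v) - exp v) exp (- v). Between ln m and ln
  (m + 1) the floor is constant, and up to ln n the integral telescopes to the harmonic sum minus ln
  n minus 1; the last 1 cancels the constant in \<open>zeta_regular\<close>.\<close>

lemma zeta_regular_1: "zeta_regular 1 = of_real euler_mascheroni"
proof -
  define g where "g = (\<lambda>v. indicator {0<..} v *\<^sub>R (summatory_defect (\<lambda>_. 1) 1 v * exp (- 1 * of_real v)))"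
  have gi: "integrable lborel g" unfolding g_def
    by (rule halfline_Laplace_integrable[where M = 1]) (use summatory_defect_one in auto)
  define k where "k n = ln (real (Suc n))" for n
  have k: "filterlim k at_top sequentially" unfolding k_def by real_asymp
  have I: "integral {- k n..k n} g = of_real (harm (Suc n) - ln (real (Suc n)) - 1)" for n
  proof -
    have step: "(g has_integral of_real (real (Suc m) * (1 / real (Suc m) - 1 / real (Suc (Suc m))) - (k (Suc m) - k m))) {k m..k (Suc m)}" for m
    proof -
      have km: "k m \<le> k (Suc m)" by (simp add: k_def)
      have "((\<lambda>v. complex_of_real (real (Suc m) * exp (- v) - 1)) has_integral of_real ((- real (Suc m) * exp (- k (Suc m)) - k (Suc m)) - (- real (Suc m) * exp (- k m) - k m))) {k m..k (Suc m)}"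
      proof (intro has_integral_of_real fundamental_theorem_of_calculus km)
        fix v assume "v \<in> {k m..k (Suc m)}"
        have "((\<lambda>v. - real (Suc m) * exp (- v) - v) has_real_derivative (real (Suc m) * exp (- v) - 1)) (at v within {k m..k (Suc m)})"
          by (auto intro!: derivative_eq_intros simp del: of_nat_Suc)
        thus "((\<lambda>v. - real (Suc m) * exp (- v) - v) has_vector_derivative (real (Suc m) * exp (- v) - 1)) (at v within {k m..k (Suc m)})"
          by (simp only: has_real_derivative_iff_has_vector_derivative)
      qed
      moreover have "(- real (Suc m) * exp (- k (Suc m)) - k (Suc m)) - (- real (Suc m) * exp (- k m) - k m) = real (Suc m) * (1 / real (Suc m) - 1 / real (Suc (Suc m))) - (k (Suc m) - k m)"
      proof -
        have ek: "exp (- k j) = 1 / real (Suc j)" for j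
          by (simp add: k_def exp_minus inverse_eq_divide)
        show ?thesis unfolding ek by (simp add: right_diff_distrib del: of_nat_Suc)
      qed
      ultimately have "((\<lambda>v. complex_of_real (real (Suc m) * exp (- v) - 1)) has_integral of_real (real (Suc m) * (1 / real (Suc m) - 1 / real (Suc (Suc m))) - (k (Suc m) - k m))) {k m..k (Suc m)}"
        by (simp only:)
      thus ?thesis
      proof (rule has_integral_spike_finite[of "{k m, k (Suc m)}", rotated 2])
        fix v assume v: "v \<in> {k m..k (Suc m)} - {k m, k (Suc m)}"
        hence "k m < v" "v < k (Suc m)" by auto
        hence "exp (k m) < exp v" "exp v < exp (k (Suc m))" by simp_all
        hence "real (Suc m) < exp v" "exp v < real (Suc (Suc m))" by (simp_all add: k_def)
        hence "\<lfloor>exp v\<rfloor> = int (Suc m)" by (intro floor_unique) auto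
        moreover have "v > 0" using \<open>k m < v\<close> by (rule le_less_trans[rotated]) (simp add: k_def)
        ultimately show "g v = complex_of_real (real (Suc m) * exp (- v) - 1)"
          by (simp add: g_def summatory_defect_def algebra_simps flip: exp_of_real exp_add)
      qed auto
    qed
    have "(g has_integral of_real (harm (Suc n) - ln (real (Suc n)) - 1)) {0..k n}"
    proof (induction n)
      case 0
      show ?case using has_integral_refl(2)[of g 0] by (simp add: k_def harm_def)
    next
      case (Suc n)
      have "(g has_integral (of_real (harm (Suc n) - ln (real (Suc n)) - 1) + of_real (real (Suc n) * (1 / real (Suc n) - 1 / real (Suc (Suc n))) - (k (Suc n) - k n)))) {0..k (Suc n)}"
        by (rule has_integral_combine[OF _ _ Suc step]) (auto simp: k_def)
      moreover have "harm (Suc n) - ln (real (Suc n)) - 1 + (real (Suc n) * (1 / real (Suc n) - 1 / real (Suc (Suc n))) - (k (Suc n) - k n)) = harm (Suc (Suc n)) - ln (real (Suc (Suc n))) - 1"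
      proof -
        have "real (Suc n) * (1 / real (Suc n) - 1 / real (Suc (Suc n))) = 1 / real (Suc (Suc n))"
        proof -
          have "x * (1 / x - 1 / (x + 1)) = 1 / (x + 1)" if "x > 0" for x :: real
            using that by (simp add: right_diff_distrib, simp add: field_simps)
          from this[of "real (Suc n)"] show ?thesis by (simp add: add_ac)
        qed
        moreover have "harm (Suc (Suc n)) = harm (Suc n) + 1 / real (Suc (Suc n))"
          by (subst harm_Suc) (simp add: inverse_eq_divide)
        ultimately show ?thesis unfolding k_def by linarith
      qed
      ultimately show ?case by (simp only: of_real_add[symmetric])
    qed
    moreover have "(g has_integral 0) {- k n..0}"
      by (rule has_integral_is_0) (auto simp: g_def)
    ultimately have "(g has_integral (0 + of_real (harm (Suc n) - ln (real (Suc n)) - 1))) {- k n..k n}"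
      by (intro has_integral_combine[of "- k n" 0 "k n"]) (auto simp: k_def)
    thus ?thesis by (simp add: integral_unique)
  qed
  have "(\<lambda>n. integral {- k n..k n} g) \<longlonglongrightarrow> (LBINT v. g v)"
    by (rule LBINT_eq_lim_integral[OF gi k])
  moreover have "(\<lambda>n. integral {- k n..k n} g) \<longlonglongrightarrow> of_real (euler_mascheroni - 1)"
    unfolding I by (intro tendsto_of_real tendsto_diff tendsto_const LIMSEQ_Suc[OF euler_mascheroni_LIMSEQ])
  ultimately have "(LBINT v. g v) = of_real (euler_mascheroni - 1)" using LIMSEQ_unique by blast
  thus ?thesis by (simp add: zeta_regular_def halfline_Laplace_def g_def)
qed

lemma halfline_Laplace_cnj: "halfline_Laplace (\<lambda>v. cnj (D v)) (cnj s) = cnj (halfline_Laplace D s)"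
  unfolding halfline_Laplace_def by (subst Bochner_Integration.integral_cnj[symmetric]) (simp add: exp_cnj)

lemma zeta_cnj:
  assumes "Re s > 0" "s \<noteq> 1"
  shows "zeta (cnj s) = cnj (zeta s)"
proof -
  have "cnj s \<noteq> 1" using assms(2) by (metis complex_cnj_cnj complex_cnj_one)
  moreover have "(\<lambda>v. cnj (summatory_defect (\<lambda>_. 1) 1 v)) = summatory_defect (\<lambda>_. 1) 1"
    by (auto simp: summatory_defect_def fun_eq_iff)
  ultimately show ?thesis using assms halfline_Laplace_cnj[of "summatory_defect (\<lambda>_. 1) 1" s]
    by (simp add: zeta_eq_regular zeta_regular_def)
qed

text \<open>The bracket \<open>X\<close> is invariant under s \<mapsto> 1 - s, so the quotient of
  the two zeta values is a quotient of Gamma factors. The reflection formula at s/2 + 1/2 and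
  Legendre duplication convert it into the cosine and Gamma s.\<close>

lemma zeta_functional_equation:
  fixes s :: complex
  assumes s: "0 < Re s" "Re s < 1"
  shows "zeta (1 - s) = 2 * (2 * pi) powr (- s) * cos (pi * s / 2) * Gamma s * zeta s"
proof -
  define X where "X = theta_entire pi (\<lambda>_. 1) s + theta_entire pi (\<lambda>_. 1) (1 - s) + 1 / (2 * (s - 1)) - 1 / (2 * s)"
  have s01: "s \<noteq> 0" "s \<noteq> 1" using s by auto
  have r: "rGamma (z/2) = z / 2 * rGamma (z/2 + 1)" for z :: complex using rGamma_plus1[of "z/2"] by simp
  have z1: "zeta s = 2 * pi powr (s/2) * rGamma (s/2) * X"
  proof -
    have "rGamma (s/2 + 1) = rGamma (s/2) * 2 / s" using r[of s] s01 by (simp add: field_simps)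
    thus ?thesis using s01
      by (simp add: zeta_eq zeta.entire_part_def zeta.polar_part_def X_def) (simp add: field_simps)
  qed
  have z2: "zeta (1 - s) = 2 * pi powr ((1 - s)/2) * rGamma ((1 - s)/2) * X"
  proof -
    have "rGamma ((1 - s)/2 + 1) = rGamma ((1 - s)/2) * 2 / (1 - s)" using r[of "1 - s"] s01 by (simp add: field_simps)
    thus ?thesis using s01
      by (simp add: zeta_eq zeta.entire_part_def zeta.polar_part_def X_def) (simp add: field_simps)
  qed
  have np: "s / 2 \<notin> \<int>\<^sub>\<le>\<^sub>0"
  proof
    assume "s / 2 \<in> \<int>\<^sub>\<le>\<^sub>0"
    then obtain n where "s / 2 = - of_nat n" by (elim nonpos_Ints_cases')
    hence "Re (s / 2) = - real n" by simp
    thus False using s by simp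
  qed
  have G: "Gamma (s/2) * rGamma (s/2) = 1" using np by (simp add: Gamma_def rGamma_eq_zero_iff)
  have sn: "s / 2 + 1/2 \<notin> \<int>\<^sub>\<le>\<^sub>0"
  proof
    assume "s / 2 + 1/2 \<in> \<int>\<^sub>\<le>\<^sub>0"
    then obtain n where "s / 2 + 1/2 = - of_nat n" by (elim nonpos_Ints_cases')
    hence "Re (s / 2 + 1/2) = - real n" by simp
    thus False using s by simp
  qed
  have refl: "rGamma ((1 - s)/2) = Gamma (s/2 + 1/2) * cos (pi * s / 2) / pi"
  proof -
    have "rGamma (s/2 + 1/2) * rGamma (1 - (s/2 + 1/2)) = sin (of_real pi * (s/2 + 1/2)) / of_real pi"
      by (rule rGamma_reflection_complex)
    also have "of_real pi * (s/2 + 1/2) = of_real (pi / 2) + of_real pi * s / 2" by (simp add: field_simps)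
    also have "sin (complex_of_real (pi / 2) + of_real pi * s / 2) = cos (of_real pi * s / 2)"
      by (simp only: sin_add) (simp add: sin_of_real cos_of_real)
    also have "1 - (s/2 + 1/2) = (1 - s)/2" by (simp add: field_simps)
    finally have "Gamma (s/2 + 1/2) * (rGamma (s/2 + 1/2) * rGamma ((1 - s)/2)) = Gamma (s/2 + 1/2) * (cos (of_real pi * s / 2) / of_real pi)" by simp
    moreover have "Gamma (s/2 + 1/2) * rGamma (s/2 + 1/2) = 1" using sn by (simp add: Gamma_def rGamma_eq_zero_iff)
    ultimately show ?thesis by (simp add: mult.assoc[symmetric])
  qed
  have dup: "Gamma (s/2) * Gamma (s/2 + 1/2) = exp ((1 - s) * of_real (ln 2)) * of_real (sqrt pi) * Gamma s"
    using Gamma_legendre_duplication[OF np sn] by simp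
  have "zeta (1 - s) = 2 * pi powr ((1 - s)/2) * rGamma ((1 - s)/2) * X * (Gamma (s/2) * rGamma (s/2))"
    unfolding z2 G by simp
  also have "\<dots> = pi powr ((1 - s)/2) * pi powr (- s/2) * (rGamma ((1 - s)/2) * Gamma (s/2)) * (2 * pi powr (s/2) * rGamma (s/2) * X)"
    by (simp add: powr_minus field_simps)
  also have "\<dots> = pi powr ((1 - s)/2) * pi powr (- s/2) * (Gamma (s/2) * Gamma (s/2 + 1/2)) * cos (pi * s / 2) / pi * zeta s"
    unfolding refl z1 by (simp add: mult_ac)
  also have "pi powr ((1 - s)/2) * pi powr (- s/2) * (Gamma (s/2) * Gamma (s/2 + 1/2)) = 2 * (2 * pi) powr (- s) * pi * Gamma s"
  proof -
    have ex: "exp (complex_of_real (ln x)) = of_real x" if "x > 0" for x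
      by (simp only: exp_of_real exp_ln[OF that])
    have sq: "complex_of_real (sqrt pi) = exp (of_real (ln pi / 2))"
    proof -
      have "ln (sqrt pi) = ln pi / 2" by (simp add: ln_sqrt)
      with ex[of "sqrt pi"] show ?thesis by (simp only: real_sqrt_gt_zero[OF pi_gt_zero])
    qed
    have lp: "complex_of_real pi = exp (of_real (ln pi))" using ex[of pi] by simp
    have l2: "(2::complex) = exp (of_real (ln 2))" using ex[of 2] by simp
    have pw: "complex_of_real x powr z = exp (z * of_real (ln x))" if "x > 0" for x and z :: complex
      using that by (simp add: powr_def Ln_of_real)
    have p1: "pi powr z = exp (z * of_real (ln pi))" for z :: complex by (rule pw) simp
    have p2: "(2 * pi) powr z = exp (z * (of_real (ln 2) + of_real (ln pi)))" for z :: complex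
      using pw[of "2 * pi" z] by (simp add: ln_mult)
    have "pi powr ((1 - s)/2) * pi powr (- s/2) * exp ((1 - s) * of_real (ln 2)) * of_real (sqrt pi) = exp (of_real (ln 2)) * (2 * pi) powr (- s) * exp (of_real (ln pi))"
    proof -
      have ex: "(1 - s) / 2 * L + - s / 2 * L + (1 - s) * M + L / 2 = M + - s * (M + L) + L" for L M :: complex
        by (simp add: field_simps)
      have "of_real (ln pi / 2) = complex_of_real (ln pi) / 2" by simp
      thus ?thesis by (simp only: p1 p2 sq exp_add[symmetric] ex)
    qed
    hence "pi powr ((1 - s)/2) * pi powr (- s/2) * exp ((1 - s) * of_real (ln 2)) * of_real (sqrt pi) = 2 * (2 * pi) powr (- s) * of_real pi"
      by (simp only: lp[symmetric] l2[symmetric])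
    thus ?thesis unfolding dup mult.assoc[symmetric] by (simp only:)
  qed
  finally show ?thesis by (simp add: mult_ac)
qed

section \<open>Even characters to a prime modulus\<close>

lemma dirichlet_character_cong:
  assumes "dirichlet_character m chi" "[a = b] (mod int m)"
  shows "chi a = chi b"
proof -
  have *: "chi (a + int k * int m) = chi a" for a k
  proof (induction k)
    case (Suc k)
    have "a + int (Suc k) * int m = (a + int k * int m) + int m" by (simp add: algebra_simps)
    thus ?case using assms(1) Suc by (metis dirichlet_character_def)
  qed simp
  obtain k where k: "a = b + k * int m"
    using assms(2) by (metis cong_iff_lin cong_sym mult.commute)
  show ?thesis
  proof (cases "k \<ge> 0")
    case True thus ?thesis using *[of b "nat k"] k by simp
  next
    case False thus ?thesis using *[of a "nat (- k)"] k by simp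
  qed
qed

locale odd_prime =
  fixes p :: nat
  assumes p: "prime p" "odd p"
begin

text \<open>The number of even characters modulo p, and the exponent at which a primitive root
  becomes -1.\<close>

definition "half_order = (p - 1) div 2"

lemma p_ge_3: "p \<ge> 3" using prime_ge_2_nat[OF p(1)] p(2) by (cases "p = 2") auto

lemma half_order: "p = 2 * half_order + 1" "half_order > 0" using p_ge_3 p(2) by (auto simp: half_order_def elim!: oddE)

definition "even_characters = {chi. dirichlet_character p chi \<and> chi (- 1) = 1}"

lemma coprime_iff: "coprime a (int p) \<longleftrightarrow> \<not> int p dvd a"
  using p(1) by (metis coprime_commute prime_imp_coprime_int prime_nat_int_transfer not_coprimeI dvd_refl prime_ge_2_int not_prime_unit)

lemma char_zero_iff: "dirichlet_character p chi \<Longrightarrow> chi a = 0 \<longleftrightarrow> int p dvd a"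
  using coprime_iff unfolding dirichlet_character_def by metis

lemma char_mult: "dirichlet_character p chi \<Longrightarrow> chi (a * b) = chi a * chi b"
  unfolding dirichlet_character_def by blast

lemma char_1: "dirichlet_character p chi \<Longrightarrow> chi 1 = 1"
proof -
  assume c: "dirichlet_character p chi"
  have "\<not> int p dvd 1" using p_ge_3 by simp
  hence "chi 1 \<noteq> 0" using char_zero_iff[OF c] by simp
  moreover have "chi 1 * chi 1 = chi 1" using char_mult[OF c, of 1 1] by simp
  ultimately show ?thesis by simp
qed

lemma char_power: "dirichlet_character p chi \<Longrightarrow> chi (a ^ k) = chi a ^ k"
  by (induction k) (simp_all add: char_1 char_mult)

lemma char_norm:
  assumes c: "dirichlet_character p chi" and a: "\<not> int p dvd a"
  shows "norm (chi a) = 1"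
proof -
  have "[a ^ (p - 1) = 1] (mod int p)"
  proof -
    define b where "b = nat (a mod int p)"
    have pp: "int p > 0" using p_ge_3 by simp
    have b: "int b = a mod int p" using pp by (simp add: b_def)
    hence "\<not> p dvd b" using a by (metis dvd_mod_iff int_dvd_int_iff dvd_refl)
    hence "[b ^ (p - 1) = 1] (mod p)" using fermat_theorem[OF p(1)] by blast
    hence "[int b ^ (p - 1) = 1] (mod int p)" by (metis cong_int_iff of_nat_1 of_nat_power)
    moreover have "[int b = a] (mod int p)" using b by (simp add: cong_def)
    ultimately show ?thesis by (meson cong_pow cong_sym cong_trans)
  qed
  hence "chi a ^ (p - 1) = 1" using dirichlet_character_cong[OF c] char_power[OF c] char_1[OF c] by metis
  hence "norm (chi a) ^ (p - 1) = 1" by (metis norm_one norm_power)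
  thus ?thesis using power_eq_imp_eq_base[of "norm (chi a)" "p - 1" 1] p_ge_3 by simp
qed

lemma char_norm_le: "dirichlet_character p chi \<Longrightarrow> norm (chi a) \<le> 1"
  using char_norm[of chi a] char_zero_iff[of chi a] by (cases "int p dvd a") auto

lemma char_cnj_mult: "dirichlet_character p chi \<Longrightarrow> \<not> int p dvd a \<Longrightarrow> cnj (chi a) * chi a = 1"
  using char_norm[of chi a] complex_norm_square[of "chi a"] by (simp add: mult.commute)

lemma char_cnj: "dirichlet_character p chi \<Longrightarrow> dirichlet_character p (\<lambda>a. cnj (chi a))"
  unfolding dirichlet_character_def by simp

lemma char_even: "chi \<in> even_characters \<Longrightarrow> chi (- a) = chi a"
  using char_mult[of chi "-1" a] by (simp add: even_characters_def)

text \<open>The only proper divisor of a prime is 1, and the only character modulo 1 is the constant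
  1; hence primitive means nontrivial.\<close>

lemma primitive_iff:
  "primitive_character p chi \<longleftrightarrow> dirichlet_character p chi \<and> (\<exists>a. \<not> int p dvd a \<and> chi a \<noteq> 1)"
proof
  assume pr: "primitive_character p chi"
  have "dirichlet_character 1 (\<lambda>_. 1)" by (simp add: dirichlet_character_def)
  moreover have "1 dvd p" "1 < p" using p_ge_3 by auto
  ultimately have "\<not> (\<forall>a. coprime a (int p) \<longrightarrow> chi a = 1)"
    using pr unfolding primitive_character_def by blast
  thus "dirichlet_character p chi \<and> (\<exists>a. \<not> int p dvd a \<and> chi a \<noteq> 1)"
    using pr coprime_iff by (auto simp: primitive_character_def)
next
  assume *: "dirichlet_character p chi \<and> (\<exists>a. \<not> int p dvd a \<and> chi a \<noteq> 1)"
  show "primitive_character p chi" unfolding primitive_character_def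
  proof (intro conjI notI)
    assume "\<exists>d \<psi>. d dvd p \<and> d < p \<and> dirichlet_character d \<psi> \<and> (\<forall>a. coprime a (int p) \<longrightarrow> chi a = \<psi> a)"
    then obtain d \<psi> where d: "d dvd p" "d < p" "dirichlet_character d \<psi>" "\<forall>a. coprime a (int p) \<longrightarrow> chi a = \<psi> a" by blast
    have "d = 1" using d(1,2) p(1) by (auto simp: prime_nat_iff)
    hence "\<psi> a = \<psi> 1" for a using dirichlet_character_cong[OF d(3)] by (simp add: cong_def)
    moreover have "\<psi> 1 = 1"
    proof -
      have "\<psi> 1 * \<psi> 1 = \<psi> 1" "\<psi> 1 \<noteq> 0" using d(3) unfolding dirichlet_character_def by (metis mult_1, metis coprime_1_left)
      thus ?thesis by simp
    qed
    ultimately show False using * d(4) coprime_iff by metis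
  qed (use * in auto)
qed

lemma primroot_exists:
  obtains g :: int where "\<not> int p dvd g" "\<And>a. \<not> int p dvd a \<Longrightarrow> \<exists>k. [a = g ^ k] (mod int p)"
    "\<And>i j. [g ^ i = g ^ j] (mod int p) \<longleftrightarrow> [i = j] (mod (p - 1))" "[g ^ half_order = - 1] (mod int p)"
proof -
  obtain g0 where g0: "residue_primroot p g0"
    using residue_primroot_odd_prime_power_exists[OF p] by (metis power_one_right zero_less_one)
  hence cop: "coprime p g0" and ord: "ord p g0 = p - 1"
    using p(1) by (auto simp: residue_primroot_def totient_prime)
  define g where "g = int g0"
  have ng: "\<not> int p dvd g"
  proof
    assume "int p dvd g"
    hence "p dvd g0" by (simp add: g_def)
    with cop have "p = 1" by (simp add: coprime_absorb_left)
    thus False using p_ge_3 by simp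
  qed
  have gi: "[g ^ i = g ^ j] (mod int p) \<longleftrightarrow> [i = j] (mod (p - 1))" for i j
  proof -
    have "[g ^ i = g ^ j] (mod int p) \<longleftrightarrow> [g0 ^ i = g0 ^ j] (mod p)"
      unfolding g_def by (metis cong_int_iff of_nat_power)
    also have "\<dots> \<longleftrightarrow> [i = j] (mod ord p g0)" using order_divides_expdiff[OF cop] .
    finally show ?thesis by (simp add: ord)
  qed
  have ex: "\<exists>k. [a = g ^ k] (mod int p)" if a: "\<not> int p dvd a" for a
  proof -
    define b where "b = nat (a mod int p)"
    have pp: "int p > 0" using p_ge_3 by simp
    have b: "int b = a mod int p" using pp by (simp add: b_def)
    have bp: "b < p" using b pp by (metis of_nat_less_iff pos_mod_bound)
    have "b \<noteq> 0" using a b by (metis mod_0_imp_dvd of_nat_0)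
    hence "b \<in> totatives p" using bp p(1) by (auto simp: totatives_prime)
    moreover have "bij_betw (\<lambda>i. g0 ^ i mod p) {..<totient p} (totatives p)"
      using residue_primroot_is_generator[of p g0] p_ge_3 g0 by auto
    ultimately obtain i where "b = g0 ^ i mod p" unfolding bij_betw_def by auto
    hence "int b = g ^ i mod int p" by (simp add: g_def zmod_int)
    hence "[a = g ^ i] (mod int p)" using b by (simp add: cong_def)
    thus ?thesis by blast
  qed
  \<comment> \<open>This power squares to 1 and differs from 1, as the order of g is p - 1;
    primality leaves only -1.\<close>
  have "[g ^ half_order = - 1] (mod int p)"
  proof -
    have "[g ^ (2 * half_order) = g ^ 0] (mod int p)" proof -
      have "p - 1 = 2 * half_order" using half_order by simp
      thus ?thesis unfolding gi by (simp add: cong_def)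
    qed
    hence "int p dvd (g ^ half_order - 1) * (g ^ half_order + 1)"
      by (simp add: cong_iff_dvd_diff algebra_simps power_mult power2_eq_square)
    moreover have "\<not> int p dvd (g ^ half_order - 1)"
    proof
      assume "int p dvd (g ^ half_order - 1)"
      hence "[g ^ half_order = g ^ 0] (mod int p)" by (simp add: cong_iff_dvd_diff)
      hence "[half_order = 0] (mod (p - 1))" unfolding gi .
      moreover have "half_order < p - 1" using half_order by simp
      ultimately show False using half_order(2) by (simp add: cong_def)
    qed
    ultimately have "int p dvd (g ^ half_order + 1)" using p(1) by (simp add: prime_dvd_mult_iff)
    thus ?thesis by (simp add: cong_iff_dvd_diff)
  qed
  with that ng ex gi show ?thesis by blast
qed

section \<open>Orthogonality of even characters\<close>

lemma sum_dilate:
  fixes F :: "int \<Rightarrow> complex"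
  assumes n: "\<not> int p dvd n" and F: "\<And>x y. [x = y] (mod int p) \<Longrightarrow> F x = F y"
  shows "(\<Sum>a<p. F (n * int a)) = (\<Sum>a<p. F (int a))"
proof -
  have pp: "int p > 0" using p_ge_3 by simp
  define r where "r a = nat ((n * int a) mod int p)" for a
  have rx: "[int (r a) = n * int a] (mod int p)" "r a < p" for a
    using pp by (auto simp: r_def cong_def nat_less_iff)
  have inj: "inj_on r {..<p}"
  proof (rule inj_onI)
    fix a b assume ab: "a \<in> {..<p}" "b \<in> {..<p}" "r a = r b"
    hence "[n * int a = n * int b] (mod int p)" using rx(1) by (metis cong_sym cong_trans)
    hence "[int a = int b] (mod int p)" using n coprime_iff by (metis cong_mult_lcancel)
    hence "[a = b] (mod p)" by (simp only: cong_int_iff)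
    thus "a = b" using ab by (simp add: cong_def)
  qed
  have "r ` {..<p} = {..<p}"
    by (rule card_subset_eq) (use rx(2) card_image[OF inj] in auto)
  hence "(\<Sum>a<p. F (int a)) = (\<Sum>a<p. F (int (r a)))"
    using sum.reindex[OF inj, of "\<lambda>a. F (int a)"] by simp
  also have "\<dots> = (\<Sum>a<p. F (n * int a))"
    by (rule sum.cong[OF refl]) (use F rx(1) in blast)
  finally show ?thesis by simp
qed

lemma sum_roots_unity_power:
  assumes n: "n > 0"
  shows "(\<Sum>z\<in>{z::complex. z ^ n = 1}. z ^ k) = (if n dvd k then of_nat n else 0)"
proof (cases "n dvd k")
  case True
  then obtain m where m: "k = n * m" by (elim dvdE)
  have "(\<Sum>z\<in>{z::complex. z ^ n = 1}. z ^ k) = (\<Sum>z\<in>{z::complex. z ^ n = 1}. 1)"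
    by (rule sum.cong) (auto simp: m power_mult)
  thus ?thesis using True n card_roots_unity_eq[of n] by simp
next
  case False
  define w where "w = exp (2 * of_real pi * \<i> * of_nat 1 / of_nat n)"
  have wk: "w ^ k = exp (2 * of_real pi * \<i> * of_nat k / of_nat n)"
    by (simp add: w_def exp_of_nat_mult[symmetric] field_simps)
  have wn: "w ^ n = 1" using n complex_root_unity[of n 1] by (simp add: w_def)
  have "w ^ k \<noteq> 1"
  proof
    assume "w ^ k = 1"
    hence "exp (2 * of_real pi * \<i> * of_nat k / of_nat n) = exp (2 * of_real pi * \<i> * of_nat 0 / of_nat n)"
      unfolding wk by simp
    hence "k mod n = 0 mod n" using complex_root_unity_eq[of n k 0] n by simp
    with False show False by auto
  qed
  moreover have "(\<Sum>z\<in>{z::complex. z ^ n = 1}. z ^ k) = (\<Sum>z\<in>{z::complex. z ^ n = 1}. (w * z) ^ k)"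
    by (rule sum.reindex_bij_witness[of _ "\<lambda>z. w * z" "\<lambda>z. z / w"])
       (use wn n in \<open>auto simp: power_mult_distrib power_divide zero_power\<close>)
  moreover have "(\<Sum>z\<in>{z::complex. z ^ n = 1}. (w * z) ^ k) = w ^ k * (\<Sum>z\<in>{z::complex. z ^ n = 1}. z ^ k)"
    by (simp add: power_mult_distrib sum_distrib_left)
  ultimately have "w ^ k \<noteq> 1" "(\<Sum>z\<in>{z::complex. z ^ n = 1}. z ^ k) = w ^ k * (\<Sum>z\<in>{z::complex. z ^ n = 1}. z ^ k)"
    by simp_all
  thus ?thesis using False by (metis mult_cancel_right1)
qed

text \<open>A character is determined by its value at a primitive root g, and since g^half_order =
  -1, evenness says that this value is a root of unity of order dividing \<open>half_order\<close>.
  Character sums thereby become power sums over roots of unity.\<close>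

lemma even_characters_bij:
  assumes g: "\<not> int p dvd g" "\<And>a. \<not> int p dvd a \<Longrightarrow> \<exists>k. [a = g ^ k] (mod int p)"
    "\<And>i j. [g ^ i = g ^ j] (mod int p) \<longleftrightarrow> [i = j] (mod (p - 1))" "[g ^ half_order = - 1] (mod int p)"
  shows "bij_betw (\<lambda>chi. chi g) even_characters {z. z ^ half_order = 1}"
  unfolding bij_betw_def
proof
  show "inj_on (\<lambda>chi. chi g) even_characters"
  proof (rule inj_onI, rule ext)
    fix chi1 chi2 a assume c: "chi1 \<in> even_characters" "chi2 \<in> even_characters" "chi1 g = chi2 g"
    hence c': "dirichlet_character p chi1" "dirichlet_character p chi2" by (auto simp: even_characters_def)
    show "chi1 a = chi2 a"
    proof (cases "int p dvd a")
      case True thus ?thesis using char_zero_iff[OF c'(1)] char_zero_iff[OF c'(2)] by metis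
    next
      case False
      then obtain k where "[a = g ^ k] (mod int p)" using g(2) by blast
      thus ?thesis using dirichlet_character_cong[OF c'(1)] dirichlet_character_cong[OF c'(2)] char_power[OF c'(1)] char_power[OF c'(2)] c(3) by metis
    qed
  qed
  show "(\<lambda>chi. chi g) ` even_characters = {z. z ^ half_order = 1}"
  proof (intro equalityI subsetI)
    fix z assume "z \<in> (\<lambda>chi. chi g) ` even_characters"
    then obtain chi where c: "chi \<in> even_characters" "z = chi g" by blast
    hence c': "dirichlet_character p chi" "chi (-1) = 1" by (auto simp: even_characters_def)
    have "z ^ half_order = chi (g ^ half_order)" using char_power[OF c'(1)] c(2) by simp
    also have "\<dots> = chi (-1)" by (rule dirichlet_character_cong[OF c'(1) g(4)])
    finally show "z \<in> {z. z ^ half_order = 1}" using c'(2) by simp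
  next
    fix z assume "z \<in> {z::complex. z ^ half_order = 1}"
    hence z: "z ^ half_order = 1" by simp
    \<comment> \<open>A discrete logarithm to base g. It is determined only modulo p - 1, which
      suffices because z^(p - 1) = 1.\<close>
    define ind where "ind a = (SOME k. [a = g ^ k] (mod int p))" for a
    define chi where "chi a = (if int p dvd a then 0 else z ^ ind a)" for a
    have ind: "[a = g ^ ind a] (mod int p)" if "\<not> int p dvd a" for a
      unfolding ind_def using someI_ex[OF g(2)[OF that]] .
    have zc: "z ^ i = z ^ j" if "[i = j] (mod (p - 1))" for i j
    proof -
      have zz: "z ^ (p - 1) = 1" using z half_order by (metis add_diff_cancel_right' power_mult power_one mult.commute)
      have "z ^ i = z ^ (i mod (p - 1))" for i
      proof -
        have "z ^ i = z ^ ((p - 1) * (i div (p - 1)) + i mod (p - 1))" by simp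
        also have "\<dots> = z ^ (i mod (p - 1))" by (simp only: power_add power_mult zz power_one mult_1)
        finally show ?thesis .
      qed
      thus ?thesis using that by (metis cong_def)
    qed
    have chik: "chi a = z ^ k" if "[a = g ^ k] (mod int p)" for a k
    proof -
      have na: "\<not> int p dvd a"
      proof
        assume "int p dvd a"
        hence "int p dvd g ^ k" using that by (simp add: cong_dvd_iff)
        hence "int p dvd g" using p(1) prime_dvd_power[of "int p"] by simp
        thus False using g(1) by simp
      qed
      have "[g ^ ind a = g ^ k] (mod int p)" using ind[OF na] that by (meson cong_sym cong_trans)
      hence "z ^ ind a = z ^ k" using zc g(3) by blast
      thus ?thesis using na by (simp add: chi_def)
    qed
    have "dirichlet_character p chi" unfolding dirichlet_character_def
    proof (intro conjI allI)
      fix a b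
      show "chi (a * b) = chi a * chi b"
      proof (cases "int p dvd a \<or> int p dvd b")
        case True thus ?thesis by (auto simp: chi_def)
      next
        case False
        hence "[a * b = g ^ (ind a + ind b)] (mod int p)" unfolding power_add by (intro cong_mult ind) auto
        from chik[OF this] False show ?thesis by (simp add: chi_def power_add)
      qed
    next
      fix a
      show "chi (a + int p) = chi a"
      proof (cases "int p dvd a")
        case True thus ?thesis by (simp add: chi_def)
      next
        case False
        have "[a + int p = g ^ ind a] (mod int p)" using ind[OF False] by (simp add: cong_def)
        from chik[OF this] False show ?thesis by (simp add: chi_def)
      qed
    next
      fix a
      have "z \<noteq> 0" using z half_order(2) by (metis power_0_left zero_neq_one neq0_conv)
      thus "(chi a \<noteq> 0) = coprime a (int p)" by (simp add: coprime_iff chi_def)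
    qed
    moreover have "chi (-1) = 1" using chik[OF cong_sym[OF g(4)]] z by simp
    moreover have "chi g = z" using chik[of g 1] by simp
    ultimately show "z \<in> (\<lambda>chi. chi g) ` even_characters" by (auto simp: even_characters_def)
  qed
qed

lemma finite_even_characters: "finite even_characters"
proof -
  obtain g where g: "\<not> int p dvd g" "\<And>a. \<not> int p dvd a \<Longrightarrow> \<exists>k. [a = g ^ k] (mod int p)"
    "\<And>i j. [g ^ i = g ^ j] (mod int p) \<longleftrightarrow> [i = j] (mod (p - 1))" "[g ^ half_order = - 1] (mod int p)"
    using primroot_exists by blast
  from bij_betw_finite[OF even_characters_bij[OF g]] show ?thesis
    using finite_roots_unity[of half_order] half_order(2) by auto
qed

text \<open>With z = chi g, conjugation is the power z^(half_order - 1), so the sum is a power sum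
  over roots of unity and tests i = j modulo \<open>half_order\<close>. That class splits into two
  classes modulo p - 1, which correspond to a = b and a = -b.\<close>

lemma even_character_orthogonality:
  assumes a: "\<not> int p dvd a" and b: "\<not> int p dvd b"
  shows "(\<Sum>chi\<in>even_characters. cnj (chi a) * chi b) = (if [a = b] (mod int p) \<or> [a = - b] (mod int p) then of_nat half_order else 0)"
proof -
  obtain g where g: "\<not> int p dvd g" "\<And>a. \<not> int p dvd a \<Longrightarrow> \<exists>k. [a = g ^ k] (mod int p)"
    "\<And>i j. [g ^ i = g ^ j] (mod int p) \<longleftrightarrow> [i = j] (mod (p - 1))" "[g ^ half_order = - 1] (mod int p)"
    using primroot_exists by blast
  obtain i j where i: "[a = g ^ i] (mod int p)" and j: "[b = g ^ j] (mod int p)" using g(2) a b by metis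
  have "(\<Sum>chi\<in>even_characters. cnj (chi a) * chi b) = (\<Sum>chi\<in>even_characters. (chi g) ^ ((half_order - 1) * i + j))"
  proof (rule sum.cong[OF refl])
    fix chi assume c: "chi \<in> even_characters"
    hence c': "dirichlet_character p chi" by (auto simp: even_characters_def)
    have z: "(chi g) ^ half_order = 1" using bij_betwE[OF even_characters_bij[OF g]] c by auto
    have "cnj (chi g) = cnj (chi g) * (chi g) ^ half_order" by (simp add: z)
    also have "\<dots> = (cnj (chi g) * chi g) * (chi g) ^ (half_order - 1)" using half_order(2) by (cases half_order) auto
    finally have cj: "cnj (chi g) = (chi g) ^ (half_order - 1)" using char_cnj_mult[OF c' g(1)] by simp
    have "cnj (chi a) * chi b = cnj (chi g) ^ i * (chi g) ^ j"
      using trans[OF dirichlet_character_cong[OF c' i] char_power[OF c']] trans[OF dirichlet_character_cong[OF c' j] char_power[OF c']]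
      by (simp only: complex_cnj_power)
    thus "cnj (chi a) * chi b = (chi g) ^ ((half_order - 1) * i + j)" by (simp only: cj power_add power_mult)
  qed
  also have "\<dots> = (\<Sum>z\<in>{z. z ^ half_order = 1}. z ^ ((half_order - 1) * i + j))"
    by (rule sum.reindex_bij_betw[OF even_characters_bij[OF g]])
  also have "\<dots> = (if half_order dvd (half_order - 1) * i + j then of_nat half_order else 0)"
    by (rule sum_roots_unity_power[OF half_order(2)])
  also have "half_order dvd (half_order - 1) * i + j \<longleftrightarrow> [i = j] (mod half_order)"
  proof -
    have "half_order dvd (half_order - 1) * i + j \<longleftrightarrow> int half_order dvd int ((half_order - 1) * i + j)" by (simp only: int_dvd_int_iff)
    also have "int ((half_order - 1) * i + j) = int half_order * int i + (int j - int i)"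
      using half_order(2) by (cases half_order) (simp_all add: algebra_simps)
    also have "int half_order dvd \<dots> \<longleftrightarrow> int half_order dvd (int j - int i)" by (rule dvd_add_right_iff) simp
    also have "\<dots> \<longleftrightarrow> [int j = int i] (mod int half_order)" by (simp add: cong_iff_dvd_diff)
    also have "\<dots> \<longleftrightarrow> [i = j] (mod half_order)" by (metis cong_int_iff cong_sym_eq)
    finally show ?thesis .
  qed
  also have "[i = j] (mod half_order) \<longleftrightarrow> [a = b] (mod int p) \<or> [a = - b] (mod int p)"
  proof -
    have ab: "[a = b] (mod int p) \<longleftrightarrow> [i = j] (mod (p - 1))"
      using i j g(3)[of i j] by (meson cong_sym cong_trans)
    have "[- b = g ^ (half_order + j)] (mod int p)"
      using cong_mult[OF cong_sym[OF g(4)] j] by (simp add: power_add)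
    hence anb: "[a = - b] (mod int p) \<longleftrightarrow> [i = half_order + j] (mod (p - 1))"
      using i g(3)[of i "half_order + j"] by (meson cong_sym cong_trans)
    have ph: "p - 1 = 2 * half_order" using half_order by simp
    have "[i = j] (mod half_order) \<longleftrightarrow> [i = j] (mod (2 * half_order)) \<or> [i = half_order + j] (mod (2 * half_order))"
    proof
      assume "[i = j] (mod half_order)"
      hence "int half_order dvd int i - int j" by (simp add: cong_iff_dvd_diff flip: cong_int_iff)
      then obtain k where k: "int i - int j = int half_order * k" by (elim dvdE)
      show "[i = j] (mod (2 * half_order)) \<or> [i = half_order + j] (mod (2 * half_order))"
      proof (cases "even k")
        case True
        then obtain l where "k = 2 * l" by (elim evenE)
        hence "int (2 * half_order) dvd int i - int j" using k by simp
        thus ?thesis by (simp add: cong_iff_dvd_diff flip: cong_int_iff)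
      next
        case False
        then obtain l where "k = 2 * l + 1" by (elim oddE)
        hence "int i - int (half_order + j) = int (2 * half_order) * l" using k by (simp add: algebra_simps)
        hence "int (2 * half_order) dvd int i - int (half_order + j)" by (rule dvdI)
        hence "[int i = int (half_order + j)] (mod int (2 * half_order))" by (simp only: cong_iff_dvd_diff)
        hence "[i = half_order + j] (mod (2 * half_order))" by (simp only: cong_int_iff)
        thus ?thesis by (rule disjI2)
      qed
    next
      assume "[i = j] (mod (2 * half_order)) \<or> [i = half_order + j] (mod (2 * half_order))"
      hence "[i = j] (mod half_order) \<or> [i = half_order + j] (mod half_order)"
        by (elim disj_forward cong_dvd_modulus_nat) simp_all
      thus "[i = j] (mod half_order)" by (simp add: cong_def)
    qed
    thus ?thesis unfolding ab anb ph .
  qed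
  finally show ?thesis .
qed

section \<open>The even part of the additive character modulo p, and Gauss sums\<close>

definition "pcos x = cos (2 * pi * of_int x / p)" for x :: int

lemma pcos_minus [simp]: "pcos (- x) = pcos x" by (simp add: pcos_def)

lemma pcos_cong: "[x = y] (mod int p) \<Longrightarrow> pcos x = pcos y"
proof -
  assume "[x = y] (mod int p)"
  then obtain k where k: "x = y + k * int p" by (metis cong_iff_lin cong_sym mult.commute)
  have "2 * pi * of_int x / p = 2 * pi * of_int y / p + of_int k * (2 * pi)"
    using p_ge_3 by (simp add: k field_simps)
  thus ?thesis unfolding pcos_def using cos_int_2pin[of k] sin_int_2pin[of k]
    by (simp add: cos_add mult.commute[of "of_int k"])
qed

lemma sum_pcos: "(\<Sum>b<p. pcos (int b * m)) = (if int p dvd m then real p else 0)"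
proof (cases "int p dvd m")
  case True
  have "pcos (int b * m) = 1" for b
  proof -
    have "[int b * m = 0] (mod int p)" using True by (simp add: cong_0_iff)
    from pcos_cong[OF this] show ?thesis by (simp add: pcos_def)
  qed
  thus ?thesis using True by simp
next
  case False
  define w where "w = cis (2 * pi * of_int m / p)"
  have w: "Re (w ^ b) = pcos (int b * m)" for b
    unfolding w_def Complex.DeMoivre by (simp add: pcos_def mult_ac)
  have "w ^ p = 1" unfolding w_def Complex.DeMoivre using p_ge_3 by (simp add: cis_multiple_2pi)
  moreover have "w \<noteq> 1"
  proof
    assume "w = 1"
    from arg_cong[OF this, of Re] have "cos (2 * pi * of_int m / p) = 1"
      unfolding w_def by (simp only: cis.sel one_complex.sel)
    then obtain k :: int where k: "2 * pi * of_int m / p = of_int k * 2 * pi"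
      unfolding cos_one_2pi_int by (elim exE)
    hence "2 * pi * of_int m = of_int k * 2 * pi * p" using p_ge_3 by (subst (asm) divide_eq_eq) simp
    hence "2 * pi * of_int m = 2 * pi * (of_int k * real p)" by (simp only: mult_ac)
    hence "real_of_int m = of_int k * p" by (subst (asm) mult_left_cancel) auto
    hence "real_of_int m = of_int (k * int p)" by simp
    hence "m = k * int p" by (simp only: of_int_eq_iff)
    with False show False by simp
  qed
  ultimately have "(\<Sum>b<p. w ^ b) = 0" by (simp add: sum_gp_strict)
  from arg_cong[OF this, of Re] have "(\<Sum>b<p. Re (w ^ b)) = 0" by simp
  thus ?thesis using False by (simp add: w)
qed

text \<open>For even \<open>chi\<close> the sine part of the classical Gauss sum cancels, so the
  cosine sum is the Gauss sum itself.\<close>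

definition gauss_sum :: "(int \<Rightarrow> complex) \<Rightarrow> complex" where
  "gauss_sum chi = (\<Sum>a<p. chi (int a) * of_real (pcos (int a)))"

text \<open>Orthogonality leaves only the two distinct residues of b and -b. Each contributes
  \<open>half_order\<close> times the cosine, and 2 half_order = p - 1.\<close>

lemma cos_character_expansion:
  assumes b: "\<not> int p dvd b"
  shows "(\<Sum>chi\<in>even_characters. gauss_sum (\<lambda>a. cnj (chi a)) * chi b) = of_nat (p - 1) * of_real (pcos b)"
proof -
  have pp: "int p > 0" using p_ge_3 by simp
  define r where "r x = nat (x mod int p)" for x
  have rx: "[int (r x) = x] (mod int p)" "r x < p" for x
    using pp by (auto simp: r_def cong_def nat_less_iff)
  have "(\<Sum>chi\<in>even_characters. gauss_sum (\<lambda>a. cnj (chi a)) * chi b) =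
     (\<Sum>chi\<in>even_characters. \<Sum>a<p. of_real (pcos (int a)) * (cnj (chi (int a)) * chi b))"
    by (simp add: gauss_sum_def sum_distrib_right sum_distrib_left mult_ac)
  also have "\<dots> = (\<Sum>a<p. of_real (pcos (int a)) * (\<Sum>chi\<in>even_characters. cnj (chi (int a)) * chi b))"
    by (subst sum.swap) (simp add: sum_distrib_left)
  also have "\<dots> = (\<Sum>a<p. if a \<in> {r b, r (- b)} then of_real (pcos b) * of_nat half_order else 0)"
  proof (rule sum.cong[OF refl])
    fix a assume a: "a \<in> {..<p}"
    have req: "a = r x \<longleftrightarrow> [int a = x] (mod int p)" for x
    proof
      assume "[int a = x] (mod int p)"
      hence "[int a = int (r x)] (mod int p)" using rx(1) by (meson cong_sym cong_trans)
      hence "[a = r x] (mod p)" by (simp only: cong_int_iff)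
      thus "a = r x" using a rx(2) by (simp add: cong_def)
    qed (use rx in simp)
    show "complex_of_real (pcos (int a)) * (\<Sum>chi\<in>even_characters. cnj (chi (int a)) * chi b) = (if a \<in> {r b, r (- b)} then of_real (pcos b) * of_nat half_order else 0)"
    proof (cases "int p dvd int a")
      case True
      have z: "cnj (chi (int a)) * chi b = 0" if "chi \<in> even_characters" for chi
        using that char_zero_iff True by (auto simp: even_characters_def)
      have "\<not> [int a = b] (mod int p)" "\<not> [int a = - b] (mod int p)"
        using True b by (auto dest!: cong_dvd_iff)
      moreover have "(\<Sum>chi\<in>even_characters. cnj (chi (int a)) * chi b) = 0" by (intro sum.neutral ballI z)
      ultimately show ?thesis by (simp add: req)
    next
      case False
      have "pcos (int a) = pcos b" if "a \<in> {r b, r (- b)}"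
        using that pcos_cong[of "int a" b] pcos_cong[of "int a" "- b"] by (auto simp: req)
      thus ?thesis by (auto simp: even_character_orthogonality[OF False b] req)
    qed
  qed
  also have "\<dots> = (\<Sum>a\<in>{r b, r (- b)}. of_real (pcos b) * of_nat half_order)"
    by (rule sum.mono_neutral_cong_right) (use rx(2) in auto)
  also have "r b \<noteq> r (- b)"
  proof
    assume "r b = r (- b)"
    hence "[b = - b] (mod int p)" using rx(1) by (metis cong_sym cong_trans)
    hence "int p dvd 2 * b" by (simp add: cong_iff_dvd_diff)
    moreover have "\<not> int p dvd 2" using p_ge_3 by (auto dest: zdvd_imp_le)
    ultimately show False using b p(1) by (simp add: prime_dvd_mult_iff)
  qed
  hence "(\<Sum>a\<in>{r b, r (- b)}. complex_of_real (pcos b) * of_nat half_order) = of_nat (2 * half_order) * of_real (pcos b)"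
    by simp
  moreover have "2 * half_order = p - 1" using half_order by simp
  ultimately show ?thesis by (simp only:)
qed

lemma primitive_sum_zero:
  assumes c: "primitive_character p chi"
  shows "(\<Sum>a<p. chi (int a)) = 0"
proof -
  from c obtain b where dc: "dirichlet_character p chi" and b: "\<not> int p dvd b" "chi b \<noteq> 1" using primitive_iff by blast
  have "(\<Sum>a<p. chi (int a)) = (\<Sum>a<p. chi (b * int a))"
    by (rule sum_dilate[OF b(1), of chi, symmetric]) (rule dirichlet_character_cong[OF dc])
  also have "\<dots> = chi b * (\<Sum>a<p. chi (int a))"
    by (simp add: char_mult[OF dc] sum_distrib_left)
  finally show ?thesis using b(2) by (metis mult_cancel_right1)
qed

text \<open>For n prime to p the variable a n runs through all residues. For p dividing n the
  right-hand side is 0, and the left-hand side is the full character sum, which vanishes by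
  primitivity.\<close>

lemma gauss_sum_twist:
  assumes c: "primitive_character p chi" "chi (- 1) = 1"
  shows "(\<Sum>a<p. chi (int a) * of_real (pcos (int a * n))) = cnj (chi n) * gauss_sum chi"
proof -
  have dc: "dirichlet_character p chi" using c primitive_iff by blast
  show ?thesis
  proof (cases "int p dvd n")
    case True
    have "pcos (int a * n) = 1" for a
    proof -
      have "[int a * n = 0] (mod int p)" using True by (simp add: cong_0_iff)
      from pcos_cong[OF this] show ?thesis by (simp add: pcos_def)
    qed
    moreover have "chi n = 0" using True char_zero_iff[OF dc] by simp
    ultimately show ?thesis using primitive_sum_zero[OF c(1)] by simp
  next
    case False
    have "gauss_sum chi = (\<Sum>a<p. (\<lambda>x. chi x * of_real (pcos x)) (n * int a))"
      unfolding gauss_sum_def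
      by (rule sum_dilate[OF False, symmetric]) (use dirichlet_character_cong[OF dc] pcos_cong in metis)
    also have "\<dots> = chi n * (\<Sum>a<p. chi (int a) * of_real (pcos (int a * n)))"
      by (simp add: char_mult[OF dc] sum_distrib_left mult_ac)
    finally have "cnj (chi n) * gauss_sum chi = (cnj (chi n) * chi n) * (\<Sum>a<p. chi (int a) * of_real (pcos (int a * n)))"
      by (simp add: mult.assoc)
    thus ?thesis using char_cnj_mult[OF dc False] by simp
  qed
qed

text \<open>One factor is unfolded and its coefficient cnj (chi b) is absorbed into the other by
  \<open>gauss_sum_twist\<close>. The product of cosines splits into two complete cosine sums over
  b, which select a = 1 and a = p - 1 with weight p/2 each; evenness makes chi equal to 1 at
  both.\<close>

lemma gauss_sum_mult_cnj:
  assumes c: "primitive_character p chi" "chi (- 1) = 1"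
  shows "gauss_sum chi * gauss_sum (\<lambda>a. cnj (chi a)) = of_nat p"
proof -
  have dc: "dirichlet_character p chi" using c primitive_iff by blast
  have "gauss_sum chi * gauss_sum (\<lambda>a. cnj (chi a)) = (\<Sum>b<p. (cnj (chi (int b)) * gauss_sum chi) * of_real (pcos (int b)))"
    by (subst (2) gauss_sum_def) (simp add: sum_distrib_left mult_ac)
  also have "\<dots> = (\<Sum>b<p. \<Sum>a<p. chi (int a) * of_real (pcos (int a * int b) * pcos (int b)))"
    unfolding gauss_sum_twist[OF c, symmetric] by (simp add: sum_distrib_right sum_distrib_left mult_ac)
  also have "\<dots> = (\<Sum>a<p. chi (int a) * of_real (\<Sum>b<p. pcos (int a * int b) * pcos (int b)))"
    by (subst sum.swap) (simp add: sum_distrib_left)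
  also have "\<dots> = (\<Sum>a<p. chi (int a) * of_real ((if int p dvd int a - 1 then real p else 0) / 2 + (if int p dvd int a + 1 then real p else 0) / 2))"
  proof (intro sum.cong refl arg_cong2[where f = "(*)"] arg_cong[where f = of_real])
    fix a
    have "pcos (int a * int b) * pcos (int b) = pcos (int b * (int a - 1)) / 2 + pcos (int b * (int a + 1)) / 2" for b
    proof -
      have "2 * pi * of_int (int b * (int a - 1)) / p = 2 * pi * of_int (int a * int b) / p - 2 * pi * of_int (int b) / p"
        "2 * pi * of_int (int b * (int a + 1)) / p = 2 * pi * of_int (int a * int b) / p + 2 * pi * of_int (int b) / p"
        using p_ge_3 by (simp_all add: field_simps)
      thus ?thesis unfolding pcos_def cos_times_cos by (simp only: add_divide_distrib)
    qed
    thus "(\<Sum>b<p. pcos (int a * int b) * pcos (int b)) = (if int p dvd int a - 1 then real p else 0) / 2 + (if int p dvd int a + 1 then real p else 0) / 2"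
      by (simp add: sum.distrib sum_divide_distrib[symmetric] sum_pcos)
  qed
  also have "\<dots> = (\<Sum>a<p. (if a = 1 then of_nat p / 2 else 0) + (if a = p - 1 then of_nat p / 2 else 0))"
  proof (rule sum.cong[OF refl])
    fix a assume a: "a \<in> {..<p}"
    have 1: "int p dvd int a - 1 \<longleftrightarrow> a = 1"
    proof
      assume "int p dvd int a - 1"
      hence "[a = 1] (mod p)" by (metis cong_iff_dvd_diff cong_int_iff of_nat_1)
      thus "a = 1" using a p_ge_3 by (simp add: cong_def)
    qed simp
    have 2: "int p dvd int a + 1 \<longleftrightarrow> a = p - 1"
    proof
      assume "int p dvd int a + 1"
      hence "p dvd a + 1" by (metis int_dvd_int_iff of_nat_1 of_nat_add)
      hence "p \<le> a + 1" by (rule dvd_imp_le) simp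
      thus "a = p - 1" using a by simp
    next
      assume "a = p - 1"
      thus "int p dvd int a + 1" using p_ge_3 by simp
    qed
    have "chi (int (p - 1)) = 1"
    proof -
      have "[int (p - 1) = - 1] (mod int p)" using p_ge_3 by (simp add: cong_iff_dvd_diff of_nat_diff)
      thus ?thesis using dirichlet_character_cong[OF dc] c(2) by simp
    qed
    thus "chi (int a) * complex_of_real ((if int p dvd int a - 1 then real p else 0) / 2 + (if int p dvd int a + 1 then real p else 0) / 2) =
      (if a = 1 then of_nat p / 2 else 0) + (if a = p - 1 then of_nat p / 2 else 0)"
      unfolding 1 2 using p_ge_3 char_1[OF dc] by auto
  qed
  also have "\<dots> = of_nat p" using p_ge_3 by (simp add: sum.distrib sum.delta)
  finally show ?thesis .
qed

end

section \<open>L-functions of even primitive characters\<close>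

lemma zeta_sums: "Re s > 1 \<Longrightarrow> (\<lambda>n. 1 / of_nat (Suc n) powr s) sums zeta s"
  using zeta.completed_series[of s] by (auto simp: zeta_eq)

lemma theta_entire_cmult: "theta_entire c (\<lambda>n. f n * k) s = theta_entire c f s * k"
  if "c > 0" "\<And>n. norm (f n) \<le> M"
proof -
  have "theta_tail c (\<lambda>n. f n * k) u = theta_tail c f u * k" for u
  proof -
    have "summable (\<lambda>n. norm (f n * of_real (exp (- c * (real (Suc n))\<^sup>2 * exp (2 * u)))))"
      using theta_tail_bound[where f = f and k = 0, OF that] by blast
    hence "summable (\<lambda>n. f n * of_real (exp (- c * (real (Suc n))\<^sup>2 * exp (2 * u))))"
      by (rule summable_norm_cancel)
    from suminf_mult2[OF this, of k] show ?thesis by (simp add: theta_tail_def mult_ac)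
  qed
  hence "(indicator {0<..} u *\<^sub>R theta_tail c (\<lambda>n. f n * k) u) * exp (s * of_real u) = ((indicator {0<..} u *\<^sub>R theta_tail c f u) * exp (s * of_real u)) * k" for u
    by (simp only: scaleR_conv_of_real mult_ac)
  thus ?thesis by (simp only: theta_entire_def integral_mult_left_zero)
qed

locale even_primitive = odd_prime +
  fixes chi :: "int \<Rightarrow> complex"
  assumes prim: "primitive_character p chi" and even: "chi (- 1) = 1"
begin

lemma dc: "dirichlet_character p chi" using prim primitive_iff by blast

lemma chi_even: "chi (- a) = chi a"
  by (rule char_even) (use dc even in \<open>simp add: even_characters_def\<close>)

lemma chi_0: "chi 0 = 0" using char_zero_iff[OF dc] by simp

text \<open>By \<open>gauss_sum_twist\<close> the finite cosine transform of chi is its conjugate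
  times the Gauss sum. As chi 0 = 0, both constant terms vanish, so there is no polar part and the
  L-function is entire.\<close>

sublocale theta_pair "\<lambda>n. chi (int (Suc n))" "\<lambda>n. cnj (chi (int (Suc n))) * gauss_sum chi" 0 0 "of_real (1 / sqrt p)" "pi / p" 1 p
proof -
  have "theta_pair (\<lambda>n. chi (int (Suc n))) (\<lambda>n. cnj (chi (int (Suc n))) * gauss_sum chi) (chi 0) (cnj (chi (int 0)) * gauss_sum chi) (of_real (1 / sqrt p)) (pi / p) 1 p"
  proof (rule theta_pair_of_periodic[where fhat = "\<lambda>n. cnj (chi (int n)) * gauss_sum chi"])
    show "0 < p" using p_ge_3 by simp
    show "chi (n + int p) = chi n" for n using dc unfolding dirichlet_character_def by blast
    show "cnj (chi (int k)) * gauss_sum chi = (\<Sum>r<p. chi (int r) * complex_of_real (cos (2 * pi * real k * (real r / real p))))" for k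
      unfolding gauss_sum_twist[OF prim even, symmetric]
      by (intro sum.cong refl arg_cong2[where f = "(*)"] arg_cong[where f = of_real]) (simp add: pcos_def mult_ac)
  qed (auto simp: chi_even char_norm_le[OF dc])
  thus "theta_pair (\<lambda>n. chi (int (Suc n))) (\<lambda>n. cnj (chi (int (Suc n))) * gauss_sum chi) 0 0 (of_real (1 / sqrt p)) (pi / p) 1 p"
    by (simp add: chi_0)
qed

lemma polar_part_0: "polar_part s = 0" unfolding polar_part_def by simp

lemma L_eq: "dirichlet_L chi = entire_part"
  unfolding dirichlet_L_def
proof (rule continued_dirichlet_series_eqI)
  show "entire_part nicely_meromorphic_on UNIV"
    by (intro analytic_on_imp_nicely_meromorphic_on) (simp only: analytic_on_open open_UNIV entire_part_holomorphic)
  show "(\<lambda>n. chi (int (Suc n)) / of_nat (Suc n) powr s) sums entire_part s" if "Re s > 1" for s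
    using completed_series[OF that] by (simp only: polar_part_0 div_0 add_0_right)
qed

lemma L_holomorphic: "dirichlet_L chi holomorphic_on A"
  unfolding L_eq by (rule entire_part_holomorphic)

lemma L_sums: "Re s > 1 \<Longrightarrow> (\<lambda>n. chi (int (Suc n)) / of_nat (Suc n) powr s) sums dirichlet_L chi s"
  using completed_series[of s] by (simp only: polar_part_0 div_0 add_0_right L_eq)

lemma sum_chi_bound: "norm (\<Sum>n<N. chi (int (Suc n))) \<le> p"
proof (induction N rule: less_induct)
  case (less N)
  show ?case
  proof (cases "N \<le> p")
    case True
    have "norm (\<Sum>n<N. chi (int (Suc n))) \<le> (\<Sum>n<N. 1)"
      by (rule sum_norm_le) (rule char_norm_le[OF dc])
    thus ?thesis using True by simp
  next
    case False
    have "(\<Sum>n<N. chi (int (Suc n))) = (\<Sum>n<p. chi (int (Suc n))) + (\<Sum>n<N - p. chi (int (Suc (n + p))))"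
      using False sum.nat_group[of "\<lambda>n. chi (int (Suc n))"] sum.atLeastLessThan_concat[of 0 p N "\<lambda>n. chi (int (Suc n))"]
        sum.shift_bounds_nat_ivl[of "\<lambda>n. chi (int (Suc n))" 0 p "N - p"]
      by (simp add: atLeast0LessThan)
    also have "(\<Sum>n<p. chi (int (Suc n))) = 0"
    proof -
      have "(\<Sum>n<Suc p. chi (int n)) = (\<Sum>n<p. chi (int n)) + chi (int p)" by simp
      moreover have "(\<Sum>n<Suc p. chi (int n)) = chi (int 0) + (\<Sum>n<p. chi (int (Suc n)))" by (rule sum.lessThan_Suc_shift)
      moreover have "chi (int p) = 0" using char_zero_iff[OF dc] by simp
      ultimately show ?thesis using primitive_sum_zero[OF prim] chi_0 by simp
    qed
    also have "(\<Sum>n<N - p. chi (int (Suc (n + p)))) = (\<Sum>n<N - p. chi (int (Suc n)))"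
    proof (rule sum.cong[OF refl])
      fix n
      have "int (Suc (n + p)) = int (Suc n) + int p" by simp
      thus "chi (int (Suc (n + p))) = chi (int (Suc n))" using dc unfolding dirichlet_character_def by metis
    qed
    finally have "(\<Sum>n<N. chi (int (Suc n))) = (\<Sum>n<N - p. chi (int (Suc n)))" by simp
    moreover have "N - p < N" using False p_ge_3 by simp
    ultimately show ?thesis using less.IH[of "N - p"] by metis
  qed
qed

lemma defect_bound: "norm (summatory_defect (\<lambda>n. chi (int (Suc n))) 0 v) \<le> p"
  using sum_chi_bound by (simp add: summatory_defect_def)

lemma L_Laplace:
  assumes s: "Re s > 0"
  shows "dirichlet_L chi s = s * halfline_Laplace (summatory_defect (\<lambda>n. chi (int (Suc n))) 0) s"
proof (rule analytic_continuation_open[where s = "{s. Re s > 1}" and s' = "{s. Re s > 0}" and z = s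
        and f = "dirichlet_L chi" and g = "\<lambda>s. s * halfline_Laplace (summatory_defect (\<lambda>n. chi (int (Suc n))) 0) s"])
  show "(\<lambda>s. s * halfline_Laplace (summatory_defect (\<lambda>n. chi (int (Suc n))) 0) s) holomorphic_on {s. Re s > 0}"
    by (intro holomorphic_intros halfline_Laplace_holomorphic[where M = p] defect_bound) measurable
  show "connected {s. Re s > 0}" by (intro convex_connected convex_halfspace_Re_gt)
  fix z assume "z \<in> {s. Re s > 1}"
  hence z: "Re z > 1" by simp
  have "(\<lambda>n. chi (int (Suc n)) / of_nat (Suc n) powr z) sums (0 * z / (z - 1) + z * halfline_Laplace (summatory_defect (\<lambda>n. chi (int (Suc n))) 0) z)"
    by (rule Dirichlet_series_Laplace[OF char_norm_le[OF dc] defect_bound z])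
  thus "dirichlet_L chi z = z * halfline_Laplace (summatory_defect (\<lambda>n. chi (int (Suc n))) 0) z"
    using sums_unique2[OF L_sums[OF z]] by simp
qed (use s L_holomorphic in \<open>auto intro!: open_halfspace_Re_gt exI[of _ 2]\<close>)

lemma L_bound: "Re s > 0 \<Longrightarrow> norm (dirichlet_L chi s) \<le> norm s * (p / Re s)"
  unfolding L_Laplace norm_mult
  by (intro mult_left_mono halfline_Laplace_bound defect_bound) auto

end

section \<open>Conjugate characters and the functional equation\<close>

lemma (in even_primitive) even_primitive_cnj: "even_primitive p (\<lambda>a. cnj (chi a))"
proof
  have "\<exists>a. \<not> int p dvd a \<and> chi a \<noteq> 1" using prim primitive_iff by blast
  thus "primitive_character p (\<lambda>a. cnj (chi a))"
    unfolding primitive_iff using char_cnj[OF dc] by auto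
qed (use even in auto)

context even_primitive
begin

interpretation conj: even_primitive p "\<lambda>a. cnj (chi a)" by (rule even_primitive_cnj)

lemma L_cnj:
  assumes s: "Re s > 0"
  shows "dirichlet_L (\<lambda>a. cnj (chi a)) (cnj s) = cnj (dirichlet_L chi s)"
proof -
  have "(\<lambda>v. cnj (summatory_defect (\<lambda>n. chi (int (Suc n))) 0 v)) = summatory_defect (\<lambda>n. cnj (chi (int (Suc n)))) 0"
    by (auto simp: summatory_defect_def fun_eq_iff)
  thus ?thesis using halfline_Laplace_cnj[of "summatory_defect (\<lambda>n. chi (int (Suc n))) 0" s] s
    by (simp add: L_Laplace conj.L_Laplace)
qed

text \<open>Both completed L-functions are twice a combination of the same two entire functions
  \<open>E\<close> and \<open>E'\<close>. The two combinations differ by the factor gauss_sum chi /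
  sqrt p, which \<open>key\<close> verifies from the product of the Gauss sums being p.\<close>

lemma L_functional_equation:
  assumes s: "0 < Re s" "Re s < 1"
  shows "Gamma (s/2) * of_real (pi / p) powr (- s/2) * dirichlet_L chi s =
     gauss_sum chi / of_real (sqrt p) * (Gamma ((1 - s)/2) * of_real (pi / p) powr (- (1 - s)/2) * dirichlet_L (\<lambda>a. cnj (chi a)) (1 - s))"
proof -
  define E where "E = theta_entire (pi / p) (\<lambda>n. chi (int (Suc n))) s"
  define E' where "E' = theta_entire (pi / p) (\<lambda>n. cnj (chi (int (Suc n)))) (1 - s)"
  have pp: "real p > 0" using p_ge_3 by simp
  have np: "Gamma (z/2) * rGamma (z/2) = 1" if "Re z > 0" for z :: complex
  proof -
    have "z / 2 \<notin> \<int>\<^sub>\<le>\<^sub>0"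
    proof
      assume "z / 2 \<in> \<int>\<^sub>\<le>\<^sub>0"
      then obtain n where "z / 2 = - of_nat n" by (elim nonpos_Ints_cases')
      hence "Re (z / 2) = - real n" by simp
      thus False using that by simp
    qed
    thus ?thesis by (simp add: Gamma_def rGamma_eq_zero_iff)
  qed
  have pw: "of_real (pi / p) powr (- z/2) * of_real (pi / p) powr (z/2) = (1::complex)" for z
  proof -
    have "of_real (pi / p) \<noteq> (0::complex)" using pp by simp
    thus ?thesis by (simp add: powr_minus del: of_real_divide)
  qed
  have 1: "dirichlet_L chi s = 2 * of_real (pi / p) powr (s/2) * (rGamma (s/2) * (E + of_real (1 / sqrt p) * (E' * gauss_sum chi)))"
    unfolding L_eq entire_part_def E_def E'_def
    by (subst theta_entire_cmult[where M = 1]) (use pp char_norm_le[OF dc] in auto)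
  have 2: "dirichlet_L (\<lambda>a. cnj (chi a)) (1 - s) = 2 * of_real (pi / p) powr ((1 - s)/2) * (rGamma ((1 - s)/2) * (E' + of_real (1 / sqrt p) * (E * gauss_sum (\<lambda>a. cnj (chi a)))))"
    unfolding conj.L_eq conj.entire_part_def E_def E'_def
    by (subst theta_entire_cmult[where M = 1]) (use pp char_norm_le[OF dc] in auto)
  have key: "gauss_sum chi / of_real (sqrt p) * (E' + of_real (1 / sqrt p) * (E * gauss_sum (\<lambda>a. cnj (chi a)))) = E + of_real (1 / sqrt p) * (E' * gauss_sum chi)"
  proof -
    have "gauss_sum chi / of_real (sqrt p) * (of_real (1 / sqrt p) * (E * gauss_sum (\<lambda>a. cnj (chi a)))) = E * (gauss_sum chi * gauss_sum (\<lambda>a. cnj (chi a))) / (of_real (sqrt p) * of_real (sqrt p))"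
      by (simp add: mult_ac)
    also have "complex_of_real (sqrt p) * of_real (sqrt p) = of_nat p"
      by (simp flip: of_real_mult)
    finally show ?thesis using pp gauss_sum_mult_cnj[OF prim even] by (simp add: distrib_left mult_ac)
  qed
  have "Gamma (s/2) * of_real (pi / p) powr (- s/2) * dirichlet_L chi s =
     2 * (Gamma (s/2) * rGamma (s/2)) * (of_real (pi / p) powr (- s/2) * of_real (pi / p) powr (s/2)) * (E + of_real (1 / sqrt p) * (E' * gauss_sum chi))"
    unfolding 1 by (simp only: mult_ac)
  also have "\<dots> = 2 * (E + of_real (1 / sqrt p) * (E' * gauss_sum chi))"
    unfolding pw np[OF s(1)] by simp
  also have "\<dots> = gauss_sum chi / of_real (sqrt p) * (2 * (E' + of_real (1 / sqrt p) * (E * gauss_sum (\<lambda>a. cnj (chi a)))))"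
    unfolding key[symmetric] by (simp only: mult_ac)
  also have "2 * (E' + of_real (1 / sqrt p) * (E * gauss_sum (\<lambda>a. cnj (chi a)))) =
     Gamma ((1 - s)/2) * of_real (pi / p) powr (- (1 - s)/2) * dirichlet_L (\<lambda>a. cnj (chi a)) (1 - s)"
  proof -
    have "Gamma ((1 - s)/2) * of_real (pi / p) powr (- (1 - s)/2) * dirichlet_L (\<lambda>a. cnj (chi a)) (1 - s) =
      2 * (Gamma ((1 - s)/2) * rGamma ((1 - s)/2)) * (of_real (pi / p) powr (- (1 - s)/2) * of_real (pi / p) powr ((1 - s)/2)) * (E' + of_real (1 / sqrt p) * (E * gauss_sum (\<lambda>a. cnj (chi a))))"
      unfolding 2 by (simp only: mult_ac)
    moreover have "Re (1 - s) > 0" using s by simp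
    ultimately show ?thesis unfolding pw by (simp only: np mult_1_right)
  qed
  finally show ?thesis .
qed

lemma L_square_critical_line:
  assumes s: "Re s = 1/2"
  shows "Gamma (s/2) * (dirichlet_L chi s)\<^sup>2 =
     gauss_sum chi / of_real (sqrt p) * (of_real (pi / p) powr (s - 1/2) * Gamma ((1 - s)/2) * of_real ((norm (dirichlet_L chi s))\<^sup>2))"
proof -
  have pp: "of_real (pi / p) \<noteq> (0::complex)" using p_ge_3 by simp
  have "1 - s = cnj s" using s by (simp add: complex_eq_iff)
  hence L: "dirichlet_L (\<lambda>a. cnj (chi a)) (1 - s) = cnj (dirichlet_L chi s)" using L_cnj[of s] s by simp
  have "Gamma (s/2) * (dirichlet_L chi s)\<^sup>2 = (of_real (pi / p) powr (- s/2) * of_real (pi / p) powr (s/2)) * (Gamma (s/2) * (dirichlet_L chi s)\<^sup>2)"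
    using pp by (simp add: powr_minus del: of_real_divide)
  also have "\<dots> = of_real (pi / p) powr (s/2) * dirichlet_L chi s * (Gamma (s/2) * of_real (pi / p) powr (- s/2) * dirichlet_L chi s)"
    by (simp only: power2_eq_square mult_ac)
  also have "\<dots> = gauss_sum chi / of_real (sqrt p) * ((of_real (pi / p) powr (s/2) * of_real (pi / p) powr (- (1 - s)/2)) * Gamma ((1 - s)/2) * (dirichlet_L chi s * cnj (dirichlet_L chi s)))"
  proof -
    have "Gamma (s/2) * of_real (pi / p) powr (- s/2) * dirichlet_L chi s = gauss_sum chi / of_real (sqrt p) * (Gamma ((1 - s)/2) * of_real (pi / p) powr (- (1 - s)/2) * cnj (dirichlet_L chi s))"
      using L_functional_equation[of s] s L by simp
    thus ?thesis by (simp only: mult_ac)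
  qed
  also have "dirichlet_L chi s * cnj (dirichlet_L chi s) = of_real ((norm (dirichlet_L chi s))\<^sup>2)"
    by (rule complex_norm_square[symmetric])
  also have "of_real (pi / p) powr (s/2) * of_real (pi / p) powr (- (1 - s)/2) = (of_real (pi / p) powr (s - 1/2) :: complex)"
    unfolding powr_add[symmetric] by (rule arg_cong[where f = "\<lambda>z. of_real (pi / p) powr z"]) (simp add: field_simps)
  finally show ?thesis .
qed

end

section \<open>Squares of Dirichlet series on vertical lines\<close>

text \<open>Finite index sets form a net rather than a sequence, so instead of dominated convergence
  the tail of the majorant \<open>c\<close> bounds the error of each finite sum directly.\<close>

lemma has_sum_integral_dominated:
  fixes F :: "'i \<Rightarrow> real \<Rightarrow> complex"
  assumes Fm: "\<And>i. F i \<in> borel_measurable borel" and Gm: "G \<in> borel_measurable borel"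
    and bd: "\<And>i t. norm (F i t) \<le> c i * h t" and h: "integrable lborel h" and c: "c summable_on UNIV"
    and c0: "\<And>i. c i \<ge> 0" and h0: "\<And>t. h t \<ge> 0" and sum: "\<And>t. ((\<lambda>i. F i t) has_sum G t) UNIV"
  shows "((\<lambda>i. LBINT t. F i t) has_sum (LBINT t. G t)) UNIV"
proof -
  have [measurable]: "F i \<in> borel_measurable borel" "G \<in> borel_measurable borel" for i using Fm Gm by auto
  have Fi: "integrable lborel (F i)" for i
    by (rule Bochner_Integration.integrable_bound[of _ "\<lambda>t. c i * h t"])
       (use h bd order_trans[OF bd abs_ge_self] in auto)
  have tail: "norm (sum (\<lambda>i. F i t) A - G t) \<le> (infsum c UNIV - sum c A) * h t" if A: "finite A" for A t
  proof -
    have 1: "((\<lambda>i. F i t) has_sum (G t - sum (\<lambda>i. F i t) A)) (UNIV - A)"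
      using has_sum_Diff[OF sum[of t], of A "sum (\<lambda>i. F i t) A"] A by (simp add: has_sum_finite)
    have "(c has_sum (infsum c UNIV - sum c A)) (UNIV - A)"
      using has_sum_Diff[OF has_sum_infsum[OF c], of A "sum c A"] A by (simp add: has_sum_finite)
    hence 2: "((\<lambda>i. c i * h t) has_sum ((infsum c UNIV - sum c A) * h t)) (UNIV - A)"
      by (rule has_sum_cmult_left)
    have "norm (G t - sum (\<lambda>i. F i t) A) \<le> (infsum c UNIV - sum c A) * h t"
      by (rule norm_infsum_le[OF 1 2 bd])
    thus ?thesis by (simp only: norm_minus_commute)
  qed
  have Gi: "integrable lborel G"
    by (rule Bochner_Integration.integrable_bound[of _ "\<lambda>t. infsum c UNIV * h t"])
       (use h tail[of "{}"] order_trans[OF _ abs_ge_self] in auto)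
  have est: "norm (sum (\<lambda>i. LBINT t. F i t) A - (LBINT t. G t)) \<le> (infsum c UNIV - sum c A) * (LBINT t. h t)" if A: "finite A" for A
  proof -
    have si: "integrable lborel (\<lambda>t. sum (\<lambda>i. F i t) A)" using Fi by auto
    have "sum (\<lambda>i. LBINT t. F i t) A - (LBINT t. G t) = (LBINT t. sum (\<lambda>i. F i t) A - G t)"
      using Fi Gi si by (simp add: Bochner_Integration.integral_diff Bochner_Integration.integral_sum)
    also have "norm \<dots> \<le> (LBINT t. norm (sum (\<lambda>i. F i t) A - G t))" by (rule integral_norm_bound)
    also have "\<dots> \<le> (LBINT t. (infsum c UNIV - sum c A) * h t)"
      using si Gi h tail[OF A] by (intro integral_mono) auto
    finally show ?thesis by simp
  qed
  have "((\<lambda>A. (infsum c UNIV - sum c A) * (LBINT t. h t)) \<longlongrightarrow> (infsum c UNIV - infsum c UNIV) * (LBINT t. h t)) (finite_subsets_at_top UNIV)"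
    using has_sum_infsum[OF c] by (intro tendsto_intros) (simp add: has_sum_def)
  hence z: "((\<lambda>A. (infsum c UNIV - sum c A) * (LBINT t. h t)) \<longlongrightarrow> 0) (finite_subsets_at_top UNIV)" by simp
  have "((\<lambda>A. sum (\<lambda>i. LBINT t. F i t) A - (LBINT t. G t)) \<longlongrightarrow> 0) (finite_subsets_at_top UNIV)"
    by (rule Lim_null_comparison[OF _ z]) (use est in \<open>auto intro!: eventually_finite_subsets_at_top_weakI\<close>)
  thus ?thesis unfolding has_sum_def by (simp add: LIM_zero_iff)
qed

lemma has_sum_product_pair:
  fixes f g :: "nat \<Rightarrow> complex"
  assumes f: "summable (\<lambda>n. norm (f n))" "f sums F" and g: "summable (\<lambda>n. norm (g n))" "g sums G"
  shows "((\<lambda>(m, n). f m * g n) has_sum (F * G)) UNIV" "(\<lambda>(m, n). norm (f m) * norm (g n)) summable_on UNIV"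
proof -
  have fn: "((\<lambda>n. norm (f n)) has_sum (\<Sum>n. norm (f n))) UNIV" and gn: "((\<lambda>n. norm (g n)) has_sum (\<Sum>n. norm (g n))) UNIV"
    using f g by (auto intro!: norm_summable_imp_has_sum summable_sums)
  have fs: "(\<lambda>m. norm (f m) * (\<Sum>n. norm (g n))) summable_on UNIV"
    using has_sum_cmult_left[OF fn] unfolding summable_on_def by blast
  have "(\<lambda>(m, n). norm (f m) * norm (g n)) summable_on (Sigma UNIV (\<lambda>_. UNIV))"
    by (rule summable_on_SigmaI[where g = "\<lambda>m. norm (f m) * (\<Sum>n. norm (g n))", OF _ fs])
       (use gn in \<open>auto intro!: has_sum_cmult_right\<close>)
  thus s: "(\<lambda>(m, n). norm (f m) * norm (g n)) summable_on UNIV" by simp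
  have "(\<lambda>x. norm ((\<lambda>(m, n). f m * g n) x)) summable_on UNIV"
    using s by (simp add: case_prod_unfold norm_mult)
  hence s2: "(\<lambda>(m, n). f m * g n) summable_on (Sigma UNIV (\<lambda>_. UNIV))"
    by (simp add: abs_summable_summable)
  have "((\<lambda>(m, n). f m * g n) has_sum (F * G)) (Sigma UNIV (\<lambda>_. UNIV))"
    by (rule has_sum_SigmaI[where g = "\<lambda>m. f m * G", OF _ _ s2])
       (use norm_summable_imp_has_sum[OF f] norm_summable_imp_has_sum[OF g] in \<open>auto intro!: has_sum_cmult_right has_sum_cmult_left\<close>)
  thus "((\<lambda>(m, n). f m * g n) has_sum (F * G)) UNIV" by simp
qed

text \<open>Squares of Dirichlet series are kept as unordered sums over pairs; the divisor function
  never has to be introduced, and conditions on the two factors remain visible.\<close>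

definition pairprod :: "nat \<times> nat \<Rightarrow> real" where
  "pairprod x = real (Suc (fst x)) * real (Suc (snd x))"

lemma pairprod_ge_1: "pairprod x \<ge> 1"
proof -
  have "1 * 1 \<le> pairprod x" unfolding pairprod_def by (intro mult_mono) auto
  thus ?thesis by simp
qed

lemma pairprod_pos [simp]: "pairprod x > 0" using pairprod_ge_1[of x] by linarith

lemma summable_Suc_powr: "c > 1 \<Longrightarrow> summable (\<lambda>n. real (Suc n) powr (- c))"
  using summable_Suc_iff[of "\<lambda>n. real n powr (- c)"] by (simp add: summable_real_powr_iff)

lemma pairprod_summable:
  assumes "c > 1"
  shows "(\<lambda>x. pairprod x powr (- c)) summable_on UNIV"
proof -
  have s: "summable (\<lambda>n. norm (complex_of_real (real (Suc n) powr (- c))))"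
    using summable_Suc_powr[OF assms] by simp
  from has_sum_product_pair(2)[OF s summable_sums[OF summable_norm_cancel[OF s]] s summable_sums[OF summable_norm_cancel[OF s]]]
  show ?thesis by (simp add: pairprod_def case_prod_unfold powr_mult)
qed

lemma norm_of_real_powr_Complex: "y > 0 \<Longrightarrow> norm (complex_of_real y powr s) = y powr Re s"
  by (simp add: norm_powr_real_powr)

lemma powr_of_real_exp: "y > 0 \<Longrightarrow> complex_of_real y powr s = exp (s * of_real (ln y))"
  by (simp add: powr_def Ln_of_real)

text \<open>To the right of 1 the double series for the square converges absolutely and uniformly on
  the line, so a Mellin integral against it can be computed term by term. The three uses differ only
  in the kernel and the coefficients.\<close>

lemma square_line_integral:
  fixes a :: "nat \<Rightarrow> complex" and K F :: "complex \<Rightarrow> complex"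
  assumes c: "c > 1" and a: "\<And>n. norm (a n) \<le> 1" and F: "\<And>s. Re s > 1 \<Longrightarrow> (\<lambda>n. a n / of_nat (Suc n) powr s) sums F s"
    and K: "integrable lborel (\<lambda>t. K (Complex c t))" and FM: "(\<lambda>t. F (Complex c t)) \<in> borel_measurable borel"
  shows "((\<lambda>x. a (fst x) * a (snd x) * (LBINT t. K (Complex c t) * of_real (pairprod x) powr (- Complex c t))) has_sum
           (LBINT t. K (Complex c t) * (F (Complex c t))\<^sup>2)) UNIV"
proof -
  have [measurable]: "(\<lambda>t. K (Complex c t)) \<in> borel_measurable borel" using K by auto
  have [measurable]: "(\<lambda>t. F (Complex c t)) \<in> borel_measurable borel" by (rule FM)
  have pm [measurable]: "(\<lambda>t. of_real (pairprod x) powr (- Complex c t)) \<in> borel_measurable borel" for x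
    by (intro borel_measurable_continuous_onI continuous_intros)
       (use pairprod_pos[of x] less_imp_le[OF pairprod_pos[of x]] in auto)
  have "((\<lambda>x. LBINT t. a (fst x) * a (snd x) * (K (Complex c t) * of_real (pairprod x) powr (- Complex c t))) has_sum
           (LBINT t. K (Complex c t) * (F (Complex c t))\<^sup>2)) UNIV"
  proof (rule has_sum_integral_dominated[where c = "\<lambda>x. pairprod x powr (- c)" and h = "\<lambda>t. norm (K (Complex c t))"])
    show "norm (a (fst x) * a (snd x) * (K (Complex c t) * of_real (pairprod x) powr (- Complex c t))) \<le> pairprod x powr (- c) * norm (K (Complex c t))" for x t
    proof -
      have "norm (a (fst x)) * norm (a (snd x)) \<le> 1 * 1" by (intro mult_mono a) auto
      hence "norm (a (fst x)) * norm (a (snd x)) * (norm (K (Complex c t)) * pairprod x powr (- c)) \<le> 1 * (norm (K (Complex c t)) * pairprod x powr (- c))"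
        by (intro mult_right_mono) auto
      moreover have "norm (complex_of_real (pairprod x) powr (- Complex c t)) = pairprod x powr (- c)"
        using norm_of_real_powr_Complex[OF pairprod_pos[of x], of "- Complex c t"] by simp
      ultimately show ?thesis by (simp add: norm_mult mult.commute)
    qed
    fix t
    define s where "s = Complex c t"
    have s: "Re s > 1" using c by (simp add: s_def)
    have "norm (a n / of_nat (Suc n) powr s) \<le> real (Suc n) powr (- c)" for n
    proof -
      have "norm (of_nat (Suc n) powr s) = real (Suc n) powr c"
        using norm_of_real_powr_Complex[of "real (Suc n)" s] by (simp add: s_def)
      thus ?thesis using a[of n] by (simp add: norm_divide powr_minus divide_simps)
    qed
    hence sm: "summable (\<lambda>n. norm (a n / of_nat (Suc n) powr s))"
      by (intro summable_comparison_test'[OF summable_Suc_powr[OF c]]) simp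
    have "((\<lambda>(m, n). (a m / of_nat (Suc m) powr s) * (a n / of_nat (Suc n) powr s)) has_sum (F s * F s)) UNIV"
      by (rule has_sum_product_pair(1)[OF sm F[OF s] sm F[OF s]])
    from has_sum_cmult_right[OF this, of "K s"]
    have "((\<lambda>x. K s * (case x of (m, n) \<Rightarrow> (a m / of_nat (Suc m) powr s) * (a n / of_nat (Suc n) powr s))) has_sum (K s * (F s)\<^sup>2)) UNIV"
      by (simp add: power2_eq_square)
    moreover have "K s * (case x of (m, n) \<Rightarrow> (a m / of_nat (Suc m) powr s) * (a n / of_nat (Suc n) powr s)) =
       a (fst x) * a (snd x) * (K s * of_real (pairprod x) powr (- s))" for x
    proof -
      have "complex_of_real (pairprod x) powr (- s) = 1 / (of_nat (Suc (fst x)) powr s * of_nat (Suc (snd x)) powr s)"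
        by (simp add: pairprod_def powr_minus powr_times_real inverse_eq_divide del: of_nat_Suc)
      thus ?thesis by (simp add: case_prod_unfold)
    qed
    ultimately show "((\<lambda>x. a (fst x) * a (snd x) * (K (Complex c t) * of_real (pairprod x) powr (- Complex c t))) has_sum (K (Complex c t) * (F (Complex c t))\<^sup>2)) UNIV"
      by (simp only: s_def)
  qed (use K pairprod_summable[OF c] in \<open>auto\<close>)
  thus ?thesis by simp
qed

text \<open>Near 1, (s - 1) zeta s = 1 + (s - 1) zeta_regular s, so the residue at the double pole
  is the derivative of the kernel times the square of this, and the constant term of zeta
  contributes 2 gamma. Fourth-order decay of the kernel against quadratic growth of the square
  leaves the quadratic decay that the line shift demands.\<close>

lemma zeta_square_shift:
  fixes K :: "complex \<Rightarrow> complex"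
  assumes K: "K holomorphic_on {s. Re s > 0}" and a: "0 < a" "a < 1" and c: "1 < c"
    and bd: "\<And>z. a \<le> Re z \<Longrightarrow> Re z \<le> c \<Longrightarrow> \<bar>Im z\<bar> \<ge> 1 \<Longrightarrow> norm (K z) \<le> B / \<bar>Im z\<bar> ^ 4"
  shows "(LBINT t. K (Complex c t) * (zeta (Complex c t))\<^sup>2) = (LBINT t. K (Complex a t) * (zeta (Complex a t))\<^sup>2)
      + 2 * pi * (deriv K 1 + 2 * of_real euler_mascheroni * K 1)"
proof -
  define g where "g s = K s * (1 + (s - 1) * zeta_regular s)\<^sup>2" for s
  define f where "f s = g s / (s - 1) ^ Suc 1" for s
  have fz: "f s = K s * (zeta s)\<^sup>2" if "Re s > 0" "s \<noteq> 1" for s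
  proof -
    have "zeta s = (1 + (s - 1) * zeta_regular s) / (s - 1)"
      using that by (simp add: zeta_eq_regular add_divide_distrib)
    thus ?thesis by (simp add: f_def g_def power_divide power2_eq_square)
  qed
  have gh: "g holomorphic_on {s. Re s > 0}"
    unfolding g_def[abs_def] by (intro holomorphic_intros K zeta_regular_holomorphic)
  have B0: "0 \<le> B" using order_trans[OF norm_ge_zero bd[of "Complex 1 1"]] a c by simp
  \<comment> \<open>1 bounds the polar term, since \<bar>z - 1\<bar> \<ge> \<bar>Im z\<bar> \<ge> 1,
    and 1 + \<bar>z\<bar> / Re z the regular part; \<bar>z\<bar> \<le> (c + 1) \<bar>Im z\<bar> in
    the strip.\<close>
  define D where "D = 2 + (c + 1) / a"
  have D0: "D \<ge> 0" using a c by (simp add: D_def)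
  have zb: "norm (zeta z) \<le> D * \<bar>Im z\<bar>" if z: "a \<le> Re z" "Re z \<le> c" "\<bar>Im z\<bar> \<ge> 1" for z
  proof -
    have z1: "Re z > 0" "z \<noteq> 1" using z a by auto
    have "\<bar>Im z\<bar> \<le> norm (z - 1)" using abs_Im_le_cmod[of "z - 1"] by simp
    hence i: "norm (1 / (z - 1)) \<le> 1" using z by (simp add: norm_divide divide_simps)
    have "norm z \<le> \<bar>Re z\<bar> + \<bar>Im z\<bar>" by (rule cmod_le)
    also have "\<dots> \<le> c * \<bar>Im z\<bar> + \<bar>Im z\<bar>"
    proof -
      have "c * 1 \<le> c * \<bar>Im z\<bar>" using z c by (intro mult_left_mono) auto
      thus ?thesis using z a by linarith
    qed
    finally have "norm z / Re z \<le> (c + 1) * \<bar>Im z\<bar> / a"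
      using z a c by (intro frac_le) (auto simp: algebra_simps)
    moreover have "norm (zeta_regular z) \<le> 1 + norm z / Re z" by (rule zeta_regular_bound[OF z1(1)])
    moreover have "norm (zeta z) \<le> norm (1 / (z - 1)) + norm (zeta_regular z)"
      unfolding zeta_eq_regular[OF z1] by (rule norm_triangle_ineq)
    ultimately have "norm (zeta z) \<le> 2 + (c + 1) * \<bar>Im z\<bar> / a" using i by linarith
    also have "\<dots> \<le> D * \<bar>Im z\<bar>" using z by (simp add: D_def algebra_simps)
    finally show ?thesis .
  qed
  have fb: "norm (f z) \<le> B * D\<^sup>2 / (Im z)\<^sup>2" if z: "a \<le> Re z" "Re z \<le> c" "\<bar>Im z\<bar> \<ge> 1" for z
  proof -
    have "Re z > 0" "z \<noteq> 1" using z a by auto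
    hence "norm (f z) = norm (K z) * (norm (zeta z))\<^sup>2" by (simp add: fz norm_mult norm_power)
    also have "\<dots> \<le> (B / \<bar>Im z\<bar> ^ 4) * (D * \<bar>Im z\<bar>)\<^sup>2"
      using bd[OF z] zb[OF z] B0 by (intro mult_mono power_mono) auto
    also have "\<dots> = B * D\<^sup>2 / (Im z)\<^sup>2"
      using z by (simp add: power_mult_distrib field_simps power2_eq_square power4_eq_xxxx)
    finally show ?thesis .
  qed
  have "(LBINT t. f (Complex c t)) = (LBINT t. f (Complex a t)) + 2 * pi * residue f 1"
  proof (rule vertical_line_shift(1)[where S = "{s. Re s > 0}"])
    show "f holomorphic_on {s. Re s > 0} - {1}"
      unfolding f_def[abs_def] by (intro holomorphic_intros holomorphic_on_subset[OF gh]) auto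
    show "connected {s. Re s > 0}" by (intro convex_connected convex_halfspace_Re_gt)
  qed (use a c fb in \<open>auto intro!: open_halfspace_Re_gt\<close>)
  moreover have "residue f 1 = deriv g 1"
    unfolding f_def[abs_def] using residue_holomorphic_over_power[OF open_halfspace_Re_gt _ gh, of 1 1] by simp
  moreover have "deriv g 1 = deriv K 1 + 2 * of_real euler_mascheroni * K 1"
  proof -
    have kd: "(K has_field_derivative deriv K 1) (at 1)"
      by (rule holomorphic_derivI[OF K open_halfspace_Re_gt]) simp
    have zd: "(zeta_regular has_field_derivative deriv zeta_regular 1) (at 1)"
      by (rule holomorphic_derivI[OF zeta_regular_holomorphic open_halfspace_Re_gt]) simp
    have "(g has_field_derivative (deriv K 1 + 2 * zeta_regular 1 * K 1)) (at 1)"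
      unfolding g_def[abs_def] by (rule derivative_eq_intros kd zd refl | simp)+
    thus ?thesis by (simp add: DERIV_imp_deriv zeta_regular_1)
  qed
  moreover have "f (Complex c t) = K (Complex c t) * (zeta (Complex c t))\<^sup>2" "f (Complex a t) = K (Complex a t) * (zeta (Complex a t))\<^sup>2" for t
    by (rule fz; use a c in \<open>auto simp: complex_eq_iff\<close>)+
  ultimately show ?thesis by simp
qed

section \<open>The Mellin kernel of the Gaussian\<close>

lemma Gamma_half_inversion:
  assumes c: "c > 0" and w: "w > 0"
  shows "(LBINT t. 1/2 * Gamma (Complex c t / 2) * of_real w powr (- Complex c t)) = 2 * pi * exp (- (w\<^sup>2))"
proof -
  have "(LBINT t. 1/2 * Gamma (Complex c t / 2) * of_real w powr (- Complex c t)) =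
     \<bar>2\<bar> *\<^sub>R (LBINT t. 1/2 * Gamma (Complex c (0 + 2 * t) / 2) * of_real w powr (- Complex c (0 + 2 * t)))"
    by (rule lborel_integral_real_affine) simp
  also have "\<dots> = (LBINT t. \<bar>2\<bar> *\<^sub>R (1/2 * Gamma (Complex c (0 + 2 * t) / 2) * of_real w powr (- Complex c (0 + 2 * t))))"
    by simp
  also have "(\<lambda>t. \<bar>2\<bar> *\<^sub>R (1/2 * Gamma (Complex c (0 + 2 * t) / 2) * of_real w powr (- Complex c (0 + 2 * t)))) =
    (\<lambda>t. Gamma (Complex (c/2) t) * of_real (w\<^sup>2) powr (- Complex (c/2) t))"
  proof
    fix t
    have "Complex c (0 + 2 * t) / 2 = Complex (c/2) t" by (simp add: complex_eq_iff)
    moreover have "- Complex c (0 + 2 * t) = 2 * - Complex (c/2) t" by (simp add: complex_eq_iff)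
    moreover have "complex_of_real w powr (2 * z) = of_real (w\<^sup>2) powr z" for z
      using w by (simp add: powr_def Ln_of_real ln_realpow mult_ac del: of_real_power)
    ultimately show "\<bar>2\<bar> *\<^sub>R (1/2 * Gamma (Complex c (0 + 2 * t) / 2) * of_real w powr (- Complex c (0 + 2 * t))) = Gamma (Complex (c/2) t) * of_real (w\<^sup>2) powr (- Complex (c/2) t)"
      by (simp only: scaleR_conv_of_real) simp
  qed
  also have "(LBINT t. Gamma (Complex (c/2) t) * of_real (w\<^sup>2) powr (- Complex (c/2) t)) = 2 * pi * exp (- (w\<^sup>2))"
    by (rule Gamma_Mellin_inversion) (use c w in auto)
  finally show ?thesis .
qed

text \<open>The Mellin transform of the cutoff exp (- (y / X)^2) in y.\<close>

definition half_Gamma_kernel :: "real \<Rightarrow> complex \<Rightarrow> complex" where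
  "half_Gamma_kernel X s = 1/2 * Gamma (s/2) * of_real X powr s"

lemma half_Gamma_kernel_holomorphic: "X > 0 \<Longrightarrow> half_Gamma_kernel X holomorphic_on {s. Re s > 0}"
proof -
  assume X: "X > 0"
  have "z / 2 \<notin> \<int>\<^sub>\<le>\<^sub>0" if "z \<in> {s. Re s > 0}" for z :: complex
  proof
    assume "z / 2 \<in> \<int>\<^sub>\<le>\<^sub>0"
    then obtain n where "z / 2 = - of_nat n" by (elim nonpos_Ints_cases')
    hence "Re (z / 2) = - real n" by simp
    thus False using that by simp
  qed
  thus ?thesis unfolding half_Gamma_kernel_def[abs_def] using X
    by (intro holomorphic_intros holomorphic_Gamma') auto
qed

lemma half_Gamma_kernel_bound:
  assumes X: "X > 0" and a: "0 < a"
  shows "\<exists>B. \<forall>z. a \<le> Re z \<longrightarrow> Re z \<le> c \<longrightarrow> \<bar>Im z\<bar> \<ge> 1 \<longrightarrow> norm (half_Gamma_kernel X z) \<le> B / \<bar>Im z\<bar> ^ 4"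
proof -
  have a2: "0 < a / 2" using a by simp
  obtain C where C: "C > 0" and "\<And>z. a/2 \<le> Re z \<Longrightarrow> Re z \<le> c/2 \<Longrightarrow> norm (Gamma z) \<le> C"
    and C2: "\<And>z. a/2 \<le> Re z \<Longrightarrow> Re z \<le> c/2 \<Longrightarrow> Im z \<noteq> 0 \<Longrightarrow> norm (Gamma z) \<le> C / \<bar>Im z\<bar> ^ 4"
    by (rule Gamma_strip_bound[OF a2, where b = "c/2" and k = 4]) (rule that)
  have Xb: "X powr y \<le> max (X powr a) (X powr c)" if "a \<le> y" "y \<le> c" for y
  proof (cases "X \<ge> 1")
    case True thus ?thesis using that by (intro max.coboundedI2 powr_mono) auto
  next
    case False thus ?thesis using that X by (intro max.coboundedI1 powr_mono') auto
  qed
  show ?thesis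
  proof (intro exI[of _ "8 * C * max (X powr a) (X powr c)"] allI impI)
    fix z assume z: "a \<le> Re z" "Re z \<le> c" "\<bar>Im z\<bar> \<ge> 1"
    have "norm (Gamma (z/2)) \<le> C / \<bar>Im (z/2)\<bar> ^ 4" using z by (intro C2) auto
    also have "\<dots> = 16 * C / \<bar>Im z\<bar> ^ 4" by (simp add: power_divide)
    finally have "1/2 * norm (Gamma (z/2)) * X powr Re z \<le> 1/2 * (16 * C / \<bar>Im z\<bar> ^ 4) * max (X powr a) (X powr c)"
      using Xb[OF z(1,2)] C by (intro mult_mono) auto
    moreover have "norm (half_Gamma_kernel X z) = 1/2 * norm (Gamma (z/2)) * X powr Re z"
      using norm_of_real_powr_Complex[OF X] by (simp add: half_Gamma_kernel_def norm_mult)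
    ultimately show "norm (half_Gamma_kernel X z) \<le> 8 * C * max (X powr a) (X powr c) / \<bar>Im z\<bar> ^ 4" by simp
  qed
qed

lemma half_Gamma_kernel_integrable:
  assumes X: "X > 0" and c: "c > 0"
  shows "integrable lborel (\<lambda>t. half_Gamma_kernel X (Complex c t))"
proof -
  obtain B where B: "\<And>z. c \<le> Re z \<Longrightarrow> Re z \<le> c \<Longrightarrow> \<bar>Im z\<bar> \<ge> 1 \<Longrightarrow> norm (half_Gamma_kernel X z) \<le> B / \<bar>Im z\<bar> ^ 4"
    using half_Gamma_kernel_bound[OF X c, of c] by blast
  have B0: "0 \<le> B" using order_trans[OF norm_ge_zero B[of "Complex c 1"]] by simp
  show ?thesis
  proof (rule integrable_of_decay)
    show "continuous_on UNIV (\<lambda>t. half_Gamma_kernel X (Complex c t))"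
      by (rule continuous_on_compose2[OF holomorphic_on_imp_continuous_on[OF half_Gamma_kernel_holomorphic[OF X]]])
         (use c in \<open>auto intro!: continuous_intros\<close>)
    fix t :: real assume t: "\<bar>t\<bar> \<ge> 1"
    have "norm (half_Gamma_kernel X (Complex c t)) \<le> B / \<bar>t\<bar> ^ 4" using B[of "Complex c t"] t by simp
    also have "\<dots> \<le> B / t\<^sup>2"
    proof (rule divide_left_mono)
      have "\<bar>t\<bar> ^ 2 \<le> \<bar>t\<bar> ^ 4" using t by (intro power_increasing) auto
      thus "t\<^sup>2 \<le> \<bar>t\<bar> ^ 4" by simp
    qed (use B0 t in auto)
    finally show "norm (half_Gamma_kernel X (Complex c t)) \<le> B / t\<^sup>2" .
  qed
qed

lemma half_Gamma_kernel_line: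
  assumes X: "X > 0" and c: "c > 0"
  shows "(LBINT t. half_Gamma_kernel X (Complex c t) * of_real (pairprod x) powr (- Complex c t)) = of_real (2 * pi * exp (- ((pairprod x / X)\<^sup>2)))"
proof -
  have "half_Gamma_kernel X s * of_real (pairprod x) powr (- s) = 1/2 * Gamma (s / 2) * of_real (pairprod x / X) powr (- s)" for s
  proof -
    have "complex_of_real X powr s * of_real (pairprod x) powr (- s) = of_real (pairprod x / X) powr (- s)"
    proof -
      have "s * of_real (ln X) + - s * of_real (ln (pairprod x)) = - s * of_real (ln (pairprod x / X))"
        using X less_imp_neq[OF pairprod_pos[of x], symmetric] by (simp add: ln_div algebra_simps)
      thus ?thesis using X by (simp only: powr_of_real_exp pairprod_pos divide_pos_pos flip: exp_add)
    qed
    thus ?thesis by (simp add: half_Gamma_kernel_def mult_ac)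
  qed
  hence e: "(\<lambda>t. half_Gamma_kernel X (Complex c t) * of_real (pairprod x) powr (- Complex c t)) =
     (\<lambda>t. 1/2 * Gamma (Complex c t / 2) * of_real (pairprod x / X) powr (- Complex c t))" by (intro ext)
  show ?thesis unfolding e
    using Gamma_half_inversion[OF c, of "pairprod x / X"] X by (simp only: divide_pos_pos pairprod_pos of_real_mult of_real_numeral)
qed

section \<open>Gaussian divisor sums\<close>

lemma zeta_line_continuous:
  assumes "c > 0" "c \<noteq> 1"
  shows "continuous_on UNIV (\<lambda>t. zeta (Complex c t))"
proof -
  have "(\<lambda>s. 1 / (s - 1) + zeta_regular s) holomorphic_on {s. Re s > 0} - {1}"
    by (intro holomorphic_intros holomorphic_on_subset[OF zeta_regular_holomorphic]) auto
  hence h: "continuous_on ({s. Re s > 0} - {1}) (\<lambda>s. 1 / (s - 1) + zeta_regular s)"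
    by (rule holomorphic_on_imp_continuous_on)
  have "continuous_on UNIV (\<lambda>t. Complex c t)" by (intro continuous_intros)
  moreover have "range (\<lambda>t. Complex c t) \<subseteq> {s. Re s > 0} - {1}" using assms by (auto simp: Complex_eq_1)
  ultimately have "continuous_on UNIV (\<lambda>t. 1 / (Complex c t - 1) + zeta_regular (Complex c t))"
    by (rule continuous_on_compose2[OF h])
  moreover have "zeta (Complex c t) = 1 / (Complex c t - 1) + zeta_regular (Complex c t)" for t
    by (rule zeta_eq_regular) (use assms in \<open>auto simp: Complex_eq_1\<close>)
  ultimately show ?thesis by simp
qed

lemma deriv_Gamma_half: "deriv Gamma (1/2 :: real) / Gamma (1/2 :: real) = Digamma (1/2)"
proof -
  have "(Gamma has_field_derivative Gamma (1/2 :: real) * Digamma (1/2)) (at (1/2))"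
    by (rule has_field_derivative_Gamma) auto
  hence "deriv Gamma (1/2 :: real) = Gamma (1/2) * Digamma (1/2)" by (rule DERIV_imp_deriv)
  moreover have "Gamma (1/2 :: real) \<noteq> 0" by (simp only: Gamma_one_half_real) simp
  ultimately show ?thesis by simp
qed

lemma half_Gamma_kernel_at_1:
  assumes X: "X > 0"
  shows "half_Gamma_kernel X 1 = of_real (sqrt pi / 2 * X)"
    and "deriv (half_Gamma_kernel X) 1 = of_real (sqrt pi / 2 * X * (ln X + 1/2 * Digamma (1/2)))"
proof -
  have G: "Gamma (1/2 :: complex) = of_real (sqrt pi)" by (rule Gamma_one_half_complex)
  have P: "complex_of_real X powr 1 = of_real X" using X by simp
  show 1: "half_Gamma_kernel X 1 = of_real (sqrt pi / 2 * X)"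
    unfolding half_Gamma_kernel_def P by (simp add: G)
  have np: "1/2 \<notin> (\<int>\<^sub>\<le>\<^sub>0 :: complex set)"
  proof
    assume "1/2 \<in> (\<int>\<^sub>\<le>\<^sub>0 :: complex set)"
    then obtain n where "(1/2 :: complex) = - of_nat n" by (elim nonpos_Ints_cases')
    hence "Re (1/2) = - real n" by (metis complex_Re_of_nat uminus_complex.sel(1))
    thus False by simp
  qed
  have "(Gamma has_field_derivative Gamma (1/2) * Digamma (1/2)) (at (1/2 :: complex))"
    by (rule has_field_derivative_Gamma[OF np])
  hence "(Gamma has_field_derivative Gamma (1/2) * Digamma (1/2)) (at (1 / 2 :: complex))" by simp
  moreover have "((\<lambda>s. s / 2) has_field_derivative (1/2)) (at (1 :: complex))" by (auto intro!: derivative_eq_intros)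
  ultimately have g: "((\<lambda>s. Gamma (s / 2)) has_field_derivative (Gamma (1/2) * Digamma (1/2) * (1/2))) (at (1 :: complex))"
    by (rule DERIV_chain2)
  have p: "((\<lambda>s. complex_of_real X powr s) has_field_derivative (of_real X * of_real (ln X))) (at 1)"
  proof -
    have "((\<lambda>s. exp (s * of_real (ln X))) has_field_derivative (exp (1 * of_real (ln X)) * of_real (ln X))) (at (1 :: complex))"
      by (auto intro!: derivative_eq_intros)
    moreover have "exp (1 * complex_of_real (ln X)) = of_real X" using powr_of_real_exp[OF X, of 1] P by simp
    moreover have "(\<lambda>s. complex_of_real X powr s) = (\<lambda>s. exp (s * of_real (ln X)))" using powr_of_real_exp[OF X] by blast
    ultimately show ?thesis by simp
  qed
  have D: "Digamma (1/2 :: complex) = of_real (Digamma (1/2))"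
    using Polygamma_of_real[of "1/2 :: real" 0, where 'a = complex] by simp
  have "((\<lambda>s. 1/2 * Gamma (s/2) * of_real X powr s) has_field_derivative
      ((1/2 * (Gamma (1/2) * Digamma (1/2) * (1/2))) * of_real X powr 1 + (of_real X * of_real (ln X)) * (1/2 * Gamma (1/2)))) (at (1 :: complex))"
    by (rule DERIV_mult[OF DERIV_cmult[OF g] p])
  hence "deriv (half_Gamma_kernel X) 1 = (1/2 * (Gamma (1/2) * Digamma (1/2) * (1/2))) * of_real X powr 1 + (of_real X * of_real (ln X)) * (1/2 * Gamma (1/2))"
    unfolding half_Gamma_kernel_def[abs_def] by (rule DERIV_imp_deriv)
  also have "\<dots> = of_real (sqrt pi / 2 * X * (ln X + 1/2 * Digamma (1/2)))"
    unfolding P D G by (simp add: algebra_simps)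
  finally show "deriv (half_Gamma_kernel X) 1 = of_real (sqrt pi / 2 * X * (ln X + 1/2 * Digamma (1/2)))" .
qed

text \<open>Moving the line from 2 to \<epsilon> picks up the main term as the residue at 1, and on
  the new line X enters only through the factor X^\<epsilon>. The estimate holds for small X as
  well, which matters because it is applied at lengths X/p and X/p^2 that may fall below 1.\<close>

lemma divisor_gaussian_sum_asymptotics:
  assumes \<epsilon>: "0 < \<epsilon>" "\<epsilon> < 1"
  shows "\<exists>C\<ge>0. \<forall>X>0. \<exists>A. ((\<lambda>x. exp (- ((pairprod x / X)\<^sup>2))) has_sum A) UNIV \<and>
     \<bar>A - sqrt pi / 2 * X * (ln X + 2 * euler_mascheroni + 1/2 * Digamma (1/2))\<bar> \<le> C * X powr \<epsilon>"
proof -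
  define C where "C = (LBINT t. norm (1/2 * Gamma (Complex \<epsilon> t / 2) * (zeta (Complex \<epsilon> t))\<^sup>2)) / (2 * pi)"
  show ?thesis
  proof (rule exI[of _ C], intro conjI allI impI)
    show "C \<ge> 0" by (simp add: C_def)
    fix X :: real assume X: "X > 0"
    let ?K = "half_Gamma_kernel X"
    have "((\<lambda>x. 1 * 1 * (LBINT t. ?K (Complex 2 t) * of_real (pairprod x) powr (- Complex 2 t))) has_sum
           (LBINT t. ?K (Complex 2 t) * (zeta (Complex 2 t))\<^sup>2)) UNIV"
    proof (rule square_line_integral[where a = "\<lambda>_. 1"])
      show "(\<lambda>t. zeta (Complex 2 t)) \<in> borel_measurable borel"
        by (intro borel_measurable_continuous_onI zeta_line_continuous) auto
      show "integrable lborel (\<lambda>t. ?K (Complex 2 t))" by (rule half_Gamma_kernel_integrable[OF X]) simp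
    qed (use zeta_sums in auto)
    hence hs: "((\<lambda>x. complex_of_real (2 * pi * exp (- ((pairprod x / X)\<^sup>2)))) has_sum
           (LBINT t. ?K (Complex 2 t) * (zeta (Complex 2 t))\<^sup>2)) UNIV"
      using half_Gamma_kernel_line[OF X, of 2] by simp
    define S where "S = Re (LBINT t. ?K (Complex 2 t) * (zeta (Complex 2 t))\<^sup>2)"
    have "((\<lambda>x. 2 * pi * exp (- ((pairprod x / X)\<^sup>2))) has_sum S) UNIV"
      using has_sum_Re[OF hs] by (simp add: S_def)
    from has_sum_cmult_right[OF this, of "1 / (2 * pi)"]
    have A: "((\<lambda>x. exp (- ((pairprod x / X)\<^sup>2))) has_sum (S / (2 * pi))) UNIV" by simp
    obtain B where B: "\<And>z. \<epsilon> \<le> Re z \<Longrightarrow> Re z \<le> 2 \<Longrightarrow> \<bar>Im z\<bar> \<ge> 1 \<Longrightarrow> norm (?K z) \<le> B / \<bar>Im z\<bar> ^ 4"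
      using half_Gamma_kernel_bound[OF X \<epsilon>(1), of 2] by blast
    have "(LBINT t. ?K (Complex 2 t) * (zeta (Complex 2 t))\<^sup>2) = (LBINT t. ?K (Complex \<epsilon> t) * (zeta (Complex \<epsilon> t))\<^sup>2)
      + 2 * pi * (deriv ?K 1 + 2 * of_real euler_mascheroni * ?K 1)"
      by (rule zeta_square_shift[OF half_Gamma_kernel_holomorphic[OF X] \<epsilon> _ B]) auto
    also have "deriv ?K 1 + 2 * of_real euler_mascheroni * ?K 1 = of_real (sqrt pi / 2 * X * (ln X + 2 * euler_mascheroni + 1/2 * Digamma (1/2)))"
      unfolding half_Gamma_kernel_at_1[OF X] by (simp add: algebra_simps)
    finally have "S = Re (LBINT t. ?K (Complex \<epsilon> t) * (zeta (Complex \<epsilon> t))\<^sup>2) + 2 * pi * (sqrt pi / 2 * X * (ln X + 2 * euler_mascheroni + 1/2 * Digamma (1/2)))"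
      unfolding S_def by (simp flip: of_real_mult)
    hence diff: "S / (2 * pi) - sqrt pi / 2 * X * (ln X + 2 * euler_mascheroni + 1/2 * Digamma (1/2)) = Re (LBINT t. ?K (Complex \<epsilon> t) * (zeta (Complex \<epsilon> t))\<^sup>2) / (2 * pi)"
      by (simp add: add_divide_distrib)
    have "\<bar>Re (LBINT t. ?K (Complex \<epsilon> t) * (zeta (Complex \<epsilon> t))\<^sup>2)\<bar> \<le> X powr \<epsilon> * (LBINT t. norm (1/2 * Gamma (Complex \<epsilon> t / 2) * (zeta (Complex \<epsilon> t))\<^sup>2))"
    proof -
      have "\<bar>Re (LBINT t. ?K (Complex \<epsilon> t) * (zeta (Complex \<epsilon> t))\<^sup>2)\<bar> \<le> norm (LBINT t. ?K (Complex \<epsilon> t) * (zeta (Complex \<epsilon> t))\<^sup>2)"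
        by (rule abs_Re_le_cmod)
      also have "\<dots> \<le> (LBINT t. norm (?K (Complex \<epsilon> t) * (zeta (Complex \<epsilon> t))\<^sup>2))" by (rule integral_norm_bound)
      also have "(\<lambda>t. norm (?K (Complex \<epsilon> t) * (zeta (Complex \<epsilon> t))\<^sup>2)) = (\<lambda>t. X powr \<epsilon> * norm (1/2 * Gamma (Complex \<epsilon> t / 2) * (zeta (Complex \<epsilon> t))\<^sup>2))"
        using norm_of_real_powr_Complex[OF X] by (simp add: half_Gamma_kernel_def norm_mult mult_ac)
      finally show ?thesis by simp
    qed
    note bound = this
    have "\<bar>Re (LBINT t. ?K (Complex \<epsilon> t) * (zeta (Complex \<epsilon> t))\<^sup>2) / (2 * pi)\<bar> = \<bar>Re (LBINT t. ?K (Complex \<epsilon> t) * (zeta (Complex \<epsilon> t))\<^sup>2)\<bar> / (2 * pi)"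
      by (simp only: abs_divide) simp
    also have "\<dots> \<le> X powr \<epsilon> * (LBINT t. norm (1/2 * Gamma (Complex \<epsilon> t / 2) * (zeta (Complex \<epsilon> t))\<^sup>2)) / (2 * pi)"
      by (rule divide_right_mono[OF bound]) simp
    also have "\<dots> = C * X powr \<epsilon>" unfolding C_def by (simp only: times_divide_eq_right mult.commute)
    finally have "\<bar>S / (2 * pi) - sqrt pi / 2 * X * (ln X + 2 * euler_mascheroni + 1/2 * Digamma (1/2))\<bar> \<le> C * X powr \<epsilon>"
      unfolding diff .
    with A show "\<exists>A. ((\<lambda>x. exp (- ((pairprod x / X)\<^sup>2))) has_sum A) UNIV \<and>
     \<bar>A - sqrt pi / 2 * X * (ln X + 2 * euler_mascheroni + 1/2 * Digamma (1/2))\<bar> \<le> C * X powr \<epsilon>" by blast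
  qed
qed

section \<open>Gaussian divisor sums twisted by an even primitive character\<close>

context even_primitive
begin

text \<open>There is no pole, so moving the line from 2 to 1/2 is exact and the result is an
  identity. On the critical line \<open>L_square_critical_line\<close> exchanges the square for the
  squared modulus; the factor (pi/p)^(s - 1/2) it brings in combines with X^s to sqrt X and the base
  pi X / p.\<close>

lemma twisted_divisor_gaussian_sum:
  assumes X: "X > 0"
  shows "((\<lambda>x. chi (int (Suc (fst x))) * chi (int (Suc (snd x))) * of_real (exp (- ((pairprod x / X)\<^sup>2)))) has_sum
      (gauss_sum chi / of_real (sqrt p) * of_real (sqrt X / (4 * pi)) *
        (LBINT t. Gamma ((1 - 2 * \<i> * of_real t) / 4) * of_real (pi * X / p) powr (\<i> * of_real t) *
           of_real ((norm (dirichlet_L chi (1/2 + \<i> * of_real t)))\<^sup>2)))) UNIV"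
proof -
  let ?K = "half_Gamma_kernel X" and ?L = "dirichlet_L chi"
  have Lc: "continuous_on UNIV (\<lambda>t. ?L (Complex c t))" for c
    by (rule continuous_on_compose2[OF holomorphic_on_imp_continuous_on[OF L_holomorphic[of UNIV]]]) (auto intro!: continuous_intros)
  have "((\<lambda>x. chi (int (Suc (fst x))) * chi (int (Suc (snd x))) * (LBINT t. ?K (Complex 2 t) * of_real (pairprod x) powr (- Complex 2 t))) has_sum
           (LBINT t. ?K (Complex 2 t) * (?L (Complex 2 t))\<^sup>2)) UNIV"
  proof (rule square_line_integral[where a = "\<lambda>n. chi (int (Suc n))"])
    show "(\<lambda>t. ?L (Complex 2 t)) \<in> borel_measurable borel"
      by (intro borel_measurable_continuous_onI Lc)
    show "integrable lborel (\<lambda>t. ?K (Complex 2 t))" by (rule half_Gamma_kernel_integrable[OF X]) simp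
    show "norm (chi (int (Suc n))) \<le> 1" for n by (rule char_norm_le[OF dc])
    show "(\<lambda>n. chi (int (Suc n)) / of_nat (Suc n) powr s) sums ?L s" if "Re s > 1" for s by (rule L_sums[OF that])
  qed auto
  hence hs: "((\<lambda>x. chi (int (Suc (fst x))) * chi (int (Suc (snd x))) * of_real (2 * pi * exp (- ((pairprod x / X)\<^sup>2)))) has_sum
           (LBINT t. ?K (Complex 2 t) * (?L (Complex 2 t))\<^sup>2)) UNIV"
    using half_Gamma_kernel_line[OF X, of 2] by simp
  obtain B where B: "\<And>z. 1/2 \<le> Re z \<Longrightarrow> Re z \<le> 2 \<Longrightarrow> \<bar>Im z\<bar> \<ge> 1 \<Longrightarrow> norm (?K z) \<le> B / \<bar>Im z\<bar> ^ 4"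
    using half_Gamma_kernel_bound[OF X, of "1/2" 2] by auto
  have B0: "0 \<le> B" using order_trans[OF norm_ge_zero B[of "Complex 1 1"]] by simp
  \<comment> \<open>The integrand is regular at 1; the point only fills the place of the exceptional
    point, and its residue is 0.\<close>
  have "(LBINT t. ?K (Complex 2 t) * (?L (Complex 2 t))\<^sup>2) = (LBINT t. ?K (Complex (1/2) t) * (?L (Complex (1/2) t))\<^sup>2) + 2 * pi * residue (\<lambda>s. ?K s * (?L s)\<^sup>2) 1"
  proof (rule vertical_line_shift(1)[where S = "{s. Re s > 0}"])
    show "(\<lambda>s. ?K s * (?L s)\<^sup>2) holomorphic_on {s. Re s > 0} - {1}"
      by (intro holomorphic_intros L_holomorphic holomorphic_on_subset[OF half_Gamma_kernel_holomorphic[OF X]]) auto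
    show "connected {s. Re s > 0}" by (intro convex_connected convex_halfspace_Re_gt)
    fix z assume z: "1/2 \<le> Re z" "Re z \<le> 2" "\<bar>Im z\<bar> \<ge> 1"
    have "norm z \<le> \<bar>Re z\<bar> + \<bar>Im z\<bar>" by (rule cmod_le)
    also have "\<dots> \<le> 3 * \<bar>Im z\<bar>" using z by linarith
    finally have "norm z * (p / Re z) \<le> (3 * \<bar>Im z\<bar>) * (p / (1/2))"
      using z by (intro mult_mono divide_left_mono) auto
    moreover have "norm (?L z) \<le> norm z * (p / Re z)" using z by (intro L_bound) auto
    moreover have "(3 * \<bar>Im z\<bar>) * (p / (1/2)) = 6 * p * \<bar>Im z\<bar>" by simp
    ultimately have l: "norm (?L z) \<le> 6 * p * \<bar>Im z\<bar>" by linarith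
    have "norm (?K z * (?L z)\<^sup>2) = norm (?K z) * (norm (?L z))\<^sup>2" by (simp add: norm_mult norm_power)
    also have "\<dots> \<le> (B / \<bar>Im z\<bar> ^ 4) * (6 * p * \<bar>Im z\<bar>)\<^sup>2"
      using B[OF z] l B0 by (intro mult_mono power_mono) auto
    also have "\<dots> = B * (6 * real p)\<^sup>2 / (Im z)\<^sup>2"
      using z by (simp add: power_mult_distrib field_simps power2_eq_square power4_eq_xxxx)
    finally show "norm (?K z * (?L z)\<^sup>2) \<le> B * (6 * real p)\<^sup>2 / (Im z)\<^sup>2" .
  qed (auto intro!: open_halfspace_Re_gt)
  also have "residue (\<lambda>s. ?K s * (?L s)\<^sup>2) 1 = 0"
    by (rule residue_holo[OF open_halfspace_Re_gt, of _ 0])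
       (auto intro!: holomorphic_intros L_holomorphic half_Gamma_kernel_holomorphic[OF X])
  finally have sh: "(LBINT t. ?K (Complex 2 t) * (?L (Complex 2 t))\<^sup>2) = (LBINT t. ?K (Complex (1/2) t) * (?L (Complex (1/2) t))\<^sup>2)" by simp
  have line: "?K (Complex (1/2) t) * (?L (Complex (1/2) t))\<^sup>2 = gauss_sum chi / of_real (sqrt p) * of_real (sqrt X / 2) *
      (Gamma ((1 - 2 * \<i> * of_real t) / 4) * of_real (pi * X / p) powr (\<i> * of_real t) * of_real ((norm (?L (1/2 + \<i> * of_real t)))\<^sup>2))" for t
  proof -
    define s where "s = Complex (1/2) t"
    have s: "Re s = 1/2" "s = 1/2 + \<i> * of_real t" by (simp_all add: s_def complex_eq_iff)
    have pp: "real p > 0" using p_ge_3 by simp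
    have "?K s * (?L s)\<^sup>2 = 1/2 * of_real X powr s * (Gamma (s/2) * (?L s)\<^sup>2)"
      by (simp add: half_Gamma_kernel_def)
    also have "\<dots> = gauss_sum chi / of_real (sqrt p) * (1/2 * (of_real X powr s * of_real (pi / p) powr (s - 1/2))) * (Gamma ((1 - s)/2) * of_real ((norm (?L s))\<^sup>2))"
      unfolding L_square_critical_line[OF s(1)] by (simp only: mult_ac)
    also have "(1 - s)/2 = (1 - 2 * \<i> * of_real t) / 4" by (simp add: s(2) field_simps)
    also have "of_real X powr s * of_real (pi / p) powr (s - 1/2) = of_real (sqrt X) * of_real (pi * X / p) powr (\<i> * of_real t)"
    proof -
      have l: "ln (pi * X / p) = ln (pi / p) + ln X" using X pp by (simp add: ln_mult ln_div)
      have "sqrt X = exp (1/2 * ln X)" using X powr_half_sqrt[of X] by (simp add: powr_def)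
      hence sq: "complex_of_real (sqrt X) = exp (1/2 * of_real (ln X))" by (simp flip: exp_of_real)
      have e: "s * L1 + (s - 1/2) * L2 = 1/2 * L1 + \<i> * of_real t * (L2 + L1)" for L1 L2 :: complex
        by (simp add: s(2) algebra_simps)
      have q: "0 < pi / p" "0 < pi * X / p" using X pp by auto
      show ?thesis
        unfolding powr_of_real_exp[OF X] powr_of_real_exp[OF q(1)] powr_of_real_exp[OF q(2)] sq exp_add[symmetric] e l of_real_add ..
    qed
    finally show ?thesis unfolding s_def[symmetric] s(2)[symmetric] by (simp add: mult_ac)
  qed
  have "((\<lambda>x. of_real (1 / (2 * pi)) * (chi (int (Suc (fst x))) * chi (int (Suc (snd x))) * of_real (2 * pi * exp (- ((pairprod x / X)\<^sup>2))))) has_sum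
     (of_real (1 / (2 * pi)) * (LBINT t. ?K (Complex (1/2) t) * (?L (Complex (1/2) t))\<^sup>2))) UNIV"
    using has_sum_cmult_right[OF hs] unfolding sh .
  moreover have "of_real (1 / (2 * pi)) * (chi (int (Suc (fst x))) * chi (int (Suc (snd x))) * of_real (2 * pi * exp (- ((pairprod x / X)\<^sup>2)))) =
     chi (int (Suc (fst x))) * chi (int (Suc (snd x))) * of_real (exp (- ((pairprod x / X)\<^sup>2)))" for x
    by (simp add: field_simps)
  moreover have "of_real (1 / (2 * pi)) * (LBINT t. ?K (Complex (1/2) t) * (?L (Complex (1/2) t))\<^sup>2) =
     gauss_sum chi / of_real (sqrt p) * of_real (sqrt X / (4 * pi)) *
        (LBINT t. Gamma ((1 - 2 * \<i> * of_real t) / 4) * of_real (pi * X / p) powr (\<i> * of_real t) *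
           of_real ((norm (?L (1/2 + \<i> * of_real t)))\<^sup>2))"
    unfolding line integral_mult_right_zero by (simp add: field_simps)
  ultimately show ?thesis by (simp only:)
qed

end

section \<open>The oscillatory kernel\<close>

lemma half_le_sin:
  fixes x :: real
  assumes "0 \<le> x" "x \<le> 1"
  shows "x / 2 \<le> sin x"
proof -
  have "sin 0 - 0 / 2 \<le> sin x - x / 2"
  proof (rule DERIV_nonneg_imp_nondecreasing[OF assms(1)])
    fix y assume y: "0 \<le> y" "y \<le> x"
    have "cos (pi / 3) \<le> cos y"
      using y assms pi_gt3 by (intro cos_monotone_0_pi_le) auto
    hence "0 \<le> cos y - 1/2" by (simp add: cos_60)
    moreover have "((\<lambda>x. sin x - x / 2) has_real_derivative cos y - 1/2) (at y)"
      by (auto intro!: derivative_eq_intros)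
    ultimately show "\<exists>d. ((\<lambda>x. sin x - x / 2) has_real_derivative d) (at y) \<and> 0 \<le> d" by blast
  qed
  thus ?thesis by simp
qed

text \<open>x^k \<le> 1 + x^3 on the whole half-line, and exp x dominates 1 and x^3 / 3!; hence the
  constant 7 = 1 + 3!.\<close>

lemma exp_minus_le_powr:
  fixes x k :: real
  assumes "x > 0" "0 \<le> k" "k \<le> 3"
  shows "exp (- x) \<le> 7 * x powr (- k)"
proof -
  have "x powr k \<le> 1 + x ^ 3"
  proof (cases "x \<ge> 1")
    case True
    have "x powr k \<le> x powr 3" using assms True by (intro powr_mono) auto
    also have "x powr 3 = x ^ 3" using assms by (simp add: powr_numeral)
    finally show ?thesis by simp
  next
    case False
    have "x powr k \<le> 1" using assms False by (intro powr_le1) auto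
    thus ?thesis using assms by (simp add: add_increasing2)
  qed
  also have "\<dots> \<le> 1 * exp x + fact 3 * exp x"
    using assms power_le_fact_exp[of x 3] by (intro add_mono) auto
  also have "\<dots> = 7 * exp x" by (simp add: fact_numeral)
  finally have "x powr k / exp x \<le> 7" by (simp add: field_simps)
  moreover have "x powr (- k) > 0" using assms by simp
  ultimately have "x powr k / exp x * x powr (-k) \<le> 7 * x powr (-k)" by (intro mult_right_mono) auto
  moreover have "x powr k / exp x * x powr (-k) = exp (- x)"
    using assms by (simp add: powr_minus exp_minus field_simps)
  ultimately show ?thesis by simp
qed

lemma norm_exp_minus_1_le:
  fixes z :: complex
  shows "norm (exp z - 1) \<le> norm z * exp (norm z)"
  using Taylor_exp_field[of z 0] by (simp add: mult.commute)

lemma norm_exp_minus_linear_le: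
  fixes z :: complex
  shows "norm (exp z - (1 + z)) \<le> (norm z)\<^sup>2 * exp (norm z)"
  using Taylor_exp_field[of z 1] by (simp add: mult.commute power2_eq_square)

lemma norm_exp_diff_le:
  fixes a b :: complex
  assumes "Re a \<le> c" "Re b \<le> c"
  shows "norm (exp a - exp b) \<le> exp c * norm (a - b)"
  by (rule field_differentiable_bound[where S = "{z. Re z \<le> c}" and f' = exp])
     (use assms in \<open>auto intro!: convex_halfspace_Re_le derivative_eq_intros\<close>)

text \<open>One of the two exponentials that make up the cosine in the zeta kernel, on the line Re s
  = 2. For t < 0 it undoes the exponential decay of Gamma, so the Gaussian factor is what makes the
  integral converge.\<close>

definition oscillatory_integrand :: "real \<Rightarrow> real \<Rightarrow> real \<Rightarrow> complex" where
  "oscillatory_integrand T y t = of_real y powr (- Complex 2 t) * exp (\<i> * pi * Complex 2 t / 2) *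
     Gamma (Complex 2 t) * exp ((Complex 2 t - 1/2)\<^sup>2 / of_real (T\<^sup>2))"

definition oscillatory_kernel :: "real \<Rightarrow> real \<Rightarrow> complex" where
  "oscillatory_kernel T y = (LBINT t. oscillatory_integrand T y t)"

text \<open>
  Inserting the Mellin integral of Gamma and carrying out the Gaussian integral first, the kernel becomes
  an integral of \<open>gaussian_phase\<close> over the line \<open>Im z = pi / 2\<close>. On the line \<open>Im z = 1 / T\<close> the factor
  \<open>exp z\<close> may be linearised, which leaves \<open>exp (i y - y^2 / T^2)\<close> with a relative error \<open>O(1 / T)\<close>.
\<close>

definition gaussian_phase :: "real \<Rightarrow> real \<Rightarrow> complex \<Rightarrow> complex" where
  "gaussian_phase T y z = exp (\<i> * of_real y * exp z + z / 2 - of_real (T\<^sup>2) * z\<^sup>2 / 4)"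

lemma integrable_exp_gaussian:
  assumes a: "a > (0::real)"
  shows "integrable lborel (\<lambda>t. exp (b * t - a * t\<^sup>2))"
proof -
  have "integrable lborel (\<lambda>t. norm (exp (- complex_of_real (a * t\<^sup>2) + of_real b * of_real t)))"
    using gaussian_integral[OF a, of "of_real b"] by (intro integrable_norm) (simp add: has_bochner_integral_iff)
  thus ?thesis by simp
qed

lemma oscillatory_kernel_eq_phase:
  assumes T: "T > 0" and y: "y > 0"
  shows "oscillatory_kernel T y = of_real (sqrt pi * T) * (LBINT v. gaussian_phase T y (Complex v (pi/2)))"
proof -
  define F :: "real \<Rightarrow> real \<Rightarrow> complex" where
    "F v t = exp (- of_real (y * exp v) + Complex 2 t * of_real v) * (exp (\<i> * pi * Complex 2 t / 2) * exp ((Complex 2 t - 1/2)\<^sup>2 / of_real (T\<^sup>2)))" for v t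
  have Re_e: "Re (\<i> * pi * Complex 2 t / 2) = - pi * t / 2" for t by simp
  have Re_q: "Re ((Complex 2 t - 1/2)\<^sup>2 / of_real (T\<^sup>2)) = 9 / (4 * T\<^sup>2) - t\<^sup>2 / T\<^sup>2" for t
    unfolding Re_divide_of_real Re_power2 by (simp add: power2_eq_square diff_divide_distrib)
  have g: "integrable lborel (\<lambda>v. norm (exp (- complex_of_real (y * exp v) + of_real 2 * of_real v)))"
    using Gamma_log_Mellin[OF _ y, of 2] by (intro integrable_norm) (simp add: has_bochner_integral_iff)
  have h: "integrable lborel (\<lambda>t. exp (9 / (4 * T\<^sup>2)) * exp ((- pi / 2) * t - (1 / T\<^sup>2) * t\<^sup>2))"
    using T by (intro integrable_mult_right integrable_exp_gaussian) auto
  have m: "(\<lambda>(v, t). F v t) \<in> borel_measurable (borel \<Otimes>\<^sub>M borel)"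
    unfolding F_def borel_prod case_prod_unfold
    by (intro borel_measurable_continuous_onI continuous_intros) (use T in auto)
  have bd: "norm (F v t) \<le> norm (exp (- complex_of_real (y * exp v) + of_real 2 * of_real v)) * (exp (9 / (4 * T\<^sup>2)) * exp ((- pi / 2) * t - (1 / T\<^sup>2) * t\<^sup>2))" for v t
    unfolding F_def norm_mult norm_exp_eq_Re Re_e Re_q by (simp flip: exp_add)
  have "oscillatory_kernel T y = (LBINT t. LBINT v. F v t)"
    unfolding oscillatory_kernel_def oscillatory_integrand_def
  proof (intro Bochner_Integration.integral_cong refl)
    fix t :: real
    have "has_bochner_integral lborel (\<lambda>v. F v t) (Gamma (Complex 2 t) * of_real y powr (- Complex 2 t) * (exp (\<i> * pi * Complex 2 t / 2) * exp ((Complex 2 t - 1/2)\<^sup>2 / of_real (T\<^sup>2))))"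
      unfolding F_def by (intro has_bochner_integral_mult_left Gamma_log_Mellin) (use y in auto)
    from has_bochner_integral_integral_eq[OF this]
    show "of_real y powr (- Complex 2 t) * exp (\<i> * pi * Complex 2 t / 2) *
     Gamma (Complex 2 t) * exp ((Complex 2 t - 1/2)\<^sup>2 / of_real (T\<^sup>2)) = (LBINT v. F v t)" by (simp only: mult_ac)
  qed
  also have "\<dots> = (LBINT v. LBINT t. F v t)"
    by (rule Fubini_product_bound[OF m g h bd])
  also have "\<dots> = (LBINT v. of_real (sqrt pi * T) * gaussian_phase T y (Complex v (pi/2)))"
  proof (intro Bochner_Integration.integral_cong refl)
    fix v :: real
    \<comment> \<open>Moving v up by \<i> pi / 2 absorbs the factor exp (\<i> pi s / 2) into exp (s
      v), and - y exp v becomes \<i> y exp z.\<close>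
    define z where "z = Complex v (pi/2)"
    have z: "z = of_real v + \<i> * (of_real pi / 2)" by (simp add: z_def complex_eq_iff)
    have ez: "\<i> * of_real y * exp z = - of_real (y * exp v)"
    proof -
      have "exp z = of_real (exp v) * exp (\<i> * (of_real pi / 2))" unfolding z exp_add by (simp add: exp_of_real)
      also have "exp (\<i> * (of_real pi / 2)) = \<i>" by (simp add: exp_eq_polar)
      finally show ?thesis by (simp add: mult_ac)
    qed
    define R where "R = complex_of_real T"
    have R: "R \<noteq> 0" using T by (simp add: R_def)
    define b where "b = \<i> * (z + 3 / R\<^sup>2)"
    have F: "F v t = exp (\<i> * of_real y * exp z + 2 * z + 9 / (4 * R\<^sup>2)) * exp (- of_real (1 / T\<^sup>2 * t\<^sup>2) + b * of_real t)" for t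
    proof -
      define \<tau> where "\<tau> = complex_of_real t"
      have c: "Complex 2 t = 2 + \<i> * \<tau>" by (simp add: \<tau>_def complex_eq_iff)
      have "Complex 2 t * of_real v + (\<i> * pi * Complex 2 t / 2 + (Complex 2 t - 1/2)\<^sup>2 / of_real (T\<^sup>2)) =
          (2 + \<i> * \<tau>) * z + (3/2 + \<i> * \<tau>)\<^sup>2 / R\<^sup>2"
        unfolding c z by (simp add: R_def algebra_simps)
      also have "\<dots> = 2 * z + 9 / (4 * R\<^sup>2) + (- (1 / R\<^sup>2 * \<tau>\<^sup>2) + b * \<tau>)"
      proof -
        have "(3/2 + \<i> * \<tau>)\<^sup>2 = 9/4 + 3 * \<i> * \<tau> - \<tau>\<^sup>2" by (simp add: power2_eq_square algebra_simps)
        hence "(3/2 + \<i> * \<tau>)\<^sup>2 / R\<^sup>2 = 9 / (4 * R\<^sup>2) + 3 * \<i> * \<tau> / R\<^sup>2 - \<tau>\<^sup>2 / R\<^sup>2"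
          by (simp only: add_divide_distrib diff_divide_distrib) simp
        thus ?thesis by (simp add: b_def algebra_simps)
      qed
      finally have e: "Complex 2 t * of_real v + (\<i> * pi * Complex 2 t / 2 + (Complex 2 t - 1/2)\<^sup>2 / of_real (T\<^sup>2)) = 2 * z + 9 / (4 * R\<^sup>2) + (- (1 / R\<^sup>2 * \<tau>\<^sup>2) + b * \<tau>)" .
      have "- of_real (1 / T\<^sup>2 * t\<^sup>2) + b * of_real t = - (1 / R\<^sup>2 * \<tau>\<^sup>2) + b * \<tau>"
        by (simp add: R_def \<tau>_def)
      thus ?thesis
        unfolding F_def exp_add[symmetric] ez using e by (simp only: add.assoc)
    qed
    have "(LBINT t. F v t) = exp (\<i> * of_real y * exp z + 2 * z + 9 / (4 * R\<^sup>2)) * (of_real (sqrt (pi / (1 / T\<^sup>2))) * exp (b\<^sup>2 / (4 * of_real (1 / T\<^sup>2))))"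
      unfolding F integral_mult_right_zero
      using has_bochner_integral_integral_eq[OF gaussian_integral[of "1 / T\<^sup>2" b]] T by simp
    also have "sqrt (pi / (1 / T\<^sup>2)) = sqrt pi * T" using T by (simp add: real_sqrt_mult)
    also have "b\<^sup>2 / (4 * of_real (1 / T\<^sup>2)) = - (R\<^sup>2 * z\<^sup>2 / 4) - 3 * z / 2 - 9 / (4 * R\<^sup>2)"
    proof -
      have "b\<^sup>2 = - (z + 3 / R\<^sup>2)\<^sup>2" by (simp add: b_def power_mult_distrib)
      hence "b\<^sup>2 / (4 * of_real (1 / T\<^sup>2)) = - (z + 3 / R\<^sup>2)\<^sup>2 * R\<^sup>2 / 4" using T by (simp add: R_def)
      also have "\<dots> = - (R\<^sup>2 * z\<^sup>2 / 4) - 3 * z / 2 - 9 / (4 * R\<^sup>2)"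
        using R by (simp add: power2_eq_square field_simps)
      finally show ?thesis .
    qed
    finally have "(LBINT t. F v t) = of_real (sqrt pi * T) * (exp (\<i> * of_real y * exp z + 2 * z + 9 / (4 * R\<^sup>2)) * exp (- (R\<^sup>2 * z\<^sup>2 / 4) - 3 * z / 2 - 9 / (4 * R\<^sup>2)))"
      by (simp only: mult_ac)
    also have "exp (\<i> * of_real y * exp z + 2 * z + 9 / (4 * R\<^sup>2)) * exp (- (R\<^sup>2 * z\<^sup>2 / 4) - 3 * z / 2 - 9 / (4 * R\<^sup>2)) = gaussian_phase T y z"
    proof -
      have "E + 2 * z + c + (- q - 3 * z / 2 - c) = E + z / 2 - q" for E c q :: complex by simp
      thus ?thesis unfolding gaussian_phase_def exp_add[symmetric] by (simp only: R_def of_real_power)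
    qed
    finally show "(LBINT t. F v t) = of_real (sqrt pi * T) * gaussian_phase T y (Complex v (pi/2))" unfolding z_def .
  qed
  also have "\<dots> = of_real (sqrt pi * T) * (LBINT v. gaussian_phase T y (Complex v (pi/2)))"
    by (rule integral_mult_right_zero)
  finally show ?thesis .
qed

text \<open>In this strip sin (Im z) \<ge> 0, so \<i> y exp z has nonpositive real part and the
  Gaussian governs the size, uniformly in y. Half of the Gaussian absorbs the term z/2 through (T v
  / 2 - 1/T)^2 \<ge> 0, and the other half gives the decay 8 / (T v)^2.\<close>

lemma norm_gaussian_phase_le:
  assumes T: "T > 0" and y: "y > 0" and z: "0 \<le> Im z" "Im z \<le> pi / 2" "Re z \<noteq> 0"
  shows "norm (gaussian_phase T y z) \<le> (exp (1 / (2 * T\<^sup>2) + T\<^sup>2 * pi\<^sup>2 / 16) * (8 / T\<^sup>2)) / (Re z)\<^sup>2"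
proof -
  define v \<theta> where "v = Re z" and "\<theta> = Im z"
  have s: "0 \<le> sin \<theta>" using z by (intro sin_ge_zero) (auto simp: \<theta>_def)
  have R: "Re (\<i> * of_real y * exp z + z / 2 - of_real (T\<^sup>2) * z\<^sup>2 / 4) = - (y * exp v * sin \<theta>) + v / 2 - T\<^sup>2 * (v\<^sup>2 - \<theta>\<^sup>2) / 4"
  proof -
    have "Re (\<i> * of_real y * exp z) = - (y * exp v * sin \<theta>)" by (simp add: Im_exp v_def \<theta>_def)
    moreover have "Re (of_real (T\<^sup>2) * z\<^sup>2 / 4) = T\<^sup>2 * (v\<^sup>2 - \<theta>\<^sup>2) / 4"
    proof -
      have "of_real (T\<^sup>2) * z\<^sup>2 / 4 = of_real (T\<^sup>2 / 4) * z\<^sup>2" by simp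
      moreover have "Re (of_real (T\<^sup>2 / 4) * z\<^sup>2) = T\<^sup>2 / 4 * Re (z\<^sup>2)" unfolding times_complex.sel Re_complex_of_real Im_complex_of_real by simp
      ultimately show ?thesis by (simp add: Re_power2 v_def \<theta>_def)
    qed
    moreover have "Re (z / 2) = v / 2" by (simp add: v_def)
    ultimately show ?thesis by (simp only: plus_complex.sel minus_complex.sel)
  qed
  have "\<theta>\<^sup>2 \<le> (pi / 2)\<^sup>2" using z by (intro power_mono) (auto simp: \<theta>_def)
  hence a: "T\<^sup>2 * \<theta>\<^sup>2 \<le> T\<^sup>2 * (pi / 2)\<^sup>2" by (intro mult_left_mono) auto
  have "0 \<le> (T * v / 2 - 1 / T)\<^sup>2" by simp
  also have "\<dots> = T\<^sup>2 * v\<^sup>2 / 4 + 1 / T\<^sup>2 - v" using T by (simp add: power2_diff power_divide power_mult_distrib)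
  finally have b: "v / 2 \<le> T\<^sup>2 * v\<^sup>2 / 8 + 1 / (2 * T\<^sup>2)" by simp
  have c: "0 \<le> y * exp v * sin \<theta>" using y s by simp
  have "- (y * exp v * sin \<theta>) + v / 2 - T\<^sup>2 * (v\<^sup>2 - \<theta>\<^sup>2) / 4 \<le> (1 / (2 * T\<^sup>2) + T\<^sup>2 * pi\<^sup>2 / 16) - T\<^sup>2 * v\<^sup>2 / 8"
  proof -
    have "T\<^sup>2 * \<theta>\<^sup>2 / 4 \<le> T\<^sup>2 * pi\<^sup>2 / 16" using a by (simp add: power_divide)
    moreover have "T\<^sup>2 * (v\<^sup>2 - \<theta>\<^sup>2) / 4 = T\<^sup>2 * v\<^sup>2 / 4 - T\<^sup>2 * \<theta>\<^sup>2 / 4"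
      by (simp add: right_diff_distrib diff_divide_distrib)
    ultimately show ?thesis using b c by linarith
  qed
  hence "norm (gaussian_phase T y z) \<le> exp ((1 / (2 * T\<^sup>2) + T\<^sup>2 * pi\<^sup>2 / 16) - T\<^sup>2 * v\<^sup>2 / 8)"
    unfolding gaussian_phase_def norm_exp_eq_Re R by simp
  also have "\<dots> = exp (1 / (2 * T\<^sup>2) + T\<^sup>2 * pi\<^sup>2 / 16) * exp (- (T\<^sup>2 * v\<^sup>2 / 8))" by (simp flip: exp_add)
  also have "exp (- (T\<^sup>2 * v\<^sup>2 / 8)) \<le> (8 / T\<^sup>2) / v\<^sup>2"
  proof -
    define x where "x = T\<^sup>2 * v\<^sup>2 / 8"
    have x: "x > 0" using T z by (simp add: x_def v_def)
    have "x \<le> exp x" using power_le_fact_exp[of x 1] x by simp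
    hence "exp (- x) \<le> 1 / x" using x by (simp add: exp_minus field_simps)
    also have "1 / x = (8 / T\<^sup>2) / v\<^sup>2" by (simp add: x_def)
    finally show ?thesis by (simp only: x_def)
  qed
  finally show ?thesis by (simp add: v_def)
qed

text \<open>The phase is entire and decays in the strip, so the line may descend from pi/2 to 1/T.
  At that height T^2 z^2 has bounded imaginary shift while \<i> y exp z is still damped at rate
  about y/T; rescaling v = w/T uses up the factor T in front.\<close>

lemma oscillatory_kernel_eq:
  assumes T: "T > 1" and y: "y > 0"
  shows "integrable lborel (\<lambda>w. gaussian_phase T y (Complex (w / T) (1 / T)))"
    and "oscillatory_kernel T y = of_real (sqrt pi) * (LBINT w. gaussian_phase T y (Complex (w / T) (1 / T)))"
proof -
  \<comment> \<open>A quarter turn, so that the height a of a horizontal line becomes the abscissa -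
    a of a vertical one.\<close>
  define f where "f \<zeta> = gaussian_phase T y (- \<i> * \<zeta>)" for \<zeta>
  have f: "f (Complex a t) = gaussian_phase T y (Complex t (- a))" for a t
    by (simp add: f_def Complex_eq algebra_simps)
  have T1: "1 / T < 1" using T by simp
  \<comment> \<open>The midpoint of the strip serves as exceptional point; \<open>f\<close> is
    entire, so its residue there is 0.\<close>
  define z0 where "z0 = complex_of_real (- (1 / T + pi / 2) / 2)"
  have ab: "- (pi / 2) < Re z0" "Re z0 < - (1 / T)" using T1 pi_gt3 by (auto simp: z0_def)
  have h: "f holomorphic_on UNIV" unfolding f_def gaussian_phase_def by (intro holomorphic_intros) auto
  have h': "f holomorphic_on UNIV - {z0}" by (rule holomorphic_on_subset[OF h]) auto
  have bd: "norm (f z) \<le> (exp (1 / (2 * T\<^sup>2) + T\<^sup>2 * pi\<^sup>2 / 16) * (8 / T\<^sup>2)) / (Im z)\<^sup>2"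
    if z: "- (pi / 2) \<le> Re z" "Re z \<le> - (1 / T)" "\<bar>Im z\<bar> \<ge> 1" for z
  proof -
    have "0 < 1 / T" using T by simp
    hence "Re z \<le> 0" "Im z \<noteq> 0" using z by linarith+
    thus ?thesis using norm_gaussian_phase_le[of T y "- \<i> * z"] z T y by (simp add: f_def)
  qed
  note sh = vertical_line_shift[OF ab open_UNIV connected_UNIV _ h' bd]
  have i: "integrable lborel (\<lambda>t. gaussian_phase T y (Complex t (1 / T)))" using sh(3) by (simp add: f)
  have e: "(LBINT v. gaussian_phase T y (Complex v (pi/2))) = (LBINT v. gaussian_phase T y (Complex v (1 / T)))"
    using sh(1) residue_holo[OF open_UNIV _ h, of z0] by (simp add: f)
  have d: "1 / T \<noteq> 0" using T by simp
  show "integrable lborel (\<lambda>w. gaussian_phase T y (Complex (w / T) (1 / T)))"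
    using lborel_integrable_real_affine[OF i d, of 0] by simp
  have "oscillatory_kernel T y = of_real (sqrt pi * T) * (LBINT v. gaussian_phase T y (Complex v (1 / T)))"
    using oscillatory_kernel_eq_phase[of T y] T y e by simp
  also have "(LBINT v. gaussian_phase T y (Complex v (1 / T))) = (1 / T) *\<^sub>R (LBINT w. gaussian_phase T y (Complex (w / T) (1 / T)))"
    using lborel_integral_real_affine[OF d, of "\<lambda>v. gaussian_phase T y (Complex v (1 / T))" 0] T by simp
  finally show "oscillatory_kernel T y = of_real (sqrt pi) * (LBINT w. gaussian_phase T y (Complex (w / T) (1 / T)))"
    using T by (simp add: scaleR_conv_of_real)
qed

text \<open>Write exp (A + U/2) - exp B as exp A (exp (U/2) - 1) + (exp A - exp B), with
  \<bar>U\<bar> at most (\<bar>w\<bar> + 1)/T. The first part is of size 1/T. The second is of size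
  y \<bar>U\<bar>^2, that is y/T^2, and the surplus y/T is paid for by taking one more power of T/y
  from the damping exp (- y0).\<close>

lemma gaussian_phase_shifted_bound:
  assumes T: "T > 1" and y: "y > 0" and \<delta>: "0 < \<delta>" "\<delta> < 1"
  defines "u w \<equiv> Complex (w / T) (1 / T)"
  shows "norm (gaussian_phase T y (u w) - exp (\<i> * of_real y * (1 + u w) - of_real (T\<^sup>2) * (u w)\<^sup>2 / 4))
     \<le> (1 / T * (T / y) powr (1 + \<delta>)) * (224 * exp (5 * \<bar>w\<bar> + 2 + (1 - w\<^sup>2) / 4))"
proof -
  define U where "U = u w"
  have U: "Re U = w / T" "Im U = 1 / T" by (simp_all add: U_def u_def)
  have T1: "0 < 1 / T" "1 / T < 1" using T by auto
  have "\<bar>w\<bar> * 1 \<le> \<bar>w\<bar> * T" using T by (intro mult_left_mono) auto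
  hence wT: "\<bar>w / T\<bar> \<le> \<bar>w\<bar>" using T by (simp add: field_simps)
  define n where "n = norm U"
  have n1: "n \<le> (\<bar>w\<bar> + 1) / T"
  proof -
    have "n \<le> \<bar>w / T\<bar> + \<bar>1 / T\<bar>" using cmod_le[of U] by (simp add: n_def U)
    thus ?thesis using T by (simp add: add_divide_distrib)
  qed
  have n2: "n \<le> \<bar>w\<bar> + 1" using cmod_le[of U] wT T1 unfolding n_def U by linarith
  have n0: "0 \<le> n" by (simp add: n_def)
  \<comment> \<open>A common lower bound for the damping of both exponentials: sin (1/T) \<ge> 1/(2
    T) and exp (w/T) \<ge> exp (- \<bar>w\<bar>).\<close>
  define y0 where "y0 = y * exp (- \<bar>w\<bar>) / (2 * T)"
  have y0: "y0 > 0" using y T by (simp add: y0_def)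
  define A B where "A = \<i> * of_real y * exp U" and "B = \<i> * of_real y * (1 + U)"
  have "1 / T / 2 \<le> sin (1 / T)" using T1 by (intro half_le_sin) auto
  moreover have "exp (- \<bar>w\<bar>) \<le> exp (w / T)" unfolding exp_le_cancel_iff using wT by linarith
  ultimately have "y * (exp (- \<bar>w\<bar>) * (1 / T / 2)) \<le> y * (exp (w / T) * sin (1 / T))"
    using y T by (intro mult_left_mono mult_mono) auto
  hence ReA: "Re A \<le> - y0" by (simp add: A_def U Im_exp y0_def mult.assoc)
  have ReB: "Re B \<le> - y0"
  proof -
    have "exp (- \<bar>w\<bar>) \<le> exp 0" by (subst exp_le_cancel_iff) simp
    hence "exp (- \<bar>w\<bar>) / 2 \<le> 1" unfolding exp_zero by linarith
    hence "y / T * (exp (- \<bar>w\<bar>) / 2) \<le> y / T * 1" using y T by (intro mult_left_mono) auto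
    thus ?thesis by (simp add: B_def U y0_def)
  qed
  have en: "exp n \<le> exp (\<bar>w\<bar> + 1)" using n2 by simp
  \<comment> \<open>The range of k covers both exponents needed, 1 + \<delta> and 2 + \<delta>. The
    constant is 56 = 7 * 2^3, and the cube of exp \<bar>w\<bar> comes from the same power.\<close>
  have K: "exp (- y0) \<le> 56 * exp (3 * \<bar>w\<bar>) * (T / y) powr k" if k: "0 \<le> k" "k \<le> 3" for k
  proof -
    have "exp (- y0) \<le> 7 * y0 powr (- k)" by (rule exp_minus_le_powr[OF y0 k])
    also have "y0 powr (- k) = (T / y * (2 * exp \<bar>w\<bar>)) powr k"
    proof -
      have "y0 powr (- k) = (1 / y0) powr k" using y0 by (simp add: powr_minus powr_divide field_simps)
      moreover have "1 / y0 = T / y * (2 * exp \<bar>w\<bar>)" using y T by (simp add: y0_def exp_minus field_simps)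
      ultimately show ?thesis by simp
    qed
    also have "\<dots> = (2 * exp \<bar>w\<bar>) powr k * (T / y) powr k" using y T by (subst powr_mult) (auto simp: mult_ac)
    also have "(2 * exp \<bar>w\<bar>) powr k \<le> (2 * exp \<bar>w\<bar>) powr 3"
    proof (rule powr_mono)
      show "1 \<le> 2 * exp \<bar>w\<bar>" using one_le_exp_iff[of "\<bar>w\<bar>"] abs_ge_zero[of w] by linarith
    qed (use k in auto)
    also have "(2 * exp \<bar>w\<bar>) powr 3 = 8 * exp (3 * \<bar>w\<bar>)"
      by (simp add: powr_numeral power_mult_distrib flip: exp_of_nat_mult)
    finally show ?thesis by (simp add: mult_right_mono)
  qed
  define Q where "Q = (T / y) powr (1 + \<delta>)"
  have Q: "Q \<ge> 0" by (simp add: Q_def)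
  define W where "W = \<bar>w\<bar> + 1"
  have W: "W \<ge> 1" by (simp add: W_def)
  have t1: "norm (exp A * (exp (U / 2) - 1)) \<le> 56 * exp (3 * \<bar>w\<bar>) * Q * (W / T * exp W)"
  proof -
    have "norm (exp (U / 2) - 1) \<le> norm (U / 2) * exp (norm (U / 2))" by (rule norm_exp_minus_1_le)
    also have "\<dots> \<le> (W / T) * exp W"
    proof (intro mult_mono)
      have "norm (U / 2) \<le> n" by (simp add: n_def norm_divide)
      thus "norm (U / 2) \<le> W / T" using n1 unfolding W_def by (rule order_trans)
      have "norm (U / 2) \<le> W" using n2 n0 by (simp add: n_def W_def norm_divide)
      thus "exp (norm (U / 2)) \<le> exp W" by simp
    qed (use W T in auto)
    finally have 1: "norm (exp (U / 2) - 1) \<le> W / T * exp W" .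
    have "norm (exp A) \<le> exp (- y0)" using ReA by simp
    also have "\<dots> \<le> 56 * exp (3 * \<bar>w\<bar>) * Q" unfolding Q_def using \<delta> by (intro K) auto
    finally show ?thesis unfolding norm_mult using 1 Q by (intro mult_mono) auto
  qed
  have t2: "norm (exp A - exp B) \<le> 56 * exp (3 * \<bar>w\<bar>) * Q * (W\<^sup>2 / T * exp W)"
  proof -
    have "norm (exp A - exp B) \<le> exp (- y0) * norm (A - B)" by (rule norm_exp_diff_le[OF ReA ReB])
    also have "norm (A - B) = y * norm (exp U - (1 + U))"
    proof -
      have "A - B = \<i> * of_real y * (exp U - (1 + U))" by (simp add: A_def B_def algebra_simps)
      thus ?thesis using y by (simp add: norm_mult)
    qed
    also have "exp (- y0) * (y * norm (exp U - (1 + U))) \<le> (56 * exp (3 * \<bar>w\<bar>) * (T / y) powr (2 + \<delta>)) * (y * ((W / T)\<^sup>2 * exp W))"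
    proof (intro mult_mono mult_left_mono)
      show "exp (- y0) \<le> 56 * exp (3 * \<bar>w\<bar>) * (T / y) powr (2 + \<delta>)" using \<delta> by (intro K) auto
      have "norm (exp U - (1 + U)) \<le> n\<^sup>2 * exp n" unfolding n_def by (rule norm_exp_minus_linear_le)
      also have "\<dots> \<le> (W / T)\<^sup>2 * exp W" using n1 n0 en by (intro mult_mono power_mono) (auto simp: W_def)
      finally show "norm (exp U - (1 + U)) \<le> (W / T)\<^sup>2 * exp W" .
    qed (use y T in auto)
    also have "(T / y) powr (2 + \<delta>) = T / y * Q"
    proof -
      have "2 + \<delta> = 1 + (1 + \<delta>)" by simp
      thus ?thesis unfolding Q_def using y T by (simp only: powr_add) simp
    qed
    also have "(56 * exp (3 * \<bar>w\<bar>) * (T / y * Q)) * (y * ((W / T)\<^sup>2 * exp W)) = 56 * exp (3 * \<bar>w\<bar>) * Q * (W\<^sup>2 / T * exp W)"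
      using y T by (simp add: power2_eq_square)
    finally show ?thesis .
  qed
  have q: "norm (exp (- (of_real (T\<^sup>2) * U\<^sup>2 / 4))) = exp ((1 - w\<^sup>2) / 4)"
  proof -
    have "of_real (T\<^sup>2) * U\<^sup>2 / 4 = of_real (T\<^sup>2 / 4) * U\<^sup>2" by simp
    hence "Re (of_real (T\<^sup>2) * U\<^sup>2 / 4) = T\<^sup>2 / 4 * Re (U\<^sup>2)"
      by (simp only: times_complex.sel Re_complex_of_real Im_complex_of_real mult_zero_left diff_zero)
    also have "\<dots> = (w\<^sup>2 - 1) / 4" using T by (simp add: Re_power2 U power_divide field_simps)
    finally have a: "Re (of_real (T\<^sup>2) * U\<^sup>2 / 4) = (w\<^sup>2 - 1) / 4" .
    have "Re (- (of_real (T\<^sup>2) * U\<^sup>2 / 4)) = - ((w\<^sup>2 - 1) / 4)" by (simp only: uminus_complex.sel a)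
    also have "\<dots> = (1 - w\<^sup>2) / 4" unfolding diff_divide_distrib minus_diff_eq by simp
    finally have "Re (- (of_real (T\<^sup>2) * U\<^sup>2 / 4)) = (1 - w\<^sup>2) / 4" .
    thus ?thesis by (simp only: norm_exp_eq_Re)
  qed
  have "gaussian_phase T y U - exp (B - of_real (T\<^sup>2) * U\<^sup>2 / 4)
       = (exp A * (exp (U / 2) - 1) + (exp A - exp B)) * exp (- (of_real (T\<^sup>2) * U\<^sup>2 / 4))"
    unfolding gaussian_phase_def A_def[symmetric] diff_conv_add_uminus exp_add by (simp add: algebra_simps)
  hence "norm (gaussian_phase T y U - exp (B - of_real (T\<^sup>2) * U\<^sup>2 / 4)) = norm (exp A * (exp (U / 2) - 1) + (exp A - exp B)) * exp ((1 - w\<^sup>2) / 4)"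
    by (simp only: norm_mult q)
  also have "\<dots> \<le> (56 * exp (3 * \<bar>w\<bar>) * Q * (W / T * exp W) + 56 * exp (3 * \<bar>w\<bar>) * Q * (W\<^sup>2 / T * exp W)) * exp ((1 - w\<^sup>2) / 4)"
    by (intro mult_right_mono order_trans[OF norm_triangle_ineq add_mono[OF t1 t2]]) auto
  also have "\<dots> = (56 * exp (3 * \<bar>w\<bar>) * (Q / T) * exp W * exp ((1 - w\<^sup>2) / 4)) * (W + W\<^sup>2)"
    by (simp add: distrib_left distrib_right add_divide_distrib mult_ac)
  also have "\<dots> \<le> (56 * exp (3 * \<bar>w\<bar>) * (Q / T) * exp W * exp ((1 - w\<^sup>2) / 4)) * (4 * exp W)"
  proof (rule mult_left_mono)
    have "W \<le> W\<^sup>2" using W by (simp add: power2_eq_square)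
    moreover have "W\<^sup>2 \<le> 2 * exp W" using power_le_fact_exp[of W 2] W by simp
    ultimately show "W + W\<^sup>2 \<le> 4 * exp W" by linarith
  qed (use Q T in auto)
  also have "\<dots> = (1 / T * Q) * (224 * (exp (3 * \<bar>w\<bar>) * exp W * exp ((1 - w\<^sup>2) / 4) * exp W))" by (simp add: mult_ac)
  also have "exp (3 * \<bar>w\<bar>) * exp W * exp ((1 - w\<^sup>2) / 4) * exp W = exp (5 * \<bar>w\<bar> + 2 + (1 - w\<^sup>2) / 4)"
    unfolding W_def by (simp add: add_divide_distrib diff_divide_distrib flip: exp_add)
  finally show ?thesis unfolding U_def[symmetric] Q_def B_def .
qed

text \<open>After linearisation the integrand is a pure Gaussian in w and is integrated exactly; the
  factor exp (- y/T) caused by the height of the line cancels against the cross term of the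
  completed square.\<close>

lemma oscillatory_kernel_main_term:
  assumes T: "T > 1"
  defines "u w \<equiv> Complex (w / T) (1 / T)"
  shows "has_bochner_integral lborel (\<lambda>w. exp (\<i> * of_real y * (1 + u w) - of_real (T\<^sup>2) * (u w)\<^sup>2 / 4))
           (of_real (2 * sqrt pi * exp (- ((y / T)\<^sup>2))) * exp (\<i> * of_real y))"
proof -
  define b where "b = \<i> * (of_real (y / T) - 1/2)"
  have e: "exp (\<i> * of_real y * (1 + u w) - of_real (T\<^sup>2) * (u w)\<^sup>2 / 4) =
      exp (- of_real (1/4 * w\<^sup>2) + b * of_real w) * exp (\<i> * of_real y - of_real (y / T) + 1/4)" for w
  proof -
    have c: "of_real T * u w = of_real w + \<i>" using T by (simp add: u_def complex_eq_iff)
    have U: "u w = (of_real w + \<i>) / of_real T" using T by (simp flip: c)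
    have "of_real (T\<^sup>2) * (u w)\<^sup>2 = (of_real w + \<i>)\<^sup>2" unfolding of_real_power power_mult_distrib[symmetric] c ..
    also have "\<dots> = of_real w ^ 2 + 2 * \<i> * of_real w - 1" by (simp add: power2_eq_square algebra_simps)
    finally have "\<i> * of_real y * (1 + u w) - of_real (T\<^sup>2) * (u w)\<^sup>2 / 4 = \<i> * of_real y * (1 + u w) - (of_real w ^ 2 + 2 * \<i> * of_real w - 1) / 4" by simp
    also have "\<dots> = \<i> * of_real y + (\<i> * of_real w * of_real (y / T) - of_real (y / T)) - (of_real w ^ 2 + 2 * \<i> * of_real w - 1) / 4"
    proof -
      have "\<i> * of_real y * (1 + u w) = \<i> * of_real y + (\<i> * of_real w * of_real (y / T) - of_real (y / T))"
        unfolding U using T by (simp add: field_simps)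
      thus ?thesis by (simp only:)
    qed
    also have "\<dots> = (- of_real (1/4 * w\<^sup>2) + b * of_real w) + (\<i> * of_real y - of_real (y / T) + 1/4)"
      by (simp add: b_def algebra_simps add_divide_distrib diff_divide_distrib)
    finally show ?thesis by (simp only: exp_add[of "- of_real (1/4 * w\<^sup>2) + b * of_real w"])
  qed
  have "has_bochner_integral lborel (\<lambda>w. exp (\<i> * of_real y * (1 + u w) - of_real (T\<^sup>2) * (u w)\<^sup>2 / 4))
     ((of_real (sqrt (pi / (1/4))) * exp (b\<^sup>2 / (4 * of_real (1/4)))) * exp (\<i> * of_real y - of_real (y / T) + 1/4))"
    unfolding e by (intro has_bochner_integral_mult_left gaussian_integral) auto
  moreover have "sqrt (pi / (1/4)) = 2 * sqrt pi" by (simp add: real_sqrt_mult)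
  moreover have "exp (b\<^sup>2 / (4 * of_real (1/4))) * exp (\<i> * of_real y - of_real (y / T) + 1/4) = of_real (exp (- ((y / T)\<^sup>2))) * exp (\<i> * of_real y)"
  proof -
    have "b\<^sup>2 = - (of_real (y / T) - 1/2)\<^sup>2" by (simp add: b_def power_mult_distrib)
    also have "\<dots> = - (of_real (y / T))\<^sup>2 + of_real (y / T) - 1/4" by (simp add: power2_eq_square algebra_simps)
    finally have "b\<^sup>2 / (4 * of_real (1/4)) + (\<i> * of_real y - of_real (y / T) + 1/4) = of_real (- ((y / T)\<^sup>2)) + \<i> * of_real y"
      by simp
    thus ?thesis unfolding exp_add[symmetric] exp_of_real[symmetric] by (simp only:)
  qed
  ultimately show ?thesis by (simp only: mult.assoc of_real_mult)
qed

text \<open>The exponent 1 + \<delta> makes the errors summable when y runs through multiples of m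
  n. The majorant \<open>G\<close> is Gaussian in w and free of T, y and \<delta>, so a single
  constant serves for all of them.\<close>

lemma oscillatory_kernel_asymptotics:
  "\<exists>C\<ge>0. \<forall>T>1. \<forall>y>0. \<forall>\<delta>. 0 < \<delta> \<longrightarrow> \<delta> < 1 \<longrightarrow>
     norm (oscillatory_kernel T y - of_real (2 * pi * exp (- ((y / T)\<^sup>2))) * exp (\<i> * of_real y)) \<le> C * (1 / T * (T / y) powr (1 + \<delta>))"
proof -
  define G :: "real \<Rightarrow> real" where "G w = 224 * exp (5 * \<bar>w\<bar> + 2 + (1 - w\<^sup>2) / 4)" for w
  have G: "integrable lborel G"
  proof (rule Bochner_Integration.integrable_bound)
    show "integrable lborel (\<lambda>w::real. 224 * exp (9/4) * (exp (5 * w - 1/4 * w\<^sup>2) + exp (- 5 * w - 1/4 * w\<^sup>2)))"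
      by (intro integrable_mult_right Bochner_Integration.integrable_add integrable_exp_gaussian) auto
    show "G \<in> borel_measurable lborel" unfolding G_def by measurable
    have "G w = 224 * exp (9/4) * exp (5 * \<bar>w\<bar> - 1/4 * w\<^sup>2)" for w
      unfolding G_def by (simp add: add_divide_distrib diff_divide_distrib flip: exp_add)
    moreover have "exp (5 * \<bar>w\<bar> - 1/4 * w\<^sup>2) \<le> exp (5 * w - 1/4 * w\<^sup>2) + exp (- 5 * w - 1/4 * w\<^sup>2)" for w :: real
      by (cases "w \<ge> 0") (simp_all add: abs_if)
    ultimately show "AE w in lborel. norm (G w) \<le> norm (224 * exp (9/4) * (exp (5 * w - 1/4 * w\<^sup>2) + exp (- 5 * w - 1/4 * w\<^sup>2)))"
      by (intro AE_I2) (simp add: mult_left_mono)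
  qed
  show ?thesis
  proof (rule exI[of _ "sqrt pi * (LBINT w. G w)"], intro conjI allI impI)
    show "0 \<le> sqrt pi * (LBINT w. G w)" by (auto simp: G_def)
    fix T y \<delta> :: real assume T: "T > 1" and y: "y > 0" and \<delta>: "0 < \<delta>" "\<delta> < 1"
    define u where "u w = Complex (w / T) (1 / T)" for w
    define M where "M w = exp (\<i> * of_real y * (1 + u w) - of_real (T\<^sup>2) * (u w)\<^sup>2 / 4)" for w
    define q where "q = 1 / T * (T / y) powr (1 + \<delta>)"
    note gaussian_phase_int = oscillatory_kernel_eq[OF T y, folded u_def]
    have M_int: "has_bochner_integral lborel M (of_real (2 * sqrt pi * exp (- ((y / T)\<^sup>2))) * exp (\<i> * of_real y))"
      unfolding M_def[abs_def] u_def by (rule oscillatory_kernel_main_term[OF T])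
    have "of_real (2 * pi * exp (- ((y / T)\<^sup>2))) * exp (\<i> * of_real y) = of_real (sqrt pi) * (LBINT w. M w)"
    proof -
      have p: "2 * pi * exp (- ((y / T)\<^sup>2)) = sqrt pi * (2 * sqrt pi * exp (- ((y / T)\<^sup>2)))" by simp
      show ?thesis unfolding p by (simp only: has_bochner_integral_integral_eq[OF M_int] of_real_mult mult.assoc)
    qed
    hence "oscillatory_kernel T y - of_real (2 * pi * exp (- ((y / T)\<^sup>2))) * exp (\<i> * of_real y) =
       of_real (sqrt pi) * (LBINT w. gaussian_phase T y (u w) - M w)"
      using gaussian_phase_int M_int by (simp add: has_bochner_integral_iff right_diff_distrib)
    hence "norm (oscillatory_kernel T y - of_real (2 * pi * exp (- ((y / T)\<^sup>2))) * exp (\<i> * of_real y)) = sqrt pi * norm (LBINT w. gaussian_phase T y (u w) - M w)"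
      by (simp add: norm_mult)
    also have "norm (LBINT w. gaussian_phase T y (u w) - M w) \<le> (LBINT w. q * G w)"
    proof (rule Bochner_Integration.integral_norm_bound_integral)
      show "integrable lborel (\<lambda>w. gaussian_phase T y (u w) - M w)"
        using gaussian_phase_int(1) M_int by (intro Bochner_Integration.integrable_diff) (auto simp: has_bochner_integral_iff)
      show "integrable lborel (\<lambda>w. q * G w)" using G by simp
      show "norm (gaussian_phase T y (u w) - M w) \<le> q * G w" for w
        unfolding M_def u_def q_def G_def by (rule gaussian_phase_shifted_bound[OF T y \<delta>])
    qed
    finally show "norm (oscillatory_kernel T y - of_real (2 * pi * exp (- ((y / T)\<^sup>2))) * exp (\<i> * of_real y)) \<le>
        sqrt pi * (LBINT w. G w) * (1 / T * (T / y) powr (1 + \<delta>))" by (simp add: q_def mult_ac)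
  qed
qed

section \<open>The twisted second moment as a divisor sum\<close>

text \<open>
  The first four factors are \<open>zeta (1 - s) / zeta s\<close>; on the critical line they turn \<open>zeta s ^ 2\<close> into
  \<open>\<bar>zeta s\<bar>^2\<close>, which makes the integrand holomorphic.
\<close>

definition zeta_twist_kernel :: "real \<Rightarrow> real \<Rightarrow> complex \<Rightarrow> complex" where
  "zeta_twist_kernel r T s = 2 * (2 * of_real pi) powr (- s) * cos (of_real pi * s / 2) * Gamma s *
     of_real r powr (s - 1/2) * exp ((s - 1/2)\<^sup>2 / of_real (T\<^sup>2))"

lemma zeta_twist_kernel_holomorphic:
  assumes "r > 0" "T > 0"
  shows "zeta_twist_kernel r T holomorphic_on {s. Re s > 0}"
proof -
  have "(\<lambda>s. 2 * exp (- s * of_real (ln (2 * pi))) * cos (pi * s / 2) * Gamma s * exp ((s - 1/2) * of_real (ln r)) * exp ((s - 1/2)\<^sup>2 / of_real (T\<^sup>2))) holomorphic_on {s. Re s > 0}"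
    using assms by (intro holomorphic_intros) (auto elim!: nonpos_Ints_cases)
  moreover have "complex_of_real (2 * pi) powr (- s) = exp (- s * of_real (ln (2 * pi)))" for s
    by (rule powr_of_real_exp) auto
  moreover have "complex_of_real r powr (s - 1/2) = exp ((s - 1/2) * of_real (ln r))" for s
    by (rule powr_of_real_exp) (use assms in auto)
  ultimately show ?thesis unfolding zeta_twist_kernel_def[abs_def] by simp
qed

lemma norm_cos_le_exp: "norm (cos (z :: complex)) \<le> exp \<bar>Im z\<bar>"
proof -
  have "norm (cos z) \<le> (norm (exp (\<i> * z)) + norm (exp (- (\<i> * z)))) / 2"
    unfolding cos_exp_eq norm_divide by (simp add: norm_triangle_ineq del: norm_exp_eq_Re)
  also have "\<dots> = (exp (- Im z) + exp (Im z)) / 2" by simp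
  also have "\<dots> \<le> exp \<bar>Im z\<bar>"
  proof -
    have "exp (- Im z) \<le> exp \<bar>Im z\<bar>" "exp (Im z) \<le> exp \<bar>Im z\<bar>" by auto
    hence "exp (- Im z) + exp (Im z) \<le> exp \<bar>Im z\<bar> + exp \<bar>Im z\<bar>" by (rule add_mono)
    thus ?thesis by simp
  qed
  finally show ?thesis .
qed

text \<open>Gamma is merely bounded here, and the growth exp (pi t / 2) of the cosine is beaten by
  the Gaussian through (t/T - pi T / 2)^2 \<ge> 0. The constant is exponential in T^2, which is
  harmless: the bound only justifies moving the line.\<close>

lemma zeta_twist_kernel_bound:
  assumes r: "r > 0" and T: "T > 0"
  shows "\<exists>B. \<forall>z. 1/2 \<le> Re z \<longrightarrow> Re z \<le> 2 \<longrightarrow> \<bar>Im z\<bar> \<ge> 1 \<longrightarrow> norm (zeta_twist_kernel r T z) \<le> B / \<bar>Im z\<bar> ^ 4"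
proof -
  have h: "(0::real) < 1/2" by simp
  obtain C where C: "C > 0" and C1: "\<And>z. 1/2 \<le> Re z \<Longrightarrow> Re z \<le> 2 \<Longrightarrow> norm (Gamma z) \<le> C"
    and "\<And>z. 1/2 \<le> Re z \<Longrightarrow> Re z \<le> 2 \<Longrightarrow> Im z \<noteq> 0 \<Longrightarrow> norm (Gamma z) \<le> C / \<bar>Im z\<bar> ^ 4"
    by (rule Gamma_strip_bound[OF h, where b = 2 and k = 4]) (rule that)
  show ?thesis
  proof (rule exI[of _ "2 * C * (1 + r) powr 2 * exp (9 / (4 * T\<^sup>2) + pi\<^sup>2 * T\<^sup>2 / 8) * (8 * T ^ 4)"], intro allI impI)
    fix z :: complex assume z: "1/2 \<le> Re z" "Re z \<le> 2" "\<bar>Im z\<bar> \<ge> 1"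
    define t where "t = \<bar>Im z\<bar>"
    have t: "t \<ge> 1" using z by (simp add: t_def)
    have n1: "norm (complex_of_real (2 * pi) powr (- z)) \<le> 1"
    proof -
      have "(2 * pi) powr (- Re z) \<le> (2 * pi) powr 0" using pi_gt3 z by (intro powr_mono) auto
      thus ?thesis using norm_of_real_powr_Complex[of "2 * pi" "- z"] by simp
    qed
    have n2: "norm (cos (pi * z / 2)) \<le> exp (pi * t / 2)"
      using norm_cos_le_exp[of "pi * z / 2"] by (simp add: t_def abs_mult)
    have n3: "norm (complex_of_real r powr (z - 1/2)) \<le> (1 + r) powr 2"
    proof -
      have "norm (complex_of_real r powr (z - 1/2)) = r powr (Re z - 1/2)" using norm_of_real_powr_Complex[OF r] by simp
      also have "\<dots> \<le> (1 + r) powr (Re z - 1/2)" using r z by (intro powr_mono2) auto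
      also have "\<dots> \<le> (1 + r) powr 2" using r z by (intro powr_mono) auto
      finally show ?thesis .
    qed
    have n4: "norm (exp ((z - 1/2)\<^sup>2 / of_real (T\<^sup>2))) \<le> exp (9 / (4 * T\<^sup>2) - t\<^sup>2 / T\<^sup>2)"
    proof -
      have "(Re z - 1/2)\<^sup>2 \<le> (3/2)\<^sup>2" using z by (intro power_mono) auto
      hence "((Re z - 1/2)\<^sup>2 - t\<^sup>2) / T\<^sup>2 \<le> (9/4 - t\<^sup>2) / T\<^sup>2" by (intro divide_right_mono) (auto simp: power_divide)
      moreover have "Re ((z - 1/2)\<^sup>2 / of_real (T\<^sup>2)) = ((Re z - 1/2)\<^sup>2 - t\<^sup>2) / T\<^sup>2"
        unfolding Re_divide_of_real Re_power2 by (simp add: t_def)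
      ultimately show ?thesis by (simp add: diff_divide_distrib)
    qed
    have e: "exp (pi * t / 2) * exp (9 / (4 * T\<^sup>2) - t\<^sup>2 / T\<^sup>2) \<le> exp (9 / (4 * T\<^sup>2) + pi\<^sup>2 * T\<^sup>2 / 8) * (8 * T ^ 4 / t ^ 4)"
    proof -
      define x where "x = t\<^sup>2 / (2 * T\<^sup>2)"
      have x: "x > 0" using T t by (simp add: x_def)
      have "0 \<le> (t / T - pi * T / 2)\<^sup>2" by simp
      also have "\<dots> = 2 * x + pi\<^sup>2 * T\<^sup>2 / 4 - pi * t" using T by (simp add: x_def power2_diff power_divide power_mult_distrib)
      finally have 1: "pi * t / 2 \<le> x + pi\<^sup>2 * T\<^sup>2 / 8" by linarith
      have 2: "t\<^sup>2 / T\<^sup>2 = 2 * x" by (simp add: x_def)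
      have "exp (pi * t / 2) * exp (9 / (4 * T\<^sup>2) - t\<^sup>2 / T\<^sup>2) \<le> exp (9 / (4 * T\<^sup>2) + pi\<^sup>2 * T\<^sup>2 / 8) * exp (- x)"
        unfolding exp_add[symmetric] exp_le_cancel_iff 2 using 1 by linarith
      also have "exp (- x) \<le> 2 / x\<^sup>2"
        using power_le_fact_exp[of x 2] x by (simp add: exp_minus field_simps)
      also have "2 / x\<^sup>2 = 8 * T ^ 4 / t ^ 4" by (simp add: x_def power_divide power_mult_distrib flip: power_mult)
      finally show ?thesis by simp
    qed
    have "norm (zeta_twist_kernel r T z) = 2 * norm (complex_of_real (2 * pi) powr (- z)) * norm (cos (pi * z / 2)) * norm (Gamma z) *
        norm (complex_of_real r powr (z - 1/2)) * norm (exp ((z - 1/2)\<^sup>2 / of_real (T\<^sup>2)))"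
      by (simp add: zeta_twist_kernel_def norm_mult del: norm_exp_eq_Re)
    also have "\<dots> \<le> 2 * 1 * exp (pi * t / 2) * C * (1 + r) powr 2 * exp (9 / (4 * T\<^sup>2) - t\<^sup>2 / T\<^sup>2)"
      using z C by (intro mult_mono n1 n2 n3 n4 C1) auto
    also have "\<dots> = 2 * C * (1 + r) powr 2 * (exp (pi * t / 2) * exp (9 / (4 * T\<^sup>2) - t\<^sup>2 / T\<^sup>2))" by simp
    also have "\<dots> \<le> 2 * C * (1 + r) powr 2 * (exp (9 / (4 * T\<^sup>2) + pi\<^sup>2 * T\<^sup>2 / 8) * (8 * T ^ 4 / t ^ 4))"
      using C by (intro mult_left_mono e) auto
    finally show "norm (zeta_twist_kernel r T z) \<le> 2 * C * (1 + r) powr 2 * exp (9 / (4 * T\<^sup>2) + pi\<^sup>2 * T\<^sup>2 / 8) * (8 * T ^ 4) / \<bar>Im z\<bar> ^ 4"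
      by (simp add: t_def)
  qed
qed

lemma zeta_twist_kernel_critical_line:
  assumes T: "T > 0"
  shows "zeta_twist_kernel r T (Complex (1/2) t) * (zeta (Complex (1/2) t))\<^sup>2 =
     of_real r powr (\<i> * of_real t) * of_real ((norm (zeta (1/2 + \<i> * of_real t)))\<^sup>2) * of_real (exp (- (t\<^sup>2 / T\<^sup>2)))"
proof -
  define s where "s = Complex (1/2) t"
  have s: "s = 1/2 + \<i> * of_real t" "Re s = 1/2" "1 - s = cnj s" by (simp_all add: s_def complex_eq_iff)
  have s1: "s \<noteq> 1" using s(2) by auto
  have "zeta (1 - s) = 2 * (2 * pi) powr (- s) * cos (pi * s / 2) * Gamma s * zeta s"
    by (rule zeta_functional_equation) (simp_all add: s(2))
  hence "cnj (zeta s) = 2 * (2 * pi) powr (- s) * cos (pi * s / 2) * Gamma s * zeta s"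
    using zeta_cnj[of s] s s1 by simp
  hence "zeta_twist_kernel r T s * (zeta s)\<^sup>2 = of_real r powr (s - 1/2) * (zeta s * cnj (zeta s)) * exp ((s - 1/2)\<^sup>2 / of_real (T\<^sup>2))"
    by (simp add: zeta_twist_kernel_def power2_eq_square mult_ac)
  also have "zeta s * cnj (zeta s) = of_real ((norm (zeta s))\<^sup>2)" by (rule complex_norm_square[symmetric])
  also have "s - 1/2 = \<i> * of_real t" by (simp add: s)
  also have "(\<i> * of_real t)\<^sup>2 / of_real (T\<^sup>2) = complex_of_real (- (t\<^sup>2 / T\<^sup>2))" by (simp add: power_mult_distrib)
  finally show ?thesis unfolding s_def[symmetric] s(1)[symmetric] exp_of_real .
qed

text \<open>The cosine vanishes at 1 and reduces the double pole of zeta s ^ 2 to a simple one,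
  whose residue is O(sqrt r) uniformly in T. The diagonal term of the final formula thus comes from
  the divisor sums and not from this residue.\<close>

lemma zeta_twist_kernel_at_1:
  assumes r: "r > 0" and T: "T > 1"
  shows "zeta_twist_kernel r T 1 = 0" and "norm (2 * pi * deriv (zeta_twist_kernel r T) 1) \<le> pi * exp 1 * sqrt r"
proof -
  define k where "k s = 2 * (2 * of_real pi) powr (- s) * Gamma s * of_real r powr (s - 1/2) * exp ((s - 1/2)\<^sup>2 / of_real (T\<^sup>2))" for s :: complex
  have K: "zeta_twist_kernel r T = (\<lambda>s::complex. cos (of_real pi * s / 2) * k s)"
    unfolding zeta_twist_kernel_def k_def by (intro ext) (simp only: mult_ac)
  have c: "cos (complex_of_real pi * 1 / 2) = 0" "sin (complex_of_real pi * 1 / 2) = 1"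
    using cos_of_real[of "pi / 2", where 'a = complex] sin_of_real[of "pi / 2", where 'a = complex] by simp_all
  show "zeta_twist_kernel r T 1 = 0" unfolding K c by simp
  have kh: "k holomorphic_on {s. Re s > 0}"
  proof -
    have "(\<lambda>s. 2 * exp (- s * of_real (ln (2 * pi))) * Gamma s * exp ((s - 1/2) * of_real (ln r)) * exp ((s - 1/2)\<^sup>2 / of_real (T\<^sup>2))) holomorphic_on {s. Re s > 0}"
      using assms by (intro holomorphic_intros) (auto elim!: nonpos_Ints_cases)
    moreover have "complex_of_real (2 * pi) powr (- s) = exp (- s * of_real (ln (2 * pi)))" for s
      by (rule powr_of_real_exp) auto
    moreover have "complex_of_real r powr (s - 1/2) = exp ((s - 1/2) * of_real (ln r))" for s
      by (rule powr_of_real_exp) (use assms in auto)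
    ultimately show ?thesis unfolding k_def[abs_def] by simp
  qed
  have "(k has_field_derivative deriv k 1) (at 1)"
    by (rule holomorphic_derivI[OF kh open_halfspace_Re_gt]) simp
  moreover have "((\<lambda>s. cos (complex_of_real pi * s / 2)) has_field_derivative (- sin (complex_of_real pi * 1 / 2) * (of_real pi / 2))) (at 1)"
    by (auto intro!: derivative_eq_intros)
  ultimately have "((\<lambda>s. cos (complex_of_real pi * s / 2) * k s) has_field_derivative
      ((- sin (complex_of_real pi * 1 / 2) * (of_real pi / 2)) * k 1 + deriv k 1 * cos (complex_of_real pi * 1 / 2))) (at 1)"
    by (intro DERIV_mult)
  hence "deriv (zeta_twist_kernel r T) 1 = (- sin (complex_of_real pi * 1 / 2) * (of_real pi / 2)) * k 1 + deriv k 1 * cos (complex_of_real pi * 1 / 2)"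
    unfolding K by (rule DERIV_imp_deriv)
  hence d: "deriv (zeta_twist_kernel r T) 1 = - (of_real pi / 2) * k 1" unfolding c by simp
  have "norm (k 1) = 2 * norm (complex_of_real (2 * pi) powr (- 1)) * norm (complex_of_real r powr (1 - 1/2)) * norm (exp ((1 - 1/2 :: complex)\<^sup>2 / of_real (T\<^sup>2)))"
    by (simp add: k_def norm_mult del: norm_exp_eq_Re)
  also have "norm (complex_of_real (2 * pi) powr (- 1)) = 1 / (2 * pi)"
    using norm_of_real_powr_Complex[of "2 * pi" "- 1"] by (simp add: powr_minus_divide)
  also have "norm (complex_of_real r powr (1 - 1/2)) = sqrt r"
    using norm_of_real_powr_Complex[OF r, of "1 - 1/2"] r by (simp add: powr_half_sqrt)
  also have "norm (exp ((1 - 1/2 :: complex)\<^sup>2 / of_real (T\<^sup>2))) = exp (1 / (4 * T\<^sup>2))"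
  proof -
    have "(1 - 1/2 :: complex)\<^sup>2 / of_real (T\<^sup>2) = of_real (1 / (4 * T\<^sup>2))" by (simp add: power2_eq_square)
    thus ?thesis by (simp only: norm_exp_eq_Re Re_complex_of_real)
  qed
  finally have "norm (k 1) = sqrt r / pi * exp (1 / (4 * T\<^sup>2))" by simp
  hence "norm (2 * pi * deriv (zeta_twist_kernel r T) 1) = pi * sqrt r * exp (1 / (4 * T\<^sup>2))"
    unfolding d by (simp add: norm_mult norm_divide)
  also have "\<dots> \<le> pi * sqrt r * exp 1"
  proof (intro mult_left_mono)
    have "1 \<le> T\<^sup>2" using T by (intro one_le_power) auto
    hence a: "1 \<le> 4 * T\<^sup>2" by linarith
    have "1 / (4 * T\<^sup>2) \<le> 1" by (subst divide_le_eq_1_pos) (use T a in auto)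
    thus "exp (1 / (4 * T\<^sup>2)) \<le> exp 1" by simp
  qed (use r in auto)
  finally show "norm (2 * pi * deriv (zeta_twist_kernel r T) 1) \<le> pi * exp 1 * sqrt r" by (simp only: mult_ac)
qed



lemma oscillatory_integrand_integrable:
  assumes y: "y > 0" and T: "T > 0"
  shows "integrable lborel (oscillatory_integrand T y)"
proof (rule Bochner_Integration.integrable_bound)
  show "integrable lborel (\<lambda>t. (y powr (- 2) * Gamma 2 * exp (9 / (4 * T\<^sup>2))) * exp ((- pi / 2) * t - (1 / T\<^sup>2) * t\<^sup>2))"
    using T by (intro integrable_mult_right integrable_exp_gaussian) auto
  have "continuous_on {s. Re s > 0} (Gamma :: complex \<Rightarrow> complex)"
    by (intro holomorphic_on_imp_continuous_on holomorphic_Gamma) (auto elim!: nonpos_Ints_cases)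
  hence cG: "continuous_on UNIV (\<lambda>t. Gamma (Complex 2 t))"
    by (rule continuous_on_compose2) (auto intro!: continuous_intros)
  have "continuous_on UNIV (\<lambda>t. exp (- Complex 2 t * of_real (ln y)) * exp (\<i> * pi * Complex 2 t / 2) *
     Gamma (Complex 2 t) * exp ((Complex 2 t - 1/2)\<^sup>2 / of_real (T\<^sup>2)))"
    using T by (intro continuous_intros cG) auto
  thus "oscillatory_integrand T y \<in> borel_measurable lborel"
    unfolding oscillatory_integrand_def[abs_def] powr_of_real_exp[OF y] measurable_lborel2
    by (rule borel_measurable_continuous_onI)
  show "AE t in lborel. norm (oscillatory_integrand T y t) \<le> norm ((y powr (- 2) * Gamma 2 * exp (9 / (4 * T\<^sup>2))) * exp ((- pi / 2) * t - (1 / T\<^sup>2) * t\<^sup>2))"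
  proof (rule AE_I2)
    fix t :: real
    have Re_e: "Re (\<i> * pi * Complex 2 t / 2) = - pi * t / 2" by simp
    have Re_q: "Re ((Complex 2 t - 1/2)\<^sup>2 / of_real (T\<^sup>2)) = 9 / (4 * T\<^sup>2) - t\<^sup>2 / T\<^sup>2"
      unfolding Re_divide_of_real Re_power2 by (simp add: power2_eq_square diff_divide_distrib)
    have "norm (oscillatory_integrand T y t) = y powr (- 2) * exp (- pi * t / 2) * norm (Gamma (Complex 2 t)) * exp (9 / (4 * T\<^sup>2) - t\<^sup>2 / T\<^sup>2)"
      unfolding oscillatory_integrand_def norm_mult norm_exp_eq_Re Re_e Re_q using norm_of_real_powr_Complex[OF y, of "- Complex 2 t"] by simp
    also have "\<dots> \<le> y powr (- 2) * exp (- pi * t / 2) * Gamma 2 * exp (9 / (4 * T\<^sup>2) - t\<^sup>2 / T\<^sup>2)"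
      using norm_Gamma_le[of "Complex 2 t"] by (intro mult_mono) auto
    also have "\<dots> = (y powr (- 2) * Gamma 2 * exp (9 / (4 * T\<^sup>2))) * exp ((- pi / 2) * t - (1 / T\<^sup>2) * t\<^sup>2)"
    proof -
      have "exp (- pi * t / 2) * exp (9 / (4 * T\<^sup>2) - t\<^sup>2 / T\<^sup>2) = exp (9 / (4 * T\<^sup>2)) * exp ((- pi / 2) * t - (1 / T\<^sup>2) * t\<^sup>2)"
        by (simp flip: exp_add)
      hence "y powr (- 2) * Gamma 2 * (exp (- pi * t / 2) * exp (9 / (4 * T\<^sup>2) - t\<^sup>2 / T\<^sup>2)) = y powr (- 2) * Gamma 2 * (exp (9 / (4 * T\<^sup>2)) * exp ((- pi / 2) * t - (1 / T\<^sup>2) * t\<^sup>2))"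
        by (simp only:)
      thus ?thesis by (simp only: mult_ac)
    qed
    also have "\<dots> \<le> norm \<dots>" by simp
    finally show "norm (oscillatory_integrand T y t) \<le> norm ((y powr (- 2) * Gamma 2 * exp (9 / (4 * T\<^sup>2))) * exp ((- pi / 2) * t - (1 / T\<^sup>2) * t\<^sup>2))" .
  qed
qed

text \<open>Twice the cosine is a sum of two exponentials, and on the line Re s = 2 conjugation
  together with t \<mapsto> - t exchanges them. All powers of s combine into y = 2 pi N / r. After
  integration only twice a real part remains.\<close>

lemma zeta_twist_kernel_eq_integrand:
  assumes r: "r > 0" and N: "N > 0"
  defines "y \<equiv> 2 * pi * N / r"
  shows "zeta_twist_kernel r T (Complex 2 t) * of_real N powr (- Complex 2 t) =
     of_real (1 / sqrt r) * (oscillatory_integrand T y t + cnj (oscillatory_integrand T y (- t)))"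
proof -
  define s where "s = Complex 2 t"
  have y: "y > 0" using r N by (simp add: y_def)
  have cs: "cnj (Complex 2 (- t)) = s" by (simp add: s_def complex_eq_iff)
  have "cnj (oscillatory_integrand T y (- t)) = cnj (of_real y powr (- Complex 2 (- t))) * cnj (exp (\<i> * pi * Complex 2 (- t) / 2)) * cnj (Gamma (Complex 2 (- t))) *
       cnj (exp ((Complex 2 (- t) - 1/2)\<^sup>2 / of_real (T\<^sup>2)))"
    by (simp add: oscillatory_integrand_def)
  also have "cnj (of_real y powr (- Complex 2 (- t))) = of_real y powr (- s)"
    unfolding powr_of_real_exp[OF y] exp_cnj by (simp add: cs)
  also have "cnj (exp (\<i> * pi * Complex 2 (- t) / 2)) = exp (- (\<i> * (pi * s / 2)))"
  proof -
    have "cnj (\<i> * pi * w / 2) = - (\<i> * (pi * cnj w / 2))" for w by simp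
    from this[of "Complex 2 (- t)"] show ?thesis unfolding exp_cnj cs by (simp only:)
  qed
  also have "cnj (Gamma (Complex 2 (- t))) = Gamma s"
    unfolding cnj_Gamma cs ..
  also have "cnj (exp ((Complex 2 (- t) - 1/2)\<^sup>2 / of_real (T\<^sup>2))) = exp ((s - 1/2)\<^sup>2 / of_real (T\<^sup>2))"
    unfolding exp_cnj by (simp add: cs)
  finally have c: "cnj (oscillatory_integrand T y (- t)) = of_real y powr (- s) * exp (- (\<i> * (pi * s / 2))) * Gamma s * exp ((s - 1/2)\<^sup>2 / of_real (T\<^sup>2))" .
  have p: "complex_of_real (2 * pi) powr (- s) * of_real r powr (s - 1/2) * of_real N powr (- s) = of_real (1 / sqrt r) * of_real y powr (- s)"
  proof -
    have "1 / sqrt r = exp (- 1/2 * ln r)" using r powr_half_sqrt[of r] by (simp add: powr_def exp_minus field_simps)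
    hence q: "complex_of_real (1 / sqrt r) = exp (- 1/2 * of_real (ln r))" by (simp flip: exp_of_real)
    have l: "ln y = ln (2 * pi) + ln N - ln r" using r N by (simp add: y_def ln_mult ln_div)
    have e: "- s * a + (s - 1/2) * b + - s * c = - 1/2 * b + - s * (a + c - b)" for a b c :: complex
      by (simp add: algebra_simps)
    have pp: "2 * pi > 0" by simp
    show ?thesis
      unfolding powr_of_real_exp[OF y] powr_of_real_exp[OF r] powr_of_real_exp[OF N] powr_of_real_exp[OF pp] q exp_add[symmetric] e l of_real_add of_real_diff ..
  qed
  have "zeta_twist_kernel r T s * of_real N powr (- s) = (complex_of_real (2 * pi) powr (- s) * of_real r powr (s - 1/2) * of_real N powr (- s)) *
     (2 * cos (pi * s / 2)) * Gamma s * exp ((s - 1/2)\<^sup>2 / of_real (T\<^sup>2))"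
    by (simp add: zeta_twist_kernel_def mult_ac)
  also have "2 * cos (pi * s / 2) = exp (\<i> * (pi * s / 2)) + exp (- (\<i> * (pi * s / 2)))"
    by (simp add: cos_exp_eq)
  finally have "zeta_twist_kernel r T s * of_real N powr (- s) = of_real (1 / sqrt r) * (of_real y powr (- s) * exp (\<i> * (pi * s / 2)) * Gamma s * exp ((s - 1/2)\<^sup>2 / of_real (T\<^sup>2)) +
      of_real y powr (- s) * exp (- (\<i> * (pi * s / 2))) * Gamma s * exp ((s - 1/2)\<^sup>2 / of_real (T\<^sup>2)))"
    unfolding p by (simp only: distrib_left distrib_right mult_ac)
  moreover have "oscillatory_integrand T y t = of_real y powr (- s) * exp (\<i> * (pi * s / 2)) * Gamma s * exp ((s - 1/2)\<^sup>2 / of_real (T\<^sup>2))"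
    unfolding oscillatory_integrand_def s_def[symmetric] by (simp only: mult.assoc times_divide_eq_right)
  ultimately show ?thesis by (simp only: c s_def)
qed

lemma zeta_twist_kernel_line:
  assumes r: "r > 0" and T: "T > 0" and N: "N > 0"
  shows "integrable lborel (\<lambda>t. zeta_twist_kernel r T (Complex 2 t))"
    and "(LBINT t. zeta_twist_kernel r T (Complex 2 t) * of_real N powr (- Complex 2 t)) =
       of_real (2 / sqrt r * Re (oscillatory_kernel T (2 * pi * N / r)))"
proof -
  have i: "integrable lborel (oscillatory_integrand T y)" "integrable lborel (\<lambda>t. cnj (oscillatory_integrand T y (- t)))"
     "(LBINT t. cnj (oscillatory_integrand T y (- t))) = cnj (oscillatory_kernel T y)" if "y > 0" for y
  proof -
    show 1: "integrable lborel (oscillatory_integrand T y)" by (rule oscillatory_integrand_integrable[OF that T])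
    show "integrable lborel (\<lambda>t. cnj (oscillatory_integrand T y (- t)))"
      using lborel_integrable_real_affine[OF 1, of "- 1" 0] by simp
    have "(LBINT t. oscillatory_integrand T y (- t)) = (LBINT t. oscillatory_integrand T y t)"
      using lborel_integral_real_affine[of "- 1" "oscillatory_integrand T y" 0] by simp
    thus "(LBINT t. cnj (oscillatory_integrand T y (- t))) = cnj (oscillatory_kernel T y)"
      by (simp add: oscillatory_kernel_def)
  qed
  have "zeta_twist_kernel r T (Complex 2 t) = of_real (1 / sqrt r) * (oscillatory_integrand T (2 * pi / r) t + cnj (oscillatory_integrand T (2 * pi / r) (- t)))" for t
    using zeta_twist_kernel_eq_integrand[OF r, of 1 T t] by simp
  moreover have "integrable lborel (\<lambda>t. of_real (1 / sqrt r) * (oscillatory_integrand T (2 * pi / r) t + cnj (oscillatory_integrand T (2 * pi / r) (- t))))"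
    using r i[of "2 * pi / r"] by (intro integrable_mult_right Bochner_Integration.integrable_add) auto
  ultimately show "integrable lborel (\<lambda>t. zeta_twist_kernel r T (Complex 2 t))" by simp
  define y where "y = 2 * pi * N / r"
  have y: "y > 0" using r N by (simp add: y_def)
  have "(LBINT t. zeta_twist_kernel r T (Complex 2 t) * of_real N powr (- Complex 2 t)) = of_real (1 / sqrt r) * (oscillatory_kernel T y + cnj (oscillatory_kernel T y))"
    unfolding zeta_twist_kernel_eq_integrand[OF r N] y_def[symmetric] integral_mult_right_zero Bochner_Integration.integral_add[OF i(1,2)[OF y]] i(3)[OF y]
    by (simp add: oscillatory_kernel_def)
  also have "\<dots> = of_real (2 / sqrt r * Re (oscillatory_kernel T y))" by (simp add: complex_add_cnj)
  finally show "(LBINT t. zeta_twist_kernel r T (Complex 2 t) * of_real N powr (- Complex 2 t)) =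
       of_real (2 / sqrt r * Re (oscillatory_kernel T (2 * pi * N / r)))" unfolding y_def .
qed

text \<open>Two errors arise. The residue at 1 is O(sqrt r). The errors of the oscillatory kernel
  add up to 2 / sqrt r times (1/T) (r T)^(1 + \<delta>) times the convergent sum \<open>Z\<close>,
  which is of order sqrt r (r T)^\<delta>.\<close>

lemma twisted_second_moment:
  assumes \<delta>: "0 < \<delta>" "\<delta> < 1"
  shows "\<exists>C\<ge>0. \<forall>r>0. \<forall>T>1. \<exists>S.
     ((\<lambda>x. cos (2 * pi * pairprod x / r) * exp (- ((pairprod x / (r * T / (2 * pi)))\<^sup>2))) has_sum S) UNIV \<and>
     norm ((LBINT t. of_real r powr (\<i> * of_real t) * of_real ((norm (zeta (1/2 + \<i> * of_real t)))\<^sup>2) * of_real (exp (- (t\<^sup>2 / T\<^sup>2))))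
        - of_real (4 * pi / sqrt r * S)) \<le> C * sqrt r * (1 + (r * T) powr \<delta>)"
proof -
  obtain C1 where C1: "C1 \<ge> 0" and osc: "\<And>T y. T > 1 \<Longrightarrow> y > 0 \<Longrightarrow>
     norm (oscillatory_kernel T y - of_real (2 * pi * exp (- ((y / T)\<^sup>2))) * exp (\<i> * of_real y)) \<le> C1 * (1 / T * (T / y) powr (1 + \<delta>))"
    using oscillatory_kernel_asymptotics \<delta> by blast
  define Z where "Z = infsum (\<lambda>x. pairprod x powr (- (1 + \<delta>))) UNIV"
  have Z: "((\<lambda>x. pairprod x powr (- (1 + \<delta>))) has_sum Z) UNIV"
    unfolding Z_def using pairprod_summable[of "1 + \<delta>"] \<delta> by (intro has_sum_infsum) auto
  have Z0: "Z \<ge> 0" unfolding Z_def by (intro infsum_nonneg) auto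
  define C where "C = pi * exp 1 + 2 * C1 * Z"
  show ?thesis
  proof (rule exI[of _ C], intro conjI allI impI)
    show "C \<ge> 0" using C1 Z0 by (simp add: C_def)
    fix r T :: real assume r: "r > 0" and T: "T > 1"
    have T0: "T > 0" using T by simp
    let ?K = "zeta_twist_kernel r T"
    define J where "J = (LBINT t. of_real r powr (\<i> * of_real t) * of_real ((norm (zeta (1/2 + \<i> * of_real t)))\<^sup>2) * complex_of_real (exp (- (t\<^sup>2 / T\<^sup>2))))"
    define I where "I = (LBINT t. ?K (Complex 2 t) * (zeta (Complex 2 t))\<^sup>2)"
    define y where "y x = 2 * pi * pairprod x / r" for x
    have y: "y x > 0" for x using r by (simp add: y_def)
    define X where "X = r * T / (2 * pi)"
    have X: "X > 0" using r T by (simp add: X_def)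
    have yT: "y x / T = pairprod x / X" for x by (simp add: y_def X_def)
    have "((\<lambda>x. 1 * 1 * (LBINT t. ?K (Complex 2 t) * of_real (pairprod x) powr (- Complex 2 t))) has_sum I) UNIV"
      unfolding I_def
    proof (rule square_line_integral[where a = "\<lambda>_. 1"])
      show "(\<lambda>t. zeta (Complex 2 t)) \<in> borel_measurable borel"
        by (intro borel_measurable_continuous_onI zeta_line_continuous) auto
      show "integrable lborel (\<lambda>t. ?K (Complex 2 t))" by (rule zeta_twist_kernel_line(1)[OF r T0, of 1]) simp
    qed (use zeta_sums in auto)
    hence I: "((\<lambda>x. complex_of_real (2 / sqrt r * Re (oscillatory_kernel T (y x)))) has_sum I) UNIV"
      unfolding zeta_twist_kernel_line(2)[OF r T0 pairprod_pos] y_def[symmetric] by (simp only: mult_1_left)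
    obtain A where A: "((\<lambda>x. exp (- ((pairprod x / X)\<^sup>2))) has_sum A) UNIV"
      using divisor_gaussian_sum_asymptotics[OF \<delta>] X by blast
    have "(\<lambda>x. cos (y x) * exp (- ((pairprod x / X)\<^sup>2))) summable_on UNIV"
    proof (rule abs_summable_summable, rule summable_on_comparison_test)
      show "(\<lambda>x. exp (- ((pairprod x / X)\<^sup>2))) summable_on UNIV" using A by (rule has_sum_imp_summable)
      show "norm (cos (y x) * exp (- ((pairprod x / X)\<^sup>2))) \<le> exp (- ((pairprod x / X)\<^sup>2))" for x
        by (simp add: abs_mult mult_left_le_one_le)
    qed auto
    then obtain S where S: "((\<lambda>x. cos (y x) * exp (- ((pairprod x / X)\<^sup>2))) has_sum S) UNIV"
      unfolding summable_on_def by blast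
    from has_sum_cmult_right[OF this, of "4 * pi / sqrt r"]
    have "((\<lambda>x. - 1 * complex_of_real (4 * pi / sqrt r * (cos (y x) * exp (- ((pairprod x / X)\<^sup>2))))) has_sum - 1 * of_real (4 * pi / sqrt r * S)) UNIV"
      by (rule has_sum_cmult_right[OF has_sum_of_real])
    from has_sum_add[OF I this]
    have d: "((\<lambda>x. complex_of_real (2 / sqrt r * Re (oscillatory_kernel T (y x))) - of_real (4 * pi / sqrt r * (cos (y x) * exp (- ((pairprod x / X)\<^sup>2)))))
       has_sum (I - of_real (4 * pi / sqrt r * S))) UNIV" by simp
    have b: "norm (complex_of_real (2 / sqrt r * Re (oscillatory_kernel T (y x))) - of_real (4 * pi / sqrt r * (cos (y x) * exp (- ((pairprod x / X)\<^sup>2)))))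
       \<le> (2 * C1 * sqrt r * (r * T) powr \<delta>) * pairprod x powr (- (1 + \<delta>))" for x
    proof -
      define D where "D = oscillatory_kernel T (y x) - of_real (2 * pi * exp (- ((y x / T)\<^sup>2))) * exp (\<i> * of_real (y x))"
      have "Re (exp (\<i> * of_real (y x))) = cos (y x)" by (simp add: Re_exp)
      hence "Re D = Re (oscillatory_kernel T (y x)) - 2 * pi * exp (- ((pairprod x / X)\<^sup>2)) * cos (y x)"
        unfolding D_def yT by simp
      hence "2 / sqrt r * Re (oscillatory_kernel T (y x)) - 4 * pi / sqrt r * (cos (y x) * exp (- ((pairprod x / X)\<^sup>2))) = 2 / sqrt r * Re D"
        by (simp add: right_diff_distrib)
      hence "norm (complex_of_real (2 / sqrt r * Re (oscillatory_kernel T (y x))) - of_real (4 * pi / sqrt r * (cos (y x) * exp (- ((pairprod x / X)\<^sup>2))))) = \<bar>2 / sqrt r * Re D\<bar>"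
        by (simp only: of_real_diff[symmetric] norm_of_real)
      also have "\<dots> = 2 / sqrt r * \<bar>Re D\<bar>" using r by (simp add: abs_mult)
      also have "\<dots> \<le> 2 / sqrt r * (C1 * (1 / T * (T / y x) powr (1 + \<delta>)))"
        using abs_Re_le_cmod[of D] osc[OF T y[of x]] r unfolding D_def[symmetric] by (intro mult_left_mono) auto
      \<comment> \<open>T / y x = X / pairprod x, and X \<le> r T because 2 pi \<ge> 1.\<close>
      also have "\<dots> \<le> 2 / sqrt r * (C1 * (1 / T * ((r * T) powr (1 + \<delta>) * pairprod x powr (- (1 + \<delta>)))))"
      proof (intro mult_left_mono)
        have "T / y x = X * (1 / pairprod x)" using yT[of x] y[of x] X T less_imp_neq[OF pairprod_pos[of x]] by (simp add: field_simps)
        also have "\<dots> \<le> (r * T) * (1 / pairprod x)"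
        proof (rule mult_right_mono)
          have "1 \<le> 2 * pi" using pi_gt3 by simp
          hence "r * T / (2 * pi) \<le> r * T / 1" using r T by (intro divide_left_mono) auto
          thus "X \<le> r * T" by (simp add: X_def)
        qed (simp add: less_imp_le)
        finally have "(T / y x) powr (1 + \<delta>) \<le> ((r * T) * (1 / pairprod x)) powr (1 + \<delta>)"
          using \<delta> T y[of x] by (intro powr_mono2) (auto simp: less_imp_le)
        also have "\<dots> = (r * T) powr (1 + \<delta>) * (1 / pairprod x) powr (1 + \<delta>)"
          by (rule powr_mult)
        also have "(1 / pairprod x) powr (1 + \<delta>) = pairprod x powr (- (1 + \<delta>))"
          by (simp only: powr_divide powr_one_eq_one powr_minus_divide)
        finally show "(T / y x) powr (1 + \<delta>) \<le> (r * T) powr (1 + \<delta>) * pairprod x powr (- (1 + \<delta>))" .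
      qed (use r T C1 in auto)
      also have "(r * T) powr (1 + \<delta>) = r * T * (r * T) powr \<delta>" using r T by (simp add: powr_add)
      also have "2 / sqrt r * (C1 * (1 / T * ((r * T * (r * T) powr \<delta>) * pairprod x powr (- (1 + \<delta>))))) =
         2 * C1 * (r / sqrt r) * (r * T) powr \<delta> * pairprod x powr (- (1 + \<delta>))" using T by simp
      also have "r / sqrt r = sqrt r" using r by (simp add: real_div_sqrt)
      finally show ?thesis .
    qed
    have n1: "norm (I - of_real (4 * pi / sqrt r * S)) \<le> (2 * C1 * sqrt r * (r * T) powr \<delta>) * Z"
      by (rule norm_infsum_le[OF d has_sum_cmult_right[OF Z]]) (rule b)
    obtain B where B: "\<And>z. 1/2 \<le> Re z \<Longrightarrow> Re z \<le> 2 \<Longrightarrow> \<bar>Im z\<bar> \<ge> 1 \<Longrightarrow> norm (?K z) \<le> B / \<bar>Im z\<bar> ^ 4"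
      using zeta_twist_kernel_bound[OF r T0] by blast
    have "I = (LBINT t. ?K (Complex (1/2) t) * (zeta (Complex (1/2) t))\<^sup>2) + 2 * pi * (deriv ?K 1 + 2 * of_real euler_mascheroni * ?K 1)"
      unfolding I_def by (rule zeta_square_shift[OF zeta_twist_kernel_holomorphic[OF r T0] _ _ _ B]) auto
    hence IJ: "I = J + 2 * pi * deriv ?K 1"
      unfolding zeta_twist_kernel_critical_line[OF T0] J_def[symmetric] zeta_twist_kernel_at_1(1)[OF r T] by simp
    have "J - of_real (4 * pi / sqrt r * S) = (I - of_real (4 * pi / sqrt r * S)) - 2 * pi * deriv ?K 1" unfolding IJ by simp
    hence "norm (J - of_real (4 * pi / sqrt r * S)) \<le> norm (I - of_real (4 * pi / sqrt r * S)) + norm (2 * pi * deriv ?K 1)"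
      by (simp only: norm_triangle_ineq4)
    also have "\<dots> \<le> (2 * C1 * sqrt r * (r * T) powr \<delta>) * Z + pi * exp 1 * sqrt r"
      by (rule add_mono[OF n1 zeta_twist_kernel_at_1(2)[OF r T]])
    also have "\<dots> = sqrt r * (2 * C1 * Z * (r * T) powr \<delta> + pi * exp 1 * 1)" by (simp add: distrib_left mult_ac)
    also have "\<dots> \<le> sqrt r * (C * (r * T) powr \<delta> + C * 1)"
      using C1 Z0 r by (intro mult_left_mono add_mono mult_right_mono) (auto simp: C_def)
    also have "\<dots> = C * sqrt r * (1 + (r * T) powr \<delta>)" by (simp add: distrib_left mult_ac)
    finally show "\<exists>S. ((\<lambda>x. cos (2 * pi * pairprod x / r) * exp (- ((pairprod x / (r * T / (2 * pi)))\<^sup>2))) has_sum S) UNIV \<and>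
     norm ((LBINT t. of_real r powr (\<i> * of_real t) * of_real ((norm (zeta (1/2 + \<i> * of_real t)))\<^sup>2) * of_real (exp (- (t\<^sup>2 / T\<^sup>2))))
        - of_real (4 * pi / sqrt r * S)) \<le> C * sqrt r * (1 + (r * T) powr \<delta>)"
      using S unfolding y_def X_def J_def by blast
  qed
qed

section \<open>Twisted divisor sums\<close>

text \<open>Substituting d m for m and e n for n shortens the sum by the factor d e. With d and e
  equal to 1 or p these sums feed the inclusion-exclusion for pairs prime to p. The predecessor in
  \<open>h\<close> compensates the index shift.\<close>

lemma has_sum_multiples:
  assumes de: "d > 0" "e > 0" and A: "((\<lambda>x. exp (- ((pairprod x / (X / (real d * real e)))\<^sup>2))) has_sum A) UNIV"
  shows "((\<lambda>x. if d dvd Suc (fst x) \<and> e dvd Suc (snd x) then exp (- ((pairprod x / X)\<^sup>2)) else 0) has_sum A) UNIV"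
proof -
  define h where "h = (\<lambda>x :: nat \<times> nat. (d * Suc (fst x) - 1, e * Suc (snd x) - 1))"
  have S: "Suc (fst (h x)) = d * Suc (fst x)" "Suc (snd (h x)) = e * Suc (snd x)" for x
    using de by (auto simp: h_def)
  have inj: "inj h"
  proof (rule injI)
    fix x y assume "h x = h y"
    hence "d * Suc (fst x) = d * Suc (fst y)" "e * Suc (snd x) = e * Suc (snd y)" using S by metis+
    thus "x = y" using de by (simp add: prod_eq_iff)
  qed
  have ran: "range h = {x. d dvd Suc (fst x) \<and> e dvd Suc (snd x)}"
  proof (intro equalityI subsetI)
    fix x assume "x \<in> range h" thus "x \<in> {x. d dvd Suc (fst x) \<and> e dvd Suc (snd x)}" using S by force
  next
    fix x assume "x \<in> {x. d dvd Suc (fst x) \<and> e dvd Suc (snd x)}"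
    then obtain k l where kl: "Suc (fst x) = d * k" "Suc (snd x) = e * l" by (auto elim!: dvdE)
    have "k > 0" "l > 0" using kl by (auto intro!: Nat.gr0I)
    hence "Suc (k - 1) = k" "Suc (l - 1) = l" by simp_all
    hence "h (k - 1, l - 1) = (d * k - 1, e * l - 1)" by (simp only: h_def fst_conv snd_conv)
    also have "\<dots> = x" by (simp flip: kl)
    finally have "h (k - 1, l - 1) = x" .
    thus "x \<in> range h" by blast
  qed
  have eq: "pairprod (h x) / X = pairprod x / (X / (real d * real e))" for x
    unfolding pairprod_def S of_nat_mult by (simp add: mult_ac del: of_nat_Suc)
  have "((\<lambda>x. exp (- ((pairprod x / X)\<^sup>2))) \<circ> h has_sum A) UNIV" using A by (simp only: o_def eq)
  hence "((\<lambda>x. exp (- ((pairprod x / X)\<^sup>2))) has_sum A) (range h)" by (simp add: has_sum_reindex[OF inj])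
  thus ?thesis unfolding ran
    by (rule iffD1[OF has_sum_cong_neutral, rotated 3]) auto
qed

lemma has_sum_sum:
  fixes f :: "'i \<Rightarrow> 'a \<Rightarrow> 'b :: {topological_comm_monoid_add}"
  assumes "finite I" "\<And>i. i \<in> I \<Longrightarrow> (f i has_sum s i) A"
  shows "((\<lambda>x. \<Sum>i\<in>I. f i x) has_sum (\<Sum>i\<in>I. s i)) A"
  using assms by (induction I rule: finite_induct) (auto intro: has_sum_add)

section \<open>Expansion of the cosine modulo p in even characters\<close>

context odd_prime
begin

definition trivial_character :: "int \<Rightarrow> complex" where
  "trivial_character a = (if int p dvd a then 0 else 1)"

lemma even_characters_eq:
  "even_characters = insert trivial_character {chi. primitive_character p chi \<and> chi (- 1) = 1}"
  "trivial_character \<notin> {chi. primitive_character p chi \<and> chi (- 1) = 1}"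
proof -
  have pr: "prime (int p)" using p(1) by simp
  have 1: "\<not> int p dvd 1" using p_ge_3 by (simp add: zdvd_not_zless)
  hence "\<not> int p dvd - 1" by simp
  moreover have "dirichlet_character p trivial_character"
    unfolding dirichlet_character_def trivial_character_def coprime_iff using pr by (auto simp: prime_dvd_mult_iff)
  ultimately have t: "trivial_character \<in> even_characters" by (simp add: even_characters_def trivial_character_def)
  have "chi = trivial_character" if c: "dirichlet_character p chi" "\<not> primitive_character p chi" for chi
  proof (rule ext)
    fix a show "chi a = trivial_character a"
      using c primitive_iff[of chi] char_zero_iff[OF c(1), of a] by (auto simp: trivial_character_def)
  qed
  moreover have "dirichlet_character p chi" if "primitive_character p chi" for chi using that primitive_iff by blast
  ultimately show "even_characters = insert trivial_character {chi. primitive_character p chi \<and> chi (- 1) = 1}"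
    using t by (auto simp: even_characters_def)
  show "trivial_character \<notin> {chi. primitive_character p chi \<and> chi (- 1) = 1}"
    using primitive_iff by (auto simp: trivial_character_def)
qed

lemma gauss_sum_trivial: "gauss_sum (\<lambda>a. cnj (trivial_character a)) = - 1"
proof -
  have "gauss_sum (\<lambda>a. cnj (trivial_character a)) = (\<Sum>a\<in>{..<p} - {0}. of_real (pcos (int a)))"
    unfolding gauss_sum_def
  proof (rule sum.mono_neutral_cong_right)
    show "\<forall>a\<in>{..<p} - ({..<p} - {0}). cnj (trivial_character (int a)) * of_real (pcos (int a)) = 0"
      by (auto simp: trivial_character_def)
    show "cnj (trivial_character (int a)) * of_real (pcos (int a)) = of_real (pcos (int a))" if "a \<in> {..<p} - {0}" for a
      using that by (auto simp: trivial_character_def dest: dvd_imp_le)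
  qed auto
  also have "\<dots> = (\<Sum>a<p. of_real (pcos (int a))) - of_real (pcos (int 0))"
    using p_ge_3 by (subst sum_diff1) auto
  also have "(\<Sum>a<p. complex_of_real (pcos (int a))) = 0"
    using sum_pcos[of 1] p_ge_3 by (simp add: zdvd_not_zless flip: of_real_sum)
  finally show ?thesis by (simp add: pcos_def)
qed

text \<open>The two cases are merged into one formula. If p divides m n, the cosine is 1 and only
  the constant survives. Otherwise 1 - p/(p - 1) = - 1/(p - 1) is the contribution of the trivial
  character, whose Gauss sum is -1.\<close>

lemma pcos_expansion:
  assumes q: "\<not> int p dvd q"
  shows "of_real (pcos (q * m * n)) = 1 - of_nat p / of_nat (p - 1) * (if \<not> int p dvd m \<and> \<not> int p dvd n then 1 else 0) +
     1 / of_nat (p - 1) * (\<Sum>chi | primitive_character p chi \<and> chi (- 1) = 1. gauss_sum (\<lambda>a. cnj (chi a)) * chi q * (chi m * chi n))"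
proof -
  have pr: "prime (int p)" using p(1) by simp
  have p1: "of_nat (p - 1) \<noteq> (0 :: complex)" "of_nat p = (of_nat (p - 1) + 1 :: complex)"
    using p_ge_3 by (auto simp: of_nat_diff)
  let ?P = "{chi. primitive_character p chi \<and> chi (- 1) = 1}"
  have dc: "dirichlet_character p chi" if "chi \<in> ?P" for chi using that primitive_iff by blast
  have fin: "finite ?P" using finite_even_characters even_characters_eq(1) by (metis finite_insert)
  show ?thesis
  proof (cases "int p dvd m * n")
    case True
    have c: "pcos (q * m * n) = 1"
    proof -
      from True have "int p dvd q * m * n" by (simp add: mult.assoc)
      then obtain k where "q * m * n = int p * k" by (elim dvdE)
      hence "2 * pi * of_int (q * m * n) / real p = 2 * pi * of_int k" using p_ge_3 by simp
      thus ?thesis unfolding pcos_def by (simp only: cos_int_2pin)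
    qed
    have i: "(if \<not> int p dvd m \<and> \<not> int p dvd n then 1 else 0) = (0 :: complex)" using True pr by (auto simp: prime_dvd_mult_iff)
    have "gauss_sum (\<lambda>a. cnj (chi a)) * chi q * (chi m * chi n) = 0" if "chi \<in> ?P" for chi
      using True char_zero_iff[OF dc[OF that], of "m * n"] char_mult[OF dc[OF that], of m n] by simp
    hence s: "(\<Sum>chi\<in>?P. gauss_sum (\<lambda>a. cnj (chi a)) * chi q * (chi m * chi n)) = 0" by (intro sum.neutral ballI)
    show ?thesis unfolding s i c by simp
  next
    case False
    hence b: "\<not> int p dvd q * m * n" using q pr by (simp add: prime_dvd_mult_iff)
    have "of_nat (p - 1) * of_real (pcos (q * m * n)) = (\<Sum>chi\<in>even_characters. gauss_sum (\<lambda>a. cnj (chi a)) * chi (q * m * n))"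
      by (rule cos_character_expansion[OF b, symmetric])
    also have "\<dots> = - 1 + (\<Sum>chi\<in>?P. gauss_sum (\<lambda>a. cnj (chi a)) * chi (q * m * n))"
      unfolding even_characters_eq(1) sum.insert[OF fin even_characters_eq(2)]
      using b by (simp add: gauss_sum_trivial) (simp add: trivial_character_def)
    also have "(\<Sum>chi\<in>?P. gauss_sum (\<lambda>a. cnj (chi a)) * chi (q * m * n)) = (\<Sum>chi\<in>?P. gauss_sum (\<lambda>a. cnj (chi a)) * chi q * (chi m * chi n))"
      by (intro sum.cong refl) (simp add: char_mult[OF dc] mult_ac)
    finally have e: "of_nat (p - 1) * of_real (pcos (q * m * n)) = - 1 + (\<Sum>chi\<in>?P. gauss_sum (\<lambda>a. cnj (chi a)) * chi q * (chi m * chi n))" .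
    have "\<not> int p dvd m" "\<not> int p dvd n" using False by auto
    hence "1 - of_nat p / of_nat (p - 1) * (if \<not> int p dvd m \<and> \<not> int p dvd n then 1 else 0) +
     1 / of_nat (p - 1) * (\<Sum>chi\<in>?P. gauss_sum (\<lambda>a. cnj (chi a)) * chi q * (chi m * chi n)) =
      (- 1 + (\<Sum>chi\<in>?P. gauss_sum (\<lambda>a. cnj (chi a)) * chi q * (chi m * chi n))) / of_nat (p - 1)"
    proof -
      have "1 - (Q + 1) / Q * 1 + 1 / Q * S = (- 1 + S) / Q" if "Q \<noteq> 0" for Q S :: complex
        using that by (simp add: field_simps)
      from this[OF p1(1)] show ?thesis using \<open>\<not> int p dvd m\<close> \<open>\<not> int p dvd n\<close> by (simp only: p1(2) simp_thms if_True)
    qed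
    also have "\<dots> = of_real (pcos (q * m * n))" unfolding e[symmetric] using p1 by simp
    finally show ?thesis by simp
  qed
qed

text \<open>\<open>pcos_expansion\<close> summed against the Gaussian cutoff. For each primitive
  character the Gauss sum of the expansion meets the one from the functional equation; their product
  p, divided by sqrt p, leaves sqrt p, and no Gauss sum remains.\<close>

lemma twisted_gaussian_sum:
  assumes q: "\<not> int p dvd q" and X: "X > 0"
    and A: "\<And>Y. Y > 0 \<Longrightarrow> ((\<lambda>x. exp (- ((pairprod x / Y)\<^sup>2))) has_sum A Y) UNIV"
  shows "((\<lambda>x. complex_of_real (pcos (q * int (Suc (fst x)) * int (Suc (snd x))) * exp (- ((pairprod x / X)\<^sup>2)))) has_sum
     (of_real (A X - real p / (real p - 1) * (A X - 2 * A (X / p) + A (X / p\<^sup>2))) +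
      of_real (sqrt p * sqrt X / (4 * pi * (real p - 1))) * (\<Sum>chi | primitive_character p chi \<and> chi (- 1) = 1. chi q *
        (LBINT t. Gamma ((1 - 2 * \<i> * of_real t) / 4) * of_real (pi * X / p) powr (\<i> * of_real t) *
           of_real ((norm (dirichlet_L chi (1/2 + \<i> * of_real t)))\<^sup>2))))) UNIV"
proof -
  let ?P = "{chi. primitive_character p chi \<and> chi (- 1) = 1}"
  let ?g = "\<lambda>x. exp (- ((pairprod x / X)\<^sup>2))"
  let ?I = "\<lambda>chi. LBINT t. Gamma ((1 - 2 * \<i> * of_real t) / 4) * of_real (pi * X / p) powr (\<i> * of_real t) *
           of_real ((norm (dirichlet_L chi (1/2 + \<i> * of_real t)))\<^sup>2)"
  have pp: "real p > 0" "real p - 1 > 0" using p_ge_3 by auto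
  have fin: "finite ?P" using finite_even_characters even_characters_eq(1) by (metis finite_insert)
  have m1: "((\<lambda>x. if p dvd Suc (fst x) \<and> 1 dvd Suc (snd x) then ?g x else 0) has_sum A (X / p)) UNIV"
    by (rule has_sum_multiples) (use A[of "X / p"] pp X in simp_all)
  have m2: "((\<lambda>x. if 1 dvd Suc (fst x) \<and> p dvd Suc (snd x) then ?g x else 0) has_sum A (X / p)) UNIV"
    by (rule has_sum_multiples) (use A[of "X / p"] pp X in simp_all)
  have m3: "((\<lambda>x. if p dvd Suc (fst x) \<and> p dvd Suc (snd x) then ?g x else 0) has_sum A (X / p\<^sup>2)) UNIV"
    using pp X A[of "X / p\<^sup>2"] by (intro has_sum_multiples) (auto simp: power2_eq_square)
  \<comment> \<open>Inclusion-exclusion over the conditions that p divides the first, the second, or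
    both entries.\<close>
  have "((\<lambda>x. (?g x + - 1 * (if p dvd Suc (fst x) \<and> 1 dvd Suc (snd x) then ?g x else 0)) +
       (- 1 * (if 1 dvd Suc (fst x) \<and> p dvd Suc (snd x) then ?g x else 0) + (if p dvd Suc (fst x) \<and> p dvd Suc (snd x) then ?g x else 0))) has_sum
        ((A X + - 1 * A (X / p)) + (- 1 * A (X / p) + A (X / p\<^sup>2)))) UNIV"
    by (intro has_sum_add has_sum_cmult_right A[OF X] m1 m2 m3)
  moreover have "(?g x + - 1 * (if p dvd Suc (fst x) \<and> 1 dvd Suc (snd x) then ?g x else 0)) +
       (- 1 * (if 1 dvd Suc (fst x) \<and> p dvd Suc (snd x) then ?g x else 0) + (if p dvd Suc (fst x) \<and> p dvd Suc (snd x) then ?g x else 0)) =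
     (if \<not> p dvd Suc (fst x) \<and> \<not> p dvd Suc (snd x) then ?g x else 0)" for x
    by auto
  ultimately have c: "((\<lambda>x. if \<not> p dvd Suc (fst x) \<and> \<not> p dvd Suc (snd x) then ?g x else 0) has_sum (A X - 2 * A (X / p) + A (X / p\<^sup>2))) UNIV"
    by (simp add: algebra_simps)
  have real_part: "((\<lambda>x. complex_of_real (?g x + - (real p / (real p - 1)) * (if \<not> p dvd Suc (fst x) \<and> \<not> p dvd Suc (snd x) then ?g x else 0))) has_sum
      of_real (A X + - (real p / (real p - 1)) * (A X - 2 * A (X / p) + A (X / p\<^sup>2)))) UNIV"
    by (intro has_sum_of_real has_sum_add has_sum_cmult_right A[OF X] c)
  have B: "((\<lambda>x. (gauss_sum (\<lambda>a. cnj (chi a)) * chi q) * (chi (int (Suc (fst x))) * chi (int (Suc (snd x))) * of_real (?g x))) has_sum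
      ((gauss_sum (\<lambda>a. cnj (chi a)) * chi q) * (gauss_sum chi / of_real (sqrt p) * of_real (sqrt X / (4 * pi)) * ?I chi))) UNIV" if "chi \<in> ?P" for chi
  proof -
    interpret even_primitive p chi using that by unfold_locales auto
    show ?thesis by (intro has_sum_cmult_right twisted_divisor_gaussian_sum[OF X])
  qed
  have "((\<lambda>x. \<Sum>chi\<in>?P. (gauss_sum (\<lambda>a. cnj (chi a)) * chi q) * (chi (int (Suc (fst x))) * chi (int (Suc (snd x))) * of_real (?g x))) has_sum
      (\<Sum>chi\<in>?P. (gauss_sum (\<lambda>a. cnj (chi a)) * chi q) * (gauss_sum chi / of_real (sqrt p) * of_real (sqrt X / (4 * pi)) * ?I chi))) UNIV"
    by (rule has_sum_sum[OF fin B])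
  also have "(\<Sum>chi\<in>?P. (gauss_sum (\<lambda>a. cnj (chi a)) * chi q) * (gauss_sum chi / of_real (sqrt p) * of_real (sqrt X / (4 * pi)) * ?I chi)) =
     (\<Sum>chi\<in>?P. of_real (sqrt p * sqrt X / (4 * pi)) * (chi q * ?I chi))"
  proof (intro sum.cong refl)
    fix chi assume "chi \<in> ?P"
    hence g: "gauss_sum chi * gauss_sum (\<lambda>a. cnj (chi a)) = of_nat p" by (intro gauss_sum_mult_cnj) auto
    have "(gauss_sum (\<lambda>a. cnj (chi a)) * chi q) * (gauss_sum chi / of_real (sqrt p) * of_real (sqrt X / (4 * pi)) * ?I chi) =
       (gauss_sum chi * gauss_sum (\<lambda>a. cnj (chi a))) / of_real (sqrt p) * of_real (sqrt X / (4 * pi)) * (chi q * ?I chi)" by simp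
    also have "(gauss_sum chi * gauss_sum (\<lambda>a. cnj (chi a))) / of_real (sqrt p) = of_real (sqrt p)"
    proof -
      have "complex_of_real (real p) / of_real (sqrt p) = of_real (sqrt p)"
        unfolding of_real_divide[symmetric] using real_div_sqrt[of "real p"] by simp
      thus ?thesis unfolding g by simp
    qed
    finally show "(gauss_sum (\<lambda>a. cnj (chi a)) * chi q) * (gauss_sum chi / of_real (sqrt p) * of_real (sqrt X / (4 * pi)) * ?I chi) =
       of_real (sqrt p * sqrt X / (4 * pi)) * (chi q * ?I chi)" by simp
  qed
  also have "\<dots> = of_real (sqrt p * sqrt X / (4 * pi)) * (\<Sum>chi\<in>?P. chi q * ?I chi)" by (rule sum_distrib_left[symmetric])
  finally have "((\<lambda>x. 1 / of_nat (p - 1) * (\<Sum>chi\<in>?P. (gauss_sum (\<lambda>a. cnj (chi a)) * chi q) * (chi (int (Suc (fst x))) * chi (int (Suc (snd x))) * of_real (?g x)))) has_sum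
      (1 / of_nat (p - 1) * (of_real (sqrt p * sqrt X / (4 * pi)) * (\<Sum>chi\<in>?P. chi q * ?I chi)))) UNIV" by (rule has_sum_cmult_right)
  from has_sum_add[OF real_part this]
  have "((\<lambda>x. complex_of_real (?g x + - (real p / (real p - 1)) * (if \<not> p dvd Suc (fst x) \<and> \<not> p dvd Suc (snd x) then ?g x else 0)) +
      1 / of_nat (p - 1) * (\<Sum>chi\<in>?P. (gauss_sum (\<lambda>a. cnj (chi a)) * chi q) * (chi (int (Suc (fst x))) * chi (int (Suc (snd x))) * of_real (?g x)))) has_sum
     (of_real (A X + - (real p / (real p - 1)) * (A X - 2 * A (X / p) + A (X / p\<^sup>2))) + 1 / of_nat (p - 1) * (of_real (sqrt p * sqrt X / (4 * pi)) * (\<Sum>chi\<in>?P. chi q * ?I chi)))) UNIV" .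
  moreover have "complex_of_real (?g x + - (real p / (real p - 1)) * (if \<not> p dvd Suc (fst x) \<and> \<not> p dvd Suc (snd x) then ?g x else 0)) +
      1 / of_nat (p - 1) * (\<Sum>chi\<in>?P. (gauss_sum (\<lambda>a. cnj (chi a)) * chi q) * (chi (int (Suc (fst x))) * chi (int (Suc (snd x))) * of_real (?g x))) =
     of_real (pcos (q * int (Suc (fst x)) * int (Suc (snd x))) * ?g x)" for x
  proof -
    define G where "G = ?g x"
    define m n where "m = Suc (fst x)" and "n = Suc (snd x)"
    have p1: "of_nat (p - 1) = complex_of_real (real p - 1)" using p_ge_3 by (simp add: of_nat_diff)
    have s: "(\<Sum>chi\<in>?P. (gauss_sum (\<lambda>a. cnj (chi a)) * chi q) * (chi (int m) * chi (int n) * of_real G)) =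
        (\<Sum>chi\<in>?P. gauss_sum (\<lambda>a. cnj (chi a)) * chi q * (chi (int m) * chi (int n))) * of_real G"
      unfolding sum_distrib_right by (intro sum.cong refl) (simp only: mult_ac)
    have e: "complex_of_real (pcos (q * int m * int n) * G) = (1 - of_nat p / of_nat (p - 1) * (if \<not> p dvd m \<and> \<not> p dvd n then 1 else 0) +
     1 / of_nat (p - 1) * (\<Sum>chi\<in>?P. gauss_sum (\<lambda>a. cnj (chi a)) * chi q * (chi (int m) * chi (int n)))) * of_real G"
      using pcos_expansion[OF q, of "int m" "int n"] by (simp only: of_real_mult int_dvd_int_iff)
    show ?thesis unfolding G_def[symmetric] m_def[symmetric] n_def[symmetric] s e p1
      by (cases "p dvd m"; cases "p dvd n") (simp_all add: algebra_simps)
  qed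
  moreover have "1 / of_nat (p - 1) * (of_real (sqrt p * sqrt X / (4 * pi)) * (\<Sum>chi\<in>?P. chi q * ?I chi)) = of_real (sqrt p * sqrt X / (4 * pi * (real p - 1))) * (\<Sum>chi\<in>?P. chi q * ?I chi)"
    using p_ge_3 by (simp add: of_nat_diff)
  ultimately show ?thesis by (simp only: diff_conv_add_uminus mult_minus_left)
qed

end

section \<open>The asymptotic formula\<close>

text \<open>The coefficients satisfy 1 - p/(p - 1) (1 - 1/p)^2 = 1/p, so the terms of size X
  collapse to X/p. The logarithms of X/p and X/p^2 contribute - 2 ln p, which turns the length X
  into X/p^2 inside the logarithm.\<close>

lemma main_term_combination:
  fixes p X \<kappa> :: real
  assumes p: "p > 1" and X: "X > 0"
  defines "M \<equiv> \<lambda>Y. sqrt pi / 2 * Y * (ln Y + \<kappa>)"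
  shows "M X - p / (p - 1) * (M X - 2 * M (X / p) + M (X / p\<^sup>2)) = sqrt pi / 2 * (X / p) * (ln X - 2 * ln p + \<kappa>)"
proof -
  define c l L where "c = sqrt pi / 2 * X" and "l = ln X + \<kappa>" and "L = ln p"
  have 1: "ln (X / p) = ln X - ln p" "ln (X / p\<^sup>2) = ln X - 2 * ln p"
    using p X by (simp_all add: ln_div ln_realpow)
  have M: "M X = c * l" "M (X / p) = c / p * (l - L)" "M (X / p\<^sup>2) = c / p\<^sup>2 * (l - 2 * L)"
    unfolding M_def 1 c_def l_def L_def by simp_all
  have nz: "p \<noteq> 0" "p - 1 \<noteq> 0" using p by auto
  have "c * l - 2 * (c / p * (l - L)) + c / p\<^sup>2 * (l - 2 * L) = c * (p - 1) / p\<^sup>2 * (l * (p - 1) + 2 * L)"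
    using nz by (simp add: field_simps power2_eq_square)
  hence "M X - p / (p - 1) * (M X - 2 * M (X / p) + M (X / p\<^sup>2)) = c * l - p / (p - 1) * (c * (p - 1) / p\<^sup>2 * (l * (p - 1) + 2 * L))"
    unfolding M by (simp only:)
  also have "p / (p - 1) * (c * (p - 1) / p\<^sup>2 * (l * (p - 1) + 2 * L)) = c / p * (l * (p - 1) + 2 * L)"
    using nz by (simp add: power2_eq_square)
  also have "c * l - c / p * (l * (p - 1) + 2 * L) = c / p * (l - 2 * L)"
    using nz by (simp add: field_simps)
  finally show ?thesis by (simp add: c_def l_def L_def algebra_simps)
qed

text \<open>p/(p - 1) \<le> 2 and the inner coefficients have absolute sum 4; hence 9 = 1 + 2 *
  4.\<close>

lemma combination_error:
  fixes p X B :: real and E :: "real \<Rightarrow> real"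
  assumes p: "p \<ge> 2" and E: "\<bar>E X\<bar> \<le> B" "\<bar>E (X / p)\<bar> \<le> B" "\<bar>E (X / p\<^sup>2)\<bar> \<le> B"
  shows "\<bar>E X - p / (p - 1) * (E X - 2 * E (X / p) + E (X / p\<^sup>2))\<bar> \<le> 9 * B"
proof -
  have q: "0 \<le> p / (p - 1)" "p / (p - 1) \<le> 2" using p by (auto simp: field_simps)
  have "\<bar>p / (p - 1) * (E X - 2 * E (X / p) + E (X / p\<^sup>2))\<bar> = p / (p - 1) * \<bar>E X - 2 * E (X / p) + E (X / p\<^sup>2)\<bar>"
    using q(1) by (simp only: abs_mult abs_of_nonneg)
  also have "\<dots> \<le> 2 * (4 * B)" using q E by (intro mult_mono) linarith+
  finally have "\<bar>p / (p - 1) * (E X - 2 * E (X / p) + E (X / p\<^sup>2))\<bar> \<le> 8 * B" by simp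
  moreover have "\<bar>E X - d\<bar> \<le> 9 * B" if "\<bar>d\<bar> \<le> 8 * B" for d using that E(1) by linarith
  ultimately show ?thesis by blast
qed

theorem theorem1:
  fixes \<epsilon> :: real
  assumes "\<epsilon> > 0"
  shows "\<exists>C::real. \<forall>(p::nat) (q::nat) (T::real).
    prime p \<and> odd p \<and> prime q \<and> odd q \<and> p \<noteq> q \<and> T > 1 \<longrightarrow>
    norm
      ((LBINT t. (of_real (real p / real q) powr (\<i> * of_real t)) *
                 of_real ((norm (zeta (1/2 + \<i> * of_real t)))\<^sup>2) *
                 of_real (exp (- (t\<^sup>2 / T\<^sup>2))))
       - (of_real (sqrt (pi / (real p * real q)) * T *
            (ln (T / (2 * pi * real p * real q)) + 2 * euler_mascheroni
              + 1/2 * (deriv Gamma (1/2 :: real) / Gamma (1/2 :: real))))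
          + of_real (sqrt (T / (2 * pi)) * (sqrt (real p) / (real p - 1))) *
            (\<Sum>chi | primitive_character p chi \<and> chi (- 1) = 1.
               chi (int q) *
               (LBINT t. Gamma ((1 - 2 * \<i> * of_real t) / 4) *
                         (of_real (T / (2 * real q)) powr (\<i> * of_real t)) *
                         of_real ((norm (dirichlet_L chi (1/2 + \<i> * of_real t)))\<^sup>2)))))
    \<le> C * ((real p * real q * T) powr \<epsilon> * sqrt (real q / real p)
           + (real p * real q * T) powr \<epsilon> * sqrt (real p / real q))"
proof -
  \<comment> \<open>The asymptotics hold for exponents below 1; a smaller exponent than \<epsilon>
    is sufficient because the base p q T is at least 1.\<close>
  define \<delta> where "\<delta> = min \<epsilon> (1/2)"
  have \<delta>: "0 < \<delta>" "\<delta> < 1" "\<delta> \<le> \<epsilon>" using assms by (auto simp: \<delta>_def)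
  define \<kappa> where "\<kappa> = 2 * euler_mascheroni + 1/2 * Digamma (1/2 :: real)"
  define M where "M Y = sqrt pi / 2 * Y * (ln Y + \<kappa>)" for Y
  obtain C1 where C1: "C1 \<ge> 0" and moment: "\<And>r T. r > 0 \<Longrightarrow> T > 1 \<Longrightarrow> \<exists>S.
     ((\<lambda>x. cos (2 * pi * pairprod x / r) * exp (- ((pairprod x / (r * T / (2 * pi)))\<^sup>2))) has_sum S) UNIV \<and>
     norm ((LBINT t. of_real r powr (\<i> * of_real t) * of_real ((norm (zeta (1/2 + \<i> * of_real t)))\<^sup>2) * of_real (exp (- (t\<^sup>2 / T\<^sup>2))))
        - of_real (4 * pi / sqrt r * S)) \<le> C1 * sqrt r * (1 + (r * T) powr \<delta>)"
    using twisted_second_moment[OF \<delta>(1,2)] by blast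
  obtain C2 where C2: "C2 \<ge> 0" and div: "\<And>X. X > 0 \<Longrightarrow> \<exists>A. ((\<lambda>x. exp (- ((pairprod x / X)\<^sup>2))) has_sum A) UNIV \<and>
     \<bar>A - sqrt pi / 2 * X * (ln X + 2 * euler_mascheroni + 1/2 * Digamma (1/2))\<bar> \<le> C2 * X powr \<delta>"
    using divisor_gaussian_sum_asymptotics[OF \<delta>(1,2)] by blast
  \<comment> \<open>The divisor sum as a function of its length, so that a single error function
    \<open>E\<close> covers the lengths X, X/p and X/p^2.\<close>
  define A where "A Y = infsum (\<lambda>x. exp (- ((pairprod x / Y)\<^sup>2))) UNIV" for Y
  have A: "((\<lambda>x. exp (- ((pairprod x / Y)\<^sup>2))) has_sum A Y) UNIV" "\<bar>A Y - M Y\<bar> \<le> C2 * Y powr \<delta>" if Y: "Y > 0" for Y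
  proof -
    obtain a where a: "((\<lambda>x. exp (- ((pairprod x / Y)\<^sup>2))) has_sum a) UNIV" "\<bar>a - sqrt pi / 2 * Y * (ln Y + 2 * euler_mascheroni + 1/2 * Digamma (1/2))\<bar> \<le> C2 * Y powr \<delta>"
      using div[OF Y] by blast
    have "A Y = a" unfolding A_def by (rule infsumI[OF a(1)])
    with a show "((\<lambda>x. exp (- ((pairprod x / Y)\<^sup>2))) has_sum A Y) UNIV" "\<bar>A Y - M Y\<bar> \<le> C2 * Y powr \<delta>"
      by (simp_all add: M_def \<kappa>_def add.assoc)
  qed
  \<comment> \<open>2 bounds 1 + (r T)^\<delta> in units of the error power, and 36 pi is the
    prefactor 4 pi times the 9 of \<open>combination_error\<close>.\<close>
  define C where "C = 2 * C1 + 36 * pi * C2"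
  show ?thesis
  proof (rule exI[of _ C], intro allI impI, elim conjE)
    fix p q :: nat and T :: real
    assume p: "prime p" "odd p" and q: "prime q" "odd q" and pq: "p \<noteq> q" and T: "T > 1"
    interpret odd_prime p using p by unfold_locales
    let ?P = "{chi. primitive_character p chi \<and> chi (- 1) = 1}"
    \<comment> \<open>With this length, X/p^2 = T / (2 pi p q) is the argument of the logarithm in
      the main term and pi X / p = T / (2 q) the base of the power in the L-function
      integral.\<close>
    define r X where "r = real p / real q" and "X = r * T / (2 * pi)"
    have pos: "real p \<ge> 2" "real q \<ge> 2" using p q prime_ge_2_nat by auto
    have r: "r > 0" using pos by (simp add: r_def)
    have X: "X > 0" using r T by (simp add: X_def)
    have qp: "\<not> int p dvd int q" using p q pq by (simp add: primes_dvd_imp_eq int_dvd_int_iff) (use primes_dvd_imp_eq in blast)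
    define J where "J = (LBINT t. of_real r powr (\<i> * of_real t) * of_real ((norm (zeta (1/2 + \<i> * of_real t)))\<^sup>2) * complex_of_real (exp (- (t\<^sup>2 / T\<^sup>2))))"
    define L where "L = (\<Sum>chi\<in>?P. chi (int q) *
               (LBINT t. Gamma ((1 - 2 * \<i> * of_real t) / 4) *
                         (of_real (T / (2 * real q)) powr (\<i> * of_real t)) *
                         of_real ((norm (dirichlet_L chi (1/2 + \<i> * of_real t)))\<^sup>2)))"
    obtain S where S: "((\<lambda>x. cos (2 * pi * pairprod x / r) * exp (- ((pairprod x / X)\<^sup>2))) has_sum S) UNIV"
      and J: "norm (J - of_real (4 * pi / sqrt r * S)) \<le> C1 * sqrt r * (1 + (r * T) powr \<delta>)"
      using moment[OF r T] unfolding J_def X_def by blast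
    have "pi * X / p = T / (2 * real q)" using pos by (simp add: X_def r_def)
    note sum = twisted_gaussian_sum[OF qp X A(1), unfolded this of_nat_power, folded L_def]
    have cos: "cos (2 * pi * pairprod x / r) = pcos (int q * int (Suc (fst x)) * int (Suc (snd x)))" for x
      unfolding pcos_def pairprod_def r_def by (simp add: mult_ac del: of_nat_Suc)
    \<comment> \<open>The cosine of \<open>twisted_second_moment\<close> is \<open>pcos\<close> at q
      m n, so the two evaluations concern the same sum and must agree.\<close>
    have "of_real S = of_real (A X - real p / (real p - 1) * (A X - 2 * A (X / p) + A (X / (real p)\<^sup>2))) + of_real (sqrt p * sqrt X / (4 * pi * (real p - 1))) * L"
      by (rule has_sum_unique[OF has_sum_of_real[OF S, unfolded cos] sum])
    hence "of_real (4 * pi / sqrt r * S) = of_real (4 * pi / sqrt r) * (of_real (A X - real p / (real p - 1) * (A X - 2 * A (X / p) + A (X / (real p)\<^sup>2))) + of_real (sqrt p * sqrt X / (4 * pi * (real p - 1))) * L)"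
      by (simp only: of_real_mult)
    also have "\<dots> = of_real (4 * pi / sqrt r * (A X - real p / (real p - 1) * (A X - 2 * A (X / p) + A (X / (real p)\<^sup>2)))) + of_real (4 * pi / sqrt r * (sqrt p * sqrt X / (4 * pi * (real p - 1)))) * L"
      by (simp only: of_real_mult distrib_left mult.assoc)
    also have "4 * pi / sqrt r * (sqrt p * sqrt X / (4 * pi * (real p - 1))) = sqrt (T / (2 * pi)) * (sqrt (real p) / (real p - 1))"
    proof -
      have "sqrt X = sqrt r * sqrt (T / (2 * pi))" by (simp add: X_def flip: real_sqrt_mult)
      thus ?thesis using r by simp
    qed
    finally have S_eq: "of_real (4 * pi / sqrt r * S) = of_real (4 * pi / sqrt r * (A X - real p / (real p - 1) * (A X - 2 * A (X / p) + A (X / (real p)\<^sup>2)))) + of_real (sqrt (T / (2 * pi)) * (sqrt (real p) / (real p - 1))) * L" .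
    define E where "E Y = A Y - M Y" for Y
    have E: "\<bar>E X - real p / (real p - 1) * (E X - 2 * E (X / p) + E (X / (real p)\<^sup>2))\<bar> \<le> 9 * (C2 * X powr \<delta>)"
    proof (rule combination_error[OF pos(1)])
      have le: "\<bar>E Y\<bar> \<le> C2 * X powr \<delta>" if Y: "0 < Y" "Y \<le> X" for Y
      proof -
        have "C2 * Y powr \<delta> \<le> C2 * X powr \<delta>" using Y C2 \<delta> by (intro mult_left_mono powr_mono2) auto
        thus ?thesis using A(2)[OF Y(1)] by (simp add: E_def)
      qed
      have p2: "1 \<le> (real p)\<^sup>2" using pos by (intro one_le_power) auto
      show "\<bar>E X\<bar> \<le> C2 * X powr \<delta>" using X by (intro le) auto
      show "\<bar>E (X / p)\<bar> \<le> C2 * X powr \<delta>" using X pos by (intro le) (auto simp: divide_le_eq)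
      have "X / (real p)\<^sup>2 \<le> X / 1" using X p2 pos by (intro divide_left_mono) auto
      thus "\<bar>E (X / (real p)\<^sup>2)\<bar> \<le> C2 * X powr \<delta>" using X pos by (intro le) auto
    qed
    have "A X - real p / (real p - 1) * (A X - 2 * A (X / p) + A (X / (real p)\<^sup>2)) =
       (M X - real p / (real p - 1) * (M X - 2 * M (X / p) + M (X / (real p)\<^sup>2))) + (E X - real p / (real p - 1) * (E X - 2 * E (X / p) + E (X / (real p)\<^sup>2)))"
      unfolding E_def by (simp add: right_diff_distrib distrib_left)
    also have "M X - real p / (real p - 1) * (M X - 2 * M (X / p) + M (X / (real p)\<^sup>2)) = sqrt pi / 2 * (X / p) * (ln X - 2 * ln p + \<kappa>)"
      unfolding M_def by (rule main_term_combination) (use pos X in auto)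
    finally have AM: "4 * pi / sqrt r * (A X - real p / (real p - 1) * (A X - 2 * A (X / p) + A (X / (real p)\<^sup>2))) =
        4 * pi / sqrt r * (sqrt pi / 2 * (X / p) * (ln X - 2 * ln p + \<kappa>)) + 4 * pi / sqrt r * (E X - real p / (real p - 1) * (E X - 2 * E (X / p) + E (X / (real p)\<^sup>2)))"
      by (simp only: distrib_left)
    define main where "main = sqrt (pi / (real p * real q)) * T *
            (ln (T / (2 * pi * real p * real q)) + 2 * euler_mascheroni
              + 1/2 * (deriv Gamma (1/2 :: real) / Gamma (1/2 :: real)))"
    have main: "4 * pi / sqrt r * (sqrt pi / 2 * (X / p) * (ln X - 2 * ln p + \<kappa>)) = main"
    proof -
      have "X = real p * (T / (2 * pi * real p * real q)) * real p" using pos by (simp add: X_def r_def field_simps)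
      hence "ln X = ln p + ln (T / (2 * pi * real p * real q)) + ln p"
        using pos T by (simp add: ln_mult ln_div)
      hence 1: "ln X - 2 * ln p + \<kappa> = ln (T / (2 * pi * real p * real q)) + 2 * euler_mascheroni + 1/2 * (deriv Gamma (1/2 :: real) / Gamma (1/2 :: real))"
        unfolding \<kappa>_def deriv_Gamma_half by linarith
      have "4 * pi / sqrt r * (sqrt pi / 2 * (X / p)) = sqrt pi * T / (sqrt r * real q)"
      proof -
        have "X / p = T / (2 * pi * real q)" using pos by (simp add: X_def r_def)
        thus ?thesis by simp
      qed
      also have "sqrt r * real q = sqrt (real p * real q)"
      proof -
        have "sqrt r * real q = sqrt (real p) * (real q / sqrt (real q))" by (simp add: r_def real_sqrt_divide)
        also have "real q / sqrt (real q) = sqrt (real q)" using pos by (intro real_div_sqrt) auto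
        finally show ?thesis by (simp add: real_sqrt_mult)
      qed
      finally have "4 * pi / sqrt r * (sqrt pi / 2 * (X / p)) = sqrt (pi / (real p * real q)) * T"
        by (simp add: real_sqrt_divide)
      thus ?thesis unfolding main_def 1[symmetric] mult.assoc[symmetric] by (simp only:)
    qed
    define P where "P = real p * real q * T"
    have P: "P \<ge> 1" "r * T \<le> P" "X \<le> P"
    proof -
      have a: "1 \<le> real p * T" using mult_mono[of 1 "real p" 1 T] pos T by simp
      have "1 * 1 \<le> real q * (real p * T)" using a pos by (intro mult_mono) auto
      thus "P \<ge> 1" by (simp add: P_def mult_ac)
      have "real p * T / real q \<le> real p * T / 1" using pos T by (intro divide_left_mono) auto
      also have "\<dots> \<le> real p * T * real q" unfolding div_by_1 using mult_left_mono[of 1 "real q" "real p * T"] pos T by simp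
      finally show rT: "r * T \<le> P" by (simp add: r_def P_def mult_ac)
      have "r * T / (2 * pi) \<le> r * T / 1" using r T pi_gt3 by (intro divide_left_mono) auto
      thus "X \<le> P" using rT by (simp add: X_def)
    qed
    have Pe: "y powr \<delta> \<le> P powr \<epsilon>" if "0 \<le> y" "y \<le> P" for y
    proof -
      have "y powr \<delta> \<le> P powr \<delta>" using that \<delta> by (intro powr_mono2) auto
      also have "\<dots> \<le> P powr \<epsilon>" using P \<delta> by (intro powr_mono) auto
      finally show ?thesis .
    qed
    have P1: "1 \<le> P powr \<epsilon>" using Pe[of 1] P by simp
    \<comment> \<open>The prefactor 1 / sqrt r of the divisor sums produces the error term with q/p;
      the factor sqrt r in the error of the moment produces the one with p/q.\<close>
    have sr: "1 / sqrt r = sqrt (real q / real p)" by (simp add: r_def real_sqrt_divide)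
    have "J - (of_real main + of_real (sqrt (T / (2 * pi)) * (sqrt (real p) / (real p - 1))) * L) =
        (J - of_real (4 * pi / sqrt r * S)) + of_real (4 * pi / sqrt r * (E X - real p / (real p - 1) * (E X - 2 * E (X / p) + E (X / (real p)\<^sup>2))))"
      unfolding S_eq AM main by simp
    hence bound: "norm (J - (of_real main + of_real (sqrt (T / (2 * pi)) * (sqrt (real p) / (real p - 1))) * L)) \<le>
        norm (J - of_real (4 * pi / sqrt r * S)) + \<bar>4 * pi / sqrt r * (E X - real p / (real p - 1) * (E X - 2 * E (X / p) + E (X / (real p)\<^sup>2)))\<bar>"
      by (simp only: norm_triangle_ineq flip: norm_of_real[where 'a = complex])
    have "\<bar>4 * pi / sqrt r * (E X - real p / (real p - 1) * (E X - 2 * E (X / p) + E (X / (real p)\<^sup>2)))\<bar> \<le> 4 * pi / sqrt r * (9 * (C2 * P powr \<epsilon>))"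
    proof -
      have "\<bar>4 * pi / sqrt r * (E X - real p / (real p - 1) * (E X - 2 * E (X / p) + E (X / (real p)\<^sup>2)))\<bar> = 4 * pi / sqrt r * \<bar>E X - real p / (real p - 1) * (E X - 2 * E (X / p) + E (X / (real p)\<^sup>2))\<bar>"
        unfolding abs_mult using r by simp
      also have "\<dots> \<le> 4 * pi / sqrt r * (9 * (C2 * X powr \<delta>))" using E r by (intro mult_left_mono) auto
      also have "\<dots> \<le> 4 * pi / sqrt r * (9 * (C2 * P powr \<epsilon>))" using Pe[of X] X P C2 r by (intro mult_left_mono) auto
      finally show ?thesis .
    qed
    also have "4 * pi / sqrt r * (9 * (C2 * P powr \<epsilon>)) = 36 * pi * C2 * (P powr \<epsilon> * sqrt (real q / real p))"
      unfolding sr[symmetric] by simp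
    finally have b2: "\<bar>4 * pi / sqrt r * (E X - real p / (real p - 1) * (E X - 2 * E (X / p) + E (X / (real p)\<^sup>2)))\<bar> \<le> 36 * pi * C2 * (P powr \<epsilon> * sqrt (real q / real p))" .
    have b1: "norm (J - of_real (4 * pi / sqrt r * S)) \<le> 2 * C1 * (P powr \<epsilon> * sqrt (real p / real q))"
    proof -
      have "C1 * sqrt r * (1 + (r * T) powr \<delta>) \<le> C1 * sqrt r * (P powr \<epsilon> + P powr \<epsilon>)"
        using C1 r T P P1 by (intro mult_left_mono add_mono Pe) auto
      thus ?thesis using J by (simp add: r_def mult_ac)
    qed
    note bound
    also note add_mono[OF b1 b2]
    also have "2 * C1 * (P powr \<epsilon> * sqrt (real p / real q)) + 36 * pi * C2 * (P powr \<epsilon> * sqrt (real q / real p)) \<le>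
        C * (P powr \<epsilon> * sqrt (real p / real q)) + C * (P powr \<epsilon> * sqrt (real q / real p))"
      using C1 C2 by (intro add_mono mult_right_mono) (auto simp: C_def)
    also have "\<dots> = C * (P powr \<epsilon> * sqrt (real q / real p) + P powr \<epsilon> * sqrt (real p / real q))" by (simp only: distrib_left add.commute)
    finally show "norm
      ((LBINT t. (of_real (real p / real q) powr (\<i> * of_real t)) *
                 of_real ((norm (zeta (1/2 + \<i> * of_real t)))\<^sup>2) *
                 of_real (exp (- (t\<^sup>2 / T\<^sup>2))))
       - (of_real (sqrt (pi / (real p * real q)) * T *
            (ln (T / (2 * pi * real p * real q)) + 2 * euler_mascheroni
              + 1/2 * (deriv Gamma (1/2 :: real) / Gamma (1/2 :: real))))
          + of_real (sqrt (T / (2 * pi)) * (sqrt (real p) / (real p - 1))) *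
            (\<Sum>chi | primitive_character p chi \<and> chi (- 1) = 1.
               chi (int q) *
               (LBINT t. Gamma ((1 - 2 * \<i> * of_real t) / 4) *
                         (of_real (T / (2 * real q)) powr (\<i> * of_real t)) *
                         of_real ((norm (dirichlet_L chi (1/2 + \<i> * of_real t)))\<^sup>2)))))
    \<le> C * ((real p * real q * T) powr \<epsilon> * sqrt (real q / real p)
           + (real p * real q * T) powr \<epsilon> * sqrt (real p / real q))"
      unfolding J_def L_def main_def r_def P_def .
  qed
qed

end
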